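(* For $N=1$, $m\geq 3$ and $m$ even, $$\mathrm{HH}^*(\Lambda_1)/\mathcal{N}\cong \mathbb{K}[\chi_{2,0},\chi_{m,1},\chi_{m,-1}]/(\chi_{2,0}^m - \chi_{m,1}\chi_{m,-1})$$ and hence $\mathrm{HH}^*(\Lambda_1)/\mathcal{N}$ is a commutative finitely generated algebra of Krull dimension $2$.
   Context: Let $\mathbb{K}$ be a field. Let $\mathcal{Q}$ be the quiver with vertices $0,1,\ldots,m-1$ and, for each $i$ (indices modulo $m$), arrows $a_i:i\to i+1$ and $\bar a_i:i+1\to i$. Paths are written from left to right; $e_i$ is the trivial path at $i$. $\Lambda_N=\mathbb{K}\mathcal{Q}/I_N$ where $I_N$ is generated by $a_ia_{i+1}$, $\bar a_{i-1}\bar a_{i-2}$, $(a_i\bar a_i)^N-(\bar a_{i-1}a_{i-1})^N$ for all $i$. $\mathrm{HH}^*(\Lambda_N)=\mathrm{Ext}^*_{\Lambda_N^e}(\Lambda_N,\Lambda_N)$ with the Yoneda product; $\mathcal{N}$ is the ideal generated by all homogeneous nilpotent elements. Write $\otimes=\otimes_{\mathbb{K}}$. A minimal projective bimodule resolution of $\Lambda_N$ is $(P^*,\partial^* )$ with $P^n=\bigoplus_{i=0}^{m-1}\bigoplus_{r=0}^n\Lambda_Ne_i\otimes e_{i+n-2r}\Lambda_N$. Write $e_i\otimes_r e_{i+n-2r}$ for the generator of the $(i,r)$-summand of $P^n$ (first index modulo $m$; generators in $P^{n-1}$ with tensor subscript $-1$ or $n$ are $0$). Unsubscripted $a,\bar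 a$ denote the arrows of that type making the expression composable. $\partial^0$ is multiplication, and for $n\geq1$, $\partial^n(e_i\otimes_r e_{i+n-2r})$ is: if $n-2r>0$: $e_i\otimes_r e_{i+n-1-2r}a+(-1)^{n+r}a e_{i+1}\otimes_r e_{i+n-2r}+(-1)^{n+r}\bar a(a\bar a)^{N-1}e_{i-1}\otimes_{r-1}e_{i+n-2r}+(-1)^n e_i\otimes_{r-1}e_{i+n+1-2r}\bar a(a\bar a)^{N-1}$; if $n-2r<0$: $e_i\otimes_r e_{i+n-1-2r}a(\bar aa)^{N-1}+(-1)^{n+r}a(\bar aa)^{N-1} e_{i+1}\otimes_r e_{i+n-2r}+(-1)^{n+r}\bar a e_{i-1}\otimes_{r-1}e_{i+n-2r}+(-1)^n e_i\otimes_{r-1}e_{i+n+1-2r}\bar a$; if $n=2r$: $\sum_{k=0}^{N-1}\big((\bar aa)^k[e_i\otimes_{r}e_{i-1}a+(-1)^{r}\bar a e_{i-1}\otimes_{r-1}e_i](\bar aa)^{N-k-1}+(a\bar a)^k[(-1)^{r}ae_{i+1}\otimes_{r}e_i+e_i\otimes_{r-1}e_{i+1}\bar a](a\bar a)^{N-k-1}\big)$. Classes in $\mathrm{HH}^n(\Lambda_N)$ are represented by cocycles in $\mathrm{Hom}_{\Lambda_N^e}(P^n,\Lambda_N)$; for a cocycle only the non-zero images of generators are listed. For $0\leq i\leq m-1$ and $k\in\mathbb{Z}$, $e_i\otimes e_{i+k}\in P^n$ means $e_i\otimes_r e_{i+n-2r}$ with $r=(n-k)/2$ ($k$ is not reduced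 modulo $m$). Here, for all $i=0,\ldots,m-1$: $\chi_{2,0}\in\mathrm{HH}^2$: $e_i\otimes e_i\mapsto(-1)^ie_i$; $\chi_{m,1}\in\mathrm{HH}^m$: $e_i\otimes e_{i+m}\mapsto e_i$; $\chi_{m,-1}\in\mathrm{HH}^m$: $e_i\otimes e_{i-m}\mapsto e_i$. In the quotient, these symbols denote the images of the classes. *)

theory Defs
  imports
    "HOL-Library.Extended_Nat"
    "Graph_Theory.Arc_Walk"
    "HOL-Algebra.Free_Abelian_Groups"
    "HOL-Algebra.Generated_Groups"
    "HOL-Algebra.Generated_Rings"
    "HOL-Algebra.QuotRing"
    "HOL-Algebra.Module"
begin

section \<open>Algebras over a field\<close>

text \<open>
  The ground field is a type of class \<^class>\<open>field\<close>. A (not necessarily commutative) algebra over it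
  is given by the record type \<^typ>\<open>('k, 'a) module\<close>, which carries ring operations and a scalar
  multiplication.
\<close>

definition field_ring :: "'k::field ring" where
  "field_ring = \<lparr>carrier = UNIV, monoid.mult = (*), monoid.one = 1, ring.zero = 0, ring.add = (+)\<rparr>"

definition quot_alg :: "('k, 'a, 'c) module_scheme \<Rightarrow> 'a set \<Rightarrow> ('k, 'a set) module"
    (infixl \<open>Quota\<close> 65) where
  "A Quota I =
    \<lparr>carrier = carrier (A Quot I), monoid.mult = monoid.mult (A Quot I),
     monoid.one = monoid.one (A Quot I), ring.zero = ring.zero (A Quot I), ring.add = ring.add (A Quot I),
     smult = (\<lambda>k X. \<Union>x\<in>X. I +>\<^bsub>A\<^esub> (k \<odot>\<^bsub>A\<^esub> x))\<rparr>"

definition alg_iso ::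
    "('k, 'a, 'c) module_scheme \<Rightarrow> ('k, 'b, 'd) module_scheme \<Rightarrow> ('a \<Rightarrow> 'b) set" where
  "alg_iso A B = {h \<in> ring_iso A B. \<forall>k. \<forall>x\<in>carrier A. h (k \<odot>\<^bsub>A\<^esub> x) = k \<odot>\<^bsub>B\<^esub> h x}"

definition fin_gen_algebra :: "('k, 'a, 'c) module_scheme \<Rightarrow> bool" where
  "fin_gen_algebra A \<longleftrightarrow>
    (\<exists>S. finite S \<and> S \<subseteq> carrier A \<and>
         generate_ring A (S \<union> range (\<lambda>k. k \<odot>\<^bsub>A\<^esub> \<one>\<^bsub>A\<^esub>)) = carrier A)"

definition krull_dim :: "('a, 'c) ring_scheme \<Rightarrow> enat" where
  "krull_dim R =
    (SUP n \<in> {n. \<exists>C :: nat \<Rightarrow> 'a set. (\<forall>i\<le>n. primeideal (C i) R) \<and> (\<forall>i<n. C i \<subset> C (Suc i))}.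
       enat n)"


section \<open>Bimodules and their homomorphisms\<close>

text \<open>
  Only the additive part of the inherited ring record matters for a bimodule; as usual for module
  records, \<^const>\<open>monoid.mult\<close> and \<^const>\<open>monoid.one\<close> are irrelevant.
\<close>

record ('a, 'b) bimodule = "'b ring" +
  lact :: "'a \<Rightarrow> 'b \<Rightarrow> 'b"
  ract :: "'b \<Rightarrow> 'a \<Rightarrow> 'b"

definition regular_bimod :: "('a, 'c) ring_scheme \<Rightarrow> ('a, 'a) bimodule" where
  "regular_bimod A =
    \<lparr>carrier = carrier A, monoid.mult = monoid.mult A, monoid.one = monoid.one A,
     ring.zero = ring.zero A, ring.add = ring.add A,
     lact = monoid.mult A, ract = monoid.mult A\<rparr>"

text \<open>Homomorphisms are extensional, so that equal maps are equal as HOL functions.\<close>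

definition bimod_hom ::
    "('a, 'c) ring_scheme \<Rightarrow> ('a, 'x) bimodule \<Rightarrow> ('a, 'y) bimodule \<Rightarrow> ('x \<Rightarrow> 'y) set" where
  "bimod_hom A M N =
    {f \<in> carrier M \<rightarrow>\<^sub>E carrier N.
       (\<forall>x\<in>carrier M. \<forall>y\<in>carrier M. f (x \<oplus>\<^bsub>M\<^esub> y) = f x \<oplus>\<^bsub>N\<^esub> f y) \<and>
       (\<forall>a\<in>carrier A. \<forall>x\<in>carrier M. f (lact M a x) = lact N a (f x) \<and> f (ract M x a) = ract N (f x) a)}"

definition dsum :: "'i set \<Rightarrow> ('i \<Rightarrow> ('a, 'x) bimodule) \<Rightarrow> ('a, 'i \<Rightarrow> 'x) bimodule" where
  "dsum I M =
    \<lparr>carrier = {x \<in> \<Pi>\<^sub>E i\<in>I. carrier (M i). finite {i \<in> I. x i \<noteq> \<zero>\<^bsub>M i\<^esub>}},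
     monoid.mult = undefined, monoid.one = undefined,
     ring.zero = (\<lambda>i\<in>I. \<zero>\<^bsub>M i\<^esub>),
     ring.add = (\<lambda>x y. \<lambda>i\<in>I. x i \<oplus>\<^bsub>M i\<^esub> y i),
     lact = (\<lambda>a x. \<lambda>i\<in>I. lact (M i) a (x i)),
     ract = (\<lambda>x a. \<lambda>i\<in>I. ract (M i) (x i) a)\<rparr>"

definition dsum_inj :: "'i set \<Rightarrow> ('i \<Rightarrow> ('a, 'x) bimodule) \<Rightarrow> 'i \<Rightarrow> 'x \<Rightarrow> ('i \<Rightarrow> 'x)" where
  "dsum_inj I M i x = (\<lambda>j\<in>I. if j = i then x else \<zero>\<^bsub>M j\<^esub>)"


section \<open>Tensor products over the ground field\<close>

definition tensor_rels ::
    "('k, 'v, 'c) module_scheme \<Rightarrow> ('k, 'w, 'd) module_scheme \<Rightarrow> ('v \<times> 'w \<Rightarrow>\<^sub>0 int) set" where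
  "tensor_rels V W =
    {frag_of (v \<oplus>\<^bsub>V\<^esub> v', w) - frag_of (v, w) - frag_of (v', w) | v v' w.
       v \<in> carrier V \<and> v' \<in> carrier V \<and> w \<in> carrier W} \<union>
    {frag_of (v, w \<oplus>\<^bsub>W\<^esub> w') - frag_of (v, w) - frag_of (v, w') | v w w'.
       v \<in> carrier V \<and> w \<in> carrier W \<and> w' \<in> carrier W} \<union>
    {frag_of (k \<odot>\<^bsub>V\<^esub> v, w) - frag_of (v, k \<odot>\<^bsub>W\<^esub> w) | k v w. v \<in> carrier V \<and> w \<in> carrier W}"

definition tensor_kernel ::
    "('k, 'v, 'c) module_scheme \<Rightarrow> ('k, 'w, 'd) module_scheme \<Rightarrow> ('v \<times> 'w \<Rightarrow>\<^sub>0 int) set" where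
  "tensor_kernel V W = generate (free_Abelian_group (carrier V \<times> carrier W)) (tensor_rels V W)"

definition tensor_group ::
    "('k, 'v, 'c) module_scheme \<Rightarrow> ('k, 'w, 'd) module_scheme \<Rightarrow> ('v \<times> 'w \<Rightarrow>\<^sub>0 int) set monoid" where
  "tensor_group V W = free_Abelian_group (carrier V \<times> carrier W) Mod tensor_kernel V W"

definition tensor_class ::
    "('k, 'v, 'c) module_scheme \<Rightarrow> ('k, 'w, 'd) module_scheme
      \<Rightarrow> ('v \<times> 'w \<Rightarrow>\<^sub>0 int) \<Rightarrow> ('v \<times> 'w \<Rightarrow>\<^sub>0 int) set" where
  "tensor_class V W c = tensor_kernel V W #>\<^bsub>free_Abelian_group (carrier V \<times> carrier W)\<^esub> c"

definition left_ideal_at :: "('k, 'a) module \<Rightarrow> 'a \<Rightarrow> ('k, 'a) module" where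
  "left_ideal_at A e = A\<lparr>carrier := (\<lambda>x. x \<otimes>\<^bsub>A\<^esub> e) ` carrier A\<rparr>"

definition right_ideal_at :: "('k, 'a) module \<Rightarrow> 'a \<Rightarrow> ('k, 'a) module" where
  "right_ideal_at A f = A\<lparr>carrier := (\<lambda>x. f \<otimes>\<^bsub>A\<^esub> x) ` carrier A\<rparr>"

text \<open>The bimodule \<open>A e \<otimes> f A\<close>, with \<open>a (v \<otimes> w) b = a v \<otimes> w b\<close>.\<close>

definition proj_bimod ::
    "('k, 'a) module \<Rightarrow> 'a \<Rightarrow> 'a \<Rightarrow> ('a, ('a \<times> 'a \<Rightarrow>\<^sub>0 int) set) bimodule" where
  "proj_bimod A e f =
    (let V = left_ideal_at A e; W = right_ideal_at A f in
     \<lparr>carrier = carrier (tensor_group V W), monoid.mult = undefined, monoid.one = undefined,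
      ring.zero = \<one>\<^bsub>tensor_group V W\<^esub>, ring.add = monoid.mult (tensor_group V W),
      lact = (\<lambda>a X. \<Union>c\<in>X. tensor_class V W (frag_extend (\<lambda>(v, w). frag_of (a \<otimes>\<^bsub>A\<^esub> v, w)) c)),
      ract = (\<lambda>X a. \<Union>c\<in>X. tensor_class V W (frag_extend (\<lambda>(v, w). frag_of (v, w \<otimes>\<^bsub>A\<^esub> a)) c))\<rparr>)"

definition proj_bimod_gen :: "('k, 'a) module \<Rightarrow> 'a \<Rightarrow> 'a \<Rightarrow> ('a \<times> 'a \<Rightarrow>\<^sub>0 int) set" where
  "proj_bimod_gen A e f = tensor_class (left_ideal_at A e) (right_ideal_at A f) (frag_of (e, f))"


section \<open>The Ext algebra of the regular bimodule, computed by a resolution\<close>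

text \<open>
  Throughout this section \<open>P 0 \<leftarrow> P 1 \<leftarrow> \<dots>\<close> with differentials \<open>d (Suc n) : P (Suc n) \<rightarrow> P n\<close> and
  augmentation \<open>eps : P 0 \<rightarrow> A\<close> is meant to be a projective bimodule resolution of \<open>A\<close>; the value
  \<open>d 0\<close> is not used.
\<close>

definition cochains ::
    "('k, 'a) module \<Rightarrow> (nat \<Rightarrow> ('a, 'p) bimodule) \<Rightarrow> nat \<Rightarrow> ('k, 'p \<Rightarrow> 'a) module" where
  "cochains A P n =
    \<lparr>carrier = bimod_hom A (P n) (regular_bimod A), monoid.mult = undefined, monoid.one = undefined,
     ring.zero = (\<lambda>x\<in>carrier (P n). \<zero>\<^bsub>A\<^esub>),
     ring.add = (\<lambda>f g. \<lambda>x\<in>carrier (P n). f x \<oplus>\<^bsub>A\<^esub> g x),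
     smult = (\<lambda>k f. \<lambda>x\<in>carrier (P n). k \<odot>\<^bsub>A\<^esub> f x)\<rparr>"

definition cocycles ::
    "('k, 'a) module \<Rightarrow> (nat \<Rightarrow> ('a, 'p) bimodule) \<Rightarrow> (nat \<Rightarrow> 'p \<Rightarrow> 'p) \<Rightarrow> nat \<Rightarrow> ('p \<Rightarrow> 'a) set" where
  "cocycles A P d n =
    {f \<in> carrier (cochains A P n).
       compose (carrier (P (Suc n))) f (d (Suc n)) = \<zero>\<^bsub>cochains A P (Suc n)\<^esub>}"

fun coboundaries ::
    "('k, 'a) module \<Rightarrow> (nat \<Rightarrow> ('a, 'p) bimodule) \<Rightarrow> (nat \<Rightarrow> 'p \<Rightarrow> 'p) \<Rightarrow> nat \<Rightarrow> ('p \<Rightarrow> 'a) set" where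
  "coboundaries A P d 0 = {\<zero>\<^bsub>cochains A P 0\<^esub>}"
| "coboundaries A P d (Suc n) =
    (\<lambda>f. compose (carrier (P (Suc n))) f (d (Suc n))) ` carrier (cochains A P n)"

definition Ext_mod ::
    "('k, 'a) module \<Rightarrow> (nat \<Rightarrow> ('a, 'p) bimodule) \<Rightarrow> (nat \<Rightarrow> 'p \<Rightarrow> 'p) \<Rightarrow> nat
      \<Rightarrow> ('k, ('p \<Rightarrow> 'a) set) module" where
  "Ext_mod A P d n = (cochains A P n)\<lparr>carrier := cocycles A P d n\<rparr> Quota coboundaries A P d n"

definition coho_class ::
    "('k, 'a) module \<Rightarrow> (nat \<Rightarrow> ('a, 'p) bimodule) \<Rightarrow> (nat \<Rightarrow> 'p \<Rightarrow> 'p) \<Rightarrow> nat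
      \<Rightarrow> ('p \<Rightarrow> 'a) \<Rightarrow> ('p \<Rightarrow> 'a) set" where
  "coho_class A P d n f = coboundaries A P d n +>\<^bsub>cochains A P n\<^esub> f"

text \<open>Liftings of a cocycle \<open>g : P q \<rightarrow> A\<close> to a chain map \<open>P (q + k) \<rightarrow> P k\<close>, \<open>k \<ge> 0\<close>.\<close>

definition liftings ::
    "('k, 'a) module \<Rightarrow> (nat \<Rightarrow> ('a, 'p) bimodule) \<Rightarrow> (nat \<Rightarrow> 'p \<Rightarrow> 'p) \<Rightarrow> ('p \<Rightarrow> 'a)
      \<Rightarrow> nat \<Rightarrow> ('p \<Rightarrow> 'a) \<Rightarrow> (nat \<Rightarrow> 'p \<Rightarrow> 'p) set" where
  "liftings A P d eps q g =
    {L. (\<forall>k. L k \<in> bimod_hom A (P (q + k)) (P k)) \<and>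
        compose (carrier (P q)) eps (L 0) = g \<and>
        (\<forall>k. compose (carrier (P (q + Suc k))) (d (Suc k)) (L (Suc k)) =
             compose (carrier (P (q + Suc k))) (L k) (d (q + Suc k)))}"

text \<open>
  The Yoneda product of classes of degrees \<open>p\<close> and \<open>q\<close> is the class of \<open>f \<circ> L p\<close> for representatives
  \<open>f\<close>, \<open>g\<close> and a lifting \<open>L\<close> of \<open>g\<close>. As in \<^const>\<open>rcoset_mult\<close>, the union runs over all choices; when
  \<open>P\<close> is a projective resolution, all of them give the same class.
\<close>

definition yoneda_prod ::
    "('k, 'a) module \<Rightarrow> (nat \<Rightarrow> ('a, 'p) bimodule) \<Rightarrow> (nat \<Rightarrow> 'p \<Rightarrow> 'p) \<Rightarrow> ('p \<Rightarrow> 'a)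
      \<Rightarrow> nat \<Rightarrow> nat \<Rightarrow> ('p \<Rightarrow> 'a) set \<Rightarrow> ('p \<Rightarrow> 'a) set \<Rightarrow> ('p \<Rightarrow> 'a) set" where
  "yoneda_prod A P d eps p q X Y =
    (\<Union>f\<in>X. \<Union>g\<in>Y. \<Union>L\<in>liftings A P d eps q g.
       coho_class A P d (q + p) (compose (carrier (P (q + p))) f (L p)))"

definition homog ::
    "('k, 'a) module \<Rightarrow> (nat \<Rightarrow> ('a, 'p) bimodule) \<Rightarrow> (nat \<Rightarrow> 'p \<Rightarrow> 'p) \<Rightarrow> nat
      \<Rightarrow> ('p \<Rightarrow> 'a) set \<Rightarrow> nat \<Rightarrow> ('p \<Rightarrow> 'a) set" where
  "homog A P d n X = (\<lambda>j. if j = n then X else \<zero>\<^bsub>Ext_mod A P d j\<^esub>)"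

text \<open>The graded algebra \<open>\<Oplus>n. Ext n\<close>; its elements are the families of classes with finite support.\<close>

definition Ext_alg ::
    "('k, 'a) module \<Rightarrow> (nat \<Rightarrow> ('a, 'p) bimodule) \<Rightarrow> (nat \<Rightarrow> 'p \<Rightarrow> 'p) \<Rightarrow> ('p \<Rightarrow> 'a)
      \<Rightarrow> ('k, nat \<Rightarrow> ('p \<Rightarrow> 'a) set) module" where
  "Ext_alg A P d eps =
    \<lparr>carrier = {x. (\<forall>n. x n \<in> carrier (Ext_mod A P d n)) \<and> finite {n. x n \<noteq> \<zero>\<^bsub>Ext_mod A P d n\<^esub>}},
     monoid.mult = (\<lambda>x y n. \<Oplus>\<^bsub>Ext_mod A P d n\<^esub>p\<in>{..n}.
                      yoneda_prod A P d eps p (n - p) (x p) (y (n - p))),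
     monoid.one = homog A P d 0 (coho_class A P d 0 eps),
     ring.zero = (\<lambda>n. \<zero>\<^bsub>Ext_mod A P d n\<^esub>),
     ring.add = (\<lambda>x y n. x n \<oplus>\<^bsub>Ext_mod A P d n\<^esub> y n),
     smult = (\<lambda>k x n. k \<odot>\<^bsub>Ext_mod A P d n\<^esub> x n)\<rparr>"

definition homog_nilpotents ::
    "('k, 'a) module \<Rightarrow> (nat \<Rightarrow> ('a, 'p) bimodule) \<Rightarrow> (nat \<Rightarrow> 'p \<Rightarrow> 'p) \<Rightarrow> ('p \<Rightarrow> 'a)
      \<Rightarrow> (nat \<Rightarrow> ('p \<Rightarrow> 'a) set) set" where
  "homog_nilpotents A P d eps =
    {x \<in> carrier (Ext_alg A P d eps).
       (\<exists>n X. x = homog A P d n X) \<and>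
       (\<exists>s::nat. x [^]\<^bsub>Ext_alg A P d eps\<^esub> s = \<zero>\<^bsub>Ext_alg A P d eps\<^esub>)}"


section \<open>Path algebras\<close>

text \<open>
  A path is a pair of its start vertex and its list of arrows (so that trivial paths are
  distinguished), and paths are multiplied from left to right.
\<close>

definition path_algebra :: "('v, 'e) pre_digraph \<Rightarrow> ('k::field, 'v \<times> 'e list \<Rightarrow>\<^sub>0 'k) module" where
  "path_algebra G =
    \<lparr>carrier = {c. Poly_Mapping.keys c \<subseteq> {(u, p). \<exists>v. pre_digraph.awalk G u p v}},
     monoid.mult = (\<lambda>b c. \<Sum>(u, p)\<in>Poly_Mapping.keys b. \<Sum>(v, q)\<in>Poly_Mapping.keys c.
               if pre_digraph.awalk G u p v
               then Poly_Mapping.single (u, p @ q)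
                      (Poly_Mapping.lookup b (u, p) * Poly_Mapping.lookup c (v, q))
               else 0),
     monoid.one = (\<Sum>v\<in>verts G. Poly_Mapping.single (v, []) 1),
     ring.zero = 0,
     ring.add = (+),
     smult = (\<lambda>k. Poly_Mapping.map ((*) k))\<rparr>"


section \<open>The algebras \<open>\<Lambda>\<^sub>N\<close>\<close>

text \<open>\<open>Arr i : i \<rightarrow> i + 1\<close> is the arrow \<open>a\<^sub>i\<close> and \<open>Bar i : i + 1 \<rightarrow> i\<close> is its partner.\<close>

datatype arrow = Arr int | Bar int

definition cyc_quiver :: "nat \<Rightarrow> (int, arrow) pre_digraph" where
  "cyc_quiver m =
    \<lparr>verts = {0..<int m},
     arcs = Arr ` {0..<int m} \<union> Bar ` {0..<int m},
     tail = (\<lambda>x. case x of Arr i \<Rightarrow> i | Bar i \<Rightarrow> (i + 1) mod int m),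
     head = (\<lambda>x. case x of Arr i \<Rightarrow> (i + 1) mod int m | Bar i \<Rightarrow> i)\<rparr>"

type_synonym 'k kq = "int \<times> arrow list \<Rightarrow>\<^sub>0 'k"
type_synonym 'k lam = "'k kq set"
type_synonym 'k pres = "int \<times> int \<Rightarrow> ('k lam \<times> 'k lam \<Rightarrow>\<^sub>0 int) set"

text \<open>In the following three definitions the index is read modulo \<open>m\<close>.\<close>

definition vtx :: "nat \<Rightarrow> int \<Rightarrow> 'k::field kq" where
  "vtx m i = Poly_Mapping.single (i mod int m, []) 1"

definition arr :: "nat \<Rightarrow> int \<Rightarrow> 'k::field kq" where
  "arr m i = Poly_Mapping.single (i mod int m, [Arr (i mod int m)]) 1"

definition bar :: "nat \<Rightarrow> int \<Rightarrow> 'k::field kq" where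
  "bar m i = Poly_Mapping.single ((i + 1) mod int m, [Bar (i mod int m)]) 1"

definition rel_ideal :: "nat \<Rightarrow> nat \<Rightarrow> 'k::field kq set" where
  "rel_ideal m N =
    (let R = path_algebra (cyc_quiver m) in
     Idl\<^bsub>R\<^esub> (\<Union>i\<in>{0..<int m}.
       {arr m i \<otimes>\<^bsub>R\<^esub> arr m (i + 1),
        bar m (i - 1) \<otimes>\<^bsub>R\<^esub> bar m (i - 2),
        (arr m i \<otimes>\<^bsub>R\<^esub> bar m i) [^]\<^bsub>R\<^esub> N \<ominus>\<^bsub>R\<^esub> (bar m (i - 1) \<otimes>\<^bsub>R\<^esub> arr m (i - 1)) [^]\<^bsub>R\<^esub> N}))"

definition Lam :: "nat \<Rightarrow> nat \<Rightarrow> ('k::field, 'k lam) module" where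
  "Lam m N = path_algebra (cyc_quiver m) Quota rel_ideal m N"

definition idem :: "nat \<Rightarrow> nat \<Rightarrow> int \<Rightarrow> 'k::field lam" where
  "idem m N i = rel_ideal m N +>\<^bsub>path_algebra (cyc_quiver m)\<^esub> vtx m i"

text \<open>
  The unsubscripted arrows: the sums of all arrows of each type. In a product with a path or with an
  idempotent only the one composable summand survives.
\<close>

definition arrs :: "nat \<Rightarrow> nat \<Rightarrow> 'k::field lam" where
  "arrs m N = rel_ideal m N +>\<^bsub>path_algebra (cyc_quiver m)\<^esub> (\<Sum>i\<in>{0..<int m}. arr m i)"

definition bars :: "nat \<Rightarrow> nat \<Rightarrow> 'k::field lam" where
  "bars m N = rel_ideal m N +>\<^bsub>path_algebra (cyc_quiver m)\<^esub> (\<Sum>i\<in>{0..<int m}. bar m i)"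


section \<open>The minimal projective bimodule resolution of \<open>\<Lambda>\<^sub>N\<close>\<close>

definition res_index :: "nat \<Rightarrow> nat \<Rightarrow> (int \<times> int) set" where
  "res_index m n = {0..<int m} \<times> {0..int n}"

definition res_summand ::
    "nat \<Rightarrow> nat \<Rightarrow> nat \<Rightarrow> int \<times> int \<Rightarrow> ('k::field lam, ('k lam \<times> 'k lam \<Rightarrow>\<^sub>0 int) set) bimodule" where
  "res_summand m N n = (\<lambda>(i, r). proj_bimod (Lam m N) (idem m N i) (idem m N (i + int n - 2 * r)))"

definition res :: "nat \<Rightarrow> nat \<Rightarrow> nat \<Rightarrow> ('k::field lam, 'k pres) bimodule" where
  "res m N n = dsum (res_index m n) (res_summand m N n)"

text \<open>\<open>gen m N n i r\<close> is \<open>e\<^sub>i \<otimes>\<^sub>r e\<^bsub>i+n-2r\<^esub>\<close>.\<close>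

definition gen :: "nat \<Rightarrow> nat \<Rightarrow> nat \<Rightarrow> int \<Rightarrow> int \<Rightarrow> 'k::field pres" where
  "gen m N n i r =
    (if 0 \<le> r \<and> r \<le> int n
     then dsum_inj (res_index m n) (res_summand m N n) (i mod int m, r)
            (proj_bimod_gen (Lam m N) (idem m N i) (idem m N (i + int n - 2 * r)))
     else \<zero>\<^bsub>res m N n\<^esub>)"

text \<open>The bimodule homomorphism from \<open>P\<^sup>n\<close> with prescribed images of the generators.\<close>

definition hom_of_gens ::
    "nat \<Rightarrow> nat \<Rightarrow> nat \<Rightarrow> ('k::field lam, 'y) bimodule \<Rightarrow> (int \<Rightarrow> int \<Rightarrow> 'y) \<Rightarrow> 'k pres \<Rightarrow> 'y" where
  "hom_of_gens m N n M img =
    (THE f. f \<in> bimod_hom (Lam m N) (res m N n) M \<and>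
            (\<forall>(i, r)\<in>res_index m n. f (gen m N n i r) = img i r))"

text \<open>The multiplication map \<open>P\<^sup>0 \<rightarrow> \<Lambda>\<^sub>N\<close> is determined by \<open>e\<^sub>i \<otimes> e\<^sub>i \<mapsto> e\<^sub>i\<close>.\<close>

definition res_aug :: "nat \<Rightarrow> nat \<Rightarrow> 'k::field pres \<Rightarrow> 'k lam" where
  "res_aug m N = hom_of_gens m N 0 (regular_bimod (Lam m N)) (\<lambda>i r. idem m N i)"

definition sgn_pow :: "('x, 'c) ring_scheme \<Rightarrow> int \<Rightarrow> 'x \<Rightarrow> 'x" where
  "sgn_pow M k x = (if even k then x else \<ominus>\<^bsub>M\<^esub> x)"

definition diff_img :: "nat \<Rightarrow> nat \<Rightarrow> nat \<Rightarrow> int \<Rightarrow> int \<Rightarrow> 'k::field pres" where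
  "diff_img m N n i r =
    (let A = Lam m N; M = res m N (n - 1); G = gen m N (n - 1);
         a = arrs m N; b = bars m N;
         ab = (\<lambda>k::nat. (a \<otimes>\<^bsub>A\<^esub> b) [^]\<^bsub>A\<^esub> k); ba = (\<lambda>k::nat. (b \<otimes>\<^bsub>A\<^esub> a) [^]\<^bsub>A\<^esub> k);
         s = sgn_pow M
     in
     if int n - 2 * r > 0 then
       ract M (G i r) a
       \<oplus>\<^bsub>M\<^esub> s (int n + r) (lact M a (G (i + 1) r))
       \<oplus>\<^bsub>M\<^esub> s (int n + r) (lact M (b \<otimes>\<^bsub>A\<^esub> ab (N - 1)) (G (i - 1) (r - 1)))
       \<oplus>\<^bsub>M\<^esub> s (int n) (ract M (G i (r - 1)) (b \<otimes>\<^bsub>A\<^esub> ab (N - 1)))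
     else if int n - 2 * r < 0 then
       ract M (G i r) (a \<otimes>\<^bsub>A\<^esub> ba (N - 1))
       \<oplus>\<^bsub>M\<^esub> s (int n + r) (lact M (a \<otimes>\<^bsub>A\<^esub> ba (N - 1)) (G (i + 1) r))
       \<oplus>\<^bsub>M\<^esub> s (int n + r) (lact M b (G (i - 1) (r - 1)))
       \<oplus>\<^bsub>M\<^esub> s (int n) (ract M (G i (r - 1)) b)
     else
       (\<Oplus>\<^bsub>M\<^esub>k\<in>{..<N}.
          lact M (ba k) (ract M (ract M (G i r) a \<oplus>\<^bsub>M\<^esub> s r (lact M b (G (i - 1) (r - 1)))) (ba (N - k - 1)))
          \<oplus>\<^bsub>M\<^esub>
          lact M (ab k) (ract M (s r (lact M a (G (i + 1) r)) \<oplus>\<^bsub>M\<^esub> ract M (G i (r - 1)) b) (ab (N - k - 1)))))"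

text \<open>The differential \<open>P\<^sup>n \<rightarrow> P\<^bsup>n-1\<^esup>\<close> for \<open>n \<ge> 1\<close>.\<close>

definition res_diff :: "nat \<Rightarrow> nat \<Rightarrow> nat \<Rightarrow> 'k::field pres \<Rightarrow> 'k pres" where
  "res_diff m N n = hom_of_gens m N n (res m N (n - 1)) (diff_img m N n)"


section \<open>Hochschild cohomology of \<open>\<Lambda>\<^sub>N\<close>\<close>

type_synonym 'k hh = "nat \<Rightarrow> ('k pres \<Rightarrow> 'k lam) set"

definition HH :: "nat \<Rightarrow> nat \<Rightarrow> ('k::field, 'k hh) module" where
  "HH m N = Ext_alg (Lam m N) (res m N) (res_diff m N) (res_aug m N)"

definition nil_ideal :: "nat \<Rightarrow> nat \<Rightarrow> 'k::field hh set" where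
  "nil_ideal m N =
    Idl\<^bsub>HH m N\<^esub> (homog_nilpotents (Lam m N) (res m N) (res_diff m N) (res_aug m N))"

definition HH_mod_nil :: "nat \<Rightarrow> nat \<Rightarrow> ('k::field, 'k hh set) module" where
  "HH_mod_nil m N = HH m N Quota nil_ideal m N"

text \<open>
  The class in degree \<open>n\<close> of the cocycle sending \<open>e\<^sub>i \<otimes> e\<^bsub>i+k\<^esub>\<close>, \<open>0 \<le> i < m\<close>, to \<open>c i\<close> and the other
  generators to \<open>0\<close>. The integer \<open>k\<close> is not reduced modulo \<open>m\<close>: it stands for \<open>r = (n - k) / 2\<close>.
\<close>

definition hh_class :: "nat \<Rightarrow> nat \<Rightarrow> nat \<Rightarrow> int \<Rightarrow> (int \<Rightarrow> 'k::field lam) \<Rightarrow> 'k hh" where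
  "hh_class m N n k c =
    homog (Lam m N) (res m N) (res_diff m N) n
      (coho_class (Lam m N) (res m N) (res_diff m N) n
        (hom_of_gens m N n (regular_bimod (Lam m N))
          (\<lambda>i r. if int n - 2 * r = k then c i else \<zero>\<^bsub>Lam m N\<^esub>)))"

definition chi20 :: "nat \<Rightarrow> nat \<Rightarrow> 'k::field hh" where
  "chi20 m N = hh_class m N 2 0 (\<lambda>i. ((- 1) ^ nat i) \<odot>\<^bsub>Lam m N\<^esub> idem m N i)"

definition chi_plus :: "nat \<Rightarrow> nat \<Rightarrow> 'k::field hh" where
  "chi_plus m N = hh_class m N m (int m) (idem m N)"

definition chi_minus :: "nat \<Rightarrow> nat \<Rightarrow> 'k::field hh" where
  "chi_minus m N = hh_class m N m (- int m) (idem m N)"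


section \<open>The polynomial ring in three variables\<close>

text \<open>\<open>X20\<close>, \<open>Xplus\<close>, \<open>Xminus\<close> are the names of the indeterminates for the three classes above.\<close>

datatype chi_var = X20 | Xplus | Xminus

type_synonym 'k poly3 = "(chi_var \<Rightarrow>\<^sub>0 nat) \<Rightarrow>\<^sub>0 'k"

definition poly3_alg :: "('k::field, 'k poly3) module" where
  "poly3_alg =
    \<lparr>carrier = UNIV, monoid.mult = (*), monoid.one = 1, ring.zero = 0, ring.add = (+),
     smult = (\<lambda>k. Poly_Mapping.map ((*) k))\<rparr>"

definition var :: "chi_var \<Rightarrow> 'k::field poly3" where
  "var x = Poly_Mapping.single (Poly_Mapping.single x 1) 1"

definition chi_ideal :: "nat \<Rightarrow> 'k::field poly3 set" where
  "chi_ideal m = Idl\<^bsub>poly3_alg\<^esub> {var X20 ^ m - var Xplus * var Xminus}"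

end

theory Submission
  imports Defs "HOL-Library.Function_Algebras" "HOL-Computational_Algebra.Formal_Power_Series"
begin

text \<open>
  With \<open>G\<^sub>s = \<Sum>\<^sub>i e\<^sub>i \<otimes>\<^sub>s e\<^bsub>i+n-2s\<^esub>\<close> the \<open>n\<close>-th term of the resolution is a free left module on the \<open>G\<^sub>s u\<close>,
  \<open>0 \<le> s \<le> n\<close>, \<open>u \<in> {1, a, b, ab}\<close>, where \<open>a\<close>, \<open>b\<close> are the sums of the two types of arrows. In these
  coordinates the resolution has an explicit contracting homotopy, which makes liftings of a cocycle
  unique up to homotopy, and one lifting is obtained by translating the values of the cocycle.
  Hence the Yoneda product is a convolution with signs of the families of values \<open>F\<^sub>s\<close> on the \<open>G\<^sub>s\<close>.

  A cocycle with values in the radical has cube zero. Modulo the radical a cocycle is determined by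
  one scalar for each \<open>(n, r)\<close> with \<open>r \<le> n\<close> and \<open>m\<close> dividing \<open>n - 2r\<close>. As \<open>m\<close> is even, such \<open>n\<close> are even, all
  such scalars occur, and the signs disappear. So the quotient is the span of the monomials
  \<open>x\<^bsup>n-r\<^esup> y\<^bsup>r\<^esup>\<close> with \<open>m\<close> dividing \<open>n - 2r\<close>, the ring generated by \<open>x y\<close>, \<open>x\<^bsup>m\<^esup>\<close> and \<open>y\<^bsup>m\<^esup>\<close>. There
  \<open>(x y)\<^bsup>m\<^esup> = x\<^bsup>m\<^esup> y\<^bsup>m\<^esup>\<close> is the only relation.
\<close>

section \<open>The algebra \<open>\<Lambda>\<^sub>1\<close> in coordinates\<close>

text \<open>The notions are built from choices: tensor products are quotients of free abelian
  groups, \<open>hom_of_gens\<close> is a definite description, and \<open>yoneda_prod\<close> is a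
  union over all representatives and all liftings, which is a single class only once liftings are
  unique up to homotopy. Hence everything is moved to coordinates. Summing over the vertices leaves
  the \<open>n + 1\<close> elements \<open>G_s\<close> with one shift rule,
  \<open>e_i G_s = G_s e_(i+n-2s)\<close>; a bimodule homomorphism is any family of values obeying
  that rule.

  For N = 1 the cochain differential is a graded commutator with one fixed element, so the Leibniz
  rule is automatic. The cocycle condition makes the scalars at neighbouring vertices agree up to
  \<open>(-1)^(n+s)\<close>. So the scalar at vertex 0 carries everything, and going once around the
  cycle is consistent for even m. This is also the origin of \<open>(-1)^i\<close> in
  \<open>chi20\<close>.

  The bound on the Krull dimension avoids transcendence degrees: three elements satisfy a polynomial
  relation by a dimension count, and its normalized form is incompatible with a chain of four
  primes.\<close>

text \<open>\<open>Zz c c' c'' d\<close> stands for \<open>\<Sum>\<^sub>i c i e\<^sub>i + c' i e\<^sub>i a + c'' i e\<^sub>i b + d i e\<^sub>i a b\<close>, \<open>i \<in> \<int>\<close>, and \<open>\<Lambda>\<^sub>1\<close> is the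
  subalgebra of the elements with \<open>m\<close>-periodic coefficients.\<close>

datatype 'k zz = Zz (ce: "int \<Rightarrow> 'k") (ca: "int \<Rightarrow> 'k") (cb: "int \<Rightarrow> 'k") (cz: "int \<Rightarrow> 'k")

lemma zz_eq_iff: "x = y \<longleftrightarrow> (\<forall>i. ce x i = ce y i \<and> ca x i = ca y i \<and> cb x i = cb y i \<and> cz x i = cz y i)"
  by (cases x; cases y) (auto simp: fun_eq_iff)

text \<open>With indices in all integers the shifts \<open>i + 1\<close> and \<open>i - 1\<close>
  need no reduction; periodicity enters only as the predicate \<open>per\<close>. The product is
  that of the algebra with N = 1: there is no component for the squares of \<open>a\<close> and
  \<open>b\<close>, and \<open>a b\<close> and \<open>b a\<close> both contribute to
  \<open>cz\<close>.\<close>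

instantiation zz :: (comm_ring_1) ring_1
begin
definition "0 = Zz (\<lambda>_. 0) (\<lambda>_. 0) (\<lambda>_. 0) (\<lambda>_. 0)"
definition "1 = Zz (\<lambda>_. 1) (\<lambda>_. 0) (\<lambda>_. 0) (\<lambda>_. 0)"
definition "x + y = Zz (\<lambda>i. ce x i + ce y i) (\<lambda>i. ca x i + ca y i) (\<lambda>i. cb x i + cb y i) (\<lambda>i. cz x i + cz y i)"
definition "x - y = Zz (\<lambda>i. ce x i - ce y i) (\<lambda>i. ca x i - ca y i) (\<lambda>i. cb x i - cb y i) (\<lambda>i. cz x i - cz y i)"
definition "- x = Zz (\<lambda>i. - ce x i) (\<lambda>i. - ca x i) (\<lambda>i. - cb x i) (\<lambda>i. - cz x i)"
definition "x * y = Zz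
   (\<lambda>i. ce x i * ce y i)
   (\<lambda>i. ce x i * ca y i + ca x i * ce y (i + 1))
   (\<lambda>i. ce x i * cb y i + cb x i * ce y (i - 1))
   (\<lambda>i. ce x i * cz y i + cz x i * ce y i + ca x i * cb y (i + 1) + cb x i * ca y (i - 1))"

lemma zz_sel [simp]:
  "ce 0 i = 0" "ca 0 i = 0" "cb 0 i = 0" "cz 0 i = 0"
  "ce 1 i = 1" "ca 1 i = 0" "cb 1 i = 0" "cz 1 i = 0"
  "ce (x + y) i = ce x i + ce y i" "ca (x + y) i = ca x i + ca y i"
  "cb (x + y) i = cb x i + cb y i" "cz (x + y) i = cz x i + cz y i"
  "ce (x - y) i = ce x i - ce y i" "ca (x - y) i = ca x i - ca y i"
  "cb (x - y) i = cb x i - cb y i" "cz (x - y) i = cz x i - cz y i"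
  "ce (- x) i = - ce x i" "ca (- x) i = - ca x i" "cb (- x) i = - cb x i" "cz (- x) i = - cz x i"
  "ce (x * y) i = ce x i * ce y i"
  "ca (x * y) i = ce x i * ca y i + ca x i * ce y (i + 1)"
  "cb (x * y) i = ce x i * cb y i + cb x i * ce y (i - 1)"
  "cz (x * y) i = ce x i * cz y i + cz x i * ce y i + ca x i * cb y (i + 1) + cb x i * ca y (i - 1)"
  by (simp_all add: zero_zz_def one_zz_def plus_zz_def minus_zz_def uminus_zz_def times_zz_def)

instance
  by standard (auto simp: zz_eq_iff algebra_simps)
end

lemma zz_sum_sel [simp]:
  "ce (sum f S) i = (\<Sum>x\<in>S. ce (f x) i)" "ca (sum f S) i = (\<Sum>x\<in>S. ca (f x) i)"
  "cb (sum f S) i = (\<Sum>x\<in>S. cb (f x) i)" "cz (sum f S) i = (\<Sum>x\<in>S. cz (f x) i)"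
  by (induction S rule: infinite_finite_induct) auto

definition zD :: "(int \<Rightarrow> 'k::comm_ring_1) \<Rightarrow> 'k zz" where "zD d = Zz d (\<lambda>_. 0) (\<lambda>_. 0) (\<lambda>_. 0)"
definition zK :: "'k::comm_ring_1 \<Rightarrow> 'k zz" where "zK k = zD (\<lambda>_. k)"
definition zA :: "'k::comm_ring_1 zz" where "zA = Zz (\<lambda>_. 0) (\<lambda>_. 1) (\<lambda>_. 0) (\<lambda>_. 0)"
definition zB :: "'k::comm_ring_1 zz" where "zB = Zz (\<lambda>_. 0) (\<lambda>_. 0) (\<lambda>_. 1) (\<lambda>_. 0)"
definition zE :: "nat \<Rightarrow> int \<Rightarrow> 'k::comm_ring_1 zz" where
  "zE m i = zD (\<lambda>j. if j mod int m = i mod int m then 1 else 0)"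

lemma zz_sel2 [simp]:
  "ce (zD d) i = d i" "ca (zD d) i = 0" "cb (zD d) i = 0" "cz (zD d) i = 0"
  "ce (zK k) i = k" "ca (zK k) i = 0" "cb (zK k) i = 0" "cz (zK k) i = 0"
  "ce zA i = 0" "ca zA i = 1" "cb zA i = 0" "cz zA i = 0"
  "ce zB i = 0" "ca zB i = 0" "cb zB i = 1" "cz zB i = 0"
  "ce (zE m j) i = (if i mod int m = j mod int m then 1 else 0)" "ca (zE m j) i = 0" "cb (zE m j) i = 0" "cz (zE m j) i = 0"
  by (simp_all add: zD_def zK_def zA_def zB_def zE_def)

lemma zz_decomp: "x = zD (ce x) + zD (ca x) * zA + zD (cb x) * zB + zD (cz x) * (zA * zB)"
  by (simp add: zz_eq_iff)

lemma zAB [simp]: "zA * zA = 0" "zB * zB = 0" "zB * zA = zA * zB"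
  by (simp_all add: zz_eq_iff)

lemma zAB' [simp]: "zA * (zA * x) = 0" "zB * (zB * x) = 0" "zB * (zA * x) = zA * (zB * x)"
  by (simp_all flip: mult.assoc)

lemma zK_central: "zK k * x = x * zK k"
  by (simp add: zz_eq_iff)

lemma zK_simps: "zK (k + l) = zK k + zK l" "zK (k * l) = zK k * zK l" "zK 1 = 1" "zK 0 = 0"
  by (simp_all add: zz_eq_iff)

definition per :: "nat \<Rightarrow> 'k::comm_ring_1 zz \<Rightarrow> bool" where
  "per m x \<longleftrightarrow> (\<forall>i. ce x (i mod int m) = ce x i \<and> ca x (i mod int m) = ca x i \<and>
     cb x (i mod int m) = cb x i \<and> cz x (i mod int m) = cz x i)"

lemma perD:
  assumes "per m x" "i mod int m = j mod int m"
  shows "ce x i = ce x j" "ca x i = ca x j" "cb x i = cb x j" "cz x i = cz x j"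
proof -
  have "ce x (i mod int m) = ce x i" "ca x (i mod int m) = ca x i" "cb x (i mod int m) = cb x i" "cz x (i mod int m) = cz x i"
    and "ce x (j mod int m) = ce x j" "ca x (j mod int m) = ca x j" "cb x (j mod int m) = cb x j" "cz x (j mod int m) = cz x j"
    using assms(1) by (auto simp: per_def)
  then show "ce x i = ce x j" "ca x i = ca x j" "cb x i = cb x j" "cz x i = cz x j"
    unfolding assms(2) by simp_all
qed

lemma per_intros [simp, intro]:
  "per m 0" "per m 1" "per m x \<Longrightarrow> per m y \<Longrightarrow> per m (x + y)" "per m x \<Longrightarrow> per m y \<Longrightarrow> per m (x - y)"
  "per m x \<Longrightarrow> per m (- x)" "per m zA" "per m zB" "per m (zK k)" "per m (zE m i)"
  by (simp_all add: per_def)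

lemma per_mult [simp, intro]:
  assumes "per m x" "per m y" shows "per m (x * y)"
proof -
  have s: "(i mod int m + 1) mod int m = (i + 1) mod int m" "(i mod int m - 1) mod int m = (i - 1) mod int m" for i
    by (simp_all add: mod_simps)
  have 1: "ce y (i mod int m + 1) = ce y (i + 1)" "cb y (i mod int m + 1) = cb y (i + 1)"
    "ce y (i mod int m - 1) = ce y (i - 1)" "ca y (i mod int m - 1) = ca y (i - 1)" for i
    by (rule perD[OF assms(2)], rule s)+
  show ?thesis
    using assms by (simp add: per_def 1)
qed

lemma per_sum [simp, intro]: "(\<And>i. i \<in> S \<Longrightarrow> per m (f i)) \<Longrightarrow> per m (sum f S)"
  by (induction S rule: infinite_finite_induct) auto

lemma zE_cong: "i mod int m = j mod int m \<Longrightarrow> zE m i = zE m j"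
  by (simp add: zE_def)

lemma zE_mod [simp]: "zE m (i mod int m) = zE m i"
  by (rule zE_cong) simp

lemma zE_mult: "zE m i * zE m j = (if i mod int m = j mod int m then zE m i else 0)"
  by (auto simp add: zz_eq_iff)

lemma zE_idem [simp]: "zE m i * zE m i = zE m i" by (simp add: zE_mult)

lemma zA_zE: "zA * zE m i = zE m (i - 1) * zA"
  by (simp add: zz_eq_iff mod_eq_dvd_iff algebra_simps)

lemma zB_zE: "zB * zE m i = zE m (i + 1) * zB"
  by (simp add: zz_eq_iff mod_eq_dvd_iff algebra_simps)

lemma sum_zE: 
  assumes "m > 0" shows "(\<Sum>i\<in>{0..<int m}. zE m i) = (1 :: 'k::comm_ring_1 zz)"
proof -
  have "(\<Sum>i\<in>{0..<int m}. if j mod int m = i mod int m then 1 else 0) = (1::'k)" for j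
  proof -
    have "(\<Sum>i\<in>{0..<int m}. if j mod int m = i mod int m then 1 else 0) = (\<Sum>i\<in>{0..<int m}. if i = j mod int m then 1 else (0::'k))"
      by (rule sum.cong) auto
    then show ?thesis using assms by simp
  qed
  then show ?thesis by (simp add: zz_eq_iff)
qed

text \<open>Periodicity matters because \<open>zE m i\<close> is supported on the whole residue
  class of \<open>i\<close>, where \<open>d\<close> has to be constant.\<close>

lemma zD_zE_per:
  assumes "per m (zD d)"
  shows "zD d * zE m i = zK (d i) * zE m i"
proof -
  have *: "d j = d i" if "j mod int m = i mod int m" for j
    using perD(1)[OF assms that] by simp
  show ?thesis unfolding zz_eq_iff by (auto intro: *)
qed

lemma per_zD [simp]: "per m (zD d) \<longleftrightarrow> (\<forall>i. d (i mod int m) = d i)"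
  by (auto simp: per_def)

lemma zD_expand:
  assumes "m > 0" "per m (zD d)"
  shows "zD d = (\<Sum>i\<in>{0..<int m}. zK (d i) * zE m i)"
proof -
  have "zD d = zD d * (\<Sum>i\<in>{0..<int m}. zE m i)" by (simp only: sum_zE[OF assms(1)] mult_1_right)
  also have "\<dots> = (\<Sum>i\<in>{0..<int m}. zK (d i) * zE m i)"
    unfolding sum_distrib_left by (rule sum.cong[OF refl]) (rule zD_zE_per[OF assms(2)])
  finally show ?thesis .
qed

text \<open>The part of degree \<open>k\<close> modulo \<open>m\<close>, spanned by the paths from \<open>i\<close> to \<open>i + k\<close>.\<close>

definition gr :: "nat \<Rightarrow> int \<Rightarrow> 'k::comm_ring_1 zz \<Rightarrow> bool" where
  "gr m k x \<longleftrightarrow> per m x \<and> (\<forall>i. zE m i * x = x * zE m (i + k))"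

lemma gr_intros [simp, intro]:
  "gr m k 0" "gr m 0 1" "gr m k x \<Longrightarrow> gr m k y \<Longrightarrow> gr m k (x + y)" "gr m k x \<Longrightarrow> gr m k y \<Longrightarrow> gr m k (x - y)"
  "gr m k x \<Longrightarrow> gr m k (- x)" 
  by (auto simp: gr_def algebra_simps)

lemma gr_A [simp]: "gr m 1 zA" and gr_B [simp]: "gr m (-1) zB"
  by (auto simp: gr_def zA_zE zB_zE)

lemma gr_mult:
  assumes "gr m k x" "gr m l y" shows "gr m (k + l) (x * y)"
proof -
  have "zE m i * (x * y) = x * y * zE m (i + (k + l))" for i
    using assms unfolding gr_def by (metis mult.assoc add.assoc)
  then show ?thesis using assms by (auto simp: gr_def)
qed

lemma gr_sum [intro]: "(\<And>i. i \<in> S \<Longrightarrow> gr m k (f i)) \<Longrightarrow> gr m k (sum f S)"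
  by (induction S rule: infinite_finite_induct) auto

lemma gr_sign [intro]: "gr m k x \<Longrightarrow> gr m k ((-1) ^ n * x)"
  by (cases "even n") auto

text \<open>A vertex coefficient belongs to a trivial path, which ends where it starts. This is the
  source of the condition that m divides \<open>n - 2 * r\<close>.\<close>

lemma gr_ce: assumes "gr m k x" "ce x i \<noteq> 0" shows "int m dvd k"
proof -
  have "ce (zE m i * x) i = ce (x * zE m (i + k)) i" using assms by (simp add: gr_def)
  then have "i mod int m = (i + k) mod int m" using assms by (simp split: if_splits)
  then have "int m dvd (i + k) - i" by (metis mod_eq_dvd_iff)
  then show ?thesis by simp
qed

definition rad :: "'k::comm_ring_1 zz \<Rightarrow> bool" where "rad x \<longleftrightarrow> (\<forall>i. ce x i = 0)"

text \<open>The radical is spanned by paths of positive length, and no nonzero path has length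
  three. The nilpotency of cocycles with radical values rests on this.\<close>

lemma rad3: assumes "rad x" "rad y" "rad w" shows "x * y * w = 0"
  using assms by (simp add: zz_eq_iff rad_def)

lemma rad_intros [intro]: "rad 0" "rad x \<Longrightarrow> rad y \<Longrightarrow> rad (x + y)" "rad x \<Longrightarrow> rad (x * y)" "rad y \<Longrightarrow> rad (x * y)" "rad zA" "rad zB"
  "rad x \<Longrightarrow> rad (- x)"
  by (auto simp: rad_def)

section \<open>The convolution algebra of cochains\<close>

text \<open>\<open>tc x n r\<close> is the value on \<open>G_r\<close> in cohomological degree
  \<open>n\<close>. All degrees are kept in one object without support conditions, so that the
  convolution makes the whole type a ring.\<close>

datatype 'b tw = Tw (tc: "nat \<Rightarrow> nat \<Rightarrow> 'b")

lemma tw_eq_iff: "x = y \<longleftrightarrow> (\<forall>n r. tc x n r = tc y n r)"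
  by (cases x; cases y) (auto simp: fun_eq_iff)

text \<open>Both sides run over the triples of natural numbers with sum \<open>n\<close>; the pair
  \<open>(j, i)\<close> on the left corresponds to \<open>(i, j - i)\<close> on the right.\<close>

lemma conv_assoc:
  fixes f :: "nat \<Rightarrow> nat \<Rightarrow> nat \<Rightarrow> 'b::comm_monoid_add"
  shows "(\<Sum>j\<le>n. \<Sum>i\<le>j. f i (j - i) (n - j)) = (\<Sum>j\<le>n. \<Sum>i\<le>n - j. f j i (n - j - i))"
proof -
  have "(\<Sum>j\<le>n. \<Sum>i\<le>j. f i (j - i) (n - j)) = (\<Sum>(j, i)\<in>(SIGMA j:{..n}. {..j}). f i (j - i) (n - j))"
    by (simp add: sum.Sigma)
  also have "\<dots> = (\<Sum>(j, i)\<in>(SIGMA j:{..n}. {..n - j}). f j i (n - j - i))"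
    by (rule sum.reindex_bij_witness[where i = "\<lambda>(j, i). (j + i, j)" and j = "\<lambda>(j, i). (i, j - i)"]) auto
  also have "\<dots> = (\<Sum>j\<le>n. \<Sum>i\<le>n - j. f j i (n - j - i))"
    by (simp add: sum.Sigma)
  finally show ?thesis .
qed

text \<open>Two independent instances of \<open>conv_assoc\<close>, one for the degree and one for
  the index r; the sums are interchanged to bring each pair together.\<close>

lemma conv2_assoc:
  fixes f :: "nat \<Rightarrow> nat \<Rightarrow> nat \<Rightarrow> nat \<Rightarrow> nat \<Rightarrow> nat \<Rightarrow> 'b::comm_monoid_add"
  shows "(\<Sum>p\<le>n. \<Sum>t\<le>r. \<Sum>p'\<le>p. \<Sum>t'\<le>t. f p' (p - p') (n - p) t' (t - t') (r - t)) =
         (\<Sum>p\<le>n. \<Sum>t\<le>r. \<Sum>p'\<le>n - p. \<Sum>t'\<le>r - t. f p p' (n - p - p') t t' (r - t - t'))" (is "?L = ?R")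
proof -
  have "?L = (\<Sum>p\<le>n. \<Sum>p'\<le>p. \<Sum>t\<le>r. \<Sum>t'\<le>t. f p' (p - p') (n - p) t' (t - t') (r - t))"
    by (rule sum.cong[OF refl], rule sum.swap)
  also have "\<dots> = (\<Sum>p\<le>n. \<Sum>p'\<le>p. \<Sum>t\<le>r. \<Sum>t'\<le>r - t. f p' (p - p') (n - p) t t' (r - t - t'))"
    by (intro sum.cong[OF refl] conv_assoc)
  also have "\<dots> = (\<Sum>p\<le>n. \<Sum>p'\<le>n - p. \<Sum>t\<le>r. \<Sum>t'\<le>r - t. f p p' (n - p - p') t t' (r - t - t'))"
    by (rule conv_assoc)
  also have "\<dots> = ?R"
    by (rule sum.cong[OF refl], rule sum.swap)
  finally show ?thesis .
qed

lemma sum_atMost_single: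
  fixes n k :: nat
  assumes "\<And>p. p \<le> n \<Longrightarrow> p \<noteq> k \<Longrightarrow> f p = (0::'b::comm_monoid_add)" 
  shows "(\<Sum>p\<le>n. f p) = (if k \<le> n then f k else 0)"
proof -
  have "(\<Sum>p\<le>n. f p) = (\<Sum>p\<in>{..n}. if p = k then f k else 0)" by (rule sum.cong) (use assms in auto)
  also have "\<dots> = (if k \<le> n then f k else 0)" by (subst sum.delta) auto
  finally show ?thesis .
qed

lemma sum_atMost_single2:
  fixes n k r l :: nat
  assumes "\<And>p t. p \<le> n \<Longrightarrow> t \<le> r \<Longrightarrow> \<not> (p = k \<and> t = l) \<Longrightarrow> f p t = (0::'b::comm_monoid_add)"
  shows "(\<Sum>p\<le>n. \<Sum>t\<le>r. f p t) = (if k \<le> n \<and> l \<le> r then f k l else 0)"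
proof -
  have "(\<Sum>p\<le>n. \<Sum>t\<le>r. f p t) = (if k \<le> n then \<Sum>t\<le>r. f k t else 0)"
    by (rule sum_atMost_single) (use assms in \<open>auto intro!: sum.neutral\<close>)
  moreover have "(\<Sum>t\<le>r. f k t) = (if l \<le> r then f k l else 0)" if "k \<le> n"
    by (rule sum_atMost_single) (use assms that in auto)
  ultimately show ?thesis by presburger
qed

lemma sign_left: "x * ((-1) ^ n * y) = (-1) ^ n * (x * (y::'b::ring_1))"
  by (cases "even n") auto

text \<open>The exponent of the sign is the degree of the left factor times the index of the right
  factor. It is biadditive, hence a 2-cocycle, and therefore the twisted convolution is still
  associative. The same sign appears in the explicit lifting \<open>lamc\<close>.\<close>

instantiation tw :: (ring_1) ring_1
begin
definition "0 = Tw (\<lambda>_ _. 0)"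
definition "1 = Tw (\<lambda>n r. if n = 0 \<and> r = 0 then 1 else 0)"
definition "x + y = Tw (\<lambda>n r. tc x n r + tc y n r)"
definition "x - y = Tw (\<lambda>n r. tc x n r - tc y n r)"
definition "- x = Tw (\<lambda>n r. - tc x n r)"
definition "x * y = Tw (\<lambda>n r. \<Sum>p\<le>n. \<Sum>t\<le>r. (-1) ^ (p * (r - t)) * (tc x p t * tc y (n - p) (r - t)))"

lemma tw_sel [simp]:
  "tc 0 n r = 0" "tc 1 n r = (if n = 0 \<and> r = 0 then 1 else 0)" "tc (x + y) n r = tc x n r + tc y n r"
  "tc (x - y) n r = tc x n r - tc y n r" "tc (- x) n r = - tc x n r"
  by (simp_all add: zero_tw_def one_tw_def plus_tw_def minus_tw_def uminus_tw_def)

lemma tc_mult: "tc (x * y) n r = (\<Sum>p\<le>n. \<Sum>t\<le>r. (-1) ^ (p * (r - t)) * (tc x p t * tc y (n - p) (r - t)))"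
  by (simp add: times_tw_def)

instance
proof
  fix x y z :: "'a tw"
  show "x * y * z = x * (y * z)"
  proof (unfold tw_eq_iff, intro allI)
    fix n r
    \<comment> \<open>The exponent keeps \<open>p' + (p - p')\<close> unsimplified: the summand has
      to be a function of the three parts of \<open>n\<close> and the three parts of
      \<open>r\<close>, as \<open>conv2_assoc\<close> requires.\<close>
    have "tc (x * y * z) n r = (\<Sum>p\<le>n. \<Sum>t\<le>r. \<Sum>p'\<le>p. \<Sum>t'\<le>t.
        (-1) ^ ((p' + (p - p')) * (r - t) + p' * (t - t')) * (tc x p' t' * tc y (p - p') (t - t') * tc z (n - p) (r - t)))"
      unfolding tc_mult sum_distrib_left sum_distrib_right
      by (intro sum.cong refl) (auto simp: power_add mult.assoc)
    also have "\<dots> = (\<Sum>p\<le>n. \<Sum>t\<le>r. \<Sum>p'\<le>n - p. \<Sum>t'\<le>r - t.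
        (-1) ^ ((p + p') * (r - t - t') + p * t') * (tc x p t * tc y p' t' * tc z (n - p - p') (r - t - t')))"
      by (rule conv2_assoc)
    also have "\<dots> = tc (x * (y * z)) n r"
      unfolding tc_mult sum_distrib_left sum_distrib_right
    proof (intro sum.cong refl)
      fix p t p' t' assume "t' \<in> {..r - t}"
      then obtain k where "r - t = t' + k" using le_Suc_ex by blast
      then have "(p + p') * (r - t - t') + p * t' = p * (r - t) + p' * (r - t - t')"
        by (simp add: algebra_simps)
      then show "(-1) ^ ((p + p') * (r - t - t') + p * t') * (tc x p t * tc y p' t' * tc z (n - p - p') (r - t - t')) =
        (-1) ^ (p * (r - t)) * (tc x p t * ((-1) ^ (p' * (r - t - t')) * (tc y p' t' * tc z (n - p - p') (r - t - t'))))"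
        by (simp only: power_add sign_left[of "tc x p t"] mult.assoc)
    qed
    finally show "tc (x * y * z) n r = tc (x * (y * z)) n r" .
  qed
  show "1 * x = x"
  proof (unfold tw_eq_iff, intro allI)
    fix n r
    show "tc (1 * x) n r = tc x n r"
      unfolding tc_mult by (subst sum_atMost_single2[where k = 0 and l = 0]) auto
  qed
  show "x * 1 = x"
  proof (unfold tw_eq_iff, intro allI)
    fix n r
    show "tc (x * 1) n r = tc x n r"
      unfolding tc_mult by (subst sum_atMost_single2[where k = n and l = r]) auto
  qed
  show "(0::'a tw) \<noteq> 1" by (metis tw_sel(1,2) zero_neq_one)
qed (auto simp: tw_eq_iff tc_mult algebra_simps sum.distrib)
end

lemma tw_sum_sel [simp]: "tc (sum f S) n r = (\<Sum>x\<in>S. tc (f x) n r)"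
  by (induction S rule: infinite_finite_induct) auto

text \<open>The grading automorphism; it carries the sign in the Leibniz rule for
  \<open>dl\<close>.\<close>

definition hat :: "'b::ring_1 tw \<Rightarrow> 'b tw" where "hat x = Tw (\<lambda>n r. (-1) ^ n * tc x n r)"

lemma tc_hat [simp]: "tc (hat x) n r = (-1) ^ n * tc x n r" by (simp add: hat_def)

lemma hat_hat [simp]: "hat (hat x) = x"
  by (auto simp: tw_eq_iff simp flip: mult.assoc power_add)

lemma sign_hat:
  fixes x y :: "'b::ring_1"
  assumes "even n \<longleftrightarrow> (even p \<longleftrightarrow> even q)"
  shows "(-1) ^ n * ((-1) ^ s * (x * y)) = (-1) ^ s * ((-1) ^ p * x * ((-1) ^ q * y))"
  using assms by (cases "even p"; cases "even q"; cases "even s") simp_all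

lemma hat_mult: "hat (x * y) = hat x * hat y"
proof (unfold tw_eq_iff, intro allI)
  fix n r
  show "tc (hat (x * y)) n r = tc (hat x * hat y) n r"
    unfolding tc_mult tc_hat sum_distrib_left
  proof (intro sum.cong refl)
    fix p t assume "p \<in> {..n}"
    then have "even n \<longleftrightarrow> (even p \<longleftrightarrow> even (n - p))" by (auto simp: even_diff_nat)
    then show "(-1) ^ n * ((-1) ^ (p * (r - t)) * (tc x p t * tc y (n - p) (r - t))) =
       (-1) ^ (p * (r - t)) * ((-1) ^ p * tc x p t * ((-1) ^ (n - p) * tc y (n - p) (r - t)))"
      by (rule sign_hat)
  qed
qed

text \<open>The minus sign at \<open>zB\<close> turns the twist \<open>(-1)^n\<close> of the
  convolution into the sign \<open>(-1)^(n+1)\<close> that the differential from degree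
  \<open>n + 1\<close> to degree \<open>n\<close> carries on its last term.\<close>

definition theta :: "'k::comm_ring_1 zz tw" where
  "theta = Tw (\<lambda>n r. if n = 1 \<and> r = 0 then zA else if n = 1 \<and> r = 1 then - zB else 0)"

text \<open>The differential of the cochain complex is the graded commutator with \<open>theta\<close>.\<close>

definition dl :: "'k::comm_ring_1 zz tw \<Rightarrow> 'k zz tw" where "dl x = x * theta - theta * hat x"

text \<open>The two terms \<open>x * theta * hat y\<close> cancel. Consequently products of cocycles
  are cocycles, and the product of a cocycle with a coboundary, on either side, is a
  coboundary.\<close>

lemma dl_mult: "dl (x * y) = x * dl y + dl x * hat y"
  by (simp add: dl_def hat_mult algebra_simps)

lemma tc_theta: "tc theta n r = (if n = 1 \<and> r = 0 then zA else if n = 1 \<and> r = 1 then - zB else 0)"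
  by (simp add: theta_def)

lemma tc_mult_theta:
  "tc (x * theta) (Suc n) r = tc x n r * zA + (-1) ^ Suc n * (if r = 0 then 0 else tc x n (r - 1) * zB)"
proof -
  have "tc (x * theta) (Suc n) r = (\<Sum>t\<le>r. (-1) ^ (n * (r - t)) * (tc x n t * tc theta 1 (r - t)))"
    unfolding tc_mult by (subst sum_atMost_single[where k = n]) (auto simp: tc_theta intro!: sum.neutral)
  also have "\<dots> = tc x n r * zA + (-1) ^ Suc n * (if r = 0 then 0 else tc x n (r - 1) * zB)"
  proof (cases r)
    case 0 then show ?thesis by (simp add: tc_theta)
  next
    case (Suc s)
    have "(\<Sum>t\<le>s. (-1) ^ (n * (r - t)) * (tc x n t * tc theta 1 (r - t))) = (-1) ^ n * (tc x n s * - zB)"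
      by (subst sum_atMost_single[where k = s]) (auto simp: tc_theta Suc)
    then show ?thesis by (simp add: Suc tc_theta)
  qed
  finally show ?thesis .
qed

lemma tc_theta_mult:
  "tc (theta * x) (Suc n) r = (-1) ^ r * (zA * tc x n r + (if r = 0 then 0 else zB * tc x n (r - 1)))"
proof -
  have "tc (theta * x) (Suc n) r = (\<Sum>t\<le>r. (-1) ^ (r - t) * (tc theta 1 t * tc x n (r - t)))"
    unfolding tc_mult by (subst sum_atMost_single[where k = 1]) (auto simp: tc_theta intro!: sum.neutral)
  also have "\<dots> = (-1) ^ r * (zA * tc x n r + (if r = 0 then 0 else zB * tc x n (r - 1)))"
  proof (cases r)
    case 0 then show ?thesis by (simp add: tc_theta)
  next
    case (Suc s)
    have "(\<Sum>t\<le>s. (-1) ^ (r - Suc t) * (tc theta 1 (Suc t) * tc x n (r - Suc t))) = (-1) ^ s * (- zB * tc x n s)"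
      by (subst sum_atMost_single[where k = 0]) (auto simp: tc_theta Suc)
    then show ?thesis unfolding Suc sum.atMost_Suc_shift by (simp add: tc_theta distrib_left)
  qed
  finally show ?thesis .
qed

lemma tc_mult_0: "tc (x * y) 0 r = (\<Sum>t\<le>r. tc x 0 t * tc y 0 (r - t))"
  by (simp add: tc_mult)

text \<open>These are the four terms of the differential of the resolution, seen on cochains. Since
  \<open>r - 1\<close> is truncated, the terms with index \<open>r - 1\<close> must be switched off
  at \<open>r = 0\<close>.\<close>

lemma tc_dl: "tc (dl x) (Suc n) r = tc x n r * zA + (-1) ^ Suc n * (if r = 0 then 0 else tc x n (r - 1) * zB)
    + (-1) ^ (Suc n + r) * (zA * tc x n r + (if r = 0 then 0 else zB * tc x n (r - 1)))"
  unfolding dl_def tw_sel tc_mult_theta tc_theta_mult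
  by (cases "even n"; cases "even r"; cases "r = 0") (simp_all add: algebra_simps)

lemma tc_dl_0 [simp]: "tc (dl x) 0 r = 0"
  unfolding dl_def tw_sel tc_mult_0 by (simp add: tc_theta)

definition hom_part :: "nat \<Rightarrow> 'b::ring_1 tw \<Rightarrow> 'b tw" where
  "hom_part n x = Tw (\<lambda>k r. if k = n then tc x n r else 0)"

lemma tc_hom_part [simp]: "tc (hom_part n x) k r = (if k = n then tc x n r else 0)"
  by (simp add: hom_part_def)

lemma tc_mult_hom_part: "tc (hom_part p x * hom_part q y) n r =
   (if n = p + q then \<Sum>t\<le>r. (-1) ^ (p * (r - t)) * (tc x p t * tc y q (r - t)) else 0)"
proof -
  have "tc (hom_part p x * hom_part q y) n r = (if p \<le> n then \<Sum>t\<le>r. (-1) ^ (p * (r - t)) * (tc (hom_part p x) p t * tc (hom_part q y) (n - p) (r - t)) else 0)"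
    unfolding tc_mult by (subst sum_atMost_single[where k = p]) auto
  then show ?thesis by (auto intro!: sum.neutral)
qed

section \<open>Subrings of type-class rings as algebras\<close>

definition alg_of :: "'a::ring_1 set \<Rightarrow> ('k \<Rightarrow> 'a \<Rightarrow> 'a) \<Rightarrow> ('k, 'a) module" where
  "alg_of C sm = \<lparr>carrier = C, monoid.mult = (*), monoid.one = 1, ring.zero = 0, ring.add = (+), smult = sm\<rparr>"

lemma alg_of_sel [simp]:
  "carrier (alg_of C sm) = C" "x \<otimes>\<^bsub>alg_of C sm\<^esub> y = x * y" "\<one>\<^bsub>alg_of C sm\<^esub> = 1"
  "\<zero>\<^bsub>alg_of C sm\<^esub> = 0" "x \<oplus>\<^bsub>alg_of C sm\<^esub> y = x + y" "k \<odot>\<^bsub>alg_of C sm\<^esub> x = sm k x"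
  by (simp_all add: alg_of_def)

definition subring_set :: "'a::ring_1 set \<Rightarrow> bool" where
  "subring_set C \<longleftrightarrow> 1 \<in> C \<and> (\<forall>x\<in>C. \<forall>y\<in>C. x - y \<in> C \<and> x * y \<in> C)"

lemma subring_setD:
  assumes "subring_set C"
  shows "1 \<in> C" "0 \<in> C" "x \<in> C \<Longrightarrow> y \<in> C \<Longrightarrow> x - y \<in> C" "x \<in> C \<Longrightarrow> y \<in> C \<Longrightarrow> x * y \<in> C"
    "x \<in> C \<Longrightarrow> - x \<in> C" "x \<in> C \<Longrightarrow> y \<in> C \<Longrightarrow> x + y \<in> C" "x \<in> C \<Longrightarrow> x ^ n \<in> C"
proof -
  show 1: "1 \<in> C" and d: "x \<in> C \<Longrightarrow> y \<in> C \<Longrightarrow> x - y \<in> C" and m: "x \<in> C \<Longrightarrow> y \<in> C \<Longrightarrow> x * y \<in> C" for x y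
    using assms by (auto simp: subring_set_def)
  show 0: "0 \<in> C" using d[OF 1 1] by simp
  show n: "x \<in> C \<Longrightarrow> - x \<in> C" for x using d[OF 0, of x] by simp
  show "x \<in> C \<Longrightarrow> y \<in> C \<Longrightarrow> x + y \<in> C" using d[of x "- y"] n by simp
  show "x \<in> C \<Longrightarrow> x ^ n \<in> C" by (induction n) (auto intro: 1 m)
qed

lemma ring_alg_of: "subring_set C \<Longrightarrow> ring (alg_of C sm)"
  apply (rule ringI)
     apply (rule abelian_groupI)
          apply (auto simp: algebra_simps subring_setD)[5]
  subgoal for x by (rule bexI[of _ "- x"]) (auto simp: subring_setD)
   apply (rule monoidI)
  by (auto simp: algebra_simps subring_setD)

lemma cring_alg_of: "subring_set C \<Longrightarrow> cring (alg_of C sm)" for C :: "'a::comm_ring_1 set"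
  by (intro cring.intro ring_alg_of comm_monoid.intro comm_monoid_axioms.intro ring.is_monoid)
     (auto simp: algebra_simps)

lemma ring_a_inv_eqI:
  assumes "ring R" "x \<in> carrier R" "y \<in> carrier R" "x \<oplus>\<^bsub>R\<^esub> y = \<zero>\<^bsub>R\<^esub>"
  shows "\<ominus>\<^bsub>R\<^esub> x = y"
proof -
  interpret ring R by fact
  show ?thesis using assms by (metis add.inv_comm minus_equality)
qed

lemma alg_of_inv: "subring_set C \<Longrightarrow> x \<in> C \<Longrightarrow> \<ominus>\<^bsub>alg_of C sm\<^esub> x = - x"
  by (rule ring_a_inv_eqI[OF ring_alg_of]) (auto simp: subring_setD)

lemma alg_of_pow [simp]: "x [^]\<^bsub>alg_of C sm\<^esub> (n::nat) = x ^ n"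
  by (induction n) (auto simp: nat_pow_def power_commutes)

section \<open>Linear extension of functions on a basis\<close>

text \<open>The coefficient is an argument of \<open>g\<close>, which only has to be additive in it.
  Integers, scalars embedded by \<open>zK\<close> and scalars embedded by \<open>fc\<close> are thus
  covered alike.\<close>

definition pm_lin :: "('a \<Rightarrow> 'b::zero \<Rightarrow> 'c::comm_monoid_add) \<Rightarrow> ('a \<Rightarrow>\<^sub>0 'b) \<Rightarrow> 'c" where
  "pm_lin g p = (\<Sum>k\<in>Poly_Mapping.keys p. g k (Poly_Mapping.lookup p k))"

lemma pm_lin_superset:
  assumes "finite S" "Poly_Mapping.keys p \<subseteq> S" "\<And>k. g k 0 = 0"
  shows "pm_lin g p = (\<Sum>k\<in>S. g k (Poly_Mapping.lookup p k))"
  unfolding pm_lin_def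
  by (rule sum.mono_neutral_left) (use assms in \<open>auto simp: in_keys_iff\<close>)

lemma pm_lin_0 [simp]: "pm_lin g 0 = 0"
  by (simp add: pm_lin_def)

lemma pm_lin_single: "g k 0 = 0 \<Longrightarrow> pm_lin g (Poly_Mapping.single k c) = g k c"
  by (simp add: pm_lin_def)

lemma pm_lin_add:
  fixes g :: "'a \<Rightarrow> 'b::comm_monoid_add \<Rightarrow> 'c::comm_monoid_add"
  assumes "\<And>k. g k 0 = 0" "\<And>k a b. g k (a + b) = g k a + g k b"
  shows "pm_lin g (p + q) = pm_lin g p + pm_lin g q"
proof -
  let ?S = "Poly_Mapping.keys p \<union> Poly_Mapping.keys q"
  have "pm_lin g (p + q) = (\<Sum>k\<in>?S. g k (Poly_Mapping.lookup (p + q) k))"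
    "pm_lin g p = (\<Sum>k\<in>?S. g k (Poly_Mapping.lookup p k))"
    "pm_lin g q = (\<Sum>k\<in>?S. g k (Poly_Mapping.lookup q k))"
    by (rule pm_lin_superset, use assms keys_add[of p q] in auto)+
  then show ?thesis by (simp add: lookup_add assms sum.distrib)
qed

lemma pm_expand: "p = (\<Sum>k\<in>Poly_Mapping.keys p. Poly_Mapping.single k (Poly_Mapping.lookup p k))"
  for p :: "'a \<Rightarrow>\<^sub>0 'b::comm_monoid_add"
proof (rule poly_mapping_eqI)
  fix l
  have "Poly_Mapping.lookup (\<Sum>k\<in>S. Poly_Mapping.single k (Poly_Mapping.lookup p k)) l =
     (\<Sum>k\<in>S. Poly_Mapping.lookup (Poly_Mapping.single k (Poly_Mapping.lookup p k)) l)" for S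
    by (induction S rule: infinite_finite_induct) (simp_all add: lookup_add)
  then show "Poly_Mapping.lookup p l = Poly_Mapping.lookup (\<Sum>k\<in>Poly_Mapping.keys p. Poly_Mapping.single k (Poly_Mapping.lookup p k)) l"
    by (auto simp: lookup_single when_def in_keys_iff)
qed

lemma lookup_pm_map: "Poly_Mapping.lookup (Poly_Mapping.map ((*) k) p) l = k * Poly_Mapping.lookup (p :: 'a \<Rightarrow>\<^sub>0 'k::field) l"
  by (simp add: map.rep_eq when_def)

text \<open>In the last case the basis element is known to occur in \<open>p\<close>; this is how
  conditions on the support, such as being a walk, reach an induction.\<close>

lemma pm_induct [case_names zero add single]:
  fixes p :: "'a \<Rightarrow>\<^sub>0 'b::comm_monoid_add"
  assumes "P 0"
    and "\<And>p q. P p \<Longrightarrow> P q \<Longrightarrow> P (p + q)"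
    and "\<And>k c. k \<in> Poly_Mapping.keys p \<Longrightarrow> P (Poly_Mapping.single k c)"
  shows "P p"
proof -
  have "P (\<Sum>k\<in>S. Poly_Mapping.single k (Poly_Mapping.lookup p k))" if "S \<subseteq> Poly_Mapping.keys p" for S
    using finite_subset[OF that finite_keys] that
    by (induction S rule: finite_induct) (use assms in auto)
  then show ?thesis using pm_expand[of p] by (metis order_refl)
qed

section \<open>Homomorphisms and quotients of algebras\<close>

text \<open>The first isomorphism theorem for algebras, set up once for three maps: from the path
  algebra onto the coordinates of \<Lambda>, from the polynomial ring onto the target ring, and from
  the cohomology ring onto the target ring.\<close>

locale alg_epi =
  fixes A :: "('k, 'a) module" and C :: "'b::ring_1 set" and sm :: "'k \<Rightarrow> 'b \<Rightarrow> 'b" and h :: "'a \<Rightarrow> 'b"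
  assumes ring_A: "ring A"
    and sub_C: "subring_set C"
    and surj: "h ` carrier A = C"
    and h_mult: "\<And>x y. x \<in> carrier A \<Longrightarrow> y \<in> carrier A \<Longrightarrow> h (x \<otimes>\<^bsub>A\<^esub> y) = h x * h y"
    and h_add: "\<And>x y. x \<in> carrier A \<Longrightarrow> y \<in> carrier A \<Longrightarrow> h (x \<oplus>\<^bsub>A\<^esub> y) = h x + h y"
    and h_one: "h \<one>\<^bsub>A\<^esub> = 1"
    and smult_closed: "\<And>k x. x \<in> carrier A \<Longrightarrow> k \<odot>\<^bsub>A\<^esub> x \<in> carrier A"
    and h_smult: "\<And>k x. x \<in> carrier A \<Longrightarrow> h (k \<odot>\<^bsub>A\<^esub> x) = sm k (h x)"
begin

definition "ker = {x \<in> carrier A. h x = 0}"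

definition "fac X = the_elem (h ` X)"

lemma hom: "ring_hom_ring A (alg_of C sm) h"
proof (rule ring_hom_ringI[OF ring_A ring_alg_of[OF sub_C]])
  show "h x \<in> carrier (alg_of C sm)" if "x \<in> carrier A" for x
    using that surj by auto
qed (simp_all add: h_mult h_add h_one)

lemma ker_eq: "ker = a_kernel A (alg_of C sm) h"
  by (auto simp: ker_def a_kernel_def' )

lemma h_zero: "h \<zero>\<^bsub>A\<^esub> = 0"
proof -
  have "h \<zero>\<^bsub>A\<^esub> = h \<zero>\<^bsub>A\<^esub> + h \<zero>\<^bsub>A\<^esub>"
    using h_add[of "\<zero>\<^bsub>A\<^esub>" "\<zero>\<^bsub>A\<^esub>"] ring.ring_simprules(2,8)[OF ring_A] by simp
  then show ?thesis by simp
qed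

lemma ideal_ker: "ideal ker A"
  unfolding ker_eq by (rule ring_hom_ring.kernel_is_ideal[OF hom])

lemma coset_eq: "u \<in> carrier A \<Longrightarrow> ker +>\<^bsub>A\<^esub> u = {v \<in> carrier A. h v = h u}"
  unfolding ker_eq using ring_hom_ring.rcos_eq_homeq[OF hom] by simp

lemma quot_sel [simp]:
  "carrier (A Quota I) = carrier (A Quot I)" "monoid.mult (A Quota I) = monoid.mult (A Quot I)"
  "\<one>\<^bsub>A Quota I\<^esub> = \<one>\<^bsub>A Quot I\<^esub>" "\<zero>\<^bsub>A Quota I\<^esub> = \<zero>\<^bsub>A Quot I\<^esub>"
  "ring.add (A Quota I) = ring.add (A Quot I)"
  by (simp_all add: quot_alg_def)

lemma fac_coset: "u \<in> carrier A \<Longrightarrow> fac (ker +>\<^bsub>A\<^esub> u) = h u"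
  unfolding fac_def ker_eq by (rule ring_hom_ring.the_elem_simp[OF hom])

lemma carrier_quot: "carrier (A Quota ker) = (\<lambda>u. ker +>\<^bsub>A\<^esub> u) ` carrier A"
  by (auto simp: FactRing_def A_RCOSETS_def')

lemma fac_iso: "fac \<in> ring_iso (A Quota ker) (alg_of C sm)"
proof -
  have "fac \<in> ring_iso (A Quot ker) (alg_of C sm)"
    using ring_hom_ring.FactRing_iso_set[OF hom] surj unfolding fac_def[abs_def] ker_eq by simp
  then show ?thesis unfolding ring_iso_def ring_hom_def by simp
qed

text \<open>All elements of a coset have the same image under \<open>h\<close>, so the union in
  \<open>quot_alg\<close> runs over copies of a single coset.\<close>

lemma smult_quot:
  assumes "u \<in> carrier A"
  shows "k \<odot>\<^bsub>A Quota ker\<^esub> (ker +>\<^bsub>A\<^esub> u) = ker +>\<^bsub>A\<^esub> (k \<odot>\<^bsub>A\<^esub> u)"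
proof -
  have "k \<odot>\<^bsub>A Quota ker\<^esub> (ker +>\<^bsub>A\<^esub> u) = (\<Union>x\<in>ker +>\<^bsub>A\<^esub> u. ker +>\<^bsub>A\<^esub> (k \<odot>\<^bsub>A\<^esub> x))"
    by (simp add: quot_alg_def)
  also have "\<dots> = (\<Union>x\<in>ker +>\<^bsub>A\<^esub> u. ker +>\<^bsub>A\<^esub> (k \<odot>\<^bsub>A\<^esub> u))"
    by (rule SUP_cong) (use assms in \<open>auto simp: coset_eq smult_closed h_smult\<close>)
  also have "\<dots> = ker +>\<^bsub>A\<^esub> (k \<odot>\<^bsub>A\<^esub> u)"
    using assms by (auto simp: coset_eq smult_closed h_smult)
  finally show ?thesis .
qed

lemma fac_alg_iso: "fac \<in> alg_iso (A Quota ker) (alg_of C sm)"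
  unfolding alg_iso_def
proof (intro CollectI conjI allI ballI fac_iso)
  fix k X assume "X \<in> carrier (A Quota ker)"
  then obtain u where "u \<in> carrier A" "X = ker +>\<^bsub>A\<^esub> u" unfolding carrier_quot by blast
  then show "fac (k \<odot>\<^bsub>A Quota ker\<^esub> X) = k \<odot>\<^bsub>alg_of C sm\<^esub> fac X"
    by (simp only: smult_quot fac_coset smult_closed h_smult alg_of_sel)
qed

lemma ring_quot: "ring (A Quota ker)"
proof -
  have "ker \<subseteq> carrier A" by (auto simp: ker_def)
  have "(\<lambda>u. ker +>\<^bsub>A\<^esub> u) \<in> ring_hom A (A Quot ker)"
    by (rule ideal.rcos_ring_hom[OF ideal_ker])
  then have "(\<lambda>u. ker +>\<^bsub>A\<^esub> u) \<in> ring_hom A (A Quota ker)"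
    by (simp add: ring_hom_def)
  from ring.ring_hom_imp_img_ring[OF ring_A this]
  have "ring ((A Quota ker)\<lparr>carrier := carrier (A Quota ker), zero := ker +>\<^bsub>A\<^esub> \<zero>\<^bsub>A\<^esub>\<rparr>)"
    unfolding carrier_quot .
  moreover have "ker +>\<^bsub>A\<^esub> \<zero>\<^bsub>A\<^esub> = \<zero>\<^bsub>A Quota ker\<^esub>"
    using ring.ring_simprules(2)[OF ring_A] h_zero
    by (simp add: coset_eq FactRing_def) (simp add: ker_def)
  moreover have "(A Quota ker)\<lparr>carrier := carrier (A Quota ker), zero := \<zero>\<^bsub>A Quota ker\<^esub>\<rparr> = A Quota ker"
    by (simp add: quot_alg_def)
  ultimately show ?thesis by (simp only:)
qed

lemma smult_quot_closed: "X \<in> carrier (A Quota ker) \<Longrightarrow> k \<odot>\<^bsub>A Quota ker\<^esub> X \<in> carrier (A Quota ker)"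
  unfolding carrier_quot by (elim imageE) (simp only: smult_quot smult_closed image_eqI)

end

lemma alg_iso_inv:
  assumes "h \<in> alg_iso A B" "ring A" "\<And>k x. x \<in> carrier A \<Longrightarrow> k \<odot>\<^bsub>A\<^esub> x \<in> carrier A"
  shows "inv_into (carrier A) h \<in> alg_iso B A"
proof -
  have h: "h \<in> ring_iso A B" and s: "\<And>k x. x \<in> carrier A \<Longrightarrow> h (k \<odot>\<^bsub>A\<^esub> x) = k \<odot>\<^bsub>B\<^esub> h x"
    using assms(1) by (auto simp: alg_iso_def)
  note b = ring_iso_memE(5)[OF h]
  have "inv_into (carrier A) h (k \<odot>\<^bsub>B\<^esub> y) = k \<odot>\<^bsub>A\<^esub> inv_into (carrier A) h y" if y: "y \<in> carrier B" for k y
  proof -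
    obtain x where x: "x \<in> carrier A" "y = h x" using b y by (auto simp: bij_betw_def)
    show ?thesis unfolding x(2) s[OF x(1), symmetric]
      using b x(1) assms(3) by (simp add: bij_betw_def)
  qed
  then show ?thesis using ring_iso_set_sym[OF assms(2) h] by (auto simp: alg_iso_def)
qed

lemma alg_iso_comp:
  assumes "f \<in> alg_iso A B" "g \<in> alg_iso B D" shows "g \<circ> f \<in> alg_iso A D"
  using assms ring_iso_set_trans[of f A B g D] ring_iso_memE(1)[of f A B]
  by (auto simp: alg_iso_def)

lemma ring_iso_hom_ring:
  assumes "h \<in> ring_iso R S" "ring R" "ring S" shows "ring_hom_ring R S h"
  by (rule ring_hom_ringI2) (use assms in \<open>auto simp: ring_iso_def\<close>)

lemma cring_iso:
  assumes "h \<in> ring_iso R S" "ring R" "cring S" shows "cring R"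
proof -
  interpret S: cring S by fact
  interpret R: ring R by fact
  have inj: "inj_on h (carrier R)" using ring_iso_memE(5)[OF assms(1)] by (simp add: bij_betw_def)
  have "x \<otimes>\<^bsub>R\<^esub> y = y \<otimes>\<^bsub>R\<^esub> x" if "x \<in> carrier R" "y \<in> carrier R" for x y
    by (rule inj_onD[OF inj]) (use that ring_iso_memE[OF assms(1)] S.m_comm in auto)
  then show ?thesis
    by (intro cring.intro comm_monoid.intro comm_monoid_axioms.intro R.is_monoid assms(2))
qed

lemma cring_field_ring: "cring (field_ring :: 'k::field ring)"
proof -
  have "cring (alg_of (UNIV :: 'k set) undefined)"
    by (rule cring_alg_of) (simp add: subring_set_def)
  then show ?thesis
    by (simp add: alg_of_def field_ring_def cring_def ring_def abelian_group_def abelian_monoid_def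
        abelian_group_axioms_def ring_axioms_def monoid_def comm_monoid_def comm_monoid_axioms_def
        comm_group_def group_def group_axioms_def Units_def)
qed

text \<open>Every axiom is an equation in \<open>A\<close>, which may be checked after applying the
  injective map \<open>h\<close>.\<close>

lemma alg_iso_algebra:
  assumes "h \<in> alg_iso A B" "ring A" "\<And>k x. x \<in> carrier A \<Longrightarrow> k \<odot>\<^bsub>A\<^esub> x \<in> carrier A"
    and "algebra field_ring B"
  shows "algebra field_ring A"
proof -
  interpret B: algebra field_ring B by fact
  interpret A: ring A by fact
  have h: "h \<in> ring_iso A B" and s: "\<And>k x. x \<in> carrier A \<Longrightarrow> h (k \<odot>\<^bsub>A\<^esub> x) = k \<odot>\<^bsub>B\<^esub> h x"
    using assms(1) by (auto simp: alg_iso_def)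
  have inj: "inj_on h (carrier A)" using ring_iso_memE(5)[OF h] by (simp add: bij_betw_def)
  note hh = ring_iso_memE(1-4)[OF h] s assms(3)
  have F [simp]: "carrier field_ring = UNIV" by (simp add: field_ring_def)
  show ?thesis
  proof (rule algebraI)
    show "cring field_ring" by (rule cring_field_ring)
    show "cring A" by (rule cring_iso[OF h assms(2)]) (rule algebra.axioms(2)[OF assms(4)])
    show "(a \<oplus>\<^bsub>field_ring\<^esub> b) \<odot>\<^bsub>A\<^esub> x = a \<odot>\<^bsub>A\<^esub> x \<oplus>\<^bsub>A\<^esub> b \<odot>\<^bsub>A\<^esub> x" if "x \<in> carrier A" for a b x
      by (rule inj_onD[OF inj]) (use that in \<open>simp_all add: hh B.smult_l_distr\<close>)
    show "a \<odot>\<^bsub>A\<^esub> (x \<oplus>\<^bsub>A\<^esub> y) = a \<odot>\<^bsub>A\<^esub> x \<oplus>\<^bsub>A\<^esub> a \<odot>\<^bsub>A\<^esub> y" if "x \<in> carrier A" "y \<in> carrier A" for a x y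
      by (rule inj_onD[OF inj]) (use that in \<open>simp_all add: hh B.smult_r_distr\<close>)
    show "(a \<otimes>\<^bsub>field_ring\<^esub> b) \<odot>\<^bsub>A\<^esub> x = a \<odot>\<^bsub>A\<^esub> (b \<odot>\<^bsub>A\<^esub> x)" if "x \<in> carrier A" for a b x
      by (rule inj_onD[OF inj]) (use that in \<open>simp_all add: hh B.smult_assoc1\<close>)
    show "\<one>\<^bsub>field_ring\<^esub> \<odot>\<^bsub>A\<^esub> x = x" if "x \<in> carrier A" for x
      by (rule inj_onD[OF inj]) (use that in \<open>simp_all add: hh B.smult_one\<close>)
    show "(a \<odot>\<^bsub>A\<^esub> x) \<otimes>\<^bsub>A\<^esub> y = a \<odot>\<^bsub>A\<^esub> (x \<otimes>\<^bsub>A\<^esub> y)" if "x \<in> carrier A" "y \<in> carrier A" for a x y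
      by (rule inj_onD[OF inj]) (use that in \<open>simp_all add: hh B.smult_assoc2\<close>)
  qed (use assms(3) in auto)
qed

section \<open>Invariance of the Krull dimension under isomorphisms\<close>

lemma krull_dim_mono:
  fixes R :: "('a, 'x) ring_scheme" and S :: "('c, 'y) ring_scheme"
  assumes h: "h \<in> ring_iso R S" and R: "cring R" and S: "cring S"
  shows "krull_dim S \<le> krull_dim R"
proof -
  interpret R: cring R by fact
  interpret S: cring S by fact
  interpret h: ring_hom_ring R S h
    by (rule ring_iso_hom_ring[OF h]) unfold_locales
  have im: "h ` carrier R = carrier S" using ring_iso_memE(5)[OF h] by (simp add: bij_betw_def)
  have "{n. \<exists>C :: nat \<Rightarrow> 'c set. (\<forall>i\<le>n. primeideal (C i) S) \<and> (\<forall>i<n. C i \<subset> C (Suc i))} \<subseteq>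
    {n. \<exists>C :: nat \<Rightarrow> 'a set. (\<forall>i\<le>n. primeideal (C i) R) \<and> (\<forall>i<n. C i \<subset> C (Suc i))}"
  proof clarify
    fix n and C :: "nat \<Rightarrow> 'c set"
    assume C: "\<forall>i\<le>n. primeideal (C i) S" "\<forall>i<n. C i \<subset> C (Suc i)"
    let ?D = "\<lambda>i. {r \<in> carrier R. h r \<in> C i}"
    have "primeideal (?D i) R" if "i \<le> n" for i
      by (rule h.primeideal_vimage[OF R]) (use C that in auto)
    \<comment> \<open>Strictness survives the passage to preimages because \<open>h\<close> is
      surjective.\<close>
    moreover have "?D i \<subset> ?D (Suc i)" if "i < n" for i
    proof -
      have "C i \<subset> C (Suc i)" using C that by auto
      then obtain y where y: "y \<in> C (Suc i)" "y \<notin> C i" by auto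
      have "C (Suc i) \<subseteq> carrier S" using C(1) that
        by (meson Suc_leI ideal.axioms(1) additive_subgroup.a_subset primeideal.axioms(1))
      then obtain x where "x \<in> carrier R" "h x = y" using y im by (metis imageE subsetD)
      then show ?thesis using y \<open>C i \<subset> C (Suc i)\<close> by auto
    qed
    ultimately show "\<exists>C :: nat \<Rightarrow> 'a set. (\<forall>i\<le>n. primeideal (C i) R) \<and> (\<forall>i<n. C i \<subset> C (Suc i))"
      by (intro exI[of _ ?D]) auto
  qed
  then show ?thesis unfolding krull_dim_def by (intro SUP_subset_mono) auto
qed

lemma krull_dim_iso:
  assumes "h \<in> ring_iso R S" "cring R" "cring S"
  shows "krull_dim R = krull_dim S"
  using krull_dim_mono[OF assms] krull_dim_mono[OF ring_iso_set_sym[OF cring.axioms(1)[OF assms(2)] assms(1)] assms(3,2)]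
  by (rule antisym[rotated])

section \<open>The target ring inside power series in two variables\<close>

definition mon :: "nat \<Rightarrow> nat \<Rightarrow> 'k::field fps fps" where
  "mon n r = fps_X ^ n * fps_const (fps_X ^ r)"

definition fc :: "'k::field \<Rightarrow> 'k fps fps" where
  "fc c = fps_const (fps_const c)"

lemma nth_fc_mon [simp]: "fps_nth (fps_nth (fc c * mon n r) i) j = (if i = n \<and> j = r then c else 0)"
  by (simp add: fc_def mon_def fps_X_power_iff)

lemma nth_mon [simp]: "fps_nth (fps_nth (mon n r) i) j = (if i = n \<and> j = r then 1 else 0)"
  by (simp add: mon_def fps_X_power_iff)

lemma nth_fc_mult [simp]: "fps_nth (fps_nth (fc c * f) i) j = c * fps_nth (fps_nth f i) j"
  by (simp add: fc_def)

lemma nth_fc [simp]: "fps_nth (fps_nth (fc c) i) j = (if i = 0 \<and> j = 0 then c else 0)"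
  by (simp add: fc_def)

lemma mon_0 [simp]: "mon 0 0 = 1" by (simp add: mon_def)

lemma mon_mult: "mon n r * mon n' r' = mon (n + n') (r + r')"
  by (simp add: mon_def power_add ac_simps flip: fps_const_mult)

lemma mon_power: "mon n r ^ i = mon (n * i) (r * i)"
  by (induction i) (auto simp: mon_mult)

lemma fc_simps: "fc 0 = 0" "fc 1 = 1" "fc (a + b) = fc a + fc b" "fc (a * b) = fc a * fc b" "fc (- a) = - fc a"
  by (simp_all add: fc_def flip: fps_const_add fps_const_mult fps_const_neg)

lemma ff_eqI: "(\<And>n r. fps_nth (fps_nth f n) r = fps_nth (fps_nth g n) r) \<Longrightarrow> f = g"
  by (simp add: fps_eq_iff)

text \<open>\<open>mon n r\<close> stands for \<open>x\<^bsup>n-r\<^esup> y\<^bsup>r\<^esup>\<close>.\<close>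

definition Tset :: "nat \<Rightarrow> 'k::field fps fps set" where
  "Tset m = {f. (\<exists>N. \<forall>n>N. fps_nth f n = 0) \<and>
     (\<forall>n r. fps_nth (fps_nth f n) r \<noteq> 0 \<longrightarrow> r \<le> n \<and> int m dvd int n - 2 * int r)}"

lemma TsetD: "f \<in> Tset m \<Longrightarrow> fps_nth (fps_nth f n) r \<noteq> 0 \<Longrightarrow> r \<le> n \<and> int m dvd int n - 2 * int r"
  by (auto simp: Tset_def)

text \<open>Power series serve as ambient type because they form an integral domain whose
  coefficients can be read off. The bound on \<open>n\<close>, together with
  \<open>r \<le> n\<close>, makes the elements of \<open>Tset m\<close> polynomials.\<close>

lemma Tset_fin: assumes "f \<in> Tset m" obtains N where "\<And>n r. n > N \<Longrightarrow> fps_nth (fps_nth f n) r = 0"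
proof -
  from assms obtain N where "\<forall>n>N. fps_nth f n = 0" by (auto simp: Tset_def)
  then have "n > N \<Longrightarrow> fps_nth (fps_nth f n) r = 0" for n r by auto
  then show thesis by (rule that)
qed

lemma TsetI: 
  assumes "\<And>n r. n > N \<Longrightarrow> fps_nth (fps_nth f n) r = 0"
    "\<And>n r. fps_nth (fps_nth f n) r \<noteq> 0 \<Longrightarrow> r \<le> n \<and> int m dvd int n - 2 * int r"
  shows "f \<in> Tset m"
proof -
  have "fps_nth f n = 0" if "n > N" for n using assms(1)[OF that] by (simp add: fps_eq_iff)
  then show ?thesis using assms(2) unfolding Tset_def by blast
qed

lemma ff_mult_nth: "fps_nth (fps_nth (f * g) n) r =
    (\<Sum>i\<le>n. \<Sum>j\<le>r. fps_nth (fps_nth f i) j * fps_nth (fps_nth g (n - i)) (r - j))"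
  by (simp add: fps_mult_nth fps_sum_nth atLeast0AtMost)

lemma Tset_mult: assumes "f \<in> Tset m" "g \<in> Tset m" shows "f * g \<in> Tset m"
proof -
  obtain N where N: "\<And>n r. n > N \<Longrightarrow> fps_nth (fps_nth f n) r = 0" using Tset_fin[OF assms(1)] by metis
  obtain M where M: "\<And>n r. n > M \<Longrightarrow> fps_nth (fps_nth g n) r = 0" using Tset_fin[OF assms(2)] by metis
  show ?thesis
  proof (rule TsetI[of "N + M"])
    fix n r assume n: "n > N + M"
    have "fps_nth (fps_nth f i) j * fps_nth (fps_nth g (n - i)) (r - j) = 0" for i j
      using N[of i j] M[of "n - i" "r - j"] n by (cases "i > N") auto
    then show "fps_nth (fps_nth (f * g) n) r = 0" by (simp only: ff_mult_nth sum.neutral_const)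
  next
    fix n r assume "fps_nth (fps_nth (f * g) n) r \<noteq> 0"
    then obtain i where i: "i \<le> n" "(\<Sum>j\<le>r. fps_nth (fps_nth f i) j * fps_nth (fps_nth g (n - i)) (r - j)) \<noteq> 0"
      unfolding ff_mult_nth by (metis (no_types, lifting) atMost_iff sum.not_neutral_contains_not_neutral)
    then obtain j where j: "j \<le> r" "fps_nth (fps_nth f i) j * fps_nth (fps_nth g (n - i)) (r - j) \<noteq> 0"
      by (metis (no_types, lifting) atMost_iff sum.not_neutral_contains_not_neutral)
    then have 1: "j \<le> i \<and> int m dvd int i - 2 * int j" "r - j \<le> n - i \<and> int m dvd int (n - i) - 2 * int (r - j)"
      using TsetD[OF assms(1)] TsetD[OF assms(2)] by (metis mult_eq_0_iff)+
    then have "int m dvd (int i - 2 * int j) + (int (n - i) - 2 * int (r - j))" by (intro dvd_add) auto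
    also have "\<dots> = int n - 2 * int r" using i j by simp
    finally show "r \<le> n \<and> int m dvd int n - 2 * int r" using 1 i j by auto
  qed
qed

lemma subring_Tset: "subring_set (Tset m)"
  unfolding subring_set_def
proof (intro conjI ballI)
  show "(1 :: 'a fps fps) \<in> Tset m" by (rule TsetI[of 0]) (auto split: if_splits)
next
  fix f g :: "'a fps fps" assume fg: "f \<in> Tset m" "g \<in> Tset m"
  show "f * g \<in> Tset m" using fg by (rule Tset_mult)
  obtain N where N: "\<And>n r. n > N \<Longrightarrow> fps_nth (fps_nth f n) r = 0" using Tset_fin[OF fg(1)] by metis
  obtain M where M: "\<And>n r. n > M \<Longrightarrow> fps_nth (fps_nth g n) r = 0" using Tset_fin[OF fg(2)] by metis
  show "f - g \<in> Tset m"
  proof (rule TsetI[of "max N M"])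
    fix n r assume "fps_nth (fps_nth (f - g) n) r \<noteq> 0"
    then have "fps_nth (fps_nth f n) r \<noteq> 0 \<or> fps_nth (fps_nth g n) r \<noteq> 0" by auto
    then show "r \<le> n \<and> int m dvd int n - 2 * int r" using TsetD[OF fg(1)] TsetD[OF fg(2)] by auto
  qed (use N M in auto)
qed

lemmas Tset_closed = subring_setD[OF subring_Tset]

lemma fc_mon_T: "r \<le> n \<Longrightarrow> int m dvd int n - 2 * int r \<Longrightarrow> fc c * mon n r \<in> Tset m"
  by (rule TsetI[of n]) (auto split: if_splits)

lemma fc_T: "fc c \<in> Tset m"
  using fc_mon_T[of 0 0 m c] by simp

lemma ff_expand:
  assumes "\<And>n r. n > N \<Longrightarrow> fps_nth (fps_nth f n) r = 0" "\<And>n r. fps_nth (fps_nth f n) r \<noteq> 0 \<Longrightarrow> r \<le> n"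
  shows "f = (\<Sum>(n, r)\<in>(SIGMA n:{..N}. {..n}). fc (fps_nth (fps_nth f n) r) * mon n r)"
proof (rule ff_eqI)
  fix i j
  have "fps_nth (fps_nth (\<Sum>(n, r)\<in>(SIGMA n:{..N}. {..n}). fc (fps_nth (fps_nth f n) r) * mon n r) i) j
     = (\<Sum>x\<in>(SIGMA n:{..N}. {..n}). if x = (i, j) then fps_nth (fps_nth f i) j else 0)"
    unfolding fps_sum_nth by (rule sum.cong) (auto split: if_splits)
  also have "\<dots> = (if i \<le> N \<and> j \<le> i then fps_nth (fps_nth f i) j else 0)" by auto
  also have "\<dots> = fps_nth (fps_nth f i) j" using assms by (metis leI)
  finally show "fps_nth (fps_nth f i) j = fps_nth (fps_nth (\<Sum>(n, r)\<in>(SIGMA n:{..N}. {..n}). fc (fps_nth (fps_nth f n) r) * mon n r) i) j" ..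
qed

section \<open>The presentation by generators and relations\<close>

definition mexp :: "nat \<Rightarrow> nat \<Rightarrow> nat \<Rightarrow> chi_var \<Rightarrow>\<^sub>0 nat" where
  "mexp a b c = Poly_Mapping.single X20 a + Poly_Mapping.single Xplus b + Poly_Mapping.single Xminus c"

lemma lookup_mexp [simp]: "Poly_Mapping.lookup (mexp a b c) X20 = a" "Poly_Mapping.lookup (mexp a b c) Xplus = b"
  "Poly_Mapping.lookup (mexp a b c) Xminus = c"
  by (simp_all add: mexp_def lookup_add lookup_single)

lemma mexp_cases: obtains a b c where "k = mexp a b c"
proof
  show "k = mexp (Poly_Mapping.lookup k X20) (Poly_Mapping.lookup k Xplus) (Poly_Mapping.lookup k Xminus)"
  proof (rule poly_mapping_eqI)
    fix v show "Poly_Mapping.lookup k v = Poly_Mapping.lookup (mexp (Poly_Mapping.lookup k X20) (Poly_Mapping.lookup k Xplus) (Poly_Mapping.lookup k Xminus)) v"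
      by (cases v) auto
  qed
qed

lemma mexp_add: "mexp a b c + mexp a' b' c' = mexp (a + a') (b + b') (c + c')"
  by (simp add: mexp_def single_add ac_simps)

lemma mexp_0: "mexp 0 0 0 = 0" by (simp add: mexp_def)

abbreviation "mono3 k c \<equiv> Poly_Mapping.single (k :: chi_var \<Rightarrow>\<^sub>0 nat) c"

lemma var_eq: "var X20 = mono3 (mexp 1 0 0) 1" "var Xplus = mono3 (mexp 0 1 0) 1" "var Xminus = mono3 (mexp 0 0 1) 1"
  by (simp_all add: var_def mexp_def)

lemma mono3_mult: "mono3 (mexp a b c) x * mono3 (mexp a' b' c') y = mono3 (mexp (a + a') (b + b') (c + c')) (x * y)"
  by (simp add: mult_single mexp_add)

lemma mono3_power: "mono3 (mexp a b c) 1 ^ n = mono3 (mexp (a * n) (b * n) (c * n)) (1 :: 'k::field)"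
proof (induction n)
  case 0 then show ?case by (simp add: mexp_0)
next
  case (Suc n) then show ?case by (simp add: mono3_mult)
qed

text \<open>The bidegree \<open>(n, r)\<close> of the image of a monomial: the variables have
  bidegrees \<open>(2, 1)\<close>, \<open>(m, 0)\<close> and \<open>(m, m)\<close>, like the three
  classes they stand for.\<close>

definition dg :: "nat \<Rightarrow> (chi_var \<Rightarrow>\<^sub>0 nat) \<Rightarrow> nat \<times> nat" where
  "dg m k = (2 * Poly_Mapping.lookup k X20 + m * (Poly_Mapping.lookup k Xplus + Poly_Mapping.lookup k Xminus),
             Poly_Mapping.lookup k X20 + m * Poly_Mapping.lookup k Xminus)"

definition Ev :: "nat \<Rightarrow> 'k::field poly3 \<Rightarrow> 'k fps fps" where
  "Ev m = pm_lin (\<lambda>k c. fc c * mon (fst (dg m k)) (snd (dg m k)))"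

lemma Ev_single [simp]: "Ev m (mono3 k c) = fc c * mon (fst (dg m k)) (snd (dg m k))"
  by (simp add: Ev_def pm_lin_single fc_simps)

lemma Ev_add: "Ev m (p + q) = Ev m p + Ev m q"
  unfolding Ev_def by (rule pm_lin_add) (auto simp: fc_simps algebra_simps)

lemma Ev_0 [simp]: "Ev m 0 = 0" by (simp add: Ev_def)

lemma Ev_minus: "Ev m (p - q) = Ev m p - Ev m q"
  using Ev_add[of m "p - q" q] by (simp add: algebra_simps)

lemma Ev_mult: "Ev m (p * q) = Ev m p * Ev m q"
proof (induction p rule: pm_induct)
  case (single k c)
  show ?case
  proof (induction q rule: pm_induct)
    case (single l d)
    have "dg m (k + l) = (fst (dg m k) + fst (dg m l), snd (dg m k) + snd (dg m l))"
      by (simp add: dg_def lookup_add algebra_simps)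
    then show ?case
      by (simp add: mult_single fc_simps ac_simps flip: mon_mult)
  qed (simp_all add: Ev_add algebra_simps)
qed (simp_all add: Ev_add algebra_simps)

lemma Ev_T: "Ev m p \<in> Tset m"
proof (induction p rule: pm_induct)
  case (single k c)
  have "int (2 * Poly_Mapping.lookup k X20 + m * (Poly_Mapping.lookup k Xplus + Poly_Mapping.lookup k Xminus)) -
    2 * int (Poly_Mapping.lookup k X20 + m * Poly_Mapping.lookup k Xminus) =
    int m * (int (Poly_Mapping.lookup k Xplus) - int (Poly_Mapping.lookup k Xminus))"
    by (simp add: algebra_simps)
  then show ?case by (auto simp: dg_def intro!: fc_mon_T simp: algebra_simps)
qed (auto simp: Ev_add Tset_closed)

text \<open>The monomial of bidegree \<open>(n, r)\<close> that is not divisible by both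
  \<open>Xplus\<close> and \<open>Xminus\<close>. The number \<open>n - 2 * r\<close> is m times the
  difference of their exponents, so its sign decides which of the two occurs.\<close>

definition red :: "nat \<Rightarrow> nat \<times> nat \<Rightarrow> (chi_var \<Rightarrow>\<^sub>0 nat)" where
  "red m = (\<lambda>(n, r). if 2 * r \<le> n then mexp r ((n - 2 * r) div m) 0 else mexp (n - r) 0 ((2 * r - n) div m))"

lemma dg_red:
  assumes "m > 0" "r \<le> n" "int m dvd int n - 2 * int r" shows "dg m (red m (n, r)) = (n, r)"
proof (cases "2 * r \<le> n")
  case True
  then have "int (n - 2 * r) = int n - 2 * int r" by simp
  then have "m dvd n - 2 * r" using assms(3) by (metis int_dvd_int_iff)
  then show ?thesis using True by (auto simp: red_def dg_def)
next
  case False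
  then have "int (2 * r - n) = - (int n - 2 * int r)" by simp
  then have "m dvd 2 * r - n" using assms(3) by (metis int_dvd_int_iff dvd_minus_iff)
  then show ?thesis using False assms by (auto simp: red_def dg_def)
qed

lemma Ev_surj: assumes "m > 0" "f \<in> Tset m" shows "f \<in> range (Ev m)"
proof -
  obtain N where N: "\<And>n r. n > N \<Longrightarrow> fps_nth (fps_nth f n) r = 0" using Tset_fin[OF assms(2)] by metis
  let ?c = "\<lambda>n r. fps_nth (fps_nth f n) r"
  have "Ev m (\<Sum>x\<in>S. mono3 (red m x) (case x of (n, r) \<Rightarrow> ?c n r)) = (\<Sum>x\<in>S. Ev m (mono3 (red m x) (case x of (n, r) \<Rightarrow> ?c n r)))" for S
    by (induction S rule: infinite_finite_induct) (auto simp: Ev_add)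
  \<comment> \<open>Off the support of \<open>f\<close> the division in \<open>red\<close> may be
    inexact and the bidegree wrong, but there the coefficient is zero.\<close>
  moreover have "Ev m (mono3 (red m x) (case x of (n, r) \<Rightarrow> ?c n r)) = (case x of (n, r) \<Rightarrow> fc (?c n r) * mon n r)" for x
    using dg_red[OF assms(1), of "snd x" "fst x"] TsetD[OF assms(2), of "fst x" "snd x"]
    by (cases "?c (fst x) (snd x) = 0") (auto simp: fc_simps split: prod.splits)
  ultimately have "Ev m (\<Sum>x\<in>(SIGMA n:{..N}. {..n}). mono3 (red m x) (case x of (n, r) \<Rightarrow> ?c n r)) = (\<Sum>(n, r)\<in>(SIGMA n:{..N}. {..n}). fc (?c n r) * mon n r)"
    by (simp only:)
  also have "\<dots> = f" by (rule ff_expand[symmetric, OF N]) (use TsetD[OF assms(2)] in auto)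
  finally show ?thesis by (metis rangeI)
qed

definition rel3 :: "nat \<Rightarrow> 'k::field poly3" where
  "rel3 m = var X20 ^ m - var Xplus * var Xminus"

lemma Ev_rel3 [simp]: "Ev m (rel3 m) = 0"
  by (simp add: rel3_def var_eq mono3_power mono3_mult Ev_minus dg_def mult_2)

lemma rel3_dvd_power: "rel3 m dvd var X20 ^ (m * d) - (var Xplus * var Xminus) ^ d"
proof -
  have "x - y dvd x ^ d - y ^ d" for x y :: "'a poly3"
  proof (induction d)
    case (Suc d)
    have "x ^ Suc d - y ^ Suc d = x * (x ^ d - y ^ d) + (x - y) * y ^ d" by (simp add: algebra_simps)
    then show ?case using Suc by (metis dvd_add dvd_mult dvd_triv_left)
  qed simp
  then show ?thesis unfolding rel3_def power_mult .
qed

text \<open>Normal forms modulo the relation. They link vanishing under \<open>Ev m\<close> with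
  divisibility by \<open>rel3 m\<close>: a polynomial is congruent to its normal form, and the
  normal form can be read off from the evaluation.\<close>

definition NF :: "nat \<Rightarrow> 'k::field poly3 \<Rightarrow> 'k poly3" where
  "NF m = pm_lin (\<lambda>k c. mono3 (red m (dg m k)) c)"

lemma NF_single: "NF m (mono3 k c) = mono3 (red m (dg m k)) c"
  by (simp add: NF_def pm_lin_single)

lemma NF_add: "NF m (p + q) = NF m p + NF m q"
  unfolding NF_def by (rule pm_lin_add) (auto simp: single_add)

lemma red_dg_mk: assumes "m > 0" 
  shows "red m (dg m (mexp a b c)) = mexp (a + m * min b c) (b - min b c) (c - min b c)"
proof (cases "c \<le> b")
  case True
  then have "2 * (a + m * c) \<le> 2 * a + m * (b + c)" by (simp add: algebra_simps)
  moreover have "2 * a + m * (b + c) - 2 * (a + m * c) = m * (b - c)" using True by (simp add: algebra_simps diff_mult_distrib2)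
  ultimately show ?thesis using True assms by (simp add: red_def dg_def min_def)
next
  case False
  then have "\<not> 2 * (a + m * c) \<le> 2 * a + m * (b + c)" using assms by (simp add: algebra_simps)
  moreover have "2 * (a + m * c) - (2 * a + m * (b + c)) = m * (c - b)" using False by (simp add: algebra_simps diff_mult_distrib2)
  moreover have "2 * a + m * (b + c) - (a + m * c) = a + m * b" by (simp add: algebra_simps)
  ultimately show ?thesis using False assms by (simp add: red_def dg_def min_def)
qed

text \<open>On a monomial with \<open>d = min b c\<close>, the normal form replaces the factor
  \<open>(Xplus * Xminus) ^ d\<close> by \<open>X20 ^ (m * d)\<close>.\<close>

lemma NF_cong: assumes "m > 0" shows "rel3 m dvd NF m p - (p :: 'k::field poly3)"
proof (induction p rule: pm_induct)
  case (single k x)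
  obtain a b c where k: "k = mexp a b c" by (rule mexp_cases)
  define d where "d = min b c"
  have "d \<le> b" "d \<le> c" by (auto simp: d_def)
  then have 1: "mono3 k x = mono3 (mexp a (b - d) (c - d)) x * (var Xplus * var Xminus) ^ d"
    by (simp add: k var_eq mono3_mult mono3_power)
  have 2: "NF m (mono3 k x) = mono3 (mexp a (b - d) (c - d)) x * var X20 ^ (m * d)"
    unfolding NF_single k red_dg_mk[OF assms] by (simp add: var_eq mono3_mult mono3_power d_def)
  show ?case unfolding 2 unfolding 1 right_diff_distrib[symmetric] by (intro dvd_mult rel3_dvd_power)
next
  case (add p q)
  have "NF m (p + q) - (p + q) = (NF m p - p) + (NF m q - q)" by (simp add: NF_add)
  then show ?case using add by (metis dvd_add)
qed (simp add: NF_def)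

text \<open>Distinct reduced monomials have distinct bidegrees. So \<open>Ev m\<close> merges
  exactly those coefficients that \<open>NF m\<close> has merged already.\<close>

lemma lookup_NF:
  assumes "m > 0"
  shows "Poly_Mapping.lookup (NF m p) l = 
    (if red m (dg m l) = l then fps_nth (fps_nth (Ev m p) (fst (dg m l))) (snd (dg m l)) else 0)"
proof (induction p rule: pm_induct)
  case (single k c)
  obtain x y z where k: "k = mexp x y z" by (rule mexp_cases)
  \<comment> \<open>Trading \<open>Xplus * Xminus\<close> for \<open>X20 ^ m\<close> does not change
    the bidegree.\<close>
  have dr: "dg m (red m (dg m k)) = dg m k"
  proof -
    obtain y' z' where "y = min y z + y'" "z = min y z + z'" by (metis le_add_diff_inverse min.cobounded1 min.cobounded2)
    moreover have "dg m (mexp (x + m * d) y' z') = dg m (mexp x (d + y') (d + z'))" for d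
      unfolding dg_def lookup_mexp by (simp add: algebra_simps)
    ultimately show ?thesis unfolding k red_dg_mk[OF assms]
      by (metis add_diff_cancel_left')
  qed
  have "red m (dg m k) = l \<longleftrightarrow> red m (dg m l) = l \<and> dg m k = dg m l" using dr by auto
  then show ?case
    by (auto simp: NF_single lookup_single when_def prod_eq_iff)
qed (auto simp: NF_def[symmetric] NF_add Ev_add lookup_add, simp_all add: NF_def)

lemma Ev_kernel: assumes "m > 0" shows "Ev m p = 0 \<longleftrightarrow> rel3 m dvd p"
proof
  assume "Ev m p = 0"
  then have "NF m p = 0" by (intro poly_mapping_eqI) (simp add: lookup_NF[OF assms])
  then show "rel3 m dvd p" using NF_cong[OF assms, of p] by simp
qed (auto simp: Ev_mult)

lemma poly3_alg_eq: "poly3_alg = alg_of UNIV (\<lambda>k. Poly_Mapping.map ((*) k))"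
  by (simp add: poly3_alg_def alg_of_def)

lemma pm_map_eq: "Poly_Mapping.map ((*) k) p = Poly_Mapping.single 0 k * (p :: 'k::field poly3)"
proof (induction p rule: pm_induct)
  case (single l c)
  show ?case by (simp add: mult_single)
next
  case (add p q)
  have "Poly_Mapping.map ((*) k) (p + q) = Poly_Mapping.map ((*) k) p + Poly_Mapping.map ((*) k) q"
    by (rule poly_mapping_eqI) (simp add: lookup_pm_map lookup_add algebra_simps)
  then show ?case using add by (simp only: distrib_left)
next
  case zero
  show ?case by (rule poly_mapping_eqI) (simp add: lookup_pm_map)
qed

lemma chi_ideal_eq: "chi_ideal m = {p :: 'k::field poly3. rel3 m dvd p}"
proof -
  interpret cring "poly3_alg :: ('k, 'k poly3) module"
    unfolding poly3_alg_eq by (rule cring_alg_of) (simp add: subring_set_def)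
  have "chi_ideal m = PIdl\<^bsub>poly3_alg\<^esub> (rel3 m :: 'k poly3)"
    unfolding chi_ideal_def rel3_def[symmetric] by (rule cgenideal_eq_genideal[symmetric]) (simp add: poly3_alg_def)
  also have "\<dots> = {p. rel3 m dvd p}"
    unfolding cgenideal_def by (auto simp: poly3_alg_def dvd_def mult.commute)
  finally show ?thesis .
qed

lemma Ev_epi:
  assumes m: "m > 0"
  shows "alg_epi (poly3_alg :: ('k::field, 'k poly3) module) (Tset m) (\<lambda>k f. fc k * f) (Ev m)"
proof (rule alg_epi.intro)
  show "ring (poly3_alg :: ('k, 'k poly3) module)"
    unfolding poly3_alg_eq by (rule ring_alg_of) (simp add: subring_set_def)
  show "Ev m ` carrier poly3_alg = (Tset m :: 'k fps fps set)"
    using Ev_surj[OF m] Ev_T[of m] by (auto simp: poly3_alg_def)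
  have "Ev m (mono3 0 1) = (1 :: 'k fps fps)" unfolding Ev_single by (simp add: dg_def fc_simps)
  then show "Ev m \<one>\<^bsub>poly3_alg\<^esub> = (1 :: 'k fps fps)" by (simp add: poly3_alg_def)
  show "Ev m (k \<odot>\<^bsub>poly3_alg\<^esub> p) = fc k * Ev m p" for k and p :: "'k poly3"
    unfolding poly3_alg_eq alg_of_sel pm_map_eq Ev_mult Ev_single by (simp add: dg_def)
qed (auto simp: poly3_alg_eq Ev_mult Ev_add subring_Tset)

lemma ker_Ev: "m > 0 \<Longrightarrow> alg_epi.ker poly3_alg (Ev m) = (chi_ideal m :: 'k::field poly3 set)"
  unfolding alg_epi.ker_def[OF Ev_epi] chi_ideal_eq by (simp add: Ev_kernel) (simp add: poly3_alg_def)

section \<open>The Krull dimension of the target ring\<close>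

interpretation ffv: vector_space "\<lambda>(k::'k::field) (f::'k fps fps). fc k * f"
  by standard (simp_all add: fc_simps algebra_simps)

text \<open>A filtration by degree: \<open>Wset D\<close> is spanned by at most
  \<open>(D + 1)^2\<close> monomials, and this quadratic growth is what bounds the dimension by
  two.\<close>

definition Wset :: "nat \<Rightarrow> 'k::field fps fps set" where
  "Wset D = {f. \<forall>n r. fps_nth (fps_nth f n) r \<noteq> 0 \<longrightarrow> n \<le> D \<and> r \<le> n}"

lemma Wset_mult: assumes "f \<in> Wset D" "g \<in> Wset E" shows "f * g \<in> Wset (D + E)"
  unfolding Wset_def
proof (intro CollectI allI impI)
  fix n r assume "fps_nth (fps_nth (f * g) n) r \<noteq> 0"
  then obtain i where i: "i \<le> n" "(\<Sum>j\<le>r. fps_nth (fps_nth f i) j * fps_nth (fps_nth g (n - i)) (r - j)) \<noteq> 0"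
    unfolding ff_mult_nth by (metis (no_types, lifting) atMost_iff sum.not_neutral_contains_not_neutral)
  then obtain j where j: "j \<le> r" "fps_nth (fps_nth f i) j * fps_nth (fps_nth g (n - i)) (r - j) \<noteq> 0"
    by (metis (no_types, lifting) atMost_iff sum.not_neutral_contains_not_neutral)
  then have "fps_nth (fps_nth f i) j \<noteq> 0" "fps_nth (fps_nth g (n - i)) (r - j) \<noteq> 0" by auto
  then have "i \<le> D \<and> j \<le> i" "n - i \<le> E \<and> r - j \<le> n - i"
    using assms unfolding Wset_def by blast+
  then show "n \<le> D + E \<and> r \<le> n" using i j by auto
qed

lemma Wset_mono: "D \<le> E \<Longrightarrow> f \<in> Wset D \<Longrightarrow> f \<in> Wset E"
  by (force simp: Wset_def)

lemma Wset_power: "f \<in> Wset D \<Longrightarrow> f ^ i \<in> Wset (i * D)"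
proof (induction i)
  case 0
  then show ?case using nth_fc[of 1] by (auto simp: Wset_def fc_simps split: if_splits)
next
  case (Suc i)
  then show ?case using Wset_mult[of f D "f ^ i" "i * D"] by simp
qed

lemma Tset_Wset: assumes "f \<in> Tset m" obtains D where "f \<in> Wset D"
proof -
  obtain N where N: "\<And>n r. n > N \<Longrightarrow> fps_nth (fps_nth f n) r = 0" using Tset_fin[OF assms] by metis
  have "n \<le> N \<and> r \<le> n" if "fps_nth (fps_nth f n) r \<noteq> 0" for n r
    using that N[of n r] TsetD[OF assms that] by (cases "n \<le> N") auto
  then have "f \<in> Wset N" unfolding Wset_def by blast
  then show thesis by (rule that)
qed

lemma Wset_span: "Wset D \<subseteq> ffv.span ((\<lambda>(n, r). mon n r :: 'k::field fps fps) ` (SIGMA n:{..D}. {..n}))"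
proof
  fix f :: "'k fps fps" assume f: "f \<in> Wset D"
  have "f = (\<Sum>(n, r)\<in>(SIGMA n:{..D}. {..n}). fc (fps_nth (fps_nth f n) r) * mon n r)"
    by (rule ff_expand) (use f in \<open>force simp: Wset_def\<close>)+
  moreover have "(\<Sum>(n, r)\<in>(SIGMA n:{..D}. {..n}). fc (fps_nth (fps_nth f n) r) * mon n r) \<in> ffv.span ((\<lambda>(n, r). mon n r) ` (SIGMA n:{..D}. {..n}))"
    by (rule ffv.span_sum, clarify, rule ffv.span_scale, rule ffv.span_base) auto
  ultimately show "f \<in> ffv.span ((\<lambda>(n, r). mon n r) ` (SIGMA n:{..D}. {..n}))" by simp
qed

lemma not_inj_onE:
  assumes "\<not> inj_on f A"
  obtains s t where "s \<in> A" "t \<in> A" "s \<noteq> t" "f s = f t"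
  using assms unfolding inj_on_def by blast

text \<open>The \<open>(k + 1)^3\<close> products with exponents at most \<open>k\<close> lie in a
  space of dimension at most \<open>(k D + 1)^2\<close>, where \<open>D\<close> bounds the total
  degree of the three elements. For large \<open>k\<close> there are more products than
  dimensions.\<close>

lemma algebraic_dependence:
  fixes x y z :: "'k::field fps fps"
  assumes "x \<in> Tset m" "y \<in> Tset m" "z \<in> Tset m"
  shows "\<exists>k q. (\<Sum>i\<le>k. \<Sum>j\<le>k. \<Sum>l\<le>k. fc (q i j l) * (x ^ i * (y ^ j * z ^ l))) = 0 \<and>
    (\<exists>i\<le>k. \<exists>j\<le>k. \<exists>l\<le>k. q i j l \<noteq> 0)"
proof -
  obtain D0 D1 D2 where D: "x \<in> Wset D0" "y \<in> Wset D1" "z \<in> Wset D2"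
    using Tset_Wset assms by metis
  define D where "D = D0 + D1 + D2"
  \<comment> \<open>Chosen so that \<open>((k + 1) (D + 1))^2 = (k + 1)^2 k\<close>, which is less
    than \<open>(k + 1)^3\<close>.\<close>
  define k where "k = (D + 1) ^ 2"
  let ?I = "{..k} \<times> {..k} \<times> {..k}"
  let ?v = "\<lambda>(i, j, l). x ^ i * (y ^ j * z ^ l)"
  let ?M = "(\<lambda>(n, r). mon n r :: 'k fps fps) ` (SIGMA n:{..k * D}. {..n})"
  have vW: "?v t \<in> Wset (k * D)" if "t \<in> ?I" for t
  proof -
    obtain i j l where t: "t = (i, j, l)" by (cases t) auto
    then have t': "i \<le> k" "j \<le> k" "l \<le> k" using that by auto
    have "x ^ i * (y ^ j * z ^ l) \<in> Wset (i * D0 + (j * D1 + l * D2))"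
      by (intro Wset_mult Wset_power D)
    moreover have "i * D0 + (j * D1 + l * D2) \<le> k * D0 + (k * D1 + k * D2)"
      by (intro add_mono mult_right_mono t') auto
    ultimately show ?thesis using t Wset_mono by (auto simp: D_def algebra_simps)
  qed
  have "?M \<subseteq> (\<lambda>(n, r). mon n r) ` ({..k * D} \<times> {..k * D})" by auto
  then have "card ?M \<le> card ({..k * D} \<times> {..k * D})" by (meson card_image_le card_mono finite_SigmaI finite_atMost finite_imageI order_trans)
  also have "\<dots> = (k * D + 1) ^ 2" by (simp add: power2_eq_square)
  also have "\<dots> \<le> ((k + 1) * (D + 1)) ^ 2" by (rule power_mono) auto
  also have "\<dots> = (k + 1) ^ 2 * k" unfolding power_mult_distrib k_def[symmetric] ..
  also have "\<dots> < (k + 1) ^ 2 * (k + 1)" by simp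
  also have "\<dots> = card ?I" by (simp add: card_cartesian_product power2_eq_square)
  finally have card: "card ?M < card ?I" .
  have finM: "finite ?M" by auto
  have "\<exists>q. (\<Sum>t\<in>?I. fc (q t) * ?v t) = 0 \<and> (\<exists>t\<in>?I. q t \<noteq> 0)"
  \<comment> \<open>Linear dependence of a set counts each product once. Coinciding products are
    therefore treated apart: they give the relation with coefficients 1 and -1.\<close>
  proof (cases "inj_on ?v ?I")
    case True
    have sub: "?v ` ?I \<subseteq> ffv.span ?M" using Wset_span[of "k * D"] vW by blast
    have "ffv.dependent (?v ` ?I)"
    proof (rule ccontr)
      assume "\<not> ffv.dependent (?v ` ?I)"
      then have "card (?v ` ?I) \<le> card ?M" using ffv.independent_span_bound[OF finM _ sub] by blast
      then show False using card card_image[OF True] by simp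
    qed
    then obtain u where u: "\<exists>v\<in>?v ` ?I. u v \<noteq> 0" "(\<Sum>v\<in>?v ` ?I. fc (u v) * v) = 0"
      using ffv.dependent_finite[of "?v ` ?I"] by auto
    have "(\<Sum>t\<in>?I. fc (u (?v t)) * ?v t) = 0"
      using u(2) by (subst (asm) sum.reindex[OF True]) (simp add: o_def)
    then show ?thesis using u(1) by (intro exI[of _ "\<lambda>t. u (?v t)"]) auto
  next
    case False
    then obtain s t where st: "s \<in> ?I" "t \<in> ?I" "s \<noteq> t" "?v s = ?v t"
      by (rule not_inj_onE)
    define q where "q = (\<lambda>w. if w = s then 1 else if w = t then -1 else (0::'k))"
    have "(\<Sum>w\<in>?I. fc (q w) * ?v w) = (\<Sum>w\<in>{s, t}. fc (q w) * ?v w)"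
      by (rule sum.mono_neutral_right) (use st in \<open>auto simp: q_def fc_simps\<close>)
    also have "\<dots> = 0" using st by (simp add: q_def fc_simps)
    finally show ?thesis using st by (intro exI[of _ q]) (auto simp: q_def)
  qed
  then obtain q where q: "(\<Sum>t\<in>?I. fc (q t) * ?v t) = 0" "\<exists>t\<in>?I. q t \<noteq> 0" by blast
  have "(\<Sum>i\<le>k. \<Sum>j\<le>k. \<Sum>l\<le>k. fc (q (i, j, l)) * (x ^ i * (y ^ j * z ^ l))) = 0"
    using q(1) unfolding sum.cartesian_product' case_prod_conv .
  moreover have "\<exists>i\<le>k. \<exists>j\<le>k. \<exists>l\<le>k. q (i, j, l) \<noteq> 0" using q(2) by auto
  ultimately show ?thesis by (rule_tac exI[of _ k], rule_tac exI[of _ "\<lambda>i j l. q (i, j, l)"], rule_tac conjI)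
qed

text \<open>Splits off the lowest power of \<open>x\<close> that occurs. Applied to
  \<open>x\<close>, then to \<open>y\<close> in the lowest coefficient, then to \<open>z\<close>, it
  isolates the lexicographically least monomial.\<close>

lemma power_sum_split:
  fixes f :: "nat \<Rightarrow> 'a::comm_ring_1"
  assumes C: "subring_set C" "x \<in> C" "\<And>i. f i \<in> C" and k0: "k0 \<le> k" "\<And>i. i < k0 \<Longrightarrow> f i = 0"
  obtains a where "a \<in> C" "(\<Sum>i\<le>k. x ^ i * f i) = x ^ k0 * (f k0 + x * a)"
proof -
  define a where "a = (\<Sum>i\<in>{Suc k0..k}. x ^ (i - Suc k0) * f i)"
  have sumC: "(\<Sum>i\<in>S. g i) \<in> C" if "\<And>i. g i \<in> C" for g :: "nat \<Rightarrow> 'a" and S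
    by (induction S rule: infinite_finite_induct) (use that subring_setD[OF C(1)] in auto)
  have "a \<in> C" unfolding a_def by (rule sumC) (use subring_setD[OF C(1)] C in auto)
  have "{..k} = {..<k0} \<union> ({k0} \<union> {Suc k0..k})" using k0 by auto
  then have "(\<Sum>i\<le>k. x ^ i * f i) = (\<Sum>i<k0. x ^ i * f i) + (x ^ k0 * f k0 + (\<Sum>i\<in>{Suc k0..k}. x ^ i * f i))"
    by (simp only:) (subst sum.union_disjoint; auto)+
  also have "(\<Sum>i<k0. x ^ i * f i) = 0" using k0 by simp
  also have "(\<Sum>i\<in>{Suc k0..k}. x ^ i * f i) = x ^ k0 * (x * a)"
    unfolding a_def sum_distrib_left
  proof (rule sum.cong)
    fix i assume "i \<in> {Suc k0..k}"
    then obtain d where "i = Suc k0 + d" using le_Suc_ex[of "Suc k0" i] by auto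
    then show "x ^ i * f i = x ^ k0 * (x * (x ^ (i - Suc k0) * f i))" by (simp add: power_add algebra_simps)
  qed simp
  finally show thesis by (intro that[OF \<open>a \<in> C\<close>]) (simp add: algebra_simps)
qed

lemma least_le:
  fixes P :: "nat \<Rightarrow> bool"
  assumes "\<exists>i\<le>k. P i"
  obtains i0 where "i0 \<le> k" "P i0" "\<forall>i<i0. \<not> P i"
proof -
  from assms obtain i where i: "i \<le> k" "P i" by (elim exE conjE)
  show thesis
  proof (rule that)
    show "Least P \<le> k" using Least_le[of P, OF i(2)] i(1) by (rule order_trans)
    show "P (Least P)" by (rule LeastI[of P, OF i(2)])
    show "\<forall>j<Least P. \<not> P j" by (intro allI impI) (rule not_less_Least)
  qed
qed

text \<open>The form of an algebraic relation used in the constructive characterization of Krull dimension: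
  it is obtained by factoring out the lexicographically smallest monomial.\<close>

lemma singular_relation:
  fixes x y z :: "'k::field fps fps"
  assumes T: "x \<in> Tset m" "y \<in> Tset m" "z \<in> Tset m"
  obtains k0 k1 k2 a b c where "a \<in> Tset m" "b \<in> Tset m" "c \<in> Tset m"
    "x ^ k0 * (y ^ k1 * (z ^ k2 * (1 + z * c) + y * b) + x * a) = 0"
proof -
  obtain k q where q: "(\<Sum>i\<le>k. \<Sum>j\<le>k. \<Sum>l\<le>k. fc (q i j l) * (x ^ i * (y ^ j * z ^ l))) = 0"
    and nz: "\<exists>i\<le>k. \<exists>j\<le>k. \<exists>l\<le>k. q i j l \<noteq> 0"
    using algebraic_dependence[OF assms] by (erule_tac exE, erule_tac exE, erule_tac conjE) (rule that)
  obtain k0 where k0: "k0 \<le> k" "\<exists>j\<le>k. \<exists>l\<le>k. q k0 j l \<noteq> 0" "\<forall>i<k0. \<not> (\<exists>j\<le>k. \<exists>l\<le>k. q i j l \<noteq> 0)"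
    by (rule least_le[OF nz]) (rule that)
  obtain k1 where k1: "k1 \<le> k" "\<exists>l\<le>k. q k0 k1 l \<noteq> 0" "\<forall>j<k1. \<not> (\<exists>l\<le>k. q k0 j l \<noteq> 0)"
    by (rule least_le[OF k0(2)]) (rule that)
  obtain k2 where k2: "k2 \<le> k" "q k0 k1 k2 \<noteq> 0" "\<forall>l<k2. \<not> q k0 k1 l \<noteq> 0"
    by (rule least_le[OF k1(2)]) (rule that)
  define f2 where "f2 = (\<lambda>i j l. fc (q i j l) :: 'k fps fps)"
  define f1 where "f1 = (\<lambda>i j. \<Sum>l\<le>k. z ^ l * f2 i j l)"
  define f0 where "f0 = (\<lambda>i. \<Sum>j\<le>k. y ^ j * f1 i j)"
  note sT = subring_Tset[of m]
  have sumT: "(\<Sum>i\<in>S. g i) \<in> Tset m" if "\<And>i. g i \<in> Tset m" for g :: "nat \<Rightarrow> 'k fps fps" and S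
    by (induction S rule: infinite_finite_induct) (simp_all add: that Tset_closed)
  have fT: "f2 i j l \<in> Tset m" "f1 i j \<in> Tset m" "f0 i \<in> Tset m" for i j l
    unfolding f0_def f1_def f2_def by (intro sumT Tset_closed fc_T T)+
  have z2: "q i j l = 0 \<Longrightarrow> f2 i j l = 0" for i j l
    by (simp add: f2_def fc_simps)
  have z1: "f1 i j = 0" if "\<forall>l\<le>k. q i j l = 0" for i j
    unfolding f1_def by (intro sum.neutral ballI) (use that in \<open>simp add: f2_def fc_simps\<close>)
  have z0: "f0 i = 0" if "\<forall>j\<le>k. \<forall>l\<le>k. q i j l = 0" for i
    unfolding f0_def by (intro sum.neutral ballI) (use that in \<open>simp add: z1\<close>)
  have "(\<Sum>i\<le>k. x ^ i * f0 i) = 0"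
    using q unfolding f0_def f1_def f2_def by (simp add: sum_distrib_left algebra_simps)
  moreover obtain a where a: "a \<in> Tset m" "(\<Sum>i\<le>k. x ^ i * f0 i) = x ^ k0 * (f0 k0 + x * a)"
    by (rule power_sum_split[OF sT T(1) fT(3) k0(1)]) (use k0(3) z0 in blast)
  moreover obtain b where b: "b \<in> Tset m" "f0 k0 = y ^ k1 * (f1 k0 k1 + y * b)"
    unfolding f0_def
    by (rule power_sum_split[OF sT T(2) fT(2)[of k0] k1(1)]) (use k1(3) z1 in blast)
  moreover obtain c where c: "c \<in> Tset m" "f1 k0 k1 = z ^ k2 * (f2 k0 k1 k2 + z * c)"
    unfolding f1_def
    by (rule power_sum_split[OF sT T(3) fT(1)[of k0 k1] k2(1)]) (use k2(3) z2 in blast)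
  ultimately have rel: "x ^ k0 * (y ^ k1 * (z ^ k2 * (f2 k0 k1 k2 + z * c) + y * b) + x * a) = 0" by simp
  \<comment> \<open>The coefficient of the least monomial is a nonzero scalar, hence a unit, and is
    scaled to 1.\<close>
  define u where "u = fc (inverse (q k0 k1 k2))"
  have u: "u * f2 k0 k1 k2 = 1" using k2(2) by (simp add: u_def f2_def fc_simps flip: fc_simps(4))
  have "x ^ k0 * (y ^ k1 * (z ^ k2 * (1 + z * (u * c)) + y * (u * b)) + x * (u * a)) =
     u * (x ^ k0 * (y ^ k1 * (z ^ k2 * (f2 k0 k1 k2 + z * c) + y * b) + x * a))"
    unfolding u[symmetric] by (simp add: algebra_simps)
  also have "\<dots> = 0" unfolding rel by simp
  finally have rel': "x ^ k0 * (y ^ k1 * (z ^ k2 * (1 + z * (u * c)) + y * (u * b)) + x * (u * a)) = 0" .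
  have uT: "u \<in> Tset m" unfolding u_def by (rule fc_T)
  show thesis
    by (rule that[OF _ _ _ rel']) (intro Tset_closed uT a(1) b(1) c(1))+
qed

lemma primeideal_alg_of:
  fixes \<psi> :: "'a::comm_ring_1 \<Rightarrow> 'b::idom"
  assumes C: "subring_set C" and "\<psi> 1 = 1" "\<And>x y. \<psi> (x - y) = \<psi> x - \<psi> y" "\<And>x y. \<psi> (x * y) = \<psi> x * \<psi> y"
  shows "primeideal {x \<in> C. \<psi> x = 0} (alg_of C sm)"
proof (rule primeidealI)
  note c = subring_setD[OF C]
  have z: "\<psi> 0 = 0" using assms(3)[of 0 0] by simp
  have n: "\<psi> (- x) = - \<psi> x" for x using assms(3)[of 0 x] z by simp
  have p: "\<psi> (x + y) = \<psi> x + \<psi> y" for x y using assms(3)[of x "- y"] n by simp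
  show "cring (alg_of C sm)" by (rule cring_alg_of[OF C])
  show "carrier (alg_of C sm) \<noteq> {x \<in> C. \<psi> x = 0}"
    using c(1) assms(2) by (metis (mono_tags, lifting) mem_Collect_eq zero_neq_one alg_of_sel(1))
  show "ideal {x \<in> C. \<psi> x = 0} (alg_of C sm)"
  proof (rule idealI)
    show "ring (alg_of C sm)" by (rule ring_alg_of[OF C])
    show "subgroup {x \<in> C. \<psi> x = 0} (add_monoid (alg_of C sm))"
    proof
      fix x assume x: "x \<in> {x \<in> C. \<psi> x = 0}"
      have "inv\<^bsub>add_monoid (alg_of C sm)\<^esub> x = - x"
        using alg_of_inv[OF C, of x sm] x by (simp add: a_inv_def)
      then show "inv\<^bsub>add_monoid (alg_of C sm)\<^esub> x \<in> {x \<in> C. \<psi> x = 0}" using x by (simp add: c n)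
    qed (auto simp: c z p)
  qed (auto simp: c assms)
qed (auto simp: assms)

text \<open>For the upper bound, \<open>x\<close>, \<open>y\<close>, \<open>z\<close> are taken from
  the successive differences of a chain of four primes; the relation between them can then be peeled
  until 1 lies in the largest prime. For the lower bound, kernels of specializations form a chain of
  three primes.\<close>

lemma krull_dim_T:
  assumes "m > 0"
  shows "krull_dim (alg_of (Tset m :: 'k::field fps fps set) sm) = 2"
proof (rule antisym)
  let ?R = "alg_of (Tset m :: 'k fps fps set) sm"
  show "krull_dim ?R \<le> 2"
    unfolding krull_dim_def
  proof (rule SUP_least, clarify)
    fix n and C :: "nat \<Rightarrow> 'k fps fps set"
    assume C: "\<forall>i\<le>n. primeideal (C i) ?R" "\<forall>i<n. C i \<subset> C (Suc i)"
    have "n \<le> 2"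
    proof (rule ccontr)
      assume "\<not> n \<le> 2"
      then have prime: "primeideal (C 0) ?R" "primeideal (C 1) ?R" "primeideal (C 2) ?R" "primeideal (C 3) ?R"
        and sub: "C 0 \<subset> C 1" "C 1 \<subset> C 2" "C 2 \<subset> C 3"
        using C(1) C(2)[rule_format, of 0] C(2)[rule_format, of 1] C(2)[rule_format, of 2] by (auto simp: numeral_eq_Suc)
      then obtain x y z where xyz: "x \<in> C 1" "x \<notin> C 0" "y \<in> C 2" "y \<notin> C 1" "z \<in> C 3" "z \<notin> C 2" by blast
      have subT: "C i \<subseteq> Tset m" if "primeideal (C i) ?R" for i
        using additive_subgroup.a_subset[OF ideal.axioms(1)[OF primeideal.axioms(1)[OF that]]] by simp
      have T: "x \<in> Tset m" "y \<in> Tset m" "z \<in> Tset m" using xyz subT prime by blast+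
      have diff: "u - v \<in> P" if "primeideal P ?R" "u \<in> P" "v \<in> P" for P u v
      proof -
        interpret primeideal P ?R by fact
        have "v \<in> Tset m" using Icarr[OF that(3)] by simp
        then have "\<ominus>\<^bsub>?R\<^esub> v = - v" by (rule alg_of_inv[OF subring_Tset])
        then show ?thesis using additive_subgroup.a_closed[OF is_additive_subgroup that(2) additive_subgroup.a_inv_closed[OF is_additive_subgroup that(3)]] by simp
      qed
      have mult: "u * v \<in> P" if "primeideal P ?R" "u \<in> P" "v \<in> Tset m" for P u v
        using ideal.I_r_closed[OF primeideal.axioms(1)[OF that(1)], of u v] that by simp
      have prm: "v \<in> P" if "primeideal P ?R" "u ^ k * v \<in> P" "u \<notin> P" "u \<in> Tset m" "v \<in> Tset m" for P u v k
        using that(2)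
      proof (induction k)
        case (Suc k)
        then have "u * (u ^ k * v) \<in> P" by (simp add: mult.assoc)
        moreover have "u ^ k * v \<in> Tset m" by (intro Tset_closed that)
        ultimately have "u ^ k * v \<in> P" using primeideal.I_prime[OF that(1), of u "u ^ k * v"] that(3,4) by simp
        then show ?case by (rule Suc.IH)
      qed simp
      have z0: "0 \<in> C 0" using additive_subgroup.zero_closed[OF ideal.axioms(1)[OF primeideal.axioms(1)[OF prime(1)]]] by simp
      obtain k0 k1 k2 a b c where abc: "a \<in> Tset m" "b \<in> Tset m" "c \<in> Tset m"
        and rel: "x ^ k0 * (y ^ k1 * (z ^ k2 * (1 + z * c) + y * b) + x * a) = 0"
        by (rule singular_relation[OF T])
      let ?w2 = "1 + z * c"
      let ?w1 = "z ^ k2 * ?w2 + y * b"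
      let ?w0 = "y ^ k1 * ?w1 + x * a"
      have wT: "?w2 \<in> Tset m" "?w1 \<in> Tset m" "?w0 \<in> Tset m" by (intro Tset_closed T abc)+
      \<comment> \<open>Each round cancels a power of an element outside the prime, passes to the
        next prime, and subtracts a multiple of the same element, which lies in that next
        prime.\<close>
      have "?w0 \<in> C 0" using prm[OF prime(1) _ xyz(2) T(1) wT(3)] rel z0 by metis
      then have "?w0 - x * a \<in> C 1" using sub(1) diff[OF prime(2) _ mult[OF prime(2) xyz(1) abc(1)]] by blast
      then have "?w1 \<in> C 1" using prm[OF prime(2) _ xyz(4) T(2) wT(2)] by simp
      then have "?w1 - y * b \<in> C 2" using sub(2) diff[OF prime(3) _ mult[OF prime(3) xyz(3) abc(2)]] by blast
      then have "?w2 \<in> C 2" using prm[OF prime(3) _ xyz(6) T(3) wT(1)] by simp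
      then have "?w2 - z * c \<in> C 3" using sub(3) diff[OF prime(4) _ mult[OF prime(4) xyz(5) abc(3)]] by blast
      then have "1 \<in> C 3" by simp
      then have "Tset m \<subseteq> C 3" using mult[OF prime(4)] by fastforce
      then show False using subT[OF prime(4)] primeideal.I_notcarr[OF prime(4)] by auto
    qed
    then show "enat n \<le> 2" by (metis enat_ord_simps(1) numeral_eq_enat)
  qed
  \<comment> \<open>\<open>\<psi>1\<close> sets the inner variable to zero, which keeps the
    monomials with \<open>r = 0\<close>; \<open>\<psi>2\<close> takes the constant term. The
    inclusions are strict because of the images of \<open>X20\<close> and
    \<open>Xplus\<close>.\<close>
  define \<psi>1 where "\<psi>1 = (\<lambda>f :: 'k fps fps. Abs_fps (\<lambda>n. fps_nth (fps_nth f n) 0))"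
  define \<psi>2 where "\<psi>2 = (\<lambda>f :: 'k fps fps. fps_nth (fps_nth f 0) 0)"
  define C where "C = (\<lambda>i::nat. if i = 0 then {x \<in> Tset m. id x = 0} else if i = 1 then {x \<in> Tset m. \<psi>1 x = 0} else {x \<in> Tset m. \<psi>2 x = 0})"
  have "primeideal {x \<in> Tset m. id x = 0} ?R" by (rule primeideal_alg_of[OF subring_Tset]) auto
  moreover have "primeideal {x \<in> Tset m. \<psi>1 x = 0} ?R"
    by (rule primeideal_alg_of[OF subring_Tset]) (auto simp: \<psi>1_def fps_eq_iff fps_mult_nth fps_sum_nth)
  moreover have "primeideal {x \<in> Tset m. \<psi>2 x = 0} ?R"
    by (rule primeideal_alg_of[OF subring_Tset]) (auto simp: \<psi>2_def)
  ultimately have prime: "primeideal (C i) ?R" for i by (auto simp: C_def)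
  have e20: "mon 2 1 \<in> Tset m" using fc_mon_T[of 1 2 m 1] by (simp add: fc_simps)
  have ep: "mon m 0 \<in> Tset m" using fc_mon_T[of 0 m m 1] by (simp add: fc_simps)
  have "mon 2 1 \<in> C 1 - C 0" using e20 by (auto simp: C_def \<psi>1_def fps_eq_iff)
  moreover have "fps_nth (fps_nth (mon 2 1) 2) 1 = (1 :: 'k)" by simp
  ultimately have "mon 2 1 \<in> C 1 - C 0" by auto
  moreover have "mon m 0 \<in> C 2 - C 1"
    using ep assms by (auto simp: C_def \<psi>1_def \<psi>2_def fps_eq_iff)
  moreover have "C 0 \<subseteq> C 1" by (auto simp: C_def \<psi>1_def fps_eq_iff)
  moreover have "C 1 \<subseteq> C 2" by (auto simp: C_def \<psi>1_def \<psi>2_def fps_eq_iff)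
  ultimately have "C 0 \<subset> C 1" "C 1 \<subset> C 2" by blast+
  then have "C i \<subset> C (Suc i)" if "i < 2" for i
  proof -
    have "i = 0 \<or> i = 1" using that by auto
    then show ?thesis using \<open>C 0 \<subset> C 1\<close> \<open>C 1 \<subset> C 2\<close> by (elim disjE) (simp_all add: numeral_2_eq_2)
  qed
  then have "enat 2 \<le> krull_dim ?R" unfolding krull_dim_def by (intro SUP_upper) (use prime in blast)
  then show "2 \<le> krull_dim ?R" by (simp add: numeral_eq_enat)
qed

section \<open>Walks in the cyclic quiver and its path algebra\<close>

lemma pm_lin_add_fun: "pm_lin (\<lambda>k y. g k y + h k y) c = pm_lin g c + pm_lin h c"
  by (simp add: pm_lin_def sum.distrib)

lemma pm_lin_zero_fun: "(\<And>k y. g k y = 0) \<Longrightarrow> pm_lin g c = 0"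
  by (simp add: pm_lin_def)

definition wk :: "nat \<Rightarrow> int \<Rightarrow> arrow list \<Rightarrow> int \<Rightarrow> bool" where
  "wk m u p v = pre_digraph.awalk (cyc_quiver m) u p v"

definition tl_arr :: "nat \<Rightarrow> arrow \<Rightarrow> int" where "tl_arr m = tail (cyc_quiver m)"
definition hd_arr :: "nat \<Rightarrow> arrow \<Rightarrow> int" where "hd_arr m = head (cyc_quiver m)"

lemma tl_hd [simp]: "tl_arr m (Arr i) = i" "tl_arr m (Bar i) = (i + 1) mod int m"
  "hd_arr m (Arr i) = (i + 1) mod int m" "hd_arr m (Bar i) = i"
  by (simp_all add: tl_arr_def hd_arr_def cyc_quiver_def)

lemma arcs_cyc: "x \<in> arcs (cyc_quiver m) \<longleftrightarrow> (\<exists>i\<in>{0..<int m}. x = Arr i \<or> x = Bar i)"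
  by (auto simp: cyc_quiver_def)

lemma verts_cyc [simp]: "verts (cyc_quiver m) = {0..<int m}"
  by (simp add: cyc_quiver_def)

lemma wk_Nil [simp]: "wk m u [] v \<longleftrightarrow> u \<in> {0..<int m} \<and> u = v"
  by (simp add: wk_def pre_digraph.awalk_def pre_digraph.cas.simps)

lemma hd_arr_verts: "m > 0 \<Longrightarrow> x \<in> arcs (cyc_quiver m) \<Longrightarrow> hd_arr m x \<in> {0..<int m}"
  unfolding arcs_cyc by auto

lemma tl_arr_verts: "m > 0 \<Longrightarrow> x \<in> arcs (cyc_quiver m) \<Longrightarrow> tl_arr m x \<in> {0..<int m}"
  unfolding arcs_cyc by auto

lemma wk_Cons: "m > 0 \<Longrightarrow> wk m u (x # p) v \<longleftrightarrow> x \<in> arcs (cyc_quiver m) \<and> tl_arr m x = u \<and> wk m (hd_arr m x) p v"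
  using hd_arr_verts[of m x] tl_arr_verts[of m x]
  by (auto simp: wk_def pre_digraph.awalk_def pre_digraph.cas.simps tl_arr_def hd_arr_def)

lemma wk_verts: "m > 0 \<Longrightarrow> wk m u p v \<Longrightarrow> u \<in> {0..<int m} \<and> v \<in> {0..<int m}"
proof (induction p arbitrary: u)
  case (Cons x p)
  then show ?case using tl_arr_verts[of m x] by (auto simp: wk_Cons)
qed simp

lemma wk_append: "m > 0 \<Longrightarrow> wk m u (p @ q) w \<longleftrightarrow> (\<exists>v. wk m u p v \<and> wk m v q w)"
proof (induction p arbitrary: u)
  case Nil
  then show ?case using wk_verts[of m u q w] by auto
qed (simp add: wk_Cons)

lemma wk_unique: "m > 0 \<Longrightarrow> wk m u p v \<Longrightarrow> wk m u p v' \<Longrightarrow> v = v'"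
  by (induction p arbitrary: u) (auto simp: wk_Cons)

text \<open>The product of the path algebra, written as a bilinear extension: in this form
  additivity in both arguments is available, and identities reduce to basis paths by
  \<open>pm_induct\<close>.\<close>

definition pmul :: "nat \<Rightarrow> 'k::field kq \<Rightarrow> 'k kq \<Rightarrow> 'k kq" where
  "pmul m b c = pm_lin (\<lambda>k x. pm_lin (\<lambda>l y. if wk m (fst k) (snd k) (fst l)
       then Poly_Mapping.single (fst k, snd k @ snd l) (x * y) else 0) c) b"

lemma pmul_single [simp]:
  "pmul m (Poly_Mapping.single (u, p) x) (Poly_Mapping.single (v, q) y) =
     (if wk m u p v then Poly_Mapping.single (u, p @ q) (x * y) else 0)"
  unfolding pmul_def by (subst pm_lin_single; (subst pm_lin_single)?) (auto simp: pm_lin_zero_fun)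

lemma pmul_add1: "pmul m (b + b') c = pmul m b c + pmul m b' c"
  unfolding pmul_def
proof (rule pm_lin_add)
  fix k :: "int \<times> arrow list" and x y :: 'a
  show "pm_lin (\<lambda>l z. if wk m (fst k) (snd k) (fst l) then Poly_Mapping.single (fst k, snd k @ snd l) ((x + y) * z) else 0) c =
    pm_lin (\<lambda>l z. if wk m (fst k) (snd k) (fst l) then Poly_Mapping.single (fst k, snd k @ snd l) (x * z) else 0) c +
    pm_lin (\<lambda>l z. if wk m (fst k) (snd k) (fst l) then Poly_Mapping.single (fst k, snd k @ snd l) (y * z) else 0) c"
    unfolding pm_lin_add_fun[symmetric]
    by (rule arg_cong[of _ _ "\<lambda>g. pm_lin g c"]) (auto simp: fun_eq_iff distrib_right single_add)
qed (rule pm_lin_zero_fun, simp)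

lemma pmul_add2: "pmul m b (c + c') = pmul m b c + pmul m b c'"
proof -
  have "pm_lin (\<lambda>l y. if wk m (fst k) (snd k) (fst l) then Poly_Mapping.single (fst k, snd k @ snd l) (x * y) else 0) (c + c') =
    pm_lin (\<lambda>l y. if wk m (fst k) (snd k) (fst l) then Poly_Mapping.single (fst k, snd k @ snd l) (x * y) else 0) c +
    pm_lin (\<lambda>l y. if wk m (fst k) (snd k) (fst l) then Poly_Mapping.single (fst k, snd k @ snd l) (x * y) else 0) c'"
    for k :: "int \<times> arrow list" and x :: 'a
    by (rule pm_lin_add) (auto simp: distrib_left single_add)
  then show ?thesis unfolding pmul_def by (simp only: pm_lin_add_fun)
qed

lemma pmul_0 [simp]: "pmul m 0 c = 0" "pmul m b 0 = 0"
  by (simp add: pmul_def) (simp add: pmul_def pm_lin_zero_fun)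

lemma pmul_sum: "pmul m (\<Sum>i\<in>S. f i) c = (\<Sum>i\<in>S. pmul m (f i) c)" "pmul m c (\<Sum>i\<in>S. f i) = (\<Sum>i\<in>S. pmul m c (f i))"
  by (induction S rule: infinite_finite_induct) (auto simp: pmul_add1 pmul_add2)

lemma pmul_diff: "pmul m (b - b') c = pmul m b c - pmul m b' c" "pmul m b (c - c') = pmul m b c - pmul m b c'"
proof -
  have "pmul m (b - b' + b') c = pmul m (b - b') c + pmul m b' c" "pmul m b (c - c' + c') = pmul m b (c - c') + pmul m b c'"
    by (rule pmul_add1, rule pmul_add2)
  then show "pmul m (b - b') c = pmul m b c - pmul m b' c" "pmul m b (c - c') = pmul m b c - pmul m b c'"
    by (simp_all add: algebra_simps)
qed

lemma pmul_assoc: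
  assumes m: "m > 0"
  shows "pmul m (pmul m b c) d = pmul m b (pmul m c d)"
proof (induction b rule: pm_induct)
  case (single k x)
  obtain u p where k: "k = (u, p)" by (cases k)
  show ?case
  proof (induction c rule: pm_induct)
    case (single l y)
    obtain v q where l: "l = (v, q)" by (cases l)
    show ?case
    proof (induction d rule: pm_induct)
      case (single n z)
      obtain w r where n: "n = (w, r)" by (cases n)
      have "wk m u (p @ q) w \<longleftrightarrow> wk m v q w" if "wk m u p v"
      proof
        assume "wk m u (p @ q) w"
        then obtain t where t: "wk m u p t" "wk m t q w" unfolding wk_append[OF m] by (elim exE conjE)
        show "wk m v q w" using t(2) unfolding wk_unique[OF m t(1) that] .
      qed (use that in \<open>auto simp only: wk_append[OF m]\<close>)
      then show ?case by (simp add: k l n mult.assoc)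
    qed (simp_all add: pmul_add2)
  qed (simp_all add: pmul_add1 pmul_add2)
qed (simp_all add: pmul_add1)

definition walks :: "nat \<Rightarrow> (int \<times> arrow list) set" where
  "walks m = {(u, p). \<exists>v. wk m u p v}"

abbreviation "PA m \<equiv> path_algebra (cyc_quiver m)"

lemma PA_sel [simp]:
  "carrier (PA m) = {c. Poly_Mapping.keys c \<subseteq> walks m}" "b \<otimes>\<^bsub>PA m\<^esub> c = pmul m b c"
  "\<one>\<^bsub>PA m\<^esub> = (\<Sum>v\<in>{0..<int m}. Poly_Mapping.single (v, []) 1)" "\<zero>\<^bsub>PA m\<^esub> = 0" "b \<oplus>\<^bsub>PA m\<^esub> c = b + c"
  "k \<odot>\<^bsub>PA m\<^esub> c = Poly_Mapping.map ((*) k) c"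
proof -
  show "b \<otimes>\<^bsub>PA m\<^esub> c = pmul m b c"
    unfolding pmul_def pm_lin_def path_algebra_def wk_def monoid.simps
    by (intro sum.cong refl) (auto simp: split_def intro!: sum.cong)
qed (simp_all add: path_algebra_def walks_def wk_def)

lemma walks_append:
  assumes m: "m > 0" and "(v, q) \<in> walks m" "wk m u p v" shows "(u, p @ q) \<in> walks m"
proof -
  obtain w where "wk m v q w" using assms(2) by (auto simp: walks_def)
  then have "wk m u (p @ q) w" using assms(3) by (auto simp only: wk_append[OF m])
  then show ?thesis by (auto simp: walks_def)
qed

lemma walks_Nil [simp]: "(u, []) \<in> walks m \<longleftrightarrow> u \<in> {0..<int m}"
  by (auto simp: walks_def)

lemma pmul_closed:
  assumes m: "m > 0" and "Poly_Mapping.keys b \<subseteq> walks m" "Poly_Mapping.keys c \<subseteq> walks m"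
  shows "Poly_Mapping.keys (pmul m b c) \<subseteq> walks m"
proof (induction b rule: pm_induct)
  case (single k x)
  obtain u p where k: "k = (u, p)" by (cases k)
  have kw: "(u, p) \<in> walks m" using single assms(2) k by auto
  show ?case
  proof (induction c rule: pm_induct)
    case (single l y)
    obtain v q where l: "l = (v, q)" by (cases l)
    have lw: "(v, q) \<in> walks m" using single assms(3) l by auto
    show ?case using walks_append[OF m lw] by (simp add: k l)
  next
    case (add p q) then show ?case unfolding pmul_add2 using keys_add by fastforce
  qed simp
next
  case (add p q) then show ?case unfolding pmul_add1 using keys_add by fastforce
qed simp

lemma PA_one: assumes m: "m > 0" and "Poly_Mapping.keys c \<subseteq> walks m"
  shows "pmul m (\<Sum>v\<in>{0..<int m}. Poly_Mapping.single (v, []) 1) c = c"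
    "pmul m c (\<Sum>v\<in>{0..<int m}. Poly_Mapping.single (v, []) 1) = c"
proof -
  show "pmul m (\<Sum>v\<in>{0..<int m}. Poly_Mapping.single (v, []) 1) c = c"
  proof (induction c rule: pm_induct)
    case (single k x)
    obtain u p where k: "k = (u, p)" by (cases k)
    obtain w where "wk m u p w" using single assms(2) k by (auto simp: walks_def)
    then have "u \<in> {0..<int m}" using wk_verts[OF m] by blast
    moreover have "(\<Sum>v\<in>{0..<int m}. if 0 \<le> v \<and> v < int m \<and> v = u then Poly_Mapping.single (v, p) x else 0) = 
      (\<Sum>v\<in>{0..<int m}. if v = u then Poly_Mapping.single (u, p) x else 0)" by (rule sum.cong) auto
    ultimately show ?case by (simp add: k pmul_sum)
  qed (simp_all add: pmul_add2)
  show "pmul m c (\<Sum>v\<in>{0..<int m}. Poly_Mapping.single (v, []) 1) = c"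
  proof (induction c rule: pm_induct)
    case (single k x)
    obtain u p where k: "k = (u, p)" by (cases k)
    obtain w where w: "wk m u p w" using single assms(2) k by (auto simp: walks_def)
    then have wm: "w \<in> {0..<int m}" using wk_verts[OF m] by blast
    have "wk m u p v \<longleftrightarrow> v = w" for v
      using wk_unique[OF m w, of v] w by blast
    then show ?case using wm by (simp add: k pmul_sum)
  qed (simp_all add: pmul_add1)
qed

lemma ring_PA: assumes m: "m > 0" shows "ring (PA m :: ('k::field, 'k kq) module)"
proof (rule ringI)
  have ka: "Poly_Mapping.keys (b + c) \<subseteq> walks m" if "Poly_Mapping.keys b \<subseteq> walks m" "Poly_Mapping.keys c \<subseteq> walks m"
    for b c :: "'k kq" using that keys_add[of b c] by blast
  show "abelian_group (PA m :: ('k, 'k kq) module)"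
  proof (rule abelian_groupI)
    fix x :: "'k kq" assume "x \<in> carrier (PA m)"
    then show "\<exists>y\<in>carrier (PA m). y \<oplus>\<^bsub>PA m\<^esub> x = \<zero>\<^bsub>PA m\<^esub>"
      by (intro bexI[of _ "- x"]) (auto simp: Poly_Mapping.keys.rep_eq)
  qed (simp_all add: ka add.assoc add.commute)
  show "Group.monoid (PA m :: ('k, 'k kq) module)"
  proof (rule monoidI)
    have "Poly_Mapping.keys (\<Sum>v\<in>S. Poly_Mapping.single (v, []) (1::'k)) \<subseteq> walks m" if "S \<subseteq> {0..<int m}" for S :: "int set"
      using finite_subset[OF that] that
      by (induction S rule: finite_induct) (simp_all add: ka)
    then show "\<one>\<^bsub>PA m\<^esub> \<in> carrier (PA m :: ('k, 'k kq) module)" by simp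
  qed (simp_all add: pmul_closed[OF m] pmul_assoc[OF m] PA_one[OF m])
qed (simp_all add: pmul_add1 pmul_add2)

section \<open>Evaluation of paths in coordinates\<close>

definition word :: "arrow list \<Rightarrow> 'k::field zz" where
  "word p = prod_list (map (\<lambda>x. case x of Arr i \<Rightarrow> zA | Bar i \<Rightarrow> zB) p)"

lemma word_simps [simp]: "word [] = 1" "word (Arr i # p) = zA * word p" "word (Bar i # p) = zB * word p"
  "word (p @ q) = word p * word q"
  by (simp_all add: word_def)

lemma per_word [simp]: "per m (word p)"
proof (induction p)
  case (Cons x p) then show ?case by (cases x) auto
qed simp

text \<open>Each arrow moves the idempotent by one vertex. In \<open>pim_mult\<close> this turns the
  composability test of \<open>pmul\<close> into the orthogonality of two idempotents.\<close>

lemma zE_word: "m > 0 \<Longrightarrow> wk m u p v \<Longrightarrow> zE m u * word p = (word p * zE m v :: 'k::field zz)"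
proof (induction p arbitrary: u)
  case (Cons x p)
  have w: "wk m (hd_arr m x) p v" and tl: "tl_arr m x = u"
    using Cons.prems by (simp_all add: wk_Cons)
  note IH = Cons.IH[OF Cons.prems(1) w]
  show ?case
  proof (cases x)
    case (Arr i)
    have "zE m u * (zA * word p) = (zE m i * zA) * (word p :: 'k zz)"
      unfolding tl[symmetric] Arr by (simp add: mult.assoc)
    also have "zE m i * zA = (zA * zE m (i + 1) :: 'k zz)" by (simp add: zA_zE)
    finally show ?thesis using IH by (simp add: Arr mult.assoc)
  next
    case (Bar i)
    have "zE m u * (zB * word p) = (zE m (i + 1) * zB) * (word p :: 'k zz)"
      unfolding tl[symmetric] Bar by (simp add: mult.assoc)
    also have "zE m (i + 1) * zB = (zB * zE m i :: 'k zz)" by (simp add: zB_zE)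
    finally show ?thesis using IH by (simp add: Bar mult.assoc)
  qed
qed simp

lemma zK_left: "x * (zK k * y) = zK k * (x * y)"
  by (metis mult.assoc zK_central)

definition pim :: "nat \<Rightarrow> 'k::field kq \<Rightarrow> 'k zz" where
  "pim m = pm_lin (\<lambda>k x. zK x * (zE m (fst k) * word (snd k)))"

lemma pim_single [simp]: "pim m (Poly_Mapping.single (u, p) x) = zK x * (zE m u * word p)"
  by (simp add: pim_def pm_lin_single zK_simps)

lemma pim_add: "pim m (b + c) = pim m b + pim m c"
  unfolding pim_def by (rule pm_lin_add) (auto simp: zK_simps distrib_right)

lemma pim_0 [simp]: "pim m 0 = 0" by (simp add: pim_def)

lemma pim_diff: "pim m (b - c) = pim m b - pim m c"
  using pim_add[of m "b - c" c] by (simp add: algebra_simps)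

lemma pim_sum: "pim m (\<Sum>i\<in>S. f i) = (\<Sum>i\<in>S. pim m (f i))"
  by (induction S rule: infinite_finite_induct) (auto simp: pim_add)

lemma per_pim [simp]: "per m (pim m c)"
proof (induction c rule: pm_induct)
  case (single k c) then show ?case by (cases k) simp
qed (simp_all add: pim_add)

lemma pim_mult:
  assumes m: "m > 0" and "Poly_Mapping.keys b \<subseteq> walks m" "Poly_Mapping.keys c \<subseteq> walks m"
  shows "pim m (pmul m b c) = pim m b * pim m c"
proof (induction b rule: pm_induct)
  case (single k x)
  obtain u p where k: "k = (u, p)" by (cases k)
  obtain u' where kw: "wk m u p u'" using single assms(2) k by (auto simp: walks_def)
  show ?case
  proof (induction c rule: pm_induct)
    case (single l y)
    obtain v q where l: "l = (v, q)" by (cases l)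
    obtain v' where lw: "wk m v q v'" using single assms(3) l by (auto simp: walks_def)
    have uv: "u' \<in> {0..<int m}" "v \<in> {0..<int m}" using wk_verts[OF m] kw lw by blast+
    have "zK x * (zE m u * word p) * (zK y * (zE m v * word q)) = zK (x * y) * (word p * (zE m u' * zE m v) * word q)"
      unfolding zE_word[OF m kw]
      by (simp only: mult.assoc zK_simps(2) zK_left[of "word p"] zK_left[of "zE m u'"])
    also have "\<dots> = (if u' = v then zK (x * y) * (word p * zE m u' * word q) else 0)"
      using uv by (auto simp: zE_mult)
    also have "\<dots> = (if u' = v then zK (x * y) * (zE m u * word (p @ q)) else 0)"
      unfolding zE_word[OF m kw, symmetric] by (simp add: mult.assoc)
    finally have eq: "zK x * (zE m u * word p) * (zK y * (zE m v * word q)) = (if u' = v then zK (x * y) * (zE m u * word (p @ q)) else 0)" .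
    have "wk m u p v \<longleftrightarrow> u' = v" using wk_unique[OF m kw, of v] kw by blast
    then show ?case unfolding k l pim_single eq pmul_single by simp
  qed (simp_all add: pmul_add2 pim_add distrib_left)
qed (simp_all add: pmul_add1 pim_add distrib_right)

text \<open>A linear section of \<open>pim m\<close>. At each vertex \<open>i\<close> it uses one
  path for each of the four components; the barred arrow that starts at \<open>i\<close> has index
  \<open>i - 1\<close>, and \<open>a\<close> followed by its partner is the chosen path of length
  two.\<close>

definition rho :: "nat \<Rightarrow> 'k::field zz \<Rightarrow> 'k kq" where
  "rho m y = (\<Sum>i\<in>{0..<int m}. Poly_Mapping.single (i, []) (ce y i) + Poly_Mapping.single (i, [Arr i]) (ca y i) +
     Poly_Mapping.single (i, [Bar ((i - 1) mod int m)]) (cb y i) + Poly_Mapping.single (i, [Arr i, Bar i]) (cz y i))"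

lemma rho_add: "rho m (x + y) = rho m x + rho m y"
  unfolding rho_def sum.distrib[symmetric] by (rule sum.cong) (auto simp: single_add)

lemma rho_0 [simp]: "rho m 0 = 0" by (simp add: rho_def)

lemma pim_rho: assumes m: "m > 0" and y: "per m y" shows "pim m (rho m y) = y"
proof -
  have p: "per m (zD (ce y))" "per m (zD (ca y))" "per m (zD (cb y))" "per m (zD (cz y))"
    using y by (auto simp: per_def)
  have "pim m (rho m y) = (\<Sum>i\<in>{0..<int m}. zK (ce y i) * zE m i + zK (ca y i) * zE m i * zA
     + zK (cb y i) * zE m i * zB + zK (cz y i) * zE m i * (zA * zB))"
    unfolding rho_def pim_sum by (simp add: pim_add mult.assoc)
  also have "\<dots> = zD (ce y) + zD (ca y) * zA + zD (cb y) * zB + zD (cz y) * (zA * zB)"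
    unfolding zD_expand[OF m p(1)] zD_expand[OF m p(2)] zD_expand[OF m p(3)] zD_expand[OF m p(4)]
    by (simp add: sum.distrib sum_distrib_right)
  also have "\<dots> = y" by (rule zz_decomp[symmetric])
  finally show ?thesis .
qed


section \<open>The algebra \<open>\<Lambda>\<^sub>1\<close>\<close>

definition rels1 :: "nat \<Rightarrow> 'k::field kq set" where
  "rels1 m = (\<Union>i\<in>{0..<int m}. {pmul m (arr m i) (arr m (i + 1)), pmul m (bar m (i - 1)) (bar m (i - 2)),
      pmul m (arr m i) (bar m i) - pmul m (bar m (i - 1)) (arr m (i - 1))})"

lemma wk_arr: "m > 0 \<Longrightarrow> wk m (i mod int m) [Arr (i mod int m)] ((i + 1) mod int m)"
  and wk_bar: "m > 0 \<Longrightarrow> wk m ((i + 1) mod int m) [Bar (i mod int m)] (i mod int m)"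
  by (simp_all add: wk_Cons arcs_cyc mod_simps)

lemma keys_arr: "m > 0 \<Longrightarrow> Poly_Mapping.keys (arr m i) \<subseteq> walks m"
  and keys_bar: "m > 0 \<Longrightarrow> Poly_Mapping.keys (bar m i) \<subseteq> walks m"
  using wk_arr[of m i] wk_bar[of m i] by (auto simp: arr_def bar_def walks_def simp del: wk_Nil)

lemma arr_arr: "m > 0 \<Longrightarrow> pmul m (arr m i) (arr m (i + 1)) =
    Poly_Mapping.single (i mod int m, [Arr (i mod int m), Arr ((i + 1) mod int m)]) 1"
  and bar_bar: "m > 0 \<Longrightarrow> pmul m (bar m (i - 1)) (bar m (i - 2)) =
    Poly_Mapping.single (i mod int m, [Bar ((i - 1) mod int m), Bar ((i - 2) mod int m)]) 1"
  and arr_bar: "m > 0 \<Longrightarrow> pmul m (arr m i) (bar m i) =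
    Poly_Mapping.single (i mod int m, [Arr (i mod int m), Bar (i mod int m)]) 1"
  and bar_arr: "m > 0 \<Longrightarrow> pmul m (bar m (i - 1)) (arr m (i - 1)) =
    Poly_Mapping.single (i mod int m, [Bar ((i - 1) mod int m), Arr ((i - 1) mod int m)]) 1"
  using wk_arr[of m i] wk_bar[of m "i - 1"] wk_bar[of m i]
  by (simp_all add: arr_def bar_def)

lemma rel_ideal_eq:
  assumes m: "m > 0"
  shows "rel_ideal m 1 = Idl\<^bsub>PA m\<^esub> (rels1 m :: 'k::field kq set)"
proof -
  interpret ring "PA m :: ('k, 'k kq) module" by (rule ring_PA[OF m])
  have c: "arr m i \<in> carrier (PA m)" "bar m i \<in> carrier (PA m)" for i
    using keys_arr[OF m] keys_bar[OF m] by auto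
  have pc: "pmul m x y \<in> carrier (PA m)" if "x \<in> carrier (PA m)" "y \<in> carrier (PA m)" for x y :: "'k kq"
    using m_closed[OF that] by simp
  have mi: "x \<ominus>\<^bsub>PA m\<^esub> y = x - y" if "x \<in> carrier (PA m)" "y \<in> carrier (PA m)" for x y :: "'k kq"
  proof -
    have yc: "- y \<in> carrier (PA m)" using that(2) by (auto simp: Poly_Mapping.keys.rep_eq)
    have "\<ominus>\<^bsub>PA m\<^esub> y = - y" by (rule ring_a_inv_eqI[OF ring_axioms that(2) yc]) simp
    then show ?thesis by (simp add: a_minus_def)
  qed
  have one: "x [^]\<^bsub>PA m\<^esub> (1::nat) = x" if "x \<in> carrier (PA m)" for x :: "'k kq"
    using that by (rule nat_pow_eone)
  have "(pmul m (arr m i) (bar m i)) [^]\<^bsub>PA m\<^esub> (1::nat) \<ominus>\<^bsub>PA m\<^esub> (pmul m (bar m (i - 1)) (arr m (i - 1))) [^]\<^bsub>PA m\<^esub> (1::nat) =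
     pmul m (arr m i) (bar m i) - (pmul m (bar m (i - 1)) (arr m (i - 1)) :: 'k kq)" for i
    unfolding one[OF pc[OF c(1) c(2)]] one[OF pc[OF c(2) c(1)]] by (rule mi) (intro pc c)+
  then show ?thesis unfolding rel_ideal_def rels1_def Let_def PA_sel(2) by simp
qed

lemma PA_epi:
  assumes m: "m > 0"
  shows "alg_epi (PA m :: ('k::field, 'k kq) module) {y. per m y} (\<lambda>k y. zK k * y) (pim m)"
proof (rule alg_epi.intro)
  show "ring (PA m :: ('k, 'k kq) module)" by (rule ring_PA[OF m])
  show "subring_set {y :: 'k zz. per m y}" by (auto simp: subring_set_def)
  have rc: "Poly_Mapping.keys (rho m y) \<subseteq> walks m" for y :: "'k zz"
  proof -
    have a: "Poly_Mapping.keys (b + c) \<subseteq> walks m" if "Poly_Mapping.keys b \<subseteq> walks m" "Poly_Mapping.keys c \<subseteq> walks m"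
      for b c :: "'k kq" using that keys_add[of b c] by blast
    have s: "Poly_Mapping.keys (\<Sum>i\<in>S. f i) \<subseteq> walks m" if "\<And>i. i \<in> S \<Longrightarrow> Poly_Mapping.keys (f i) \<subseteq> walks m" for f :: "int \<Rightarrow> 'k kq" and S
      using that by (induction S rule: infinite_finite_induct) (simp_all add: a)
    have w: "(i, []) \<in> walks m" "(i, [Arr i]) \<in> walks m" "(i, [Bar ((i - 1) mod int m)]) \<in> walks m" "(i, [Arr i, Bar i]) \<in> walks m"
      if "i \<in> {0..<int m}" for i
      using that m by (auto simp: walks_def wk_Cons arcs_cyc mod_simps)
    show ?thesis unfolding rho_def by (intro s a) (use w in auto)
  qed
  show "pim m ` carrier (PA m) = {y :: 'k zz. per m y}"
  proof (intro equalityI subsetI)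
    fix y :: "'k zz" assume "y \<in> {y. per m y}"
    then have "y = pim m (rho m y)" using pim_rho[OF m, of y] by simp
    then show "y \<in> pim m ` carrier (PA m)" using rc by (intro image_eqI[of _ _ "rho m y"]) auto
  qed auto
  show "pim m \<one>\<^bsub>PA m\<^esub> = (1 :: 'k zz)"
    using sum_zE[OF m, where 'k = 'k] by (simp add: pim_sum zK_simps)
  show "k \<odot>\<^bsub>PA m\<^esub> x \<in> carrier (PA m)" if "x \<in> carrier (PA m)" for k and x :: "'k kq"
    using that by (auto simp: Poly_Mapping.keys.rep_eq map.rep_eq when_def)
  show "pim m (k \<odot>\<^bsub>PA m\<^esub> x) = zK k * pim m x" for k and x :: "'k kq"
  proof (induction x rule: pm_induct)
    case (single l c)
    then show ?case by (cases l) (simp add: zK_simps mult.assoc)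
  next
    case (add p q)
    have "Poly_Mapping.map ((*) k) (p + q) = Poly_Mapping.map ((*) k) p + Poly_Mapping.map ((*) k) q"
      by (rule poly_mapping_eqI) (simp add: lookup_pm_map lookup_add distrib_left)
    then show ?case using add by (simp add: pim_add distrib_left)
  next
    case zero
    have "Poly_Mapping.map ((*) k) (0 :: 'k kq) = 0" by (rule poly_mapping_eqI) (simp add: lookup_pm_map)
    then show ?case by simp
  qed
qed (simp_all add: pim_mult[OF m] pim_add)

text \<open>Modulo the ideal every path is congruent to its normal form
  \<open>rho m (pim m c)\<close>; this is proved by appending one arrow at a time. An element killed
  by \<open>pim m\<close> has normal form 0 and so lies in the ideal.\<close>

lemma ker_pim_subset_rel_ideal:
  fixes c :: "'k::field kq"
  assumes m: "m > 0" and "Poly_Mapping.keys c \<subseteq> walks m" and "pim m c = 0"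
  shows "c \<in> rel_ideal m 1"
proof -
  let ?R = "PA m :: ('k, 'k kq) module"
  interpret R: ring ?R by (rule ring_PA[OF m])
  define I where "I = (rel_ideal m 1 :: 'k kq set)"
  have relc: "rels1 m \<subseteq> carrier ?R"
  proof -
    have c: "arr m i \<in> carrier ?R" "bar m i \<in> carrier ?R" for i
      using keys_arr[OF m] keys_bar[OF m] by auto
    have pc: "pmul m x y \<in> carrier ?R" if "x \<in> carrier ?R" "y \<in> carrier ?R" for x y
      using R.m_closed[OF that] by simp
    have mc: "x - y \<in> carrier ?R" if "x \<in> carrier ?R" "y \<in> carrier ?R" for x y
      using that keys_diff[of x y] by auto
    show ?thesis unfolding rels1_def by (intro UN_least insert_subsetI empty_subsetI pc mc c)
  qed
  have idI: "ideal I ?R" unfolding I_def rel_ideal_eq[OF m] by (rule R.genideal_ideal[OF relc])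
  have relI: "rels1 m \<subseteq> I" unfolding I_def rel_ideal_eq[OF m] by (rule R.genideal_self[OF relc])
  interpret I: ideal I ?R by (rule idI)
  have Ic: "Poly_Mapping.keys x \<subseteq> walks m" if "x \<in> I" for x using I.Icarr[OF that] by simp
  have I0: "0 \<in> I" using I.zero_closed by simp
  have Iadd: "x + y \<in> I" if "x \<in> I" "y \<in> I" for x y using additive_subgroup.a_closed[OF I.is_additive_subgroup that] by simp
  have Ineg: "- x \<in> I" if "x \<in> I" for x
  proof -
    have "\<ominus>\<^bsub>?R\<^esub> x = - x"
      by (rule ring_a_inv_eqI[OF R.ring_axioms]) (use Ic[OF that] in \<open>auto simp: Poly_Mapping.keys.rep_eq\<close>)
    then show ?thesis using additive_subgroup.a_inv_closed[OF I.is_additive_subgroup that] by simp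
  qed
  have Ir: "pmul m x y \<in> I" if "x \<in> I" "Poly_Mapping.keys y \<subseteq> walks m" for x y using I.I_r_closed[of x y] that by simp
  have Il: "pmul m y x \<in> I" if "x \<in> I" "Poly_Mapping.keys y \<subseteq> walks m" for x y using I.I_l_closed[of x y] that by simp
  have Isum: "(\<Sum>i\<in>S. f i) \<in> I" if "\<And>i. i \<in> S \<Longrightarrow> f i \<in> I" for f :: "int \<Rightarrow> 'k kq" and S
    using that by (induction S rule: infinite_finite_induct) (simp_all add: I0 Iadd)
  have pimI: "pim m x = 0" if "x \<in> I" for x
  proof -
    have "rels1 m \<subseteq> alg_epi.ker ?R (pim m)"
    proof
      fix x assume x: "x \<in> (rels1 m :: 'k kq set)"
      then have "pim m x = 0"
        unfolding rels1_def using m by (auto simp: arr_arr bar_bar arr_bar bar_arr pim_diff zK_simps)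
      then show "x \<in> alg_epi.ker ?R (pim m)" using x relc unfolding alg_epi.ker_def[OF PA_epi[OF m]] by blast
    qed
    then have "I \<subseteq> alg_epi.ker ?R (pim m)"
      unfolding I_def rel_ideal_eq[OF m] by (rule R.genideal_minimal[OF alg_epi.ideal_ker[OF PA_epi[OF m]]])
    then show ?thesis using that unfolding alg_epi.ker_def[OF PA_epi[OF m]] by blast
  qed
  define P where "P = (\<lambda>c. c - rho m (pim m c) \<in> I)"
  have Padd: "P (x + y)" if "P x" "P y" for x y
  proof -
    have "x + y - rho m (pim m (x + y)) = (x - rho m (pim m x)) + (y - rho m (pim m y))"
      by (simp add: pim_add rho_add)
    then show ?thesis using Iadd[OF that[unfolded P_def]] by (simp only: P_def)
  qed
  have PI: "P x" if "x \<in> I" for x unfolding P_def using that pimI[OF that] by simp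
  have P0: "P 0" by (rule PI[OF I0])
  have PIadd: "P x" if "P y" "x - y \<in> I" for x y
    using Padd[OF that(1) PI[OF that(2)]] by simp
  have Psum: "P (\<Sum>i\<in>S. f i)" if "\<And>i. i \<in> S \<Longrightarrow> P (f i)" for f :: "int \<Rightarrow> 'k kq" and S
    using that by (induction S rule: infinite_finite_induct) (simp_all add: P0 Padd)
  have sI: "Poly_Mapping.single (i, p) x \<in> I" if "Poly_Mapping.single (i, p) 1 \<in> I" "i \<in> {0..<int m}" for i p and x :: 'k
    using Il[OF that(1), of "Poly_Mapping.single (i, []) x"] that(2) by simp
  have aa: "Poly_Mapping.single (i, [Arr i, Arr ((i + 1) mod int m)]) x \<in> I" if "i \<in> {0..<int m}" for i and x :: 'k
  proof (rule sI[OF _ that])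
    have "pmul m (arr m i) (arr m (i + 1)) \<in> I" using relI that unfolding rels1_def by blast
    then show "Poly_Mapping.single (i, [Arr i, Arr ((i + 1) mod int m)]) 1 \<in> I" using that by (simp add: arr_arr[OF m])
  qed
  have bb: "Poly_Mapping.single (i, [Bar ((i - 1) mod int m), Bar ((i - 2) mod int m)]) x \<in> I" if "i \<in> {0..<int m}" for i and x :: 'k
  proof (rule sI[OF _ that])
    have "pmul m (bar m (i - 1)) (bar m (i - 2)) \<in> I" using relI that unfolding rels1_def by blast
    then show "Poly_Mapping.single (i, [Bar ((i - 1) mod int m), Bar ((i - 2) mod int m)]) 1 \<in> I" using that by (simp add: bar_bar[OF m])
  qed
  have ab: "Poly_Mapping.single (i, [Arr i, Bar i]) x - Poly_Mapping.single (i, [Bar ((i - 1) mod int m), Arr ((i - 1) mod int m)]) x \<in> I"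
    if i: "i \<in> {0..<int m}" for i and x :: 'k
  proof -
    have "pmul m (arr m i) (bar m i) - pmul m (bar m (i - 1)) (arr m (i - 1)) \<in> I" using relI that unfolding rels1_def by blast
    then have "Poly_Mapping.single (i, [Arr i, Bar i]) 1 - Poly_Mapping.single (i, [Bar ((i - 1) mod int m), Arr ((i - 1) mod int m)]) 1 \<in> I"
      using i by (simp add: arr_bar[OF m] bar_arr[OF m])
    from Il[OF this, of "Poly_Mapping.single (i, []) x"] show ?thesis using i by (simp add: pmul_diff)
  qed
  have rho_single: "rho m (zK x * (zE m i * w)) =
     Poly_Mapping.single (i, []) (x * ce w i) + Poly_Mapping.single (i, [Arr i]) (x * ca w i) +
     Poly_Mapping.single (i, [Bar ((i - 1) mod int m)]) (x * cb w i) + Poly_Mapping.single (i, [Arr i, Bar i]) (x * cz w i)"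
    if i: "i \<in> {0..<int m}" for i x and w :: "'k zz"
  proof -
    let ?f = "\<lambda>j. Poly_Mapping.single (j, []) (x * ce w j) + Poly_Mapping.single (j, [Arr j]) (x * ca w j) +
     Poly_Mapping.single (j, [Bar ((j - 1) mod int m)]) (x * cb w j) + Poly_Mapping.single (j, [Arr j, Bar j]) (x * cz w j)"
    have "rho m (zK x * (zE m i * w)) = (\<Sum>j\<in>{0..<int m}. if j = i then ?f i else 0)"
      unfolding rho_def by (rule sum.cong) (use i in auto)
    then show ?thesis using i by simp
  qed
  have B1: "P (Poly_Mapping.single (i, []) x)" and B2: "P (Poly_Mapping.single (i, [Arr i]) x)"
    and B3: "P (Poly_Mapping.single (i, [Bar ((i - 1) mod int m)]) x)" and B4: "P (Poly_Mapping.single (i, [Arr i, Bar i]) x)"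
    if i: "i \<in> {0..<int m}" for i and x :: 'k
    unfolding P_def pim_single rho_single[OF i] by (simp_all add: I0)
  \<comment> \<open>The commutation relation trades the second path of length two at
    \<open>i\<close> for the one that \<open>rho\<close> uses.\<close>
  have B4': "P (Poly_Mapping.single (i, [Bar ((i - 1) mod int m), Arr ((i - 1) mod int m)]) x)" if i: "i \<in> {0..<int m}" for i and x :: 'k
  proof (rule PIadd[OF B4[OF i, of x]])
    show "Poly_Mapping.single (i, [Bar ((i - 1) mod int m), Arr ((i - 1) mod int m)]) x - Poly_Mapping.single (i, [Arr i, Bar i]) x \<in> I"
      using Ineg[OF ab[OF i, of x]] by simp
  qed
  \<comment> \<open>Paths of length three lie in the ideal. If the third arrow is of type
    \<open>Arr\<close>, exchanging the first two arrows produces two consecutive arrows of that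
    type; if it is of type \<open>Bar\<close>, it forms a vanishing pair with the second
    arrow.\<close>
  have aba: "Poly_Mapping.single (i, [Arr i, Bar i, e]) x \<in> I"
    if i: "i \<in> {0..<int m}" and e: "e \<in> arcs (cyc_quiver m)" "tl_arr m e = i" for i e and x :: 'k
  proof (cases e)
    case (Arr j)
    then have j: "j = i" using e by simp
    have k: "Poly_Mapping.keys (Poly_Mapping.single (i, [e]) (1::'k)) \<subseteq> walks m"
      using e m hd_arr_verts[OF m e(1)] by (auto simp: walks_def wk_Cons)
    have w2: "wk m i [Arr i, Bar i] i" "wk m i [Bar ((i - 1) mod int m), Arr ((i - 1) mod int m)] i"
      using i m by (auto simp: wk_Cons arcs_cyc mod_simps)
    have "Poly_Mapping.single (i, [Arr i, Bar i, e]) x - Poly_Mapping.single (i, [Bar ((i - 1) mod int m), Arr ((i - 1) mod int m), e]) x \<in> I"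
      using Ir[OF ab[OF i, of x] k] w2 by (simp add: pmul_diff)
    moreover have "Poly_Mapping.single (i, [Bar ((i - 1) mod int m), Arr ((i - 1) mod int m), e]) x \<in> I"
    proof -
      let ?i = "(i - 1) mod int m"
      have ii: "?i \<in> {0..<int m}" using m by simp
      have w1: "wk m i [Bar ?i] ?i" using i m by (auto simp: wk_Cons arcs_cyc mod_simps)
      have k1: "Poly_Mapping.keys (Poly_Mapping.single (i, [Bar ?i]) (1::'k)) \<subseteq> walks m" using w1 by (auto simp: walks_def)
      have "(?i + 1) mod int m = i" using i by (simp add: mod_simps)
      then have "e = Arr ((?i + 1) mod int m)" using Arr j by simp
      then show ?thesis using Il[OF aa[OF ii, of x] k1] w1 by simp
    qed
    ultimately show ?thesis using Iadd by fastforce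
  next
    case (Bar j)
    then have ji: "(j + 1) mod int m = i" and j: "j \<in> {0..<int m}" using e by (auto simp: arcs_cyc)
    let ?i = "(i + 1) mod int m"
    have ii: "?i \<in> {0..<int m}" using m by simp
    have w1: "wk m i [Arr i] ?i" using i m by (auto simp: wk_Cons arcs_cyc mod_simps)
    have k1: "Poly_Mapping.keys (Poly_Mapping.single (i, [Arr i]) (1::'k)) \<subseteq> walks m" using w1 by (auto simp: walks_def)
    have "(?i - 1) mod int m = i" using i by (simp add: mod_simps)
    moreover have "(?i - 2) mod int m = j"
      using j ji[symmetric] by (simp add: mod_simps)
    ultimately show ?thesis using Il[OF bb[OF ii, of x] k1] w1 Bar by simp
  qed
  \<comment> \<open>A normal form times an arrow is again congruent to a normal form: four types of
    basis paths are paired with two types of arrows.\<close>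
  have step: "P (pmul m (rho m y) (Poly_Mapping.single (u, [e]) 1))"
    if e: "e \<in> arcs (cyc_quiver m)" "tl_arr m e = u" for y :: "'k zz" and u e
  proof -
    have u: "u \<in> {0..<int m}" using tl_arr_verts[OF m e(1)] e(2) by simp
    have S: "P (pmul m (Poly_Mapping.single (i, p) x) (Poly_Mapping.single (u, [e]) 1))"
      if i: "i \<in> {0..<int m}" and p: "p \<in> {[], [Arr i], [Bar ((i - 1) mod int m)], [Arr i, Bar i]}" for i p and x :: 'k
    proof (cases "wk m i p u")
      case False
      then show ?thesis by (simp add: P0)
    next
      case w: True
      have "P (Poly_Mapping.single (i, p @ [e]) x)"
      proof -
        consider "p = []" | "p = [Arr i]" | "p = [Bar ((i - 1) mod int m)]" | "p = [Arr i, Bar i]" using p by blast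
        then show ?thesis
        proof cases
          case 1
          then have iu: "i = u" using w by simp
          show ?thesis
          proof (cases e)
            case (Arr j)
            then have "j = u" using e by simp
            then show ?thesis using B2[OF i, of x] 1 iu Arr by simp
          next
            case (Bar j)
            then have "(j + 1) mod int m = u" "j \<in> {0..<int m}" using e by (auto simp: arcs_cyc)
            then have "j = (u - 1) mod int m" by (auto simp: mod_simps)
            then show ?thesis using B3[OF i, of x] 1 iu Bar by simp
          qed
        next
          case 2
          then have iu: "u = (i + 1) mod int m" using w m by (simp add: wk_Cons)
          show ?thesis
          proof (cases e)
            case (Arr j)
            then have "j = u" using e by simp
            then show ?thesis using PI[OF aa[OF i, of x]] 2 iu Arr by simp
          next
            case (Bar j)
            then have "(j + 1) mod int m = u" "j \<in> {0..<int m}" using e by (auto simp: arcs_cyc)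
            then have "j = (u - 1) mod int m" by (auto simp: mod_simps)
            also have "\<dots> = i" using iu i by (simp add: mod_simps)
            finally show ?thesis using B4[OF i, of x] 2 Bar by simp
          qed
        next
          case 3
          then have iu: "u = (i - 1) mod int m" using w m by (simp add: wk_Cons)
          show ?thesis
          proof (cases e)
            case (Arr j)
            then have "j = u" using e by simp
            then show ?thesis using B4'[OF i, of x] 3 iu Arr by simp
          next
            case (Bar j)
            then have "(j + 1) mod int m = u" "j \<in> {0..<int m}" using e by (auto simp: arcs_cyc)
            then have "j = (u - 1) mod int m" by (auto simp: mod_simps)
            also have "\<dots> = (i - 2) mod int m" using iu by (simp add: mod_simps)
            finally show ?thesis using PI[OF bb[OF i, of x]] 3 Bar by simp
          qed
        next
          case 4
          then have "u = i" using w m by (simp add: wk_Cons)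
          then show ?thesis using PI[OF aba[OF i e(1), of x]] e 4 by simp
        qed
      qed
      then show ?thesis using w by simp
    qed
    show ?thesis unfolding rho_def pmul_sum pmul_add1 by (intro Psum Padd S) auto
  qed
  have Pwalk: "P (Poly_Mapping.single (u, p) x)" if "wk m u p v" for u v p and x :: 'k
    using that
  proof (induction p arbitrary: v rule: rev_induct)
    case Nil
    then show ?case by (intro B1) simp
  next
    case (snoc e p)
    then obtain t where t: "wk m u p t" "wk m t [e] v" unfolding wk_append[OF m] by (elim exE conjE)
    have e: "e \<in> arcs (cyc_quiver m)" "tl_arr m e = t" using t(2) by (simp_all add: wk_Cons[OF m])
    have k: "Poly_Mapping.keys (Poly_Mapping.single (t, [e]) (1::'k)) \<subseteq> walks m" using t(2) by (auto simp: walks_def)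
    let ?y = "pim m (Poly_Mapping.single (u, p) x)"
    have "Poly_Mapping.single (u, p) x - rho m ?y \<in> I" using snoc.IH[OF t(1)] unfolding P_def .
    then have "pmul m (Poly_Mapping.single (u, p) x - rho m ?y) (Poly_Mapping.single (t, [e]) 1) \<in> I" using k by (rule Ir)
    then have "Poly_Mapping.single (u, p @ [e]) x - pmul m (rho m ?y) (Poly_Mapping.single (t, [e]) 1) \<in> I"
      using t(1) by (simp add: pmul_diff)
    with step[OF e, of ?y] show ?case by (rule PIadd)
  qed
  have "P c"
  proof (induction c rule: pm_induct)
    case (single k x)
    obtain u p where k: "k = (u, p)" by (cases k)
    obtain v where "wk m u p v" using single assms(2) k by (auto simp: walks_def)
    then show ?case unfolding k by (rule Pwalk)
  qed (simp_all add: P0 Padd)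
  then show ?thesis unfolding P_def I_def using assms(3) by simp
qed

lemma rel_ideal_eq_ker:
  assumes m: "m > 0"
  shows "alg_epi.ker (PA m) (pim m) = (rel_ideal m 1 :: 'k::field kq set)"
proof
  show "alg_epi.ker (PA m) (pim m) \<subseteq> (rel_ideal m 1 :: 'k::field kq set)"
    using ker_pim_subset_rel_ideal[OF m] unfolding alg_epi.ker_def[OF PA_epi[OF m]] by auto
  interpret R: ring "PA m :: ('k, 'k kq) module" by (rule ring_PA[OF m])
  have "rels1 m \<subseteq> alg_epi.ker (PA m) (pim m :: 'k kq \<Rightarrow> _)"
  proof
    fix x assume x: "x \<in> (rels1 m :: 'k kq set)"
    have k: "Poly_Mapping.keys (pmul m b c) \<subseteq> walks m" if "b \<in> range (arr m) \<union> range (bar m)" "c \<in> range (arr m) \<union> range (bar m)" for b c :: "'k kq"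
      by (rule pmul_closed[OF m]) (use that keys_arr[OF m] keys_bar[OF m] in blast)+
    have "pim m x = 0"
      using x m unfolding rels1_def by (auto simp: arr_arr bar_bar arr_bar bar_arr pim_diff zK_simps)
    moreover have "Poly_Mapping.keys x \<subseteq> walks m"
      using x unfolding rels1_def by (auto dest!: subsetD[OF keys_diff] subsetD[OF k, rotated 2])
    ultimately show "x \<in> alg_epi.ker (PA m) (pim m)" unfolding alg_epi.ker_def[OF PA_epi[OF m]] by simp
  qed
  then show "(rel_ideal m 1 :: 'k kq set) \<subseteq> alg_epi.ker (PA m) (pim m)"
    unfolding rel_ideal_eq[OF m] by (rule R.genideal_minimal[OF alg_epi.ideal_ker[OF PA_epi[OF m]]])
qed

definition alpha :: "nat \<Rightarrow> 'k::field lam \<Rightarrow> 'k zz" where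
  "alpha m = alg_epi.fac (pim m)"

lemma Lam_eq: "m > 0 \<Longrightarrow> Lam m 1 = (PA m Quota alg_epi.ker (PA m) (pim m) :: ('k::field, 'k lam) module)"
  by (simp add: Lam_def rel_ideal_eq_ker del: PA_sel)

lemma alpha_iso: "m > 0 \<Longrightarrow> alpha m \<in> alg_iso (Lam m 1) (alg_of {y :: 'k::field zz. per m y} (\<lambda>k y. zK k * y))"
  unfolding alpha_def Lam_eq by (rule alg_epi.fac_alg_iso[OF PA_epi])

lemma ring_Lam: "m > 0 \<Longrightarrow> ring (Lam m 1 :: ('k::field, 'k lam) module)"
  unfolding Lam_eq by (rule alg_epi.ring_quot[OF PA_epi])

lemma smult_Lam_closed: "m > 0 \<Longrightarrow> x \<in> carrier (Lam m 1) \<Longrightarrow> k \<odot>\<^bsub>Lam m 1\<^esub> x \<in> carrier (Lam m 1 :: ('k::field, 'k lam) module)"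
  unfolding Lam_eq by (rule alg_epi.smult_quot_closed[OF PA_epi])

lemma alpha_coset:
  assumes "m > 0" "Poly_Mapping.keys c \<subseteq> walks m"
  shows "rel_ideal m 1 +>\<^bsub>PA m\<^esub> c \<in> carrier (Lam m 1)" "alpha m (rel_ideal m 1 +>\<^bsub>PA m\<^esub> c) = pim m (c :: 'k::field kq)"
  unfolding alpha_def Lam_eq[OF assms(1)] rel_ideal_eq_ker[OF assms(1), symmetric]
  using assms(2) alg_epi.fac_coset[OF PA_epi[OF assms(1)], of c] alg_epi.carrier_quot[OF PA_epi[OF assms(1), where 'k = 'k]] by auto

lemma alpha_gens:
  assumes m: "m > 0"
  shows "idem m 1 i \<in> carrier (Lam m 1 :: ('k::field, 'k lam) module)" "alpha m (idem m 1 i) = (zE m i :: 'k zz)"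
    "arrs m 1 \<in> carrier (Lam m 1 :: ('k, 'k lam) module)" "alpha m (arrs m 1) = (zA :: 'k zz)"
    "bars m 1 \<in> carrier (Lam m 1 :: ('k, 'k lam) module)" "alpha m (bars m 1) = (zB :: 'k zz)"
proof -
  have ks: "Poly_Mapping.keys (\<Sum>i\<in>S. f i) \<subseteq> walks m" if "\<And>i. Poly_Mapping.keys (f i) \<subseteq> walks m" for f :: "int \<Rightarrow> 'k kq" and S
  proof (induction S rule: infinite_finite_induct)
    case (insert x F)
    then show ?case using keys_add[of "f x" "sum f F"] that[of x] by auto
  qed auto
  have k1: "Poly_Mapping.keys (vtx m i :: 'k kq) \<subseteq> walks m" using m by (simp add: vtx_def)
  have e: "pim m (vtx m i :: 'k kq) = zE m i" by (simp add: vtx_def zK_simps)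
  have a: "pim m (\<Sum>i\<in>{0..<int m}. arr m i :: 'k kq) = zA"
    using sum_zE[OF m, where 'k = 'k] by (simp add: pim_sum arr_def zK_simps flip: sum_distrib_right)
  have "zE m ((i + 1) mod int m) * zB = (zB * zE m i :: 'k zz)" for i by (simp add: zB_zE)
  then have b: "pim m (\<Sum>i\<in>{0..<int m}. bar m i :: 'k kq) = zB"
    using sum_zE[OF m, where 'k = 'k] by (simp add: pim_sum bar_def zK_simps flip: sum_distrib_left)
  show "idem m 1 i \<in> carrier (Lam m 1 :: ('k, 'k lam) module)" "alpha m (idem m 1 i) = (zE m i :: 'k zz)"
    unfolding idem_def using alpha_coset[OF m k1] e by auto
  show "arrs m 1 \<in> carrier (Lam m 1 :: ('k, 'k lam) module)" "alpha m (arrs m 1) = (zA :: 'k zz)"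
    unfolding arrs_def using alpha_coset[OF m ks[of "arr m" "{0..<int m}", OF keys_arr[OF m]]] a by auto
  show "bars m 1 \<in> carrier (Lam m 1 :: ('k, 'k lam) module)" "alpha m (bars m 1) = (zB :: 'k zz)"
    unfolding bars_def using alpha_coset[OF m ks[of "bar m" "{0..<int m}", OF keys_bar[OF m]]] b by auto
qed

section \<open>Tensor products in coordinates\<close>

text \<open>Names for the basis elements of \<open>e_j A\<close>: \<open>e_j\<close>,
  \<open>e_j a\<close>, \<open>e_j b\<close> and \<open>e_j a b\<close>.\<close>

datatype wd = W1 | Wa | Wb | Wz

fun wc :: "wd \<Rightarrow> 'k zz \<Rightarrow> int \<Rightarrow> 'k" where
  "wc W1 = ce" | "wc Wa = ca" | "wc Wb = cb" | "wc Wz = cz"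

fun wz :: "wd \<Rightarrow> 'k::comm_ring_1 zz" where
  "wz W1 = 1" | "wz Wa = zA" | "wz Wb = zB" | "wz Wz = zA * zB"

lemma per_wz [simp]: "per m (wz u)" by (cases u) auto

lemma wc_lin: "wc u (x + y) i = wc u x i + wc u y i" "wc u (zK k * x) i = k * wc u x i" "wc u 0 i = (0::'k::comm_ring_1)"
  by (cases u; simp)+

lemma wc_basis: "wc u (zE m j * wz u') j = (if u = u' then 1 else (0::'k::comm_ring_1))"
  by (cases u; cases u') simp_all

lemma zE_expand:
  assumes "per m y"
  shows "zE m j * y = zK (wc W1 y j) * (zE m j * wz W1) + zK (wc Wa y j) * (zE m j * wz Wa)
    + zK (wc Wb y j) * (zE m j * wz Wb) + zK (wc Wz y j) * (zE m j * wz Wz)"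
  unfolding zz_eq_iff
proof
  fix i
  show "ce (zE m j * y) i = ce (zK (wc W1 y j) * (zE m j * wz W1) + zK (wc Wa y j) * (zE m j * wz Wa)
    + zK (wc Wb y j) * (zE m j * wz Wb) + zK (wc Wz y j) * (zE m j * wz Wz)) i \<and>
   ca (zE m j * y) i = ca (zK (wc W1 y j) * (zE m j * wz W1) + zK (wc Wa y j) * (zE m j * wz Wa)
    + zK (wc Wb y j) * (zE m j * wz Wb) + zK (wc Wz y j) * (zE m j * wz Wz)) i \<and>
   cb (zE m j * y) i = cb (zK (wc W1 y j) * (zE m j * wz W1) + zK (wc Wa y j) * (zE m j * wz Wa)
    + zK (wc Wb y j) * (zE m j * wz Wb) + zK (wc Wz y j) * (zE m j * wz Wz)) i \<and>
   cz (zE m j * y) i = cz (zK (wc W1 y j) * (zE m j * wz W1) + zK (wc Wa y j) * (zE m j * wz Wa)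
    + zK (wc Wb y j) * (zE m j * wz Wb) + zK (wc Wz y j) * (zE m j * wz Wz)) i"
  proof (cases "i mod int m = j mod int m")
    case True
    show ?thesis using True by (simp add: perD[OF assms True])
  qed simp
qed

text \<open>Right multiplication by \<open>x\<close> in coordinates over the basis
  \<open>e_l u\<close>. The formulas come from expanding each product \<open>e_l u x\<close> in that
  basis; the shifts of \<open>l\<close> are the end vertices of \<open>a\<close> and
  \<open>b\<close>.\<close>

fun rco :: "int \<Rightarrow> (wd \<Rightarrow> 'k::comm_ring_1 zz) \<Rightarrow> 'k zz \<Rightarrow> wd \<Rightarrow> 'k zz" where
  "rco l y x W1 = y W1 * zK (ce x l)"
| "rco l y x Wa = y W1 * zK (ca x l) + y Wa * zK (ce x (l + 1))"
| "rco l y x Wb = y W1 * zK (cb x l) + y Wb * zK (ce x (l - 1))"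
| "rco l y x Wz = y W1 * zK (cz x l) + y Wz * zK (ce x l) + y Wa * zK (cb x (l + 1)) + y Wb * zK (ca x (l - 1))"

lemma rco_diff: "rco l (\<lambda>u. y u - y' u) x u = rco l y x u - rco l y' x u"
  by (cases u) (simp_all add: left_diff_distrib)

text \<open>Only the isomorphism with the periodic coordinates is kept, so that the cosets that make
  up \<open>Lam m 1\<close> stay out of the computations with tensors.\<close>

locale coordalg =
  fixes m :: nat and A :: "('k::field, 'a) module" and al :: "'a \<Rightarrow> 'k zz"
  assumes m_pos: "m > 0"
    and ring_A: "ring A"
    and al_iso: "al \<in> alg_iso A (alg_of {y. per m y} (\<lambda>k y. zK k * y))"
    and smult_closed: "\<And>k x. x \<in> carrier A \<Longrightarrow> k \<odot>\<^bsub>A\<^esub> x \<in> carrier A"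
begin

lemma al_ring_iso: "al \<in> ring_iso A (alg_of {y. per m y} (\<lambda>k y. zK k * y))"
  using al_iso by (simp add: alg_iso_def)

lemma al_simps:
  shows "x \<in> carrier A \<Longrightarrow> per m (al x)"
    "x \<in> carrier A \<Longrightarrow> y \<in> carrier A \<Longrightarrow> al (x \<otimes>\<^bsub>A\<^esub> y) = al x * al y"
    "x \<in> carrier A \<Longrightarrow> y \<in> carrier A \<Longrightarrow> al (x \<oplus>\<^bsub>A\<^esub> y) = al x + al y"
    "al \<one>\<^bsub>A\<^esub> = 1"
    "x \<in> carrier A \<Longrightarrow> al (k \<odot>\<^bsub>A\<^esub> x) = zK k * al x"
  using ring_iso_memE[OF al_ring_iso] al_iso by (simp_all add: alg_iso_def)

lemma al_0: "al \<zero>\<^bsub>A\<^esub> = 0"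
proof -
  have "al (\<zero>\<^bsub>A\<^esub> \<oplus>\<^bsub>A\<^esub> \<zero>\<^bsub>A\<^esub>) = al \<zero>\<^bsub>A\<^esub> + al \<zero>\<^bsub>A\<^esub>"
    using ring.ring_simprules(2)[OF ring_A] by (intro al_simps)
  then show ?thesis using ring.ring_simprules(2,8)[OF ring_A] by simp
qed

lemma A_closed:
  "x \<in> carrier A \<Longrightarrow> y \<in> carrier A \<Longrightarrow> x \<otimes>\<^bsub>A\<^esub> y \<in> carrier A"
  "x \<in> carrier A \<Longrightarrow> y \<in> carrier A \<Longrightarrow> x \<oplus>\<^bsub>A\<^esub> y \<in> carrier A"
  "\<one>\<^bsub>A\<^esub> \<in> carrier A" "\<zero>\<^bsub>A\<^esub> \<in> carrier A" "x \<in> carrier A \<Longrightarrow> \<ominus>\<^bsub>A\<^esub> x \<in> carrier A"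
  using ring.ring_simprules[OF ring_A] by auto

lemma al_inj: "x \<in> carrier A \<Longrightarrow> y \<in> carrier A \<Longrightarrow> al x = al y \<Longrightarrow> x = y"
  using ring_iso_memE(5)[OF al_ring_iso] by (auto simp: bij_betw_def inj_on_def)

definition "be y = inv_into (carrier A) al y"

lemma be: assumes "per m y" shows "be y \<in> carrier A" "al (be y) = y"
proof -
  have "y \<in> al ` carrier A" using ring_iso_memE(5)[OF al_ring_iso] assms by (auto simp: bij_betw_def)
  then show "be y \<in> carrier A" "al (be y) = y" unfolding be_def by (simp_all add: inv_into_into f_inv_into_f)
qed

text \<open>The coordinates of \<open>v \<otimes> w \<in> A e\<^sub>i \<otimes> e\<^sub>j A\<close> with respect to the basis \<open>e\<^sub>j u\<close>, \<open>u \<in> {1, a, b, ab}\<close>, of \<open>e\<^sub>j A\<close>.\<close>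

definition tq :: "int \<Rightarrow> ('a \<times> 'a \<Rightarrow>\<^sub>0 int) \<Rightarrow> wd \<Rightarrow> 'k zz" where
  "tq j c u = pm_lin (\<lambda>k n. of_int n * (al (fst k) * zK (wc u (al (snd k)) j))) c"

lemma tq_add: "tq j (c + d) u = tq j c u + tq j d u"
  unfolding tq_def by (rule pm_lin_add) (auto simp: distrib_right)

lemma tq_0 [simp]: "tq j 0 u = 0" by (simp add: tq_def)

lemma tq_diff: "tq j (c - d) u = tq j c u - tq j d u"
  using tq_add[of j "c - d" d u] by (simp add: algebra_simps)

lemma tq_minus: "tq j (- d) u = - tq j d u"
  using tq_diff[of j 0 d u] by simp

lemma tq_of [simp]: "tq j (frag_of (v, w)) u = al v * zK (wc u (al w) j)"
  by (simp add: tq_def pm_lin_single)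

end

locale coordpair = coordalg m A al for m and A :: "('k::field, 'a) module" and al +
  fixes i j :: int and e f :: 'a
  assumes e: "e \<in> carrier A" "al e = zE m i" and f: "f \<in> carrier A" "al f = zE m j"
begin

abbreviation "V \<equiv> left_ideal_at A e"
abbreviation "W \<equiv> right_ideal_at A f"
abbreviation "S \<equiv> carrier V \<times> carrier W"
abbreviation "FG \<equiv> free_Abelian_group S"
abbreviation "N \<equiv> tensor_kernel V W"
abbreviation "cls \<equiv> tensor_class V W"

lemma VW_sel [simp]: "x \<oplus>\<^bsub>V\<^esub> y = x \<oplus>\<^bsub>A\<^esub> y" "x \<oplus>\<^bsub>W\<^esub> y = x \<oplus>\<^bsub>A\<^esub> y" "k \<odot>\<^bsub>V\<^esub> x = k \<odot>\<^bsub>A\<^esub> x" "k \<odot>\<^bsub>W\<^esub> x = k \<odot>\<^bsub>A\<^esub> x"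
  by (simp_all add: left_ideal_at_def right_ideal_at_def)

lemma V_iff: "v \<in> carrier V \<longleftrightarrow> v \<in> carrier A \<and> al v * zE m i = al v"
proof
  assume "v \<in> carrier V"
  then obtain x where "x \<in> carrier A" "v = x \<otimes>\<^bsub>A\<^esub> e" by (auto simp: left_ideal_at_def)
  then show "v \<in> carrier A \<and> al v * zE m i = al v" using e by (simp add: A_closed al_simps mult.assoc)
next
  assume v: "v \<in> carrier A \<and> al v * zE m i = al v"
  then have "v = v \<otimes>\<^bsub>A\<^esub> e" using e by (intro al_inj) (simp_all add: A_closed al_simps)
  then show "v \<in> carrier V" using v by (auto simp: left_ideal_at_def)
qed

lemma W_iff: "w \<in> carrier W \<longleftrightarrow> w \<in> carrier A \<and> zE m j * al w = al w"
proof
  assume "w \<in> carrier W"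
  then obtain x where "x \<in> carrier A" "w = f \<otimes>\<^bsub>A\<^esub> x" by (auto simp: right_ideal_at_def)
  then show "w \<in> carrier A \<and> zE m j * al w = al w" using f by (simp add: A_closed al_simps flip: mult.assoc)
next
  assume w: "w \<in> carrier A \<and> zE m j * al w = al w"
  then have "w = f \<otimes>\<^bsub>A\<^esub> w" using f by (intro al_inj) (simp_all add: A_closed al_simps)
  then show "w \<in> carrier W" using w by (auto simp: right_ideal_at_def)
qed

lemma V_closed: "v \<in> carrier V \<Longrightarrow> v' \<in> carrier V \<Longrightarrow> v \<oplus>\<^bsub>A\<^esub> v' \<in> carrier V"
  "v \<in> carrier V \<Longrightarrow> k \<odot>\<^bsub>A\<^esub> v \<in> carrier V" "a \<in> carrier A \<Longrightarrow> v \<in> carrier V \<Longrightarrow> a \<otimes>\<^bsub>A\<^esub> v \<in> carrier V"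
  unfolding V_iff by (simp_all add: A_closed al_simps smult_closed distrib_right mult.assoc)

lemma W_closed: "w \<in> carrier W \<Longrightarrow> w' \<in> carrier W \<Longrightarrow> w \<oplus>\<^bsub>A\<^esub> w' \<in> carrier W"
  "w \<in> carrier W \<Longrightarrow> k \<odot>\<^bsub>A\<^esub> w \<in> carrier W" "a \<in> carrier A \<Longrightarrow> w \<in> carrier W \<Longrightarrow> w \<otimes>\<^bsub>A\<^esub> a \<in> carrier W"
  unfolding W_iff by (simp_all add: A_closed al_simps smult_closed distrib_left zK_left[of "zE m j"])
    (simp add: mult.assoc[symmetric])

lemma rels_induct [consumes 1, case_names left right scalar]:
  assumes "c \<in> tensor_rels V W"
    and "\<And>v v' w. v \<in> carrier V \<Longrightarrow> v' \<in> carrier V \<Longrightarrow> w \<in> carrier W \<Longrightarrow> P (frag_of (v \<oplus>\<^bsub>A\<^esub> v', w) - frag_of (v, w) - frag_of (v', w))"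
    and "\<And>v w w'. v \<in> carrier V \<Longrightarrow> w \<in> carrier W \<Longrightarrow> w' \<in> carrier W \<Longrightarrow> P (frag_of (v, w \<oplus>\<^bsub>A\<^esub> w') - frag_of (v, w) - frag_of (v, w'))"
    and "\<And>k v w. v \<in> carrier V \<Longrightarrow> w \<in> carrier W \<Longrightarrow> P (frag_of (k \<odot>\<^bsub>A\<^esub> v, w) - frag_of (v, k \<odot>\<^bsub>A\<^esub> w))"
  shows "P c"
  using assms(1) unfolding tensor_rels_def VW_sel
  by (elim UnE CollectE exE conjE; hypsubst) (rule assms; assumption)+

lemma FG_induct [consumes 1, case_names zero diff of]:
  assumes "Poly_Mapping.keys c \<subseteq> S" "P 0"
    "\<And>x y. Poly_Mapping.keys x \<subseteq> S \<Longrightarrow> Poly_Mapping.keys y \<subseteq> S \<Longrightarrow> P x \<Longrightarrow> P y \<Longrightarrow> P (x - y)"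
    "\<And>v w. v \<in> carrier V \<Longrightarrow> w \<in> carrier W \<Longrightarrow> P (frag_of (v, w))"
  shows "P c"
  using assms(1)
proof (rule free_Abelian_group_induct)
  fix a assume "a \<in> S"
  then show "P (frag_of a)" by (cases a) (simp add: assms(4))
qed (fact assms)+

lemma rels_carrier: "tensor_rels V W \<subseteq> carrier FG"
proof
  fix c assume c: "c \<in> tensor_rels V W"
  have d: "Poly_Mapping.keys (x - y) \<subseteq> S" if "Poly_Mapping.keys x \<subseteq> S" "Poly_Mapping.keys y \<subseteq> S" for x y :: "'a \<times> 'a \<Rightarrow>\<^sub>0 int"
    using that keys_diff[of x y] by blast
  have s: "Poly_Mapping.keys (frag_of (v, w)) \<subseteq> S" if "v \<in> carrier V" "w \<in> carrier W" for v w
    using that by simp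
  show "c \<in> carrier FG"
    using c unfolding carrier_free_Abelian_group_iff
    by (induction c rule: rels_induct) (intro d s V_closed W_closed; assumption)+
qed

lemma subgroup_N: "subgroup N FG"
  unfolding tensor_kernel_def by (rule group.generate_is_subgroup[OF group_free_Abelian_group rels_carrier])

lemma N_closed: "0 \<in> N" "c \<in> N \<Longrightarrow> d \<in> N \<Longrightarrow> c + d \<in> N" "c \<in> N \<Longrightarrow> - c \<in> N" "c \<in> N \<Longrightarrow> d \<in> N \<Longrightarrow> c - d \<in> N"
  "c \<in> N \<Longrightarrow> Poly_Mapping.keys c \<subseteq> S"
proof -
  have k: "Poly_Mapping.keys c \<subseteq> S" if "c \<in> N" for c
    using subsetD[OF subgroup.subset[OF subgroup_N] that] by simp
  show "0 \<in> N" using subgroup.one_closed[OF subgroup_N] by simp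
  have a: "c + d \<in> N" if "c \<in> N" "d \<in> N" for c d using subgroup.m_closed[OF subgroup_N that] by simp
  have n: "- c \<in> N" if "c \<in> N" for c using subgroup.m_inv_closed[OF subgroup_N that] k[OF that] by simp
  show "c \<in> N \<Longrightarrow> d \<in> N \<Longrightarrow> c + d \<in> N" "c \<in> N \<Longrightarrow> - c \<in> N" "c \<in> N \<Longrightarrow> Poly_Mapping.keys c \<subseteq> S" by (fact a n k)+
  show "c \<in> N \<Longrightarrow> d \<in> N \<Longrightarrow> c - d \<in> N" using a[of c "- d"] n by simp
qed

lemma rel_N:
  "v \<in> carrier V \<Longrightarrow> v' \<in> carrier V \<Longrightarrow> w \<in> carrier W \<Longrightarrow> frag_of (v \<oplus>\<^bsub>A\<^esub> v', w) - frag_of (v, w) - frag_of (v', w) \<in> N"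
  "v \<in> carrier V \<Longrightarrow> w \<in> carrier W \<Longrightarrow> w' \<in> carrier W \<Longrightarrow> frag_of (v, w \<oplus>\<^bsub>A\<^esub> w') - frag_of (v, w) - frag_of (v, w') \<in> N"
  "v \<in> carrier V \<Longrightarrow> w \<in> carrier W \<Longrightarrow> frag_of (k \<odot>\<^bsub>A\<^esub> v, w) - frag_of (v, k \<odot>\<^bsub>A\<^esub> w) \<in> N"
  unfolding tensor_kernel_def by (rule generate.incl, simp only: tensor_rels_def VW_sel, blast)+

lemma tq_N: "c \<in> N \<Longrightarrow> tq j c u = 0"
  unfolding tensor_kernel_def
proof (induction c rule: generate.induct)
  have r: "tq j h u = 0" if "h \<in> tensor_rels V W" for h
    using that
  proof (induction h rule: rels_induct)
    case (left v v' w)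
    then show ?case by (simp add: V_iff tq_diff al_simps distrib_right)
  next
    case (right v w w')
    then show ?case by (simp add: W_iff tq_diff al_simps wc_lin zK_simps distrib_left)
  next
    case (scalar k v w)
    have "zK k * al v * zK (wc u (al w) j) = al v * (zK k * zK (wc u (al w) j))"
      unfolding zK_central[of k "al v"] by (rule mult.assoc)
    then show ?case using scalar by (simp add: V_iff W_iff tq_diff al_simps wc_lin zK_simps)
  qed
  {
    case (incl h) then show ?case by (rule r)
  next
    case (inv h)
    then have "inv\<^bsub>FG\<^esub> h = - h" using subsetD[OF rels_carrier inv] by (intro inv_free_Abelian_group) simp
    then show ?case using r[OF inv] by (simp add: tq_minus)
  }
qed (simp_all add: tq_add)

definition tb :: "wd \<Rightarrow> 'a" where "tb u = be (zE m j * wz u)"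

lemma tb: "tb u \<in> carrier W" "al (tb u) = zE m j * wz u" "tb u \<in> carrier A"
  unfolding W_iff tb_def by (simp_all add: be flip: mult.assoc)

definition io :: "(wd \<Rightarrow> 'k zz) \<Rightarrow> ('a \<times> 'a \<Rightarrow>\<^sub>0 int)" where
  "io y = frag_of (be (y W1), tb W1) + frag_of (be (y Wa), tb Wa) + frag_of (be (y Wb), tb Wb) + frag_of (be (y Wz), tb Wz)"

definition Yset :: "(wd \<Rightarrow> 'k zz) set" where
  "Yset = {y. \<forall>u. per m (y u) \<and> y u * zE m i = y u}"

lemma be_V: "per m x \<Longrightarrow> x * zE m i = x \<Longrightarrow> be x \<in> carrier V"
  unfolding V_iff by (simp add: be)

lemma tq_Yset: "Poly_Mapping.keys c \<subseteq> S \<Longrightarrow> tq j c \<in> Yset"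
proof (induction c rule: FG_induct)
  case (of v w)
  have "al v * zK x * zE m i = al v * zE m i * zK x" for x by (simp add: mult.assoc zK_central)
  then show ?case using of by (simp add: Yset_def V_iff W_iff al_simps)
qed (auto simp: Yset_def tq_diff left_diff_distrib)

lemma io_keys: "y \<in> Yset \<Longrightarrow> Poly_Mapping.keys (io y) \<subseteq> S"
proof -
  assume y: "y \<in> Yset"
  have a: "Poly_Mapping.keys (b + c) \<subseteq> S" if "Poly_Mapping.keys b \<subseteq> S" "Poly_Mapping.keys c \<subseteq> S" for b c :: "'a \<times> 'a \<Rightarrow>\<^sub>0 int"
    using that keys_add[of b c] by blast
  have "be (y u) \<in> carrier V" for u using y by (intro be_V) (auto simp: Yset_def)
  then show ?thesis unfolding io_def by (intro a) (simp_all add: tb)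
qed

lemma tq_io: "y \<in> Yset \<Longrightarrow> tq j (io y) u = y u"
  by (cases u) (simp_all add: io_def tq_add tb wc_basis be Yset_def zK_simps del: wz.simps wc.simps)


lemma N_cong_trans: "x - y \<in> N \<Longrightarrow> y - z \<in> N \<Longrightarrow> x - z \<in> N"
  using N_closed(2)[of "x - y" "y - z"] by simp

lemma N_cong_add: "x - y \<in> N \<Longrightarrow> x' - y' \<in> N \<Longrightarrow> (x + x') - (y + y') \<in> N"
  using N_closed(2)[of "x - y" "x' - y'"] by (simp add: algebra_simps)

lemma io_diff:
  assumes "y \<in> Yset" "y' \<in> Yset"
  shows "(io y - io y') - io (\<lambda>u. y u - y' u) \<in> N"
proof -
  have 1: "frag_of (be (y u), tb u) - frag_of (be (y' u), tb u) - frag_of (be (y u - y' u), tb u) \<in> N" for u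
  proof -
    have p: "per m (y u)" "per m (y' u)" "y u * zE m i = y u" "y' u * zE m i = y' u" using assms by (auto simp: Yset_def)
    have v: "be (y u - y' u) \<in> carrier V" "be (y' u) \<in> carrier V"
      by (rule be_V; simp add: p left_diff_distrib)+
    have "be (y u - y' u) \<oplus>\<^bsub>A\<^esub> be (y' u) = be (y u)"
      by (rule al_inj) (simp_all add: p be A_closed al_simps)
    then have "frag_of (be (y u), tb u) - frag_of (be (y u - y' u), tb u) - frag_of (be (y' u), tb u) \<in> N"
      using rel_N(1)[OF v tb(1)[of u]] by simp
    then show ?thesis by (simp add: algebra_simps)
  qed
  have "(io y - io y') - io (\<lambda>u. y u - y' u) =
    ((frag_of (be (y W1), tb W1) - frag_of (be (y' W1), tb W1) - frag_of (be (y W1 - y' W1), tb W1)) +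
    (frag_of (be (y Wa), tb Wa) - frag_of (be (y' Wa), tb Wa) - frag_of (be (y Wa - y' Wa), tb Wa))) +
    ((frag_of (be (y Wb), tb Wb) - frag_of (be (y' Wb), tb Wb) - frag_of (be (y Wb - y' Wb), tb Wb)) +
    (frag_of (be (y Wz), tb Wz) - frag_of (be (y' Wz), tb Wz) - frag_of (be (y Wz - y' Wz), tb Wz)))"
    by (simp add: io_def algebra_simps)
  then show ?thesis using N_closed(2) 1 by simp
qed

text \<open>The right factor is expanded in the basis of \<open>e_j A\<close>; additivity separates
  the four terms and each scalar is moved to the left factor.\<close>

lemma io_of:
  assumes v: "v \<in> carrier V" and w: "w \<in> carrier W"
  shows "frag_of (v, w) - io (tq j (frag_of (v, w))) \<in> N"
proof -
  define c where "c = (\<lambda>u. wc u (al w) j)"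
  define t where "t = (\<lambda>u. c u \<odot>\<^bsub>A\<^esub> tb u)"
  have t: "t u \<in> carrier W" "t u \<in> carrier A" "al (t u) = zK (c u) * (zE m j * wz u)" for u
    unfolding t_def using tb by (simp_all add: W_closed smult_closed al_simps)
  have "al w = zE m j * al w" and wA: "w \<in> carrier A" using w by (auto simp: W_iff)
  then have "al w = zK (c W1) * (zE m j * wz W1) + zK (c Wa) * (zE m j * wz Wa)
    + zK (c Wb) * (zE m j * wz Wb) + zK (c Wz) * (zE m j * wz Wz)"
    unfolding c_def using zE_expand[of m "al w" j] al_simps(1)[OF wA] by simp
  then have "w = t W1 \<oplus>\<^bsub>A\<^esub> t Wa \<oplus>\<^bsub>A\<^esub> t Wb \<oplus>\<^bsub>A\<^esub> t Wz"
    by (intro al_inj) (simp_all add: wA t A_closed al_simps del: wz.simps)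
  then have h1: "frag_of (v, w) - (frag_of (v, t W1 \<oplus>\<^bsub>A\<^esub> t Wa \<oplus>\<^bsub>A\<^esub> t Wb) + frag_of (v, t Wz)) \<in> N"
    using rel_N(2)[OF v _ t(1)[of Wz], of "t W1 \<oplus>\<^bsub>A\<^esub> t Wa \<oplus>\<^bsub>A\<^esub> t Wb"] t(1) by (simp add: W_closed algebra_simps)
  have h2: "frag_of (v, t W1 \<oplus>\<^bsub>A\<^esub> t Wa \<oplus>\<^bsub>A\<^esub> t Wb) - (frag_of (v, t W1 \<oplus>\<^bsub>A\<^esub> t Wa) + frag_of (v, t Wb)) \<in> N"
    using rel_N(2)[OF v _ t(1)[of Wb], of "t W1 \<oplus>\<^bsub>A\<^esub> t Wa"] t(1) by (simp add: W_closed algebra_simps)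
  have h3: "frag_of (v, t W1 \<oplus>\<^bsub>A\<^esub> t Wa) - (frag_of (v, t W1) + frag_of (v, t Wa)) \<in> N"
    using rel_N(2)[OF v t(1)[of W1] t(1)[of Wa]] by (simp add: algebra_simps)
  have r: "x - x \<in> N" for x using N_closed(1) by simp
  have 1: "frag_of (v, w) - (frag_of (v, t W1) + frag_of (v, t Wa) + frag_of (v, t Wb) + frag_of (v, t Wz)) \<in> N"
    by (rule N_cong_trans[OF h1 N_cong_trans[OF N_cong_add[OF h2 r] N_cong_add[OF N_cong_add[OF h3 r] r]]])
  have 2: "frag_of (v, t u) - frag_of (be (tq j (frag_of (v, w)) u), tb u) \<in> N" for u
  proof -
    have vA: "v \<in> carrier A" using v by (simp add: V_iff)
    have "be (tq j (frag_of (v, w)) u) = c u \<odot>\<^bsub>A\<^esub> v"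
      by (rule al_inj) (simp_all add: vA be smult_closed al_simps c_def zK_central)
    then show ?thesis
      using N_closed(3)[OF rel_N(3)[OF v tb(1)[of u], of "c u"]] by (simp add: t_def)
  qed
  have "(frag_of (v, t W1) + frag_of (v, t Wa) + frag_of (v, t Wb) + frag_of (v, t Wz)) - io (tq j (frag_of (v, w))) \<in> N"
    unfolding io_def by (intro N_cong_add 2)
  then show ?thesis by (rule N_cong_trans[OF 1])
qed

text \<open>Modulo the tensor relations every element equals the sum of four elementary tensors
  given by its coordinates. Hence the tensor kernel is exactly the kernel of the
  coordinates.\<close>

lemma io_tq: "Poly_Mapping.keys c \<subseteq> S \<Longrightarrow> c - io (tq j c) \<in> N"
proof (induction c rule: FG_induct)
  case zero
  have y0: "(\<lambda>u. 0) \<in> Yset" by (simp add: Yset_def)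
  have "0 - io (\<lambda>u. 0) \<in> N" using io_diff[OF y0 y0] by simp
  then show ?case by (simp add: tq_def[abs_def])
next
  case (diff x y)
  have "(x - y) - (io (tq j x) - io (tq j y)) \<in> N"
    using N_closed(4)[OF diff(3,4)] by (simp add: algebra_simps)
  moreover have "(io (tq j x) - io (tq j y)) - io (tq j (x - y)) \<in> N"
    using io_diff[OF tq_Yset[OF diff(1)] tq_Yset[OF diff(2)]] by (simp add: tq_diff[abs_def])
  ultimately show ?case by (rule N_cong_trans)
qed (rule io_of)

lemma N_iff: "c \<in> N \<longleftrightarrow> Poly_Mapping.keys c \<subseteq> S \<and> (\<forall>u. tq j c u = 0)"
proof
  assume c: "Poly_Mapping.keys c \<subseteq> S \<and> (\<forall>u. tq j c u = 0)"
  then have "tq j c = tq j 0" by (simp add: fun_eq_iff)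
  then have "c - io (tq j 0) \<in> N" "0 - io (tq j 0) \<in> N" using io_tq[of c] io_tq[of 0] c by simp_all
  from N_closed(4)[OF this] show "c \<in> N" by simp
qed (simp add: tq_N N_closed(5))

lemma cls_eq: "Poly_Mapping.keys c \<subseteq> S \<Longrightarrow> cls c = {d. Poly_Mapping.keys d \<subseteq> S \<and> tq j d = tq j c}"
proof -
  assume c: "Poly_Mapping.keys c \<subseteq> S"
  have "cls c = {n + c | n. n \<in> N}" by (auto simp: tensor_class_def r_coset_def)
  also have "\<dots> = {d. d - c \<in> N}" by (auto intro: exI[of _ "_ - c"])
  also have "\<dots> = {d. Poly_Mapping.keys d \<subseteq> S \<and> tq j d = tq j c}"
  proof -
    have "Poly_Mapping.keys (d - c) \<subseteq> S \<longleftrightarrow> Poly_Mapping.keys d \<subseteq> S" for d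
      using c keys_diff[of d c] keys_add[of "d - c" c] by auto
    then show ?thesis by (simp add: N_iff tq_diff fun_eq_iff)
  qed
  finally show ?thesis .
qed

abbreviation "PB \<equiv> proj_bimod A e f"

text \<open>Any representative will do, because the cosets are the fibres of
  \<open>tq j\<close>.\<close>

definition TQ :: "('a \<times> 'a \<Rightarrow>\<^sub>0 int) set \<Rightarrow> wd \<Rightarrow> 'k zz" where
  "TQ X = tq j (SOME c. c \<in> X)"

lemma TQ_cls: "Poly_Mapping.keys c \<subseteq> S \<Longrightarrow> TQ (cls c) = tq j c"
proof -
  assume c: "Poly_Mapping.keys c \<subseteq> S"
  then have "c \<in> cls c" by (simp add: cls_eq)
  then have "(SOME d. d \<in> cls c) \<in> cls c" by (rule someI)
  then show ?thesis unfolding TQ_def cls_eq[OF c] by simp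
qed

lemma cls_inj: "Poly_Mapping.keys c \<subseteq> S \<Longrightarrow> Poly_Mapping.keys d \<subseteq> S \<Longrightarrow> tq j c = tq j d \<Longrightarrow> cls c = cls d"
  by (simp add: cls_eq)

lemma PB_carrier: "carrier PB = cls ` {c. Poly_Mapping.keys c \<subseteq> S}"
proof -
  have "carrier PB = rcosets\<^bsub>FG\<^esub> N" by (simp add: proj_bimod_def Let_def tensor_group_def FactGroup_def)
  then show ?thesis by (auto simp: RCOSETS_def tensor_class_def)
qed

lemma PB_cases: assumes "X \<in> carrier PB" obtains c where "Poly_Mapping.keys c \<subseteq> S" "X = cls c"
  using assms unfolding PB_carrier by auto

lemma TQ_inj: assumes "X \<in> carrier PB" "Y \<in> carrier PB" "TQ X = TQ Y" shows "X = Y"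
proof -
  obtain c where c: "Poly_Mapping.keys c \<subseteq> S" "X = cls c" by (rule PB_cases[OF assms(1)])
  obtain d where d: "Poly_Mapping.keys d \<subseteq> S" "Y = cls d" by (rule PB_cases[OF assms(2)])
  show ?thesis unfolding c(2) d(2) by (rule cls_inj) (use assms(3) c d in \<open>simp_all add: TQ_cls\<close>)
qed

lemma TQ_Yset: assumes "X \<in> carrier PB" shows "TQ X \<in> Yset"
proof -
  obtain c where c: "Poly_Mapping.keys c \<subseteq> S" "X = cls c" by (rule PB_cases[OF assms])
  show ?thesis unfolding c(2) TQ_cls[OF c(1)] by (rule tq_Yset[OF c(1)])
qed

lemma TQ_surj: assumes "y \<in> Yset" obtains X where "X \<in> carrier PB" "TQ X = y"
proof
  show "cls (io y) \<in> carrier PB" unfolding PB_carrier using io_keys[OF assms] by blast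
  show "TQ (cls (io y)) = y" using TQ_cls[OF io_keys[OF assms]] tq_io[OF assms] by (simp add: fun_eq_iff)
qed

lemma PB_add: assumes "X \<in> carrier PB" "Y \<in> carrier PB"
  shows "X \<oplus>\<^bsub>PB\<^esub> Y \<in> carrier PB" "TQ (X \<oplus>\<^bsub>PB\<^esub> Y) = (\<lambda>u. TQ X u + TQ Y u)"
proof -
  obtain c where c: "Poly_Mapping.keys c \<subseteq> S" "X = cls c" by (rule PB_cases[OF assms(1)])
  obtain d where d: "Poly_Mapping.keys d \<subseteq> S" "Y = cls d" by (rule PB_cases[OF assms(2)])
  have cd: "Poly_Mapping.keys (c + d) \<subseteq> S" using c d keys_add[of c d] by blast
  have "X \<oplus>\<^bsub>PB\<^esub> Y = X <#>\<^bsub>FG\<^esub> Y"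
    by (simp add: proj_bimod_def Let_def tensor_group_def FactGroup_def)
  also have "\<dots> = {x + y | x y. x \<in> cls c \<and> y \<in> cls d}"
    unfolding set_mult_def c d by auto
  also have "\<dots> = cls (c + d)"
  proof (intro equalityI subsetI)
    fix z assume "z \<in> {x + y | x y. x \<in> cls c \<and> y \<in> cls d}"
    then obtain x y where xy: "z = x + y" "Poly_Mapping.keys x \<subseteq> S" "tq j x = tq j c" "Poly_Mapping.keys y \<subseteq> S" "tq j y = tq j d"
      by (auto simp: cls_eq[OF c(1)] cls_eq[OF d(1)])
    have "Poly_Mapping.keys (x + y) \<subseteq> S" using xy keys_add[of x y] by blast
    then show "z \<in> cls (c + d)" using xy by (simp add: cls_eq[OF cd] tq_add fun_eq_iff)
  next
    fix z assume "z \<in> cls (c + d)"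
    then have z: "Poly_Mapping.keys z \<subseteq> S" "tq j z = tq j (c + d)" by (auto simp: cls_eq[OF cd])
    have "Poly_Mapping.keys (z - d) \<subseteq> S" using z d keys_diff[of z d] by blast
    then have "z - d \<in> cls c" using z by (simp add: cls_eq[OF c(1)] tq_diff tq_add fun_eq_iff)
    moreover have "d \<in> cls d" using d by (simp add: cls_eq)
    ultimately show "z \<in> {x + y | x y. x \<in> cls c \<and> y \<in> cls d}" by (intro CollectI exI[of _ "z - d"] exI[of _ d]) simp
  qed
  finally have eq: "X \<oplus>\<^bsub>PB\<^esub> Y = cls (c + d)" .
  show "X \<oplus>\<^bsub>PB\<^esub> Y \<in> carrier PB" unfolding eq PB_carrier using cd by blast
  show "TQ (X \<oplus>\<^bsub>PB\<^esub> Y) = (\<lambda>u. TQ X u + TQ Y u)" 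
    using TQ_cls[OF c(1)] TQ_cls[OF d(1)] TQ_cls[OF cd] unfolding eq c(2)[symmetric] d(2)[symmetric]
    by (simp add: tq_add fun_eq_iff)
qed

lemma PB_zero: "\<zero>\<^bsub>PB\<^esub> \<in> carrier PB" "TQ \<zero>\<^bsub>PB\<^esub> = (\<lambda>u. 0)"
proof -
  have "\<zero>\<^bsub>PB\<^esub> = N" by (simp add: proj_bimod_def Let_def tensor_group_def FactGroup_def)
  also have "\<dots> = cls 0" by (auto simp: cls_eq N_iff fun_eq_iff)
  finally have eq: "\<zero>\<^bsub>PB\<^esub> = cls 0" .
  show "\<zero>\<^bsub>PB\<^esub> \<in> carrier PB" unfolding eq PB_carrier by (rule image_eqI[OF refl]) simp
  show "TQ \<zero>\<^bsub>PB\<^esub> = (\<lambda>u. 0)" unfolding eq by (simp add: TQ_cls fun_eq_iff)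
qed

text \<open>The two actions in \<open>proj_bimod\<close> are unions over representatives. They
  collapse to one coset as soon as the new coordinates depend on the old coordinates only.\<close>

lemma cls_UN:
  assumes c: "Poly_Mapping.keys c \<subseteq> S" and g: "\<And>d. Poly_Mapping.keys d \<subseteq> S \<Longrightarrow> Poly_Mapping.keys (g d) \<subseteq> S"
    and tg: "\<And>d. Poly_Mapping.keys d \<subseteq> S \<Longrightarrow> tq j (g d) = h (tq j d)"
  shows "(\<Union>d\<in>cls c. cls (g d)) = cls (g c)"
proof -
  have "cls (g d) = cls (g c)" if "d \<in> cls c" for d
  proof -
    have d: "Poly_Mapping.keys d \<subseteq> S" "tq j d = tq j c" using that by (auto simp: cls_eq[OF c])
    show ?thesis by (rule cls_inj) (use g[OF d(1)] g[OF c] tg[OF d(1)] tg[OF c] d(2) in auto)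
  qed
  moreover have "c \<in> cls c" using c by (simp add: cls_eq)
  ultimately show ?thesis by blast
qed

lemma PB_lact: assumes "X \<in> carrier PB" and a: "a \<in> carrier A"
  shows "lact PB a X \<in> carrier PB" "TQ (lact PB a X) = (\<lambda>u. al a * TQ X u)"
proof -
  let ?g = "frag_extend (\<lambda>(v, w). frag_of (a \<otimes>\<^bsub>A\<^esub> v, w))"
  obtain c where c: "Poly_Mapping.keys c \<subseteq> S" "X = cls c" by (rule PB_cases[OF assms(1)])
  have g: "Poly_Mapping.keys (?g d) \<subseteq> S \<and> tq j (?g d) = (\<lambda>u. al a * tq j d u)" if "Poly_Mapping.keys d \<subseteq> S" for d
    using that
  proof (induction d rule: FG_induct)
    case (diff x y)
    then show ?case using keys_diff[of "?g x" "?g y"]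
      by (auto simp: frag_extend_diff tq_diff fun_eq_iff right_diff_distrib)
  next
    case (of v w)
    then have "v \<in> carrier A" by (simp add: V_iff)
    then show ?case using V_closed(3)[OF a of(1)] of a by (simp add: fun_eq_iff al_simps mult.assoc)
  qed (simp add: fun_eq_iff)
  have "lact PB a X = (\<Union>d\<in>X. cls (?g d))" by (simp add: proj_bimod_def Let_def)
  also have "\<dots> = cls (?g c)" unfolding c(2)
    by (rule cls_UN[OF c(1), where h = "\<lambda>y u. al a * y u"]) (use g in auto)
  finally have eq: "lact PB a X = cls (?g c)" .
  show "lact PB a X \<in> carrier PB" unfolding eq PB_carrier using g[OF c(1)] by blast
  show "TQ (lact PB a X) = (\<lambda>u. al a * TQ X u)"
    using TQ_cls[OF c(1)] TQ_cls[of "?g c"] g[OF c(1)] unfolding eq c(2)[symmetric] by simp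
qed

lemma PB_ract: assumes "X \<in> carrier PB" and a: "a \<in> carrier A"
  shows "ract PB X a \<in> carrier PB" "TQ (ract PB X a) = rco j (TQ X) (al a)"
proof -
  let ?g = "frag_extend (\<lambda>(v, w). frag_of (v, w \<otimes>\<^bsub>A\<^esub> a))"
  obtain c where c: "Poly_Mapping.keys c \<subseteq> S" "X = cls c" by (rule PB_cases[OF assms(1)])
  have g: "Poly_Mapping.keys (?g d) \<subseteq> S \<and> tq j (?g d) = rco j (tq j d) (al a)" if "Poly_Mapping.keys d \<subseteq> S" for d
    using that
  proof (induction d rule: FG_induct)
    case zero
    have "rco j (\<lambda>u. 0) (al a) u = 0" for u by (cases u) simp_all
    then show ?case by (simp add: tq_def[abs_def] fun_eq_iff)
  next
    case (diff x y)
    have eqd: "tq j (x - y) = (\<lambda>u. tq j x u - tq j y u)" by (simp add: tq_diff fun_eq_iff)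
    have h: "rco j (tq j (x - y)) (al a) = (\<lambda>u. rco j (tq j x) (al a) u - rco j (tq j y) (al a) u)"
      unfolding eqd by (rule ext) (rule rco_diff)
    have "tq j (?g (x - y)) = rco j (tq j (x - y)) (al a)"
      unfolding h using diff(3,4) by (simp add: frag_extend_diff tq_diff fun_eq_iff)
    moreover have "Poly_Mapping.keys (?g (x - y)) \<subseteq> S"
      unfolding frag_extend_diff using diff(3,4) keys_diff[of "?g x" "?g y"] by blast
    ultimately show ?case by blast
  next
    case (of v w)
    then have wA: "w \<in> carrier A" by (simp add: W_iff)
    have "tq j (frag_of (v, w \<otimes>\<^bsub>A\<^esub> a)) u = rco j (tq j (frag_of (v, w))) (al a) u" for u
      using wA a by (cases u) (simp_all add: al_simps zK_simps distrib_left mult.assoc)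
    then have t: "tq j (frag_of (v, w \<otimes>\<^bsub>A\<^esub> a)) = rco j (tq j (frag_of (v, w))) (al a)"
      by (rule ext)
    show ?case unfolding frag_extend_of case_prod_conv t using W_closed(3)[OF a of(2)] of(1) by (intro conjI refl) simp
  qed
  have "ract PB X a = (\<Union>d\<in>X. cls (?g d))" by (simp add: proj_bimod_def Let_def)
  also have "\<dots> = cls (?g c)" unfolding c(2)
    by (rule cls_UN[OF c(1), where h = "\<lambda>y. rco j y (al a)"]) (use g in auto)
  finally have eq: "ract PB X a = cls (?g c)" .
  show "ract PB X a \<in> carrier PB" unfolding eq PB_carrier using g[OF c(1)] by blast
  show "TQ (ract PB X a) = rco j (TQ X) (al a)"
    using TQ_cls[OF c(1)] TQ_cls[of "?g c"] g[OF c(1)] unfolding eq c(2)[symmetric] by simp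
qed

lemma PB_gen: "proj_bimod_gen A e f \<in> carrier PB" "TQ (proj_bimod_gen A e f) = (\<lambda>u. if u = W1 then zE m i else 0)"
proof -
  have "e \<in> carrier V" "f \<in> carrier W" using e f by (simp_all add: V_iff W_iff)
  then have k: "Poly_Mapping.keys (frag_of (e, f)) \<subseteq> S" by simp
  show "proj_bimod_gen A e f \<in> carrier PB" unfolding proj_bimod_gen_def PB_carrier using k by blast
  have "tq j (frag_of (e, f)) u = (if u = W1 then zE m i else 0)" for u
    by (cases u) (simp_all add: e f zK_simps)
  then show "TQ (proj_bimod_gen A e f) = (\<lambda>u. if u = W1 then zE m i else 0)"
    unfolding proj_bimod_gen_def TQ_cls[OF k] by (simp add: fun_eq_iff)
qed

end

section \<open>The terms of the resolution in coordinates\<close>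

declare One_nat_def [simp del]

lemma fun_zero [simp]: "(0 :: 'a \<Rightarrow> 'b::zero) x = 0" by (simp add: zero_fun_def)
lemma fun_plus [simp]: "(f + g) x = f x + (g x :: 'b::plus)" by (simp add: plus_fun_def)
lemma fun_minus [simp]: "(f - g) x = f x - (g x :: 'b::minus)" by (simp add: fun_diff_def)
lemma fun_uminus [simp]: "(- f) x = - (f x :: 'b::uminus)" by (simp add: fun_Compl_def)

lemma abelian_group_embed:
  fixes \<tau> :: "'a \<Rightarrow> 'c::ab_group_add" and M :: "('a, 'm) ring_scheme"
  assumes inj: "inj_on \<tau> (carrier M)"
    and add: "\<And>x y. x \<in> carrier M \<Longrightarrow> y \<in> carrier M \<Longrightarrow> x \<oplus>\<^bsub>M\<^esub> y \<in> carrier M \<and> \<tau> (x \<oplus>\<^bsub>M\<^esub> y) = \<tau> x + \<tau> y"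
    and zero: "\<zero>\<^bsub>M\<^esub> \<in> carrier M" "\<tau> \<zero>\<^bsub>M\<^esub> = 0"
    and neg: "\<And>x. x \<in> carrier M \<Longrightarrow> - \<tau> x \<in> \<tau> ` carrier M"
  shows "abelian_group M" and "\<And>x. x \<in> carrier M \<Longrightarrow> \<ominus>\<^bsub>M\<^esub> x \<in> carrier M \<and> \<tau> (\<ominus>\<^bsub>M\<^esub> x) = - \<tau> x"
proof -
  have eqI: "x = y" if "x \<in> carrier M" "y \<in> carrier M" "\<tau> x = \<tau> y" for x y
    using inj that by (auto simp: inj_on_def)
  show ab: "abelian_group M"
  proof (rule abelian_groupI)
    fix x assume x: "x \<in> carrier M"
    obtain y where y: "y \<in> carrier M" "- \<tau> x = \<tau> y" using neg[OF x] by (rule imageE) simp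
    have "y \<oplus>\<^bsub>M\<^esub> x = \<zero>\<^bsub>M\<^esub>" by (rule eqI) (use x y add zero in \<open>simp_all flip: y(2)\<close>)
    then show "\<exists>y\<in>carrier M. y \<oplus>\<^bsub>M\<^esub> x = \<zero>\<^bsub>M\<^esub>" using y(1) by blast
  next
    fix x y z assume "x \<in> carrier M" "y \<in> carrier M" "z \<in> carrier M"
    then show "x \<oplus>\<^bsub>M\<^esub> y \<oplus>\<^bsub>M\<^esub> z = x \<oplus>\<^bsub>M\<^esub> (y \<oplus>\<^bsub>M\<^esub> z)"
      by (intro eqI) (simp_all add: add add.assoc)
  next
    fix x y assume "x \<in> carrier M" "y \<in> carrier M"
    then show "x \<oplus>\<^bsub>M\<^esub> y = y \<oplus>\<^bsub>M\<^esub> x" by (intro eqI) (simp_all add: add add.commute)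
  next
    fix x assume "x \<in> carrier M"
    then show "\<zero>\<^bsub>M\<^esub> \<oplus>\<^bsub>M\<^esub> x = x" by (intro eqI) (simp_all add: add zero)
  qed (simp_all add: add zero)
  fix x assume x: "x \<in> carrier M"
  have c: "\<ominus>\<^bsub>M\<^esub> x \<in> carrier M" by (rule abelian_group.a_inv_closed[OF ab x])
  have "x \<oplus>\<^bsub>M\<^esub> \<ominus>\<^bsub>M\<^esub> x = \<zero>\<^bsub>M\<^esub>" by (rule abelian_group.r_neg[OF ab x])
  then have "\<tau> x + \<tau> (\<ominus>\<^bsub>M\<^esub> x) = 0" using add[OF x c] zero(2) by simp
  then show "\<ominus>\<^bsub>M\<^esub> x \<in> carrier M \<and> \<tau> (\<ominus>\<^bsub>M\<^esub> x) = - \<tau> x" using c by (simp add: eq_neg_iff_add_eq_0 add.commute)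
qed

text \<open>Elements of the \<open>n\<close>-th term of the resolution are written as \<open>\<Sum> q(r, u) G\<^sub>r u\<close> with
  \<open>G\<^sub>r = \<Sum>\<^sub>i e\<^sub>i \<otimes>\<^sub>r e\<^bsub>i+n-2r\<^esub>\<close> and \<open>u \<in> {1, a, b, ab}\<close>. Below, \<open>rc\<close> and \<open>Rc\<close> describe the right
  multiplication in these coordinates; the shift comes from \<open>G\<^sub>r e\<^bsub>i+n-2r\<^esub> = e\<^sub>i G\<^sub>r\<close>.\<close>

type_synonym 'k coord = "int \<Rightarrow> wd \<Rightarrow> 'k zz"

fun rc :: "int \<Rightarrow> (wd \<Rightarrow> 'k::comm_ring_1 zz) \<Rightarrow> 'k zz \<Rightarrow> wd \<Rightarrow> 'k zz" where
  "rc k y x W1 = y W1 * zD (\<lambda>l. ce x (l + k))"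
| "rc k y x Wa = y W1 * zD (\<lambda>l. ca x (l + k)) + y Wa * zD (\<lambda>l. ce x (l + k + 1))"
| "rc k y x Wb = y W1 * zD (\<lambda>l. cb x (l + k)) + y Wb * zD (\<lambda>l. ce x (l + k - 1))"
| "rc k y x Wz = y W1 * zD (\<lambda>l. cz x (l + k)) + y Wz * zD (\<lambda>l. ce x (l + k)) + y Wa * zD (\<lambda>l. cb x (l + k + 1)) + y Wb * zD (\<lambda>l. ca x (l + k - 1))"

definition Rc :: "nat \<Rightarrow> 'k::comm_ring_1 coord \<Rightarrow> 'k zz \<Rightarrow> 'k coord" where
  "Rc n q x = (\<lambda>r. rc (int n - 2 * r) (q r) x)"

definition Lc :: "'k::comm_ring_1 zz \<Rightarrow> 'k coord \<Rightarrow> 'k coord" where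
  "Lc x q = (\<lambda>r u. x * q r u)"

definition Pc :: "nat \<Rightarrow> nat \<Rightarrow> 'k::comm_ring_1 coord set" where
  "Pc m n = {q. (\<forall>r u. per m (q r u)) \<and> (\<forall>r u. \<not> (0 \<le> r \<and> r \<le> int n) \<longrightarrow> q r u = 0)}"

lemma per_shift: "per m x \<Longrightarrow> per m (zD (\<lambda>l. ce x (l + k)))" "per m x \<Longrightarrow> per m (zD (\<lambda>l. ca x (l + k)))"
  "per m x \<Longrightarrow> per m (zD (\<lambda>l. cb x (l + k)))" "per m x \<Longrightarrow> per m (zD (\<lambda>l. cz x (l + k)))"
  by (auto intro: perD simp: mod_simps)

lemma per_shift': "per m x \<Longrightarrow> per m (zD (\<lambda>l. ce x (l + k + k')))" "per m x \<Longrightarrow> per m (zD (\<lambda>l. ca x (l + k + k')))"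
  "per m x \<Longrightarrow> per m (zD (\<lambda>l. cb x (l + k + k')))"  "per m x \<Longrightarrow> per m (zD (\<lambda>l. ce x (l + k - k')))"
  "per m x \<Longrightarrow> per m (zD (\<lambda>l. ca x (l + k - k')))"
  using per_shift[of m x "k + k'"] per_shift[of m x "k - k'"] by (simp_all only: add.assoc add_diff_eq)

text \<open>On coordinates supported at \<open>e_i\<close> a diagonal element acts as its value at
  \<open>i\<close>, so the shifted functions in \<open>rc\<close> reduce to the scalars in
  \<open>rco\<close>.\<close>

lemma rc_rco:
  assumes "per m x" "\<And>u. y u * zE m i = y u"
  shows "rc k y x u = rco (i + k) y x u"
proof -
  have s: "y u * zD d = y u * zK (d i)" if "per m (zD d)" for u d
  proof -
    have "y u * zD d = y u * (zE m i * zD d)" using assms(2)[of u] by (simp flip: mult.assoc)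
    also have "zE m i * zD d = zD d * zE m i" by (simp add: zz_eq_iff)
    also have "\<dots> = zE m i * zK (d i)" unfolding zD_zE_per[OF that] by (rule zK_central)
    finally show ?thesis using assms(2)[of u] by (simp flip: mult.assoc)
  qed
  show ?thesis
    by (cases u) (simp_all add: s[OF per_shift(1)[OF assms(1)]] s[OF per_shift(2)[OF assms(1)]] s[OF per_shift(3)[OF assms(1)]] s[OF per_shift(4)[OF assms(1)]]
      s[OF per_shift'(1)[OF assms(1)]] s[OF per_shift'(2)[OF assms(1)]] s[OF per_shift'(3)[OF assms(1)]] s[OF per_shift'(4)[OF assms(1)]] s[OF per_shift'(5)[OF assms(1)]])
qed

lemma rc_add1: "rc k (\<lambda>u. y u + y' u) x u = rc k y x u + rc k y' x u"
  by (cases u) (simp_all add: distrib_right)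

lemma rc_0 [simp]: "rc k (\<lambda>u. 0) x u = 0"
  by (cases u) simp_all

lemma rc_sum: "rc k (\<lambda>u. \<Sum>i\<in>S. y i u) x u = (\<Sum>i\<in>S. rc k (y i) x u)"
  by (induction S rule: infinite_finite_induct) (simp_all add: rc_add1)

lemma Pc_group: "0 \<in> Pc m n" "q \<in> Pc m n \<Longrightarrow> q' \<in> Pc m n \<Longrightarrow> q + q' \<in> Pc m n" "q \<in> Pc m n \<Longrightarrow> - q \<in> Pc m n"
  "q \<in> Pc m n \<Longrightarrow> q' \<in> Pc m n \<Longrightarrow> q - q' \<in> Pc m n"
  by (auto simp: Pc_def)

locale cyc = fixes m :: nat assumes m3: "m \<ge> 3"
begin

lemma m_pos: "m > 0" using m3 by simp

lemma calg: "coordalg m (Lam m 1 :: ('k::field, 'k lam) module) (alpha m)"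
  by (rule coordalg.intro) (simp_all add: m_pos ring_Lam alpha_iso smult_Lam_closed)

lemma cpair: "coordpair m (Lam m 1 :: ('k::field, 'k lam) module) (alpha m) i j (idem m 1 i) (idem m 1 j)"
  by (intro coordpair.intro calg coordpair_axioms.intro alpha_gens m_pos)

abbreviation "tqi \<equiv> coordpair.TQ (alpha m)"

text \<open>Adding the summands over \<open>i\<close> loses nothing: the left factors of the i-th
  summand end at \<open>i\<close>, so right multiplication by \<open>zE m i\<close> recovers its
  coordinates.\<close>

definition Tau :: "nat \<Rightarrow> 'k::field pres \<Rightarrow> 'k coord" where
  "Tau n p = (\<lambda>r u. if 0 \<le> r \<and> r \<le> int n then \<Sum>i\<in>{0..<int m}. tqi (i + int n - 2 * r) (p (i, r)) u else 0)"

abbreviation "PR n \<equiv> (res m 1 n :: ('k::field lam, 'k pres) bimodule)"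

abbreviation "PBi n i r \<equiv> proj_bimod (Lam m 1) (idem m 1 i) (idem m 1 (i + int n - 2 * r))"

lemma res_sel:
  "\<zero>\<^bsub>PR n\<^esub> = (\<lambda>x\<in>res_index m n. \<zero>\<^bsub>PBi n (fst x) (snd x)\<^esub>)"
  "p \<oplus>\<^bsub>PR n\<^esub> p' = (\<lambda>x\<in>res_index m n. p x \<oplus>\<^bsub>PBi n (fst x) (snd x)\<^esub> p' x)"
  "lact (PR n) a p = (\<lambda>x\<in>res_index m n. lact (PBi n (fst x) (snd x)) a (p x))"
  "ract (PR n) p a = (\<lambda>x\<in>res_index m n. ract (PBi n (fst x) (snd x)) (p x) a)"
  by (simp_all add: res_def dsum_def res_summand_def case_prod_beta')

lemma fin_res_index [simp]: "finite (res_index m n)"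
  by (simp add: res_index_def)

lemma res_carrier: "p \<in> carrier (PR n) \<longleftrightarrow> p \<in> extensional (res_index m n) \<and>
   (\<forall>i r. (i, r) \<in> res_index m n \<longrightarrow> p (i, r) \<in> carrier (PBi n i r))"
  by (auto simp: res_def dsum_def res_summand_def PiE_def Pi_def)

lemma res_index_iff: "(i, r) \<in> res_index m n \<longleftrightarrow> i \<in> {0..<int m} \<and> 0 \<le> r \<and> r \<le> int n"
  by (auto simp: res_index_def)

lemma res_at: "p \<in> carrier (PR n) \<Longrightarrow> (i, r) \<in> res_index m n \<Longrightarrow> p (i, r) \<in> carrier (PBi n i r)"
  by (simp add: res_carrier)

lemma tqi_props:
  assumes "p \<in> carrier (PR n)" "(i, r) \<in> res_index m n"
  shows "per m (tqi (i + int n - 2 * r) (p (i, r)) u)"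
    "tqi (i + int n - 2 * r) (p (i, r)) u * zE m i = tqi (i + int n - 2 * r) (p (i, r)) u"
proof -
  have "p (i, r) \<in> carrier (PBi n i r)" using assms by (simp add: res_carrier)
  from coordpair.TQ_Yset[OF cpair this]
  show "per m (tqi (i + int n - 2 * r) (p (i, r)) u)"
    "tqi (i + int n - 2 * r) (p (i, r)) u * zE m i = tqi (i + int n - 2 * r) (p (i, r)) u"
    unfolding coordpair.Yset_def[OF cpair] by auto
qed

lemma sum_zE_pick:
  assumes "i \<in> {0..<int m}" "\<And>l. l \<in> {0..<int m} \<Longrightarrow> y l * zE m l = y l"
  shows "(\<Sum>l\<in>{0..<int m}. y l) * zE m i = y i"
proof -
  have "(\<Sum>l\<in>{0..<int m}. y l) * zE m i = (\<Sum>l\<in>{0..<int m}. if l = i then y i else 0)"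
    unfolding sum_distrib_right
  proof (rule sum.cong[OF refl])
    fix l assume l: "l \<in> {0..<int m}"
    have "y l * zE m i = y l * (zE m l * zE m i)" using assms(2)[OF l] by (simp flip: mult.assoc)
    then show "y l * zE m i = (if l = i then y i else 0)"
      using assms l by (simp add: zE_mult)
  qed
  then show ?thesis using assms(1) by simp
qed

lemma Tau_zE:
  assumes "p \<in> carrier (PR n)" "(i, r) \<in> res_index m n"
  shows "Tau n p r u * zE m i = tqi (i + int n - 2 * r) (p (i, r)) u"
proof -
  have r: "0 \<le> r" "r \<le> int n" and i: "i \<in> {0..<int m}" using assms(2) by (auto simp: res_index_def)
  have "(\<Sum>l\<in>{0..<int m}. tqi (l + int n - 2 * r) (p (l, r)) u) * zE m i = tqi (i + int n - 2 * r) (p (i, r)) u"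
    by (rule sum_zE_pick[OF i]) (rule tqi_props(2)[OF assms(1)], simp add: res_index_iff r)
  then show ?thesis using r by (simp add: Tau_def)
qed

lemma Tau_inj: "inj_on (Tau n) (carrier (PR n))"
proof (rule inj_onI)
  fix p p' :: "'k::field pres"
  assume p: "p \<in> carrier (PR n)" and p': "p' \<in> carrier (PR n)" and eq: "Tau n p = Tau n p'"
  show "p = p'"
  proof (rule extensionalityI[of _ "res_index m n"])
    show "p \<in> extensional (res_index m n)" "p' \<in> extensional (res_index m n)" using p p' by (simp_all add: res_carrier)
    fix x assume "x \<in> res_index m n"
    then obtain i r where x: "x = (i, r)" "(i, r) \<in> res_index m n" by (cases x) simp
    have "tqi (i + int n - 2 * r) (p (i, r)) = tqi (i + int n - 2 * r) (p' (i, r))"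
      by (rule ext) (simp only: Tau_zE[OF p x(2), symmetric] Tau_zE[OF p' x(2), symmetric] eq)
    moreover have "p (i, r) \<in> carrier (PBi n i r)" "p' (i, r) \<in> carrier (PBi n i r)" using p p' x by (simp_all add: res_carrier)
    ultimately show "p x = p' x" unfolding x(1) by (intro coordpair.TQ_inj[OF cpair])
  qed
qed

lemma Tau_Pc: "p \<in> carrier (PR n) \<Longrightarrow> Tau n p \<in> Pc m n"
  unfolding Pc_def Tau_def by (auto intro!: per_sum tqi_props(1) simp: res_index_iff)

lemma zE_right_sum: "(\<Sum>i\<in>{0..<int m}. y * zE m i) = y"
  unfolding sum_distrib_left[symmetric] by (simp only: sum_zE[OF m_pos] mult_1_right)

lemma Tau_surj:
  fixes q :: "'k::field coord"
  assumes "q \<in> Pc m n" shows "\<exists>p\<in>carrier (PR n). Tau n p = q"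
proof -
  have "\<exists>X\<in>carrier (PBi n i r). tqi (i + int n - 2 * r) X = (\<lambda>u. q r u * zE m i)" for i r
  proof -
    have "(\<lambda>u. q r u * zE m i) \<in> coordpair.Yset m i"
      unfolding coordpair.Yset_def[OF cpair, where 'k = 'k] using assms by (auto simp: Pc_def mult.assoc)
    then show ?thesis by (rule coordpair.TQ_surj[OF cpair]) blast
  qed
  then obtain X where X: "\<And>i r. X i r \<in> carrier (PBi n i r)" "\<And>i r. tqi (i + int n - 2 * r) (X i r) = (\<lambda>u. q r u * zE m i)"
    by metis
  define p where "p = (\<lambda>x\<in>res_index m n. X (fst x) (snd x))"
  have p: "p \<in> carrier (PR n)" unfolding res_carrier using X(1) by (auto simp: p_def)
  have "Tau n p r u = q r u" for r u
  proof (cases "0 \<le> r \<and> r \<le> int n")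
    case True
    then have "Tau n p r u = (\<Sum>i\<in>{0..<int m}. q r u * zE m i)"
      unfolding Tau_def by (auto simp: p_def res_index_iff X(2) intro!: sum.cong)
    then show ?thesis by (simp add: zE_right_sum)
  qed (use assms in \<open>auto simp: Tau_def Pc_def\<close>)
  then have "Tau n p = q" by (simp add: fun_eq_iff)
  then show ?thesis using p by blast
qed

lemma res_add:
  assumes "p \<in> carrier (PR n)" "p' \<in> carrier (PR n)"
  shows "p \<oplus>\<^bsub>PR n\<^esub> p' \<in> carrier (PR n)" "Tau n (p \<oplus>\<^bsub>PR n\<^esub> p') = Tau n p + Tau n p'"
proof -
  have a: "p (i, r) \<oplus>\<^bsub>PBi n i r\<^esub> p' (i, r) \<in> carrier (PBi n i r)"
    "tqi (i + int n - 2 * r) (p (i, r) \<oplus>\<^bsub>PBi n i r\<^esub> p' (i, r)) = (\<lambda>u. tqi (i + int n - 2 * r) (p (i, r)) u + tqi (i + int n - 2 * r) (p' (i, r)) u)"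
    if "(i, r) \<in> res_index m n" for i r
    by (rule coordpair.PB_add[OF cpair res_at[OF assms(1) that] res_at[OF assms(2) that]])+
  show "p \<oplus>\<^bsub>PR n\<^esub> p' \<in> carrier (PR n)" unfolding res_carrier res_sel using a(1) by auto
  show "Tau n (p \<oplus>\<^bsub>PR n\<^esub> p') = Tau n p + Tau n p'"
    unfolding fun_eq_iff Tau_def res_sel by (auto simp: res_index_iff a(2) sum.distrib[symmetric] intro!: sum.cong)
qed

lemma res_zero: "\<zero>\<^bsub>PR n\<^esub> \<in> carrier (PR n)" "Tau n \<zero>\<^bsub>PR n\<^esub> = 0"
proof -
  show "\<zero>\<^bsub>PR n\<^esub> \<in> carrier (PR n)" unfolding res_carrier res_sel by (auto intro: coordpair.PB_zero[OF cpair])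
  show "Tau n \<zero>\<^bsub>PR n\<^esub> = 0"
    unfolding fun_eq_iff Tau_def res_sel by (auto simp: res_index_iff coordpair.PB_zero[OF cpair] intro!: sum.neutral)
qed

lemma res_lact:
  assumes "p \<in> carrier (PR n)" "a \<in> carrier (Lam m 1)"
  shows "lact (PR n) a p \<in> carrier (PR n)" "Tau n (lact (PR n) a p) = Lc (alpha m a) (Tau n p)"
proof -
  have a: "lact (PBi n i r) a (p (i, r)) \<in> carrier (PBi n i r)"
    "tqi (i + int n - 2 * r) (lact (PBi n i r) a (p (i, r))) = (\<lambda>u. alpha m a * tqi (i + int n - 2 * r) (p (i, r)) u)"
    if "(i, r) \<in> res_index m n" for i r
    by (rule coordpair.PB_lact[OF cpair res_at[OF assms(1) that] assms(2)])+
  show "lact (PR n) a p \<in> carrier (PR n)" unfolding res_carrier res_sel using a(1) by auto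
  show "Tau n (lact (PR n) a p) = Lc (alpha m a) (Tau n p)"
    unfolding fun_eq_iff Tau_def Lc_def res_sel by (auto simp: res_index_iff a(2) sum_distrib_left intro!: sum.cong)
qed

lemma res_ract:
  assumes p: "p \<in> carrier (PR n)" and x: "a \<in> carrier (Lam m 1)"
  shows "ract (PR n) p a \<in> carrier (PR n)" "Tau n (ract (PR n) p a) = Rc n (Tau n p) (alpha m a)"
proof -
  have pa: "per m (alpha m a)" by (rule coordalg.al_simps(1)[OF calg x])
  have a: "ract (PBi n i r) (p (i, r)) a \<in> carrier (PBi n i r)"
    "tqi (i + int n - 2 * r) (ract (PBi n i r) (p (i, r)) a) = rco (i + int n - 2 * r) (tqi (i + int n - 2 * r) (p (i, r))) (alpha m a)"
    if "(i, r) \<in> res_index m n" for i r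
    by (rule coordpair.PB_ract[OF cpair res_at[OF p that] x])+
  have r: "rco (i + int n - 2 * r) (tqi (i + int n - 2 * r) (p (i, r))) (alpha m a) u = rc (int n - 2 * r) (tqi (i + int n - 2 * r) (p (i, r))) (alpha m a) u"
    if "(i, r) \<in> res_index m n" for i r u
    using rc_rco[where k = "int n - 2 * r" and u = u, OF pa tqi_props(2)[OF p that]] by (simp add: add_diff_eq)
  show "ract (PR n) p a \<in> carrier (PR n)" unfolding res_carrier res_sel using a(1) by auto
  show "Tau n (ract (PR n) p a) = Rc n (Tau n p) (alpha m a)"
  proof (intro ext)
    fix s u
    show "Tau n (ract (PR n) p a) s u = Rc n (Tau n p) (alpha m a) s u"
    proof (cases "0 \<le> s \<and> s \<le> int n")
      case True
      then have "Tau n (ract (PR n) p a) s u = (\<Sum>i\<in>{0..<int m}. rc (int n - 2 * s) (tqi (i + int n - 2 * s) (p (i, s))) (alpha m a) u)"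
        unfolding Tau_def res_sel by (auto simp: res_index_iff a(2) r intro!: sum.cong)
      also have "\<dots> = rc (int n - 2 * s) (\<lambda>u. \<Sum>i\<in>{0..<int m}. tqi (i + int n - 2 * s) (p (i, s)) u) (alpha m a) u"
        by (rule rc_sum[symmetric])
      also have "\<dots> = Rc n (Tau n p) (alpha m a) s u" using True by (simp add: Rc_def Tau_def)
      finally show ?thesis .
    qed (auto simp: Rc_def Tau_def)
  qed
qed

lemma idem_mod: "idem m 1 (i mod int m) = idem m 1 i" "i mod int m = j mod int m \<Longrightarrow> idem m 1 i = idem m 1 j"
  by (simp_all add: idem_def vtx_def)

lemma res_gen: "gen m 1 n i r \<in> carrier (PR n :: ('k::field lam, 'k pres) bimodule)"
  "Tau n (gen m 1 n i r) = (\<lambda>s u. if s = r \<and> u = W1 \<and> 0 \<le> r \<and> r \<le> int n then zE m i else (0 :: 'k::field zz))"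
proof -
  show c: "gen m 1 n i r \<in> carrier (PR n :: ('k lam, 'k pres) bimodule)" and "Tau n (gen m 1 n i r) = (\<lambda>s u. if s = r \<and> u = W1 \<and> 0 \<le> r \<and> r \<le> int n then zE m i else (0 :: 'k zz))"
  proof (atomize (full), cases "0 \<le> r \<and> r \<le> int n")
    case False
    then have "gen m 1 n i r = (\<zero>\<^bsub>PR n\<^esub> :: 'k pres)" unfolding gen_def by (rule if_not_P)
    moreover have "Tau n \<zero>\<^bsub>PR n\<^esub> = (\<lambda>s u. if s = r \<and> u = W1 \<and> 0 \<le> r \<and> r \<le> int n then zE m i else (0 :: 'k zz))"
      unfolding res_zero(2) using False by (intro ext) auto
    ultimately show "gen m 1 n i r \<in> carrier (PR n :: ('k lam, 'k pres) bimodule) \<and> Tau n (gen m 1 n i r) = (\<lambda>s u. if s = r \<and> u = W1 \<and> 0 \<le> r \<and> r \<le> int n then zE m i else (0 :: 'k zz))"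
      by (simp only: res_zero(1) simp_thms)
  next
    case True
    let ?i = "i mod int m"
    have im: "?i \<in> {0..<int m}" using m_pos by simp
    have "(i + int n - 2 * r) mod int m = (?i + int n - 2 * r) mod int m"
      by (metis add_diff_eq mod_add_left_eq)
    then have e: "(idem m 1 i :: 'k lam) = idem m 1 ?i" "(idem m 1 (i + int n - 2 * r) :: 'k lam) = idem m 1 (?i + int n - 2 * r)"
      by (simp_all only: idem_mod(1)) (rule idem_mod(2))
    let ?g = "proj_bimod_gen (Lam m 1) (idem m 1 ?i) (idem m 1 (?i + int n - 2 * r))"
    have g: "(gen m 1 n i r :: 'k pres) = (\<lambda>x\<in>res_index m n. if x = (?i, r) then ?g else \<zero>\<^bsub>PBi n (fst x) (snd x)\<^esub>)"
      using True unfolding gen_def e by (simp add: dsum_inj_def res_summand_def case_prod_beta')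
    note G = coordpair.PB_gen[OF cpair, where i = ?i and j = "?i + int n - 2 * r" and 'k = 'k]
    have "gen m 1 n i r \<in> carrier (PR n :: ('k lam, 'k pres) bimodule)"
      unfolding res_carrier g using G(1) by (auto intro: coordpair.PB_zero[OF cpair])
    moreover have "Tau n (gen m 1 n i r) s u = (if s = r \<and> u = W1 \<and> 0 \<le> r \<and> r \<le> int n then zE m i else (0 :: 'k zz))" for s u
    proof (cases "0 \<le> s \<and> s \<le> int n")
      case s: True
      have pt: "tqi (l + int n - 2 * s) ((gen m 1 n i r :: 'k pres) (l, s)) u = (if l = ?i then (if s = r \<and> u = W1 then zE m ?i else 0) else 0)"
        if "l \<in> {0..<int m}" for l
        unfolding g using that s by (auto simp: res_index_iff G(2) coordpair.PB_zero[OF cpair])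
      have "Tau n (gen m 1 n i r :: 'k pres) s u = (\<Sum>l\<in>{0..<int m}. tqi (l + int n - 2 * s) ((gen m 1 n i r :: 'k pres) (l, s)) u)"
        unfolding Tau_def using s by simp
      also have "\<dots> = (\<Sum>l\<in>{0..<int m}. if l = ?i then (if s = r \<and> u = W1 then zE m ?i else 0) else 0)"
        by (rule sum.cong[OF refl]) (rule pt)
      also have "\<dots> = (if s = r \<and> u = W1 \<and> 0 \<le> r \<and> r \<le> int n then zE m i else 0)"
        using im True by simp
      finally show ?thesis .
    qed (use True in \<open>auto simp: Tau_def\<close>)
    ultimately show "gen m 1 n i r \<in> carrier (PR n :: ('k lam, 'k pres) bimodule) \<and> Tau n (gen m 1 n i r) = (\<lambda>s u. if s = r \<and> u = W1 \<and> 0 \<le> r \<and> r \<le> int n then zE m i else (0 :: 'k zz))"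
      by (auto simp: fun_eq_iff)
  qed
qed

lemma res_group: "abelian_group (PR n)"
  and res_neg: "p \<in> carrier (PR n) \<Longrightarrow> \<ominus>\<^bsub>PR n\<^esub> p \<in> carrier (PR n) \<and> Tau n (\<ominus>\<^bsub>PR n\<^esub> p) = - Tau n p"
proof -
  have n: "- Tau n p \<in> Tau n ` carrier (PR n)" if p: "p \<in> carrier (PR n)" for p :: "'k::field pres"
    using Tau_surj[OF Pc_group(3)[OF Tau_Pc[OF p]]] by (metis imageI)
  show "abelian_group (PR n)"
    by (rule abelian_group_embed[OF Tau_inj]) (simp_all add: res_add res_zero n)
  show "p \<in> carrier (PR n) \<Longrightarrow> \<ominus>\<^bsub>PR n\<^esub> p \<in> carrier (PR n) \<and> Tau n (\<ominus>\<^bsub>PR n\<^esub> p) = - Tau n p"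
    by (rule abelian_group_embed[OF Tau_inj]) (simp_all add: res_add res_zero n)
qed

end

section \<open>Homomorphisms out of the resolution\<close>

lemma zA_expand: "zA * x = zD (\<lambda>i. ce x (i + 1)) * zA + zD (\<lambda>i. cb x (i + 1)) * (zA * zB)"
  and zB_expand: "zB * x = zD (\<lambda>i. ce x (i - 1)) * zB + zD (\<lambda>i. ca x (i - 1)) * (zA * zB)"
  and zAB_expand: "zA * zB * x = zD (ce x) * (zA * zB)"
  by (simp_all add: zz_eq_iff)

text \<open>Covers the two targets of interest, the regular bimodule and the terms of the resolution
  in coordinates, so that cochains and chain maps are handled by one computation.\<close>

locale bim =
  fixes l :: "'k::field zz \<Rightarrow> 'c::ab_group_add \<Rightarrow> 'c" and r :: "'c \<Rightarrow> 'k zz \<Rightarrow> 'c"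
  assumes l_add1: "l (x + y) c = l x c + l y c" and l_add2: "l x (c + d) = l x c + l x d"
    and l_mult: "l (x * y) c = l x (l y c)" and r_add1: "r (c + d) x = r c x + r d x"
    and r_add2: "r c (x + y) = r c x + r c y" and r_mult: "r c (x * y) = r (r c x) y"
    and lr: "l x (r c y) = r (l x c) y" and l_1: "l 1 c = c" and r_1: "r c 1 = c"
    and l_zK: "l (zK k) c = r c (zK k)"
begin

lemma l_0 [simp]: "l 0 c = 0" "l x 0 = 0" and r_0 [simp]: "r 0 x = 0" "r c 0 = 0"
  using l_add1[of 0 0 c] l_add2[of x 0 0] r_add1[of 0 0 x] r_add2[of c 0 0] by simp_all

lemma l_sum: "l x (\<Sum>i\<in>S. f i) = (\<Sum>i\<in>S. l x (f i))"
  and r_sum: "r (\<Sum>i\<in>S. f i) x = (\<Sum>i\<in>S. r (f i) x)"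
  by (induction S rule: infinite_finite_induct) (simp_all add: l_add2 r_add1)

text \<open>The left linear map that sends each basis element \<open>G_s u\<close> to
  \<open>\<nu> s\<close> times \<open>u\<close>.\<close>

definition Hc :: "nat \<Rightarrow> (int \<Rightarrow> 'c) \<Rightarrow> 'k coord \<Rightarrow> 'c" where
  "Hc n \<nu> q = (\<Sum>s\<in>{0..int n}. l (q s W1) (\<nu> s) + l (q s Wa) (r (\<nu> s) zA) + l (q s Wb) (r (\<nu> s) zB)
      + l (q s Wz) (r (\<nu> s) (zA * zB)))"

lemma Hc_add: "Hc n \<nu> (q + q') = Hc n \<nu> q + Hc n \<nu> q'"
  unfolding Hc_def sum.distrib[symmetric] by (rule sum.cong[OF refl]) (simp add: l_add1)

lemma Hc_0 [simp]: "Hc n \<nu> 0 = 0"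
  by (simp add: Hc_def)

lemma Hc_0' [simp]: "Hc n \<nu> (\<lambda>a b. 0) = 0"
  by (simp add: Hc_def)

lemma Hc_Lc: "Hc n \<nu> (Lc x q) = l x (Hc n \<nu> q)"
  unfolding Hc_def l_sum by (rule sum.cong[OF refl]) (simp add: Lc_def l_mult l_add2)

text \<open>The rule that \<open>G_s\<close> itself obeys when a diagonal element passes from its
  right to its left. It is what makes \<open>Hc\<close> right linear.\<close>

definition okn :: "nat \<Rightarrow> nat \<Rightarrow> (int \<Rightarrow> 'c) \<Rightarrow> bool" where
  "okn m n \<nu> \<longleftrightarrow> (\<forall>s\<in>{0..int n}. \<forall>d. per m (zD d) \<longrightarrow> r (\<nu> s) (zD d) = l (zD (\<lambda>i. d (i + (int n - 2 * s)))) (\<nu> s))"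

lemma oknD: "okn m n \<nu> \<Longrightarrow> s \<in> {0..int n} \<Longrightarrow> per m (zD d) \<Longrightarrow> r (\<nu> s) (zD d) = l (zD (\<lambda>i. d (i + (int n - 2 * s)))) (\<nu> s)"
  by (simp add: okn_def del: per_zD)

lemma per_parts: "per m x \<Longrightarrow> per m (zD (ce x))" "per m x \<Longrightarrow> per m (zD (ca x))" "per m x \<Longrightarrow> per m (zD (cb x))" "per m x \<Longrightarrow> per m (zD (cz x))"
  by (simp_all add: per_def)

lemma Hc_Rc:
  assumes ok: "okn m n \<nu>" and x: "per m x"
  shows "Hc n \<nu> (Rc n q x) = r (Hc n \<nu> q) x"
  unfolding Hc_def r_sum
proof (rule sum.cong[OF refl])
  fix s assume s: "s \<in> {0..int n}"
  let ?k = "int n - 2 * s" and ?v = "\<nu> s"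
  note D = oknD[OF ok s]
  have 1: "r ?v x = l (zD (\<lambda>i. ce x (i + ?k))) ?v + l (zD (\<lambda>i. ca x (i + ?k))) (r ?v zA)
     + l (zD (\<lambda>i. cb x (i + ?k))) (r ?v zB) + l (zD (\<lambda>i. cz x (i + ?k))) (r ?v (zA * zB))"
    by (subst zz_decomp[of x]) (simp only: r_add2 r_mult D[OF per_parts(1)[OF x]] D[OF per_parts(2)[OF x]] D[OF per_parts(3)[OF x]] D[OF per_parts(4)[OF x]] lr)
  have 2: "r (r ?v zA) x = l (zD (\<lambda>i. ce x (i + ?k + 1))) (r ?v zA) + l (zD (\<lambda>i. cb x (i + ?k + 1))) (r ?v (zA * zB))"
    unfolding r_mult[symmetric] zA_expand[of x]
    by (simp only: r_add2 r_mult D[OF per_shift(1)[OF x]] D[OF per_shift(3)[OF x]] lr)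
  have 3: "r (r ?v zB) x = l (zD (\<lambda>i. ce x (i + ?k - 1))) (r ?v zB) + l (zD (\<lambda>i. ca x (i + ?k - 1))) (r ?v (zA * zB))"
  proof -
    have p: "per m (zD (\<lambda>i. ce x (i - 1)))" "per m (zD (\<lambda>i. ca x (i - 1)))"
      using per_shift(1,2)[OF x, of "- 1"] by (simp_all only: diff_conv_add_uminus)
    show ?thesis unfolding r_mult[symmetric] zB_expand[of x]
      by (simp only: r_add2 r_mult D[OF p(1)] D[OF p(2)] lr)
  qed
  have 4: "r (r ?v (zA * zB)) x = l (zD (\<lambda>i. ce x (i + ?k))) (r ?v (zA * zB))"
    unfolding r_mult[symmetric] mult.assoc[symmetric] unfolding zAB_expand[of x]
    by (simp only: r_mult D[OF per_parts(1)[OF x]] lr)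
  show "l (Rc n q x s W1) ?v + l (Rc n q x s Wa) (r ?v zA) + l (Rc n q x s Wb) (r ?v zB) + l (Rc n q x s Wz) (r ?v (zA * zB)) =
    r (l (q s W1) ?v + l (q s Wa) (r ?v zA) + l (q s Wb) (r ?v zB) + l (q s Wz) (r ?v (zA * zB))) x"
    unfolding r_add1 lr[symmetric] 1 2 3 4 Rc_def rc.simps l_add1 l_add2 l_mult
    by (simp only: ac_simps)
qed

end

lemma bim_regular: "bim (*) ((*) :: 'k::field zz \<Rightarrow> 'k zz \<Rightarrow> 'k zz)"
  by unfold_locales (simp_all add: algebra_simps zK_central)

lemma bim_coord: "bim Lc (Rc n :: 'k::field coord \<Rightarrow> 'k zz \<Rightarrow> 'k coord)"
proof
  fix x y :: "'k zz" and c d :: "'k coord" and k :: 'k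
  show "Lc (x + y) c = Lc x c + Lc y c" "Lc x (c + d) = Lc x c + Lc x d" "Lc (x * y) c = Lc x (Lc y c)" "Lc 1 c = c"
    by (auto simp: Lc_def fun_eq_iff algebra_simps)
  have zD1: "zD (\<lambda>l. 1) = (1 :: 'k zz)" "zD (\<lambda>l. 0) = (0 :: 'k zz)" "zD (\<lambda>l. k) = zK k" by (simp_all add: zz_eq_iff)
  have "rc j (c r + d r) x u = rc j (c r) x u + rc j (d r) x u" for j r u
    by (cases u) (simp_all add: algebra_simps)
  then show "Rc n (c + d) x = Rc n c x + Rc n d x" by (simp add: Rc_def fun_eq_iff)
  have "rc j (c r) (x + y) u = rc j (c r) x u + rc j (c r) y u" for j r u
    by (cases u) (simp_all add: zz_eq_iff algebra_simps)
  then show "Rc n c (x + y) = Rc n c x + Rc n c y" by (simp add: Rc_def fun_eq_iff)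
  have "rc j (c r) (x * y) u = rc j (rc j (c r) x) y u" for j r u
    by (cases u) (simp_all add: zz_eq_iff algebra_simps)
  then show "Rc n c (x * y) = Rc n (Rc n c x) y" by (simp add: Rc_def fun_eq_iff)
  have "x * rc j (c r) y u = rc j (\<lambda>u. x * c r u) y u" for j r u
    by (cases u) (simp_all add: algebra_simps)
  then show "Lc x (Rc n c y) = Rc n (Lc x c) y" by (simp add: Rc_def Lc_def fun_eq_iff)
  have "rc j (c r) 1 u = c r u" for j r u
    by (cases u) (simp_all add: zD1)
  then show "Rc n c 1 = c" by (simp add: Rc_def fun_eq_iff)
  have "zK k * c r u = rc j (c r) (zK k) u" for j r u
    by (cases u) (simp_all add: zD1 zK_central)
  then show "Lc (zK k) c = Rc n c (zK k)" by (simp add: Rc_def Lc_def fun_eq_iff)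
qed

text \<open>The bimodule record is compared through \<open>\<sigma>\<close> with a type-class group
  that carries a \<open>bim\<close> structure. The instances are \<open>alpha m\<close> for cochains
  and \<open>Tau k\<close> for chain maps.\<close>

locale target = bim l r + cyc m for m and l :: "'k::field zz \<Rightarrow> 'c::ab_group_add \<Rightarrow> 'c" and r +
  fixes M :: "('k lam, 'y) bimodule" and \<sigma> :: "'y \<Rightarrow> 'c"
  assumes \<sigma>_inj: "inj_on \<sigma> (carrier M)"
    and M_add: "x \<in> carrier M \<Longrightarrow> y \<in> carrier M \<Longrightarrow> x \<oplus>\<^bsub>M\<^esub> y \<in> carrier M \<and> \<sigma> (x \<oplus>\<^bsub>M\<^esub> y) = \<sigma> x + \<sigma> y"
    and M_lact: "x \<in> carrier M \<Longrightarrow> a \<in> carrier (Lam m 1) \<Longrightarrow> lact M a x \<in> carrier M \<and> \<sigma> (lact M a x) = l (alpha m a) (\<sigma> x)"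
    and M_ract: "x \<in> carrier M \<Longrightarrow> a \<in> carrier (Lam m 1) \<Longrightarrow> ract M x a \<in> carrier M \<and> \<sigma> (ract M x a) = r (\<sigma> x) (alpha m a)"
    and M_zero: "0 \<in> \<sigma> ` carrier M"
begin

definition "Mc = \<sigma> ` carrier M"

definition "si c = inv_into (carrier M) \<sigma> c"

lemma si: "c \<in> Mc \<Longrightarrow> si c \<in> carrier M \<and> \<sigma> (si c) = c"
  unfolding Mc_def si_def by (simp add: inv_into_into f_inv_into_f)

lemma \<sigma>_eq: "x \<in> carrier M \<Longrightarrow> y \<in> carrier M \<Longrightarrow> \<sigma> x = \<sigma> y \<Longrightarrow> x = y"
  using \<sigma>_inj by (auto simp: inj_on_def)

lemma Mc_0: "0 \<in> Mc" using M_zero by (simp add: Mc_def)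

lemma Mc_add: "c \<in> Mc \<Longrightarrow> d \<in> Mc \<Longrightarrow> c + d \<in> Mc"
proof -
  assume "c \<in> Mc" "d \<in> Mc"
  then obtain x y where xy: "x \<in> carrier M" "c = \<sigma> x" "y \<in> carrier M" "d = \<sigma> y" unfolding Mc_def by blast
  show "c + d \<in> Mc" unfolding Mc_def
    by (rule image_eqI[of _ _ "x \<oplus>\<^bsub>M\<^esub> y"]) (use M_add[OF xy(1,3)] xy in simp_all)
qed

lemma Mc_sum: "(\<And>i. i \<in> S \<Longrightarrow> f i \<in> Mc) \<Longrightarrow> sum f S \<in> Mc"
  by (induction S rule: infinite_finite_induct) (simp_all add: Mc_0 Mc_add)

lemma Mc_l: assumes "c \<in> Mc" "per m x" shows "l x c \<in> Mc"
proof -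
  obtain y where y: "y \<in> carrier M" "c = \<sigma> y" using assms(1) by (auto simp: Mc_def)
  note b = coordalg.be[OF calg assms(2)]
  show ?thesis unfolding Mc_def y(2)
    by (rule image_eqI[of _ _ "lact M (coordalg.be (Lam m 1) (alpha m) x) y"]) (use M_lact[OF y(1) b(1)] b(2) in simp_all)
qed

lemma Mc_r: assumes "c \<in> Mc" "per m x" shows "r c x \<in> Mc"
proof -
  obtain y where y: "y \<in> carrier M" "c = \<sigma> y" using assms(1) by (auto simp: Mc_def)
  note b = coordalg.be[OF calg assms(2)]
  show ?thesis unfolding Mc_def y(2)
    by (rule image_eqI[of _ _ "ract M y (coordalg.be (Lam m 1) (alpha m) x)"]) (use M_ract[OF y(1) b(1)] b(2) in simp_all)
qed

lemma Hc_Mc: "(\<And>s. s \<in> {0..int n} \<Longrightarrow> \<nu> s \<in> Mc) \<Longrightarrow> q \<in> Pc m n \<Longrightarrow> Hc n \<nu> q \<in> Mc"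
  unfolding Hc_def by (intro Mc_sum Mc_add Mc_l Mc_r) (auto simp: Pc_def)

definition mkhom :: "nat \<Rightarrow> (int \<Rightarrow> 'c) \<Rightarrow> 'k pres \<Rightarrow> 'y" where
  "mkhom n \<nu> = (\<lambda>p\<in>carrier (PR n). si (Hc n \<nu> (Tau n p)))"

lemma mkhom:
  assumes ok: "okn m n \<nu>" and \<nu>: "\<And>s. s \<in> {0..int n} \<Longrightarrow> \<nu> s \<in> Mc"
  shows "mkhom n \<nu> \<in> bimod_hom (Lam m 1) (PR n) M" "p \<in> carrier (PR n) \<Longrightarrow> \<sigma> (mkhom n \<nu> p) = Hc n \<nu> (Tau n p)"
proof -
  have s: "mkhom n \<nu> p \<in> carrier M \<and> \<sigma> (mkhom n \<nu> p) = Hc n \<nu> (Tau n p)" if "p \<in> carrier (PR n)" for p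
    unfolding mkhom_def using that si[OF Hc_Mc[OF \<nu> Tau_Pc[OF that]]] by simp
  then show "p \<in> carrier (PR n) \<Longrightarrow> \<sigma> (mkhom n \<nu> p) = Hc n \<nu> (Tau n p)" by simp
  show "mkhom n \<nu> \<in> bimod_hom (Lam m 1) (PR n) M"
    unfolding bimod_hom_def
  proof (intro CollectI conjI ballI)
    show "mkhom n \<nu> \<in> carrier (PR n) \<rightarrow>\<^sub>E carrier M" using s by (auto simp: mkhom_def)
  next
    fix x y :: "'k pres" assume x: "x \<in> carrier (PR n)" and y: "y \<in> carrier (PR n)"
    show "mkhom n \<nu> (x \<oplus>\<^bsub>PR n\<^esub> y) = mkhom n \<nu> x \<oplus>\<^bsub>M\<^esub> mkhom n \<nu> y"
      using s[OF x] s[OF y] s[OF res_add(1)[OF x y]] M_add[of "mkhom n \<nu> x" "mkhom n \<nu> y"]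
      by (intro \<sigma>_eq) (simp_all add: res_add(2)[OF x y] Hc_add)
  next
    fix a :: "'k lam" and x :: "'k pres" assume a: "a \<in> carrier (Lam m 1)" and x: "x \<in> carrier (PR n)"
    show "mkhom n \<nu> (lact (PR n) a x) = lact M a (mkhom n \<nu> x)"
      using s[OF x] s[OF res_lact(1)[OF x a]] M_lact[OF _ a, of "mkhom n \<nu> x"]
      by (intro \<sigma>_eq) (simp_all add: res_lact(2)[OF x a] Hc_Lc)
    show "mkhom n \<nu> (ract (PR n) x a) = ract M (mkhom n \<nu> x) a"
      using s[OF x] s[OF res_ract(1)[OF x a]] M_ract[OF _ a, of "mkhom n \<nu> x"]
      by (intro \<sigma>_eq) (simp_all add: res_ract(2)[OF x a] Hc_Rc[OF ok coordalg.al_simps(1)[OF calg a]])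
  qed
qed

lemma bimod_homD:
  assumes "f \<in> bimod_hom (Lam m 1) (PR n) M"
  shows "p \<in> carrier (PR n) \<Longrightarrow> f p \<in> carrier M"
    "p \<in> carrier (PR n) \<Longrightarrow> p' \<in> carrier (PR n) \<Longrightarrow> \<sigma> (f (p \<oplus>\<^bsub>PR n\<^esub> p')) = \<sigma> (f p) + \<sigma> (f p')"
    "p \<in> carrier (PR n) \<Longrightarrow> a \<in> carrier (Lam m 1) \<Longrightarrow> \<sigma> (f (lact (PR n) a p)) = l (alpha m a) (\<sigma> (f p))"
    "p \<in> carrier (PR n) \<Longrightarrow> a \<in> carrier (Lam m 1) \<Longrightarrow> \<sigma> (f (ract (PR n) p a)) = r (\<sigma> (f p)) (alpha m a)"
proof -
  show c: "p \<in> carrier (PR n) \<Longrightarrow> f p \<in> carrier M" for p using assms by (auto simp: bimod_hom_def)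
  assume p: "p \<in> carrier (PR n)"
  {
    assume p': "p' \<in> carrier (PR n)"
    have "f (p \<oplus>\<^bsub>PR n\<^esub> p') = f p \<oplus>\<^bsub>M\<^esub> f p'"
      using assms p p' unfolding bimod_hom_def by blast
    then show "\<sigma> (f (p \<oplus>\<^bsub>PR n\<^esub> p')) = \<sigma> (f p) + \<sigma> (f p')"
      using M_add[OF c[OF p] c[OF p']] by simp
  next
    assume a: "a \<in> carrier (Lam m 1)"
    have "f (lact (PR n) a p) = lact M a (f p)" "f (ract (PR n) p a) = ract M (f p) a"
      using assms p a unfolding bimod_hom_def by blast+
    then show "\<sigma> (f (lact (PR n) a p)) = l (alpha m a) (\<sigma> (f p))"
      "\<sigma> (f (ract (PR n) p a)) = r (\<sigma> (f p)) (alpha m a)"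
      using M_lact[OF c[OF p] a] M_ract[OF c[OF p] a] by simp_all
  }
qed

text \<open>The values of a homomorphism on the elements \<open>G\<^sub>s\<close>.\<close>

definition nv :: "nat \<Rightarrow> ('k pres \<Rightarrow> 'y) \<Rightarrow> int \<Rightarrow> 'c" where
  "nv n f s = (if 0 \<le> s \<and> s \<le> int n then \<Sum>i\<in>{0..<int m}. \<sigma> (f (gen m 1 n i s)) else 0)"

definition unit_coord :: "int \<Rightarrow> wd \<Rightarrow> 'k zz \<Rightarrow> 'k coord" where
  "unit_coord s u y = (\<lambda>s' u'. if s' = s \<and> u' = u then y else 0)"

lemma Pc_expand:
  assumes "q \<in> Pc m n"
  shows "q = (\<Sum>x\<in>{0..int n} \<times> {0..<int m} \<times> {W1, Wa, Wb, Wz}. case x of (s, i, u) \<Rightarrow> unit_coord s u (q s u * zE m i))" (is "q = ?R")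
proof (intro ext)
  fix s u
  have sa: "sum f S s u = (\<Sum>x\<in>S. f x s u)" for f :: "int \<times> int \<times> wd \<Rightarrow> 'k coord" and S
    by (induction S rule: infinite_finite_induct) simp_all
  have "?R s u = (\<Sum>x\<in>{0..int n} \<times> {0..<int m} \<times> {W1, Wa, Wb, Wz}. case x of (s', i, u') \<Rightarrow> if s' = s \<and> u' = u then q s u * zE m i else 0)"
    unfolding sa by (rule sum.cong) (auto simp: unit_coord_def)
  also have "\<dots> = (\<Sum>s'\<in>{0..int n}. \<Sum>i\<in>{0..<int m}. \<Sum>u'\<in>{W1, Wa, Wb, Wz}. if s' = s \<and> u' = u then q s u * zE m i else 0)"
    unfolding sum.cartesian_product' by simp
  also have "\<dots> = (\<Sum>s'\<in>{0..int n}. if s' = s then q s u else 0)"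
  proof (rule sum.cong[OF refl])
    fix s'
    have "(\<Sum>u'\<in>{W1, Wa, Wb, Wz}. if s' = s \<and> u' = u then q s u * zE m i else 0) = (if s' = s then q s u * zE m i else 0)" for i
      by (cases u) auto
    then show "(\<Sum>i\<in>{0..<int m}. \<Sum>u'\<in>{W1, Wa, Wb, Wz}. if s' = s \<and> u' = u then q s u * zE m i else 0) = (if s' = s then q s u else 0)"
      using zE_right_sum[of "q s u"] by simp
  qed
  also have "\<dots> = q s u" using assms by (auto simp: Pc_def)
  finally show "q s u = ?R s u" ..
qed

lemma gen_lact: "lact (PR n) (idem m 1 i) (gen m 1 n j s) = (if i mod int m = j mod int m then gen m 1 n j s else (\<zero>\<^bsub>PR n\<^esub> :: 'k pres))"
proof (rule inj_onD[OF Tau_inj[where n = n]])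
  note c = res_gen(1)[of n j s, where 'k = 'k] and e = alpha_gens(1)[OF m_pos, of i, where 'k = 'k]
  show "lact (PR n) (idem m 1 i) (gen m 1 n j s) \<in> carrier (PR n :: ('k lam, 'k pres) bimodule)" by (rule res_lact(1)[OF c e])
  show "(if i mod int m = j mod int m then gen m 1 n j s else \<zero>\<^bsub>PR n\<^esub>) \<in> carrier (PR n :: ('k lam, 'k pres) bimodule)"
    by (cases "i mod int m = j mod int m") (simp_all add: c res_zero)
  have z: "zE m i * zE m j = (if i mod int m = j mod int m then zE m j else (0 :: 'k zz))"
    unfolding zE_mult by (auto intro: zE_cong)
  show "Tau n (lact (PR n) (idem m 1 i) (gen m 1 n j s)) = Tau n (if i mod int m = j mod int m then gen m 1 n j s else (\<zero>\<^bsub>PR n\<^esub> :: 'k pres))"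
    unfolding res_lact(2)[OF c e] alpha_gens(2)[OF m_pos]
    by (cases "i mod int m = j mod int m") (auto simp: res_gen(2) res_zero(2) Lc_def z intro!: ext)
qed

lemma Tau_elem:
  fixes y :: "'k zz" and n :: nat and i s :: int and u :: wd
  assumes "per m y"
  defines "p \<equiv> lact (PR n) (coordalg.be (Lam m 1) (alpha m) y) (ract (PR n) (gen m 1 n i s) (coordalg.be (Lam m 1) (alpha m) (wz u)))"
  shows "p \<in> carrier (PR n)" "0 \<le> s \<Longrightarrow> s \<le> int n \<Longrightarrow> Tau n p = unit_coord s u (y * zE m i)"
proof -
  note yb = coordalg.be[OF calg assms(1)] and bu = coordalg.be[OF calg per_wz[of m u, where 'a = 'k]]
  have 1: "ract (PR n) (gen m 1 n i s) (coordalg.be (Lam m 1) (alpha m) (wz u :: 'k zz)) \<in> carrier (PR n)"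
    by (rule res_ract(1)[OF res_gen(1) bu(1)])
  show "p \<in> carrier (PR n)" unfolding p_def by (rule res_lact(1)[OF 1 yb(1)])
  have zD1: "zD (\<lambda>l. 1) = (1 :: 'k zz)" "zD (\<lambda>l. 0) = (0 :: 'k zz)" by (simp_all add: zz_eq_iff)
  have c: "ce (wz u) = (\<lambda>i. if u = W1 then 1 else 0 :: 'k)" "ca (wz u) = (\<lambda>i. if u = Wa then 1 else 0 :: 'k)"
    "cb (wz u) = (\<lambda>i. if u = Wb then 1 else 0 :: 'k)" "cz (wz u) = (\<lambda>i. if u = Wz then 1 else 0 :: 'k)"
    by (cases u; simp add: fun_eq_iff)+
  assume s: "0 \<le> s" "s \<le> int n"
  have rr: "rc k (\<lambda>u'. if s' = s \<and> u' = W1 then zE m i else 0) (wz u) u' = (if s' = s \<and> u' = u then zE m i else (0 :: 'k zz))" for k s' u'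
    by (cases u'; cases u) (simp_all add: c zD1)
  show "Tau n p = unit_coord s u (y * zE m i)"
    unfolding p_def res_lact(2)[OF 1 yb(1)] res_ract(2)[OF res_gen(1) bu(1)] yb(2) bu(2) res_gen(2)
    using s by (auto simp: Lc_def Rc_def unit_coord_def fun_eq_iff rr)
qed

lemma Hc_unit:
  assumes "0 \<le> s" "s \<le> int n" shows "Hc n \<nu> (unit_coord s u z) = l z (r (\<nu> s) (wz u))"
proof -
  have "Hc n \<nu> (unit_coord s u z) = (\<Sum>s'\<in>{0..int n}. if s' = s then l z (r (\<nu> s) (wz u)) else 0)"
    unfolding Hc_def by (rule sum.cong[OF refl], cases u) (auto simp: unit_coord_def r_1)
  then show ?thesis using assms by simp
qed

text \<open>Every element of the term is a sum of left and right multiples of the generators. Both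
  sides are additive and agree on each such multiple.\<close>

lemma hom_formula:
  assumes f: "f \<in> bimod_hom (Lam m 1) (PR n) M" and p: "p \<in> carrier (PR n)"
  shows "\<sigma> (f p) = Hc n (nv n f) (Tau n p)"
proof -
  note fD = bimod_homD[OF f]
  have fz: "\<sigma> (f \<zero>\<^bsub>PR n\<^esub>) = 0"
  proof -
    have "\<zero>\<^bsub>PR n\<^esub> \<oplus>\<^bsub>PR n\<^esub> \<zero>\<^bsub>PR n\<^esub> = (\<zero>\<^bsub>PR n\<^esub> :: 'k pres)"
      by (rule inj_onD[OF Tau_inj[where n = n]]) (simp_all add: res_add res_zero)
    then show ?thesis using fD(2)[OF res_zero(1) res_zero(1)] by simp
  qed
  \<comment> \<open>Multiplying by \<open>e_i\<close> recovers the image of a single generator from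
    the sum over all vertices.\<close>
  have lE: "l (zE m i) (nv n f s) = \<sigma> (f (gen m 1 n i s))" if s: "0 \<le> s" "s \<le> int n" and i: "i \<in> {0..<int m}" for i s
  proof -
    have lj: "l (zE m i) (\<sigma> (f (gen m 1 n j s))) = (if j = i then \<sigma> (f (gen m 1 n i s)) else 0)" if j: "j \<in> {0..<int m}" for j
    proof -
      have "l (zE m i) (\<sigma> (f (gen m 1 n j s))) = \<sigma> (f (lact (PR n) (idem m 1 i) (gen m 1 n j s)))"
        using fD(3)[OF res_gen(1) alpha_gens(1)[OF m_pos]] by (simp add: alpha_gens[OF m_pos])
      then show ?thesis unfolding gen_lact using i j fz by auto
    qed
    have "(\<Sum>j\<in>{0..<int m}. l (zE m i) (\<sigma> (f (gen m 1 n j s)))) = (\<Sum>j\<in>{0..<int m}. if j = i then \<sigma> (f (gen m 1 n i s)) else 0)"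
      by (rule sum.cong[OF refl]) (rule lj)
    then show ?thesis using s i by (simp add: nv_def l_sum)
  qed
  let ?t = "\<lambda>x. case x of (s, i, u) \<Rightarrow> unit_coord s u (Tau n p s u * zE m i)"
  let ?I = "{0..int n} \<times> {0..<int m} \<times> {W1, Wa, Wb, Wz}"
  have el: "\<exists>e\<in>carrier (PR n). Tau n e = ?t x \<and> \<sigma> (f e) = Hc n (nv n f) (?t x)" if x: "x \<in> ?I" for x
  proof -
    obtain s i u where x: "x = (s, i, u)" "0 \<le> s" "s \<le> int n" "i \<in> {0..<int m}" using x by auto
    let ?y = "Tau n p s u"
    have py: "per m ?y" using Tau_Pc[OF p] by (simp add: Pc_def)
    let ?b = "coordalg.be (Lam m 1) (alpha m)"
    note yb = coordalg.be[OF calg py] and bu = coordalg.be[OF calg per_wz[of m u, where 'a = 'k]]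
    let ?e = "lact (PR n) (?b ?y) (ract (PR n) (gen m 1 n i s) (?b (wz u)))"
    have e: "?e \<in> carrier (PR n)" "Tau n ?e = ?t x" using Tau_elem[OF py, where n = n and i = i and s = s and u = u] x by auto
    have "\<sigma> (f ?e) = l ?y (r (\<sigma> (f (gen m 1 n i s))) (wz u))"
      using fD(3)[OF res_ract(1)[OF res_gen(1) bu(1)] yb(1)] fD(4)[OF res_gen(1) bu(1)] yb(2) bu(2) by simp
    also have "\<dots> = l (?y * zE m i) (r (nv n f s) (wz u))"
      unfolding l_mult lr[of "zE m i"] lE[OF x(2,3,4)] ..
    also have "\<dots> = Hc n (nv n f) (unit_coord s u (?y * zE m i))"
      by (rule Hc_unit[OF x(2,3), symmetric])
    finally show ?thesis using e x(1) by auto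
  qed
  have "\<exists>e\<in>carrier (PR n). Tau n e = sum ?t S \<and> \<sigma> (f e) = Hc n (nv n f) (sum ?t S)" if "S \<subseteq> ?I" for S
  proof -
    have fS: "finite S" by (rule finite_subset[OF that]) simp
    show ?thesis using fS that
  proof (induction S rule: finite_induct)
    case empty
    show ?case by (rule bexI[OF _ res_zero(1)]) (simp add: res_zero fz)
  next
    case (insert x F)
    obtain e where e: "e \<in> carrier (PR n)" "Tau n e = sum ?t F" "\<sigma> (f e) = Hc n (nv n f) (sum ?t F)" using insert by auto
    obtain e' where e': "e' \<in> carrier (PR n)" "Tau n e' = ?t x" "\<sigma> (f e') = Hc n (nv n f) (?t x)" using el[of x] insert by auto
    show ?case
      by (rule bexI[OF _ res_add(1)[OF e'(1) e(1)]])
         (simp only: sum.insert[OF insert(1,2)] res_add(2)[OF e'(1) e(1)] e e' fD(2)[OF e'(1) e(1)] Hc_add simp_thms)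
  qed
  qed
  from this[of ?I] obtain e where e: "e \<in> carrier (PR n)" "Tau n e = sum ?t ?I" "\<sigma> (f e) = Hc n (nv n f) (sum ?t ?I)" by auto
  have "sum ?t ?I = Tau n p" by (rule Pc_expand[OF Tau_Pc[OF p], symmetric])
  then have "e = p" using e p by (intro inj_onD[OF Tau_inj[where n = n]]) auto
  then show ?thesis using e \<open>sum ?t ?I = Tau n p\<close> by simp
qed


text \<open>The conditions say that the image of a generator is fixed by the two idempotents of that
  generator. Existence comes from \<open>mkhom\<close>, uniqueness from \<open>hom_formula\<close>;
  together they give the definite description its value.\<close>

lemma hom_of_gens:
  fixes img :: "int \<Rightarrow> int \<Rightarrow> 'y"
  assumes img: "\<And>i s. (i, s) \<in> res_index m n \<Longrightarrow> img i s \<in> carrier M"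
    "\<And>i s. (i, s) \<in> res_index m n \<Longrightarrow> l (zE m i) (\<sigma> (img i s)) = \<sigma> (img i s)"
    "\<And>i s. (i, s) \<in> res_index m n \<Longrightarrow> r (\<sigma> (img i s)) (zE m (i + int n - 2 * s)) = \<sigma> (img i s)"
  shows "hom_of_gens m 1 n M img \<in> bimod_hom (Lam m 1) (PR n) M"
    "nv n (hom_of_gens m 1 n M img) = (\<lambda>s. if 0 \<le> s \<and> s \<le> int n then \<Sum>i\<in>{0..<int m}. \<sigma> (img i s) else 0)"
    "(i, s) \<in> res_index m n \<Longrightarrow> hom_of_gens m 1 n M img (gen m 1 n i s) = img i s"
proof -
  define \<nu> where "\<nu> = (\<lambda>s. if 0 \<le> s \<and> s \<le> int n then \<Sum>i\<in>{0..<int m}. \<sigma> (img i s) else 0)"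
  have ok: "okn m n \<nu>"
    unfolding okn_def
  proof (intro ballI allI impI)
    fix s and d :: "int \<Rightarrow> 'k" assume s: "s \<in> {0..int n}" and d: "per m (zD d)"
    let ?k = "int n - 2 * s"
    have d': "per m (zD (\<lambda>i. d (i + ?k)))" using per_shift(1)[OF d, of ?k] by (simp only: zz_sel2)
    \<comment> \<open>On an element fixed on the right by one idempotent, a diagonal element acts as
      its value at that vertex, and this scalar can be moved to the left side.\<close>
    have "r (\<sigma> (img i s)) (zD d) = l (zD (\<lambda>i. d (i + ?k))) (\<sigma> (img i s))" if i: "i \<in> {0..<int m}" for i
    proof -
      have ix: "(i, s) \<in> res_index m n" using i s by (simp add: res_index_iff)
      let ?x = "\<sigma> (img i s)" and ?j = "i + int n - 2 * s"
      have "zE m ?j * zD d = zD d * zE m ?j" by (simp add: zz_eq_iff)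
      also have "\<dots> = zE m ?j * zK (d ?j)" unfolding zD_zE_per[OF d] by (rule zK_central)
      finally have c: "zE m ?j * zD d = zE m ?j * zK (d ?j)" .
      have "r ?x (zD d) = r (r ?x (zE m ?j)) (zD d)" unfolding img(3)[OF ix] ..
      also have "\<dots> = r (r ?x (zE m ?j)) (zK (d ?j))" unfolding r_mult[symmetric] c ..
      also have "\<dots> = l (zK (d ?j)) ?x" unfolding img(3)[OF ix] l_zK ..
      also have "\<dots> = l (zK (d ?j)) (l (zE m i) ?x)" unfolding img(2)[OF ix] ..
      also have "\<dots> = l (zD (\<lambda>i. d (i + ?k)) * zE m i) ?x"
        unfolding zD_zE_per[OF d'] l_mult by (simp add: add_diff_eq)
      also have "\<dots> = l (zD (\<lambda>i. d (i + ?k))) ?x" unfolding l_mult img(2)[OF ix] ..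
      finally show ?thesis .
    qed
    then show "r (\<nu> s) (zD d) = l (zD (\<lambda>i. d (i + ?k))) (\<nu> s)"
      using s by (simp add: \<nu>_def r_sum l_sum)
  qed
  have \<nu>Mc: "\<nu> s \<in> Mc" if "s \<in> {0..int n}" for s
    unfolding \<nu>_def using that img(1) by (auto intro!: Mc_sum simp: res_index_iff) (auto simp: Mc_def res_index_iff)
  have lE: "l (zE m i) (\<nu> s) = \<sigma> (img i s)" if ix: "(i, s) \<in> res_index m n" for i s
  proof -
    have i: "i \<in> {0..<int m}" and s: "0 \<le> s" "s \<le> int n" using ix by (auto simp: res_index_iff)
    have "l (zE m i) (\<sigma> (img j s)) = (if j = i then \<sigma> (img i s) else 0)" if j: "j \<in> {0..<int m}" for j
    proof -
      have js: "(j, s) \<in> res_index m n" using j s by (simp add: res_index_iff)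
      have "l (zE m i) (\<sigma> (img j s)) = l (zE m i * zE m j) (\<sigma> (img j s))" unfolding l_mult img(2)[OF js] ..
      then show ?thesis using i j img(2)[OF js] by (auto simp: zE_mult)
    qed
    then have "(\<Sum>j\<in>{0..<int m}. l (zE m i) (\<sigma> (img j s))) = (\<Sum>j\<in>{0..<int m}. if j = i then \<sigma> (img i s) else 0)"
      by (rule sum.cong[OF refl])
    then show ?thesis using s i by (simp add: \<nu>_def l_sum)
  qed
  let ?h = "mkhom n \<nu>"
  have h1: "?h \<in> bimod_hom (Lam m 1) (PR n) M" by (rule mkhom(1)[OF ok]) (rule \<nu>Mc)
  have h2: "\<sigma> (?h p) = Hc n \<nu> (Tau n p)" if "p \<in> carrier (PR n)" for p
    by (rule mkhom(2)[OF ok _ that]) (rule \<nu>Mc)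
  have hg: "?h (gen m 1 n i s) = img i s" if ix: "(i, s) \<in> res_index m n" for i s
  proof (rule \<sigma>_eq)
    show "?h (gen m 1 n i s) \<in> carrier M" by (rule bimod_homD(1)[OF h1 res_gen(1)])
    show "img i s \<in> carrier M" by (rule img(1)[OF ix])
    have s: "0 \<le> s" "s \<le> int n" using ix by (auto simp: res_index_iff)
    have "Tau n (gen m 1 n i s) = unit_coord s W1 (zE m i :: 'k zz)" using s by (auto simp: res_gen(2) unit_coord_def intro!: ext)
    then show "\<sigma> (?h (gen m 1 n i s)) = \<sigma> (img i s)"
      using h2[OF res_gen(1)] lE[OF ix] by (simp add: Hc_unit[OF s] r_1)
  qed
  have nvf: "nv n f = \<nu>" if "\<And>i s. (i, s) \<in> res_index m n \<Longrightarrow> f (gen m 1 n i s) = img i s" for f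
    unfolding nv_def \<nu>_def using that by (auto simp: res_index_iff intro!: ext sum.cong arg_cong[of _ _ \<sigma>])
  have "hom_of_gens m 1 n M img = ?h"
    unfolding hom_of_gens_def
  proof (rule the_equality)
    show "?h \<in> bimod_hom (Lam m 1) (PR n) M \<and> (\<forall>(i, s)\<in>res_index m n. ?h (gen m 1 n i s) = img i s)"
      using h1 hg by auto
    fix f assume f: "f \<in> bimod_hom (Lam m 1) (PR n) M \<and> (\<forall>(i, s)\<in>res_index m n. f (gen m 1 n i s) = img i s)"
    then have fh: "f \<in> bimod_hom (Lam m 1) (PR n) M" and "nv n f = \<nu>" by (auto intro!: nvf)
    show "f = ?h"
    proof (rule extensionalityI[of _ "carrier (PR n)"])
      show "f \<in> extensional (carrier (PR n))" "?h \<in> extensional (carrier (PR n))"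
        using fh h1 by (auto simp: bimod_hom_def PiE_def)
      fix p :: "'k pres" assume p: "p \<in> carrier (PR n)"
      show "f p = ?h p"
        by (rule \<sigma>_eq[OF bimod_homD(1)[OF fh p] bimod_homD(1)[OF h1 p]])
           (simp add: hom_formula[OF fh p] h2[OF p] \<open>nv n f = \<nu>\<close>)
    qed
  qed
  then show "hom_of_gens m 1 n M img \<in> bimod_hom (Lam m 1) (PR n) M"
    "nv n (hom_of_gens m 1 n M img) = (\<lambda>s. if 0 \<le> s \<and> s \<le> int n then \<Sum>i\<in>{0..<int m}. \<sigma> (img i s) else 0)"
    "(i, s) \<in> res_index m n \<Longrightarrow> hom_of_gens m 1 n M img (gen m 1 n i s) = img i s"
    using h1 hg nvf[OF hg] by (simp_all add: \<nu>_def)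
qed

lemma hom_eqI:
  assumes f: "f \<in> bimod_hom (Lam m 1) (PR n) M" and g: "g \<in> bimod_hom (Lam m 1) (PR n) M" and "nv n f = nv n g"
  shows "f = g"
proof (rule extensionalityI[of _ "carrier (PR n)"])
  show "f \<in> extensional (carrier (PR n))" "g \<in> extensional (carrier (PR n))"
    using f g by (auto simp: bimod_hom_def PiE_def)
  fix p :: "'k pres" assume p: "p \<in> carrier (PR n)"
  show "f p = g p"
    by (rule \<sigma>_eq[OF bimod_homD(1)[OF f p] bimod_homD(1)[OF g p]])
       (simp add: hom_formula[OF f p] hom_formula[OF g p] assms(3))
qed

end

context bim
begin

text \<open>A composite is determined by the images of the inner values. The condition
  \<open>okn\<close> enters because the outer map must respect the right factors
  \<open>u\<close>.\<close>

lemma Hc_comp: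
  assumes "okn m k \<mu>"
  shows "Hc k \<mu> (bim.Hc Lc (Rc k) n \<nu> q) = Hc n (\<lambda>s. Hc k \<mu> (\<nu> s)) q"
proof -
  have s: "Hc k \<mu> (\<Sum>i\<in>S. f i) = (\<Sum>i\<in>S. Hc k \<mu> (f i))" for f :: "int \<Rightarrow> 'k coord" and S
  proof (induction S rule: infinite_finite_induct)
    case (insert x F)
    then show ?case by (simp only: sum.insert[OF insert(1,2)] Hc_add)
  next
    case (infinite A)
    show ?case by (simp only: sum.infinite[OF infinite] Hc_0)
  qed (simp only: sum.empty Hc_0)
  have p: "per m (zA :: 'k zz)" "per m (zB :: 'k zz)" "per m (zA * zB :: 'k zz)" by simp_all
  show ?thesis
    unfolding bim.Hc_def[OF bim_coord] s Hc_add Hc_Lc Hc_Rc[OF assms p(1)] Hc_Rc[OF assms p(2)] Hc_Rc[OF assms p(3)]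
    unfolding Hc_def[of n] ..
qed

end

section \<open>The differential and a contraction in coordinates\<close>

definition sg :: "int \<Rightarrow> 'a::ring_1" where "sg k = (if even k then 1 else - 1)"

lemma sg_simps: "even k \<Longrightarrow> sg k = 1" "odd k \<Longrightarrow> sg k = - 1"
  by (simp_all add: sg_def)

lemma sg_nat: "sg (int n) = (- 1) ^ n"
  by (simp add: sg_def)

lemma per_sg [simp]: "per m x \<Longrightarrow> per m (sg k * x)"
  by (simp add: sg_def)

lemma zD_const: "zD (\<lambda>l. 1) = 1" "zD (\<lambda>l. 0) = 0" by (simp_all add: zz_eq_iff)

lemma rc_zA: "rc k y zA u = (case u of Wa \<Rightarrow> y W1 | Wz \<Rightarrow> y Wb | _ \<Rightarrow> 0)"
  and rc_zB: "rc k y zB u = (case u of Wb \<Rightarrow> y W1 | Wz \<Rightarrow> y Wa | _ \<Rightarrow> 0)"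
  and rc_zAB: "rc k y (zA * zB) u = (case u of Wz \<Rightarrow> y W1 | _ \<Rightarrow> 0)"
  by (cases u; simp add: zD_const)+

lemma zD_zE_shift: "zD (\<lambda>l. if (l + k) mod int m = j mod int m then 1 else 0) = zE m (j - k)"
  "zD (\<lambda>l. if (l + k + 1) mod int m = j mod int m then 1 else 0) = zE m (j - k - 1)"
  "zD (\<lambda>l. if (l + k - 1) mod int m = j mod int m then 1 else 0) = zE m (j - k + 1)"
  "zD (\<lambda>l. if (l + 1 + k) mod int m = j mod int m then 1 else 0) = zE m (j - k - 1)"
  "zD (\<lambda>l. if (l - 1 + k) mod int m = j mod int m then 1 else 0) = zE m (j - k + 1)"
  by (simp_all add: zz_eq_iff mod_eq_dvd_iff algebra_simps)

lemma rc_zE: "rc k y (zE m j) u = y u * zE m (j - k + (case u of Wa \<Rightarrow> - 1 | Wb \<Rightarrow> 1 | _ \<Rightarrow> 0))"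
  by (cases u) (simp_all add: zD_zE_shift zD_const)

text \<open>The coordinates of \<open>d(G\<^sub>s)\<close> for \<open>G\<^sub>s\<close> of degree \<open>k + 1\<close>. For \<open>N = 1\<close> the three cases of the
  differential are given by the same formula.\<close>

definition nd :: "nat \<Rightarrow> int \<Rightarrow> 'k::field coord" where
  "nd k s = (\<lambda>s' u. if 0 \<le> s \<and> s \<le> int k + 1 then
     (if s' = s \<and> s \<le> int k then (case u of W1 \<Rightarrow> sg (int k + 1 + s) * zA | Wa \<Rightarrow> 1 | _ \<Rightarrow> 0) else 0) +
     (if s' = s - 1 \<and> 1 \<le> s then (case u of W1 \<Rightarrow> sg (int k + 1 + s) * zB | Wb \<Rightarrow> sg (int k + 1) | _ \<Rightarrow> 0) else 0) else 0)"

text \<open>The differential from degree \<open>k + 1\<close> to degree \<open>k\<close>.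
  Coordinates are left coefficients, so the left factors \<open>zA\<close> and \<open>zB\<close> of
  \<open>nd\<close> appear to the right of them.\<close>

definition dc :: "nat \<Rightarrow> 'k::field coord \<Rightarrow> 'k coord" where
  "dc k q = (\<lambda>s u. if 0 \<le> s \<and> s \<le> int k then sg (int k + 1 + s) * (q s u * zA - q (s + 1) u * zB) +
     (case u of W1 \<Rightarrow> 0 | Wa \<Rightarrow> q s W1 | Wb \<Rightarrow> sg (int k + 1) * q (s + 1) W1 | Wz \<Rightarrow> q s Wb + sg (int k + 1) * q (s + 1) Wa) else 0)"

text \<open>Guided by the term \<open>G_s a\<close> of \<open>d(G_s)\<close>: it sends
  \<open>G_s a\<close> to \<open>G_s\<close> and \<open>G_s a b\<close> to \<open>G_s b\<close>. The
  last generator \<open>G_(n+1)\<close> has no such term, and there the term \<open>G_n b\<close> of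
  \<open>d(G_(n+1))\<close> is used. The summand with \<open>zA\<close> cancels the term
  \<open>a G_n b\<close> that \<open>d(G_n b)\<close> produces.\<close>

definition sc :: "nat \<Rightarrow> 'k::field coord \<Rightarrow> 'k coord" where
  "sc n q = (\<lambda>s u. case u of
      W1 \<Rightarrow> (if 0 \<le> s \<and> s \<le> int n then q s Wa else if s = int n + 1 then sg (int n + 1) * (q (int n) Wb + q (int n) Wz * zA) else 0)
    | Wb \<Rightarrow> (if 0 \<le> s \<and> s \<le> int n then q s Wz else 0) | _ \<Rightarrow> 0)"

lemma Hc_nd: "bim.Hc Lc (Rc k) (Suc k) (nd k) q = dc k q"
proof (intro ext)
  fix s u
  interpret c: bim Lc "Rc k :: 'a coord \<Rightarrow> _" by (rule bim_coord)
  have sa: "sum f S s u = (\<Sum>x\<in>S. f x s u)" for f :: "int \<Rightarrow> 'a coord" and S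
    by (induction S rule: infinite_finite_induct) simp_all
  define t where "t = (\<lambda>x. (Lc (q x W1) (nd k x) + Lc (q x Wa) (Rc k (nd k x) zA) + Lc (q x Wb) (Rc k (nd k x) zB) + Lc (q x Wz) (Rc k (nd k x) (zA * zB))) s u)"
  have H: "c.Hc (Suc k) (nd k) q s u = (\<Sum>x\<in>{0..int (Suc k)}. t x)"
    unfolding c.Hc_def sa t_def ..
  have t0: "t x = 0" if "x \<noteq> s" "x \<noteq> s + 1" for x
    using that unfolding t_def by (cases u) (auto simp: Lc_def Rc_def rc_zA rc_zB rc_zAB nd_def)
  show "c.Hc (Suc k) (nd k) q s u = dc k q s u"
  proof (cases "0 \<le> s \<and> s \<le> int k")
    case False
    then have n: "(0 \<le> s \<and> s \<le> int k) = False" by simp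
    have "t x = 0" if "x \<in> {0..int (Suc k)}" for x
      using that False unfolding t_def by (cases u) (auto simp: Lc_def Rc_def rc_zA rc_zB rc_zAB nd_def)
    then show ?thesis unfolding H dc_def n by simp
  next
    case True
    have "(\<Sum>x\<in>{0..int (Suc k)}. t x) = (\<Sum>x\<in>{s, s + 1}. t x)"
      by (rule sum.mono_neutral_right) (use True t0 in auto)
    also have "\<dots> = t s + t (s + 1)" by simp
    also have "\<dots> = dc k q s u"
      using True unfolding t_def dc_def
      by (cases u; cases "even s"; cases "even k") (simp_all add: Lc_def Rc_def rc_zA rc_zB rc_zAB nd_def sg_def algebra_simps)
    finally show ?thesis unfolding H .
  qed
qed

lemma Hc_regular: "bim.Hc (*) (*) n F (q :: 'k::field coord) = (\<Sum>s\<in>{0..int n}. q s W1 * F s + q s Wa * (F s * zA) + q s Wb * (F s * zB) + q s Wz * (F s * (zA * zB)))"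
  by (rule bim.Hc_def[OF bim_regular])

lemma sc_Pc: "q \<in> Pc m n \<Longrightarrow> sc n q \<in> Pc m (Suc n)"
proof -
  assume q: "q \<in> Pc m n"
  have "per m (sc n q s u)" for s u using q by (cases u) (auto simp: sc_def Pc_def)
  moreover have "sc n q s u = 0" if "\<not> (0 \<le> s \<and> s \<le> int (Suc n))" for s u using that by (cases u) (auto simp: sc_def)
  ultimately show ?thesis by (simp add: Pc_def)
qed

text \<open>In the kernel of the augmentation the \<open>W1\<close> coordinate is determined by the
  other three, which are the ones that \<open>sc 0\<close> uses.\<close>

lemma exact_aug:
  fixes q :: "'k::field coord"
  assumes "q \<in> Pc m 0" "bim.Hc (*) (*) 0 (\<lambda>s. if s = 0 then 1 else 0) q = 0"
  shows "dc 0 (sc 0 q) = q"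
proof (intro ext)
  fix s u
  have a: "q 0 W1 + q 0 Wa * zA + q 0 Wb * zB + q 0 Wz * (zA * zB) = 0"
    using assms(2) unfolding Hc_regular by simp
  then have a': "q 0 W1 = - (q 0 Wa * zA) - q 0 Wb * zB - q 0 Wz * (zA * zB)"
    by (simp add: algebra_simps eq_neg_iff_add_eq_0)
  show "dc 0 (sc 0 q) s u = q s u"
  proof (cases "s = 0")
    case True
    then show ?thesis by (cases u) (simp_all add: dc_def sc_def sg_def a' algebra_simps)
  next
    case False
    then have n: "(0 \<le> s \<and> s \<le> int 0) = False" by auto
    then have "q s u = 0" using assms(1) by (auto simp: Pc_def)
    then show ?thesis unfolding dc_def n by simp
  qed
qed

text \<open>The cycle condition determines the coordinates that \<open>sc\<close> forgets, namely
  \<open>W1\<close> everywhere and \<open>Wb\<close> below the last index. So a cycle is recovered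
  from its image under \<open>sc\<close>.\<close>

lemma exact_dc:
  fixes q :: "'k::field coord"
  assumes q: "q \<in> Pc m (Suc k)" and z: "dc k q = 0"
  shows "dc (Suc k) (sc (Suc k) q) = q"
proof (intro ext)
  fix s u
  have Z: "dc k q t v = 0" for t v by (simp add: z)
  let ?n = "int k + 1"
  have a: "q t W1 + sg (?n + t) * (q t Wa * zA - q (t + 1) Wa * zB) = 0" if "0 \<le> t" "t \<le> int k" for t
    using Z[of t Wa] that by (simp add: dc_def algebra_simps)
  have b: "sg ?n * q (t + 1) W1 + sg (?n + t) * (q t Wb * zA - q (t + 1) Wb * zB) = 0" if "0 \<le> t" "t \<le> int k" for t
    using Z[of t Wb] that by (simp add: dc_def algebra_simps)
  have c: "q t Wb + sg ?n * q (t + 1) Wa + sg (?n + t) * (q t Wz * zA - q (t + 1) Wz * zB) = 0" if "0 \<le> t" "t \<le> int k" for t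
    using Z[of t Wz] that by (simp add: dc_def algebra_simps)
  show "dc (Suc k) (sc (Suc k) q) s u = q s u"
  proof (cases "0 \<le> s \<and> s \<le> ?n")
    case False
    then have n: "(0 \<le> s \<and> s \<le> int (Suc k)) = False" by auto
    then have "q s u = 0" using q by (auto simp: Pc_def)
    then show ?thesis unfolding dc_def n by simp
  next
    case s: True
    show ?thesis
    proof (cases "s = ?n")
      case False
      then have s': "0 \<le> s" "s \<le> int k" using s by auto
      have a': "q s W1 = - (sg (?n + s) * (q s Wa * zA - q (s + 1) Wa * zB))"
        using a[OF s'] by (simp add: eq_neg_iff_add_eq_0)
      have c': "q s Wb = - (sg ?n * q (s + 1) Wa) - sg (?n + s) * (q s Wz * zA - q (s + 1) Wz * zB)"
        using c[OF s'] by (simp add: algebra_simps eq_neg_iff_add_eq_0)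
      show ?thesis
        using s' a' c' by (cases u; cases "even s"; cases "even k") (simp_all add: dc_def sc_def sg_def algebra_simps)
    next
      case sn: True
      \<comment> \<open>At the last index the \<open>W1\<close> coordinate is given by the condition
        at \<open>Wb\<close>; the \<open>Wb\<close> coordinate just below it is then eliminated by
        \<open>c'\<close>.\<close>
      have b': "q ?n W1 = - (sg ?n * (sg (?n + int k) * (q (int k) Wb * zA - q ?n Wb * zB)))"
        using b[of "int k"] by (cases "even k") (simp_all add: sg_def eq_neg_iff_add_eq_0 algebra_simps)
      have c': "q (int k) Wb = - (sg ?n * q ?n Wa) - sg (?n + int k) * (q (int k) Wz * zA - q ?n Wz * zB)"
        using c[of "int k"] by (simp add: algebra_simps eq_neg_iff_add_eq_0)
      have W: "q ?n W1 = - (q ?n Wa * zA) - sg ?n * (q ?n Wz * (zA * zB) + q ?n Wb * zB)"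
        unfolding b' c' by (cases "even k") (simp_all add: sg_def algebra_simps)
      show ?thesis
        unfolding sn by (cases u; cases "even k") (simp_all add: dc_def sc_def sg_def W W[unfolded add.commute[of "int k" 1]] algebra_simps)
    qed
  qed
qed

section \<open>Homomorphisms and their values on the elements \<open>G_s\<close>\<close>

context cyc
begin

text \<open>The sum over all vertices of the generators with index \<open>s\<close>, picked out by
  its coordinates.\<close>

definition Gs :: "nat \<Rightarrow> int \<Rightarrow> 'k::field pres" where
  "Gs n s = (SOME g. g \<in> carrier (PR n) \<and> Tau n g = (\<lambda>s' u. if s' = s \<and> u = W1 then 1 else 0))"

lemma Gs:
  assumes "0 \<le> s" "s \<le> int n"
  shows "Gs n s \<in> carrier (PR n :: ('k::field lam, 'k pres) bimodule)"
    "Tau n (Gs n s :: 'k pres) = (\<lambda>s' u. if s' = s \<and> u = W1 then 1 else 0)"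
proof -
  have "(\<lambda>s' u. if s' = s \<and> u = W1 then 1 else (0 :: 'k zz)) \<in> Pc m n" using assms by (auto simp: Pc_def)
  from Tau_surj[OF this]
  have "\<exists>g. g \<in> carrier (PR n) \<and> Tau n g = (\<lambda>s' u. if s' = s \<and> u = W1 then 1 else (0 :: 'k zz))" by blast
  from someI_ex[OF this] show "Gs n s \<in> carrier (PR n :: ('k lam, 'k pres) bimodule)"
    "Tau n (Gs n s :: 'k pres) = (\<lambda>s' u. if s' = s \<and> u = W1 then 1 else 0)" unfolding Gs_def by auto
qed

lemma Gs_shift:
  assumes s: "0 \<le> s" "s \<le> int n"
  shows "lact (PR n) (idem m 1 i) (Gs n s) = ract (PR n) (Gs n s :: 'k::field pres) (idem m 1 (i + (int n - 2 * s)))"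
proof (rule inj_onD[OF Tau_inj[where n = n]])
  note g = Gs(1)[OF s, where 'k = 'k] and e = alpha_gens(1)[OF m_pos, where 'k = 'k]
  show "lact (PR n) (idem m 1 i) (Gs n s :: 'k pres) \<in> carrier (PR n)"
    "ract (PR n) (Gs n s :: 'k pres) (idem m 1 (i + (int n - 2 * s))) \<in> carrier (PR n)"
    by (rule res_lact(1)[OF g e], rule res_ract(1)[OF g e])
  show "Tau n (lact (PR n) (idem m 1 i) (Gs n s)) = Tau n (ract (PR n) (Gs n s :: 'k pres) (idem m 1 (i + (int n - 2 * s))))"
    unfolding res_lact(2)[OF g e] res_ract(2)[OF g e] alpha_gens(2)[OF m_pos] Gs(2)[OF s]
    by (auto simp: Lc_def Rc_def rc_zE fun_eq_iff)
qed

lemma tco: "target m Lc (Rc k) (PR k :: ('k::field lam, 'k pres) bimodule) (Tau k)"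
proof (rule target.intro[OF bim_coord cyc_axioms target_axioms.intro])
  show "inj_on (Tau k) (carrier (PR k :: ('k lam, 'k pres) bimodule))" by (rule Tau_inj)
  show "0 \<in> Tau k ` carrier (PR k :: ('k lam, 'k pres) bimodule)"
  proof -
    have "Tau k \<zero>\<^bsub>PR k\<^esub> \<in> Tau k ` carrier (PR k :: ('k lam, 'k pres) bimodule)" by (rule imageI) (rule res_zero(1))
    then show ?thesis unfolding res_zero(2) .
  qed
qed (simp_all only: res_add res_lact res_ract simp_thms)

lemma treg: "target m (*) (*) (regular_bimod (Lam m 1) :: ('k::field lam, 'k lam) bimodule) (alpha m)"
proof (rule target.intro[OF bim_regular cyc_axioms target_axioms.intro])
  show "inj_on (alpha m) (carrier (regular_bimod (Lam m 1) :: ('k lam, 'k lam) bimodule))"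
    using coordalg.al_inj[OF calg[where 'k = 'k]] by (auto simp: regular_bimod_def inj_on_def)
  show "0 \<in> alpha m ` carrier (regular_bimod (Lam m 1) :: ('k lam, 'k lam) bimodule)"
    using imageI[OF coordalg.A_closed(4)[OF calg[where 'k = 'k]], of "alpha m"] unfolding coordalg.al_0[OF calg]
    by (simp add: regular_bimod_def)
qed (simp_all add: regular_bimod_def coordalg.al_simps[OF calg] coordalg.A_closed[OF calg])

lemma Mc_reg: "per m y \<Longrightarrow> y \<in> target.Mc (regular_bimod (Lam m 1) :: ('k::field lam, 'k lam) bimodule) (alpha m)"
  unfolding target.Mc_def[OF treg]
  by (rule image_eqI[of _ _ "coordalg.be (Lam m 1) (alpha m) y"]) (simp_all add: coordalg.be[OF calg] regular_bimod_def)

lemma Mc_co: "q \<in> Pc m k \<Longrightarrow> q \<in> target.Mc (PR k :: ('k::field lam, 'k pres) bimodule) (Tau k)"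
  unfolding target.Mc_def[OF tco] using Tau_surj by blast

end

context target
begin

lemma nv_Gs:
  assumes f: "f \<in> bimod_hom (Lam m 1) (PR n) M" and s: "0 \<le> s" "s \<le> int n"
  shows "nv n f s = \<sigma> (f (Gs n s))"
proof -
  have "Tau n (Gs n s :: 'k pres) = unit_coord s W1 1" by (simp add: Gs(2)[OF s] unit_coord_def)
  then show ?thesis using hom_formula[OF f Gs(1)[OF s]] Hc_unit[OF s, of "nv n f" W1 1] by (simp add: l_1 r_1)
qed

lemma nv_zE:
  assumes f: "f \<in> bimod_hom (Lam m 1) (PR n) M" and s: "0 \<le> s" "s \<le> int n"
  shows "l (zE m i) (nv n f s) = r (nv n f s) (zE m (i + (int n - 2 * s)))"
proof -
  note e = alpha_gens[OF m_pos, where 'k = 'k] and g = Gs(1)[OF s, where 'k = 'k]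
  have "l (zE m i) (nv n f s) = \<sigma> (f (lact (PR n) (idem m 1 i) (Gs n s)))"
    unfolding nv_Gs[OF f s] bimod_homD(3)[OF f g e(1)] e(2) ..
  also have "\<dots> = r (nv n f s) (zE m (i + (int n - 2 * s)))"
    unfolding nv_Gs[OF f s] Gs_shift[OF s] bimod_homD(4)[OF f g e(1)] e(2) ..
  finally show ?thesis .
qed

lemma nv_out: "\<not> (0 \<le> s \<and> s \<le> int n) \<Longrightarrow> nv n f s = 0"
  unfolding nv_def by (simp only: if_False)

lemma nv_Mc: "f \<in> bimod_hom (Lam m 1) (PR n) M \<Longrightarrow> s \<in> {0..int n} \<Longrightarrow> nv n f s \<in> Mc"
proof -
  assume f: "f \<in> bimod_hom (Lam m 1) (PR n) M" and "s \<in> {0..int n}"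
  then have s: "0 \<le> s" "s \<le> int n" by auto
  show ?thesis unfolding nv_Gs[OF f s] Mc_def by (rule imageI) (rule bimod_homD(1)[OF f Gs(1)[OF s]])
qed

text \<open>The idempotents sum to 1, and on the part cut out by \<open>e_i\<close> a diagonal
  element acts as a scalar. So the shift rule needs checking on idempotents only.\<close>

lemma okn_zE:
  assumes "\<And>s i. 0 \<le> s \<Longrightarrow> s \<le> int n \<Longrightarrow> l (zE m i) (\<nu> s) = r (\<nu> s) (zE m (i + (int n - 2 * s)))"
  shows "okn m n \<nu>"
  unfolding okn_def
proof (intro ballI allI impI)
  fix s and d :: "int \<Rightarrow> 'k" assume s: "s \<in> {0..int n}" and d: "per m (zD d)"
  let ?k = "int n - 2 * s" and ?x = "\<nu> s"
  have sh: "l (zE m i) ?x = r ?x (zE m (i + ?k))" for i using assms[of s i] s by simp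
  have d': "per m (zD (\<lambda>i. d (i + ?k)))" using per_shift(1)[OF d, of ?k] by (simp only: zz_sel2)
  have t: "l (zE m i) (r ?x (zD d)) = l (zD (\<lambda>i. d (i + ?k))) (l (zE m i) ?x)" for i
  proof -
    let ?j = "i + ?k"
    have "zE m ?j * zD d = zD d * zE m ?j" by (simp add: zz_eq_iff)
    also have "\<dots> = zE m ?j * zK (d ?j)" unfolding zD_zE_per[OF d] by (rule zK_central)
    finally have c: "zE m ?j * zD d = zE m ?j * zK (d ?j)" .
    have "l (zE m i) (r ?x (zD d)) = r ?x (zE m ?j * zD d)" unfolding lr sh r_mult ..
    also have "\<dots> = l (zK (d ?j)) (l (zE m i) ?x)" unfolding c r_mult sh l_zK ..
    also have "\<dots> = l (zD (\<lambda>i. d (i + ?k))) (l (zE m i) ?x)"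
      unfolding l_mult[symmetric] zD_zE_per[OF d'] ..
    finally show ?thesis .
  qed
  have one: "(\<Sum>i\<in>{0..<int m}. l (zE m i) y) = y" for y
  proof -
    have "(\<Sum>i\<in>S. l (x i) y) = l (sum x S) y" for x :: "int \<Rightarrow> 'k zz" and S
      by (induction S rule: infinite_finite_induct) (simp_all add: l_add1)
    then show ?thesis by (simp add: sum_zE[OF m_pos] l_1)
  qed
  have "r ?x (zD d) = (\<Sum>i\<in>{0..<int m}. l (zE m i) (r ?x (zD d)))" by (simp only: one)
  also have "\<dots> = l (zD (\<lambda>i. d (i + ?k))) (\<Sum>i\<in>{0..<int m}. l (zE m i) ?x)" by (simp only: t l_sum)
  finally show "r ?x (zD d) = l (zD (\<lambda>i. d (i + ?k))) ?x" by (simp only: one)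
qed

lemma nv_okn: "f \<in> bimod_hom (Lam m 1) (PR n) M \<Longrightarrow> okn m n (nv n f)"
  by (rule okn_zE) (rule nv_zE)

lemma nv_mkhom:
  assumes ok: "okn m n \<nu>" and Mc: "\<And>s. s \<in> {0..int n} \<Longrightarrow> \<nu> s \<in> Mc" and out: "\<And>s. \<not> (0 \<le> s \<and> s \<le> int n) \<Longrightarrow> \<nu> s = 0"
  shows "nv n (mkhom n \<nu>) = \<nu>"
proof
  fix s
  show "nv n (mkhom n \<nu>) s = \<nu> s"
  proof (cases "0 \<le> s \<and> s \<le> int n")
    case True
    then have s: "0 \<le> s" "s \<le> int n" by auto
    have h: "mkhom n \<nu> \<in> bimod_hom (Lam m 1) (PR n) M" by (rule mkhom(1)[OF ok]) (rule Mc)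
    have "\<sigma> (mkhom n \<nu> (Gs n s)) = Hc n \<nu> (Tau n (Gs n s))" by (rule mkhom(2)[OF ok _ Gs(1)[OF s]]) (rule Mc)
    also have "Tau n (Gs n s :: 'k pres) = unit_coord s W1 1" by (simp add: Gs(2)[OF s] unit_coord_def)
    also have "Hc n \<nu> (unit_coord s W1 1) = \<nu> s" by (simp add: Hc_unit[OF s] l_1 r_1)
    finally show ?thesis unfolding nv_Gs[OF h s] .
  next
    case False
    show ?thesis unfolding nv_out[OF False] out[OF False] ..
  qed
qed

lemma mkhom_nv:
  assumes f: "f \<in> bimod_hom (Lam m 1) (PR n) M"
  shows "mkhom n (nv n f) = f"
proof (rule hom_eqI[OF _ f])
  show "mkhom n (nv n f) \<in> bimod_hom (Lam m 1) (PR n) M"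
    by (rule mkhom(1)[OF nv_okn[OF f]]) (rule nv_Mc[OF f])
  show "nv n (mkhom n (nv n f)) = nv n f"
    by (rule nv_mkhom[OF nv_okn[OF f]]) (rule nv_Mc[OF f] nv_out, assumption)+
qed

lemma comp_hom:
  assumes f: "f \<in> bimod_hom (Lam m 1) (PR n) M" and L: "L \<in> bimod_hom (Lam m 1) (PR n') (PR n)"
  shows "compose (carrier (PR n')) f L \<in> bimod_hom (Lam m 1) (PR n') M"
    "nv n' (compose (carrier (PR n')) f L) = (\<lambda>s. Hc n (nv n f) (target.nv m (Tau n) n' L s))"
proof -
  have Lc: "L x \<in> carrier (PR n)" if "x \<in> carrier (PR n')" for x using L that by (auto simp: bimod_hom_def)
  show h: "compose (carrier (PR n')) f L \<in> bimod_hom (Lam m 1) (PR n') M"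
    unfolding bimod_hom_def
  proof (intro CollectI conjI ballI)
    show "compose (carrier (PR n')) f L \<in> carrier (PR n') \<rightarrow>\<^sub>E carrier M"
      using bimod_homD(1)[OF f Lc] by (auto simp: compose_def)
  next
    fix x y :: "'k pres" assume x: "x \<in> carrier (PR n')" and y: "y \<in> carrier (PR n')"
    have "L (x \<oplus>\<^bsub>PR n'\<^esub> y) = L x \<oplus>\<^bsub>PR n\<^esub> L y" using L x y unfolding bimod_hom_def by blast
    moreover have "f (L x \<oplus>\<^bsub>PR n\<^esub> L y) = f (L x) \<oplus>\<^bsub>M\<^esub> f (L y)" using f Lc[OF x] Lc[OF y] unfolding bimod_hom_def by blast
    ultimately show "compose (carrier (PR n')) f L (x \<oplus>\<^bsub>PR n'\<^esub> y) = compose (carrier (PR n')) f L x \<oplus>\<^bsub>M\<^esub> compose (carrier (PR n')) f L y"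
      using x y res_add(1)[OF x y] by (simp add: compose_def)
  next
    fix a :: "'k lam" and x :: "'k pres" assume a: "a \<in> carrier (Lam m 1)" and x: "x \<in> carrier (PR n')"
    have "L (lact (PR n') a x) = lact (PR n) a (L x)" "L (ract (PR n') x a) = ract (PR n) (L x) a" using L a x unfolding bimod_hom_def by blast+
    moreover have "f (lact (PR n) a (L x)) = lact M a (f (L x))" "f (ract (PR n) (L x) a) = ract M (f (L x)) a"
      using f a Lc[OF x] unfolding bimod_hom_def by blast+
    ultimately show "compose (carrier (PR n')) f L (lact (PR n') a x) = lact M a (compose (carrier (PR n')) f L x)"
      "compose (carrier (PR n')) f L (ract (PR n') x a) = ract M (compose (carrier (PR n')) f L x) a"
      using x res_lact(1)[OF x a] res_ract(1)[OF x a] by (simp_all add: compose_def)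
  qed
  show "nv n' (compose (carrier (PR n')) f L) = (\<lambda>s. Hc n (nv n f) (target.nv m (Tau n) n' L s))"
  proof
    fix s
    show "nv n' (compose (carrier (PR n')) f L) s = Hc n (nv n f) (target.nv m (Tau n) n' L s)"
    proof (cases "0 \<le> s \<and> s \<le> int n'")
      case True
      then have s: "0 \<le> s" "s \<le> int n'" by auto
      show ?thesis
        unfolding nv_Gs[OF h s] target.nv_Gs[OF tco L s]
        using hom_formula[OF f Lc[OF Gs(1)[OF s]]] Gs(1)[OF s, where 'k = 'k] by (simp add: compose_def)
    next
      case False
      show ?thesis unfolding nv_out[OF False] target.nv_out[OF tco False] by (simp only: Hc_0)
    qed
  qed
qed

end

context bim
begin

text \<open>As \<open>\<nu>\<close> vanishes outside its range, the four terms are correct at the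
  boundary indices too, and the case distinctions of \<open>nd\<close> disappear.\<close>

lemma Hc_nd_formula:
  assumes out: "\<And>s. \<not> (0 \<le> s \<and> s \<le> int n) \<Longrightarrow> \<nu> s = 0"
  shows "Hc n \<nu> (nd n s) = r (\<nu> s) zA + l (sg (int n + 1 + s) * zA) (\<nu> s) + l (sg (int n + 1 + s) * zB) (\<nu> (s - 1))
    + l (sg (int n + 1)) (r (\<nu> (s - 1)) zB)"
proof -
  let ?a = "r (\<nu> s) zA + l (sg (int n + 1 + s) * zA) (\<nu> s)"
  let ?b = "l (sg (int n + 1 + s) * zB) (\<nu> (s - 1)) + l (sg (int n + 1)) (r (\<nu> (s - 1)) zB)"
  have a0: "?a = 0" if "\<not> (0 \<le> s \<and> s \<le> int n)" using out[OF that] by simp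
  have b0: "?b = 0" if "\<not> (0 \<le> s - 1 \<and> s - 1 \<le> int n)" using out[OF that] by simp
  have "Hc n \<nu> (nd n s) = (\<Sum>x\<in>{0..int n}. (if x = s then ?a else 0) + (if x = s - 1 then ?b else 0))"
    unfolding Hc_def
  proof (rule sum.cong[OF refl])
    fix x assume "x \<in> {0..int n}"
    then show "l (nd n s x W1) (\<nu> x) + l (nd n s x Wa) (r (\<nu> x) zA) + l (nd n s x Wb) (r (\<nu> x) zB) + l (nd n s x Wz) (r (\<nu> x) (zA * zB)) =
      (if x = s then ?a else 0) + (if x = s - 1 then ?b else 0)"
      by (cases "x = s"; cases "x = s - 1") (simp_all add: nd_def l_1 r_1 ac_simps)
  qed
  also have "\<dots> = (if 0 \<le> s \<and> s \<le> int n then ?a else 0) + (if 0 \<le> s - 1 \<and> s - 1 \<le> int n then ?b else 0)"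
    by (simp add: sum.distrib)
  also have "\<dots> = ?a + ?b" using a0 b0 by simp
  finally show ?thesis by (simp add: add.assoc)
qed

end

context cyc
begin

lemma nd_zE: "Lc (zE m i) (nd k s) = Rc k (nd k s) (zE m (i + (int k + 1 - 2 * s)) :: 'k::field zz)"
  unfolding Lc_def Rc_def nd_def rc_zE
  by (intro ext, rename_tac s' u, case_tac u) (auto simp: sg_def mult.assoc zA_zE zB_zE zE_mult algebra_simps)

lemma nd_out: "\<not> (0 \<le> s \<and> s \<le> int (Suc k)) \<Longrightarrow> nd k s = 0"
  by (auto simp: nd_def fun_eq_iff)

lemma diff_img:
  assumes i: "(i, s) \<in> res_index m (Suc k)"
  shows "diff_img m 1 (Suc k) i s \<in> carrier (PR k :: ('k::field lam, 'k pres) bimodule)"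
    "Tau k (diff_img m 1 (Suc k) i s :: 'k pres) = Lc (zE m i) (nd k s)"
proof -
  let ?A = "Lam m 1 :: ('k, 'k lam) module" and ?M = "PR k :: ('k lam, 'k pres) bimodule"
  interpret M: abelian_group ?M by (rule res_group)
  interpret A: ring ?A by (rule coordalg.ring_A[OF calg])
  define a where "a = (arrs m 1 :: 'k lam)"
  define b where "b = (bars m 1 :: 'k lam)"
  have ab: "a \<in> carrier ?A" "b \<in> carrier ?A" "alpha m a = zA" "alpha m b = zB"
    unfolding a_def b_def using alpha_gens[OF m_pos, where 'k = 'k] by auto
  define G where "G = (gen m 1 k :: int \<Rightarrow> int \<Rightarrow> 'k pres)"
  have Gc: "G i s \<in> carrier ?M" for i s unfolding G_def by (rule res_gen(1))
  have Gt: "Tau k (G i r) = (\<lambda>s u. if s = r \<and> u = W1 \<and> 0 \<le> r \<and> r \<le> int k then zE m i else 0)" for i r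
    unfolding G_def by (rule res_gen(2))
  have sgc: "sgn_pow ?M j x \<in> carrier ?M" "Tau k (sgn_pow ?M j x) = (\<lambda>s u. sg j * Tau k x s u)" if "x \<in> carrier ?M" for j x
    using that res_neg[OF that] by (auto simp: sgn_pow_def sg_def fun_eq_iff)
  define X1 where "X1 = ract ?M (G i s) a"
  define X2 where "X2 = sgn_pow ?M (int (Suc k) + s) (lact ?M a (G (i + 1) s))"
  define X3 where "X3 = sgn_pow ?M (int (Suc k) + s) (lact ?M b (G (i - 1) (s - 1)))"
  define X4 where "X4 = sgn_pow ?M (int (Suc k)) (ract ?M (G i (s - 1)) b)"
  note lc = res_lact(1)[OF Gc] and rr = res_ract(1)[OF Gc]
  have X: "X1 \<in> carrier ?M" "X2 \<in> carrier ?M" "X3 \<in> carrier ?M" "X4 \<in> carrier ?M"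
    unfolding X1_def X2_def X3_def X4_def by (intro sgc(1) lc rr ab)+
  have one: "lact ?M \<one>\<^bsub>?A\<^esub> x = x" "ract ?M x \<one>\<^bsub>?A\<^esub> = x" if "x \<in> carrier ?M" for x
  proof -
    have "Tau k (lact ?M \<one>\<^bsub>?A\<^esub> x) = Tau k x" "Tau k (ract ?M x \<one>\<^bsub>?A\<^esub>) = Tau k x"
      unfolding res_lact(2)[OF that A.one_closed] res_ract(2)[OF that A.one_closed] coordalg.al_simps(4)[OF calg]
        bim.l_1[OF bim_coord] bim.r_1[OF bim_coord] by auto
    then show "lact ?M \<one>\<^bsub>?A\<^esub> x = x" "ract ?M x \<one>\<^bsub>?A\<^esub> = x"
      using inj_onD[OF Tau_inj[where n = k]] that res_lact(1)[OF that A.one_closed] res_ract(1)[OF that A.one_closed] by blast+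
  qed
  \<comment> \<open>For N = 1 all powers in the differential are 1 and the sum of the middle case
    has one term. There the degree is even, so the signs agree with those of the outer cases and
    only the grouping differs.\<close>
  have D: "diff_img m 1 (Suc k) i s = (if int (Suc k) = 2 * s then X1 \<oplus>\<^bsub>?M\<^esub> X3 \<oplus>\<^bsub>?M\<^esub> (X2 \<oplus>\<^bsub>?M\<^esub> X4)
      else X1 \<oplus>\<^bsub>?M\<^esub> X2 \<oplus>\<^bsub>?M\<^esub> X3 \<oplus>\<^bsub>?M\<^esub> X4)"
  proof (cases "int (Suc k) = 2 * s")
    case False
    then show ?thesis
      unfolding diff_img_def Let_def X1_def X2_def X3_def X4_def G_def a_def b_def
      using ab by (auto simp: a_def b_def)
  next
    case True
    then have ev: "even (int (Suc k))" by simp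
    have i1: "{..<(1::nat)} = insert 0 {}" by auto
    have S: "X3 = sgn_pow ?M s (lact ?M b (G (i - 1) (s - 1)))" "X2 = sgn_pow ?M s (lact ?M a (G (i + 1) s))" "X4 = ract ?M (G i (s - 1)) b"
      using ev unfolding X3_def X2_def X4_def sgn_pow_def by simp_all
    have c: "X1 \<oplus>\<^bsub>?M\<^esub> X3 \<in> carrier ?M" "X2 \<oplus>\<^bsub>?M\<^esub> X4 \<in> carrier ?M" using X by simp_all
    have nl: "\<not> int (Suc k) - 2 * s > 0" "\<not> int (Suc k) - 2 * s < 0" using True by auto
    have "diff_img m 1 (Suc k) i s = finsum ?M (\<lambda>ka. lact ?M ((b \<otimes>\<^bsub>?A\<^esub> a) [^]\<^bsub>?A\<^esub> ka) (ract ?M (X1 \<oplus>\<^bsub>?M\<^esub> X3) ((b \<otimes>\<^bsub>?A\<^esub> a) [^]\<^bsub>?A\<^esub> (1 - ka - 1)))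
       \<oplus>\<^bsub>?M\<^esub> lact ?M ((a \<otimes>\<^bsub>?A\<^esub> b) [^]\<^bsub>?A\<^esub> ka) (ract ?M (X2 \<oplus>\<^bsub>?M\<^esub> X4) ((a \<otimes>\<^bsub>?A\<^esub> b) [^]\<^bsub>?A\<^esub> (1 - ka - 1)))) {..<1::nat}"
      unfolding diff_img_def Let_def if_not_P[OF nl(1)] if_not_P[OF nl(2)] S X1_def unfolding G_def a_def b_def by simp
    also have "\<dots> = X1 \<oplus>\<^bsub>?M\<^esub> X3 \<oplus>\<^bsub>?M\<^esub> (X2 \<oplus>\<^bsub>?M\<^esub> X4)"
      unfolding i1 by (subst M.finsum_insert) (use X c in \<open>simp_all add: one\<close>)
    finally show ?thesis using True by simp
  qed
  have c: "X1 \<oplus>\<^bsub>?M\<^esub> X3 \<in> carrier ?M" "X2 \<oplus>\<^bsub>?M\<^esub> X4 \<in> carrier ?M" "X1 \<oplus>\<^bsub>?M\<^esub> X2 \<in> carrier ?M" "X1 \<oplus>\<^bsub>?M\<^esub> X2 \<oplus>\<^bsub>?M\<^esub> X3 \<in> carrier ?M"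
    using X by simp_all
  show "diff_img m 1 (Suc k) i s \<in> carrier ?M" unfolding D using X c by simp
  have "Tau k (diff_img m 1 (Suc k) i s) = Tau k X1 + Tau k X2 + Tau k X3 + Tau k X4"
    unfolding D by (cases "int (Suc k) = 2 * s")
     (simp_all only: if_True if_False simp_thms res_add(2)[OF c(1,2)] res_add(2)[OF X(1,3)] res_add(2)[OF X(2,4)] res_add(2)[OF c(4) X(4)] res_add(2)[OF c(3) X(3)] res_add(2)[OF X(1,2)] ac_simps)
  also have "\<dots> = Lc (zE m i) (nd k s)"
  proof (intro ext)
    fix s' u
    have s: "0 \<le> s" "s \<le> int k + 1" using i by (auto simp: res_index_iff)
    show "(Tau k X1 + Tau k X2 + Tau k X3 + Tau k X4) s' u = Lc (zE m i) (nd k s) s' u"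
      unfolding X1_def X2_def X3_def X4_def fun_plus sgc(2)[OF lc[OF ab(1)]] sgc(2)[OF lc[OF ab(2)]] sgc(2)[OF rr[OF ab(2)]]
        res_lact(2)[OF Gc ab(1)] res_lact(2)[OF Gc ab(2)] res_ract(2)[OF Gc ab(1)] res_ract(2)[OF Gc ab(2)] ab(3,4) Gt
      using s by (cases u) (auto simp: Lc_def Rc_def nd_def rc_zA rc_zB sg_def zA_zE zB_zE zD_const add.commute)
  qed
  finally show "Tau k (diff_img m 1 (Suc k) i s :: 'k pres) = Lc (zE m i) (nd k s)" .
qed

lemma res_diff:
  shows "res_diff m 1 (Suc k) \<in> bimod_hom (Lam m 1) (PR (Suc k)) (PR k :: ('k::field lam, 'k pres) bimodule)"
    "target.nv m (Tau k) (Suc k) (res_diff m 1 (Suc k) :: 'k pres \<Rightarrow> 'k pres) = nd k"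
proof -
  have c: "diff_img m 1 (Suc k) i s \<in> carrier (PR k :: ('k lam, 'k pres) bimodule)" "Lc (zE m i) (Tau k (diff_img m 1 (Suc k) i s)) = Tau k (diff_img m 1 (Suc k) i s :: 'k pres)"
    "Rc k (Tau k (diff_img m 1 (Suc k) i s :: 'k pres)) (zE m (i + int (Suc k) - 2 * s)) = Tau k (diff_img m 1 (Suc k) i s)" if "(i, s) \<in> res_index m (Suc k)" for i s
  proof -
    note d = diff_img[OF that, where 'k = 'k]
    show "diff_img m 1 (Suc k) i s \<in> carrier (PR k :: ('k lam, 'k pres) bimodule)" by (rule d(1))
    have z: "zE m i * zE m i = (zE m i :: 'k zz)" by (simp add: zE_mult)
    show L: "Lc (zE m i) (Tau k (diff_img m 1 (Suc k) i s)) = Tau k (diff_img m 1 (Suc k) i s :: 'k pres)"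
      unfolding d(2) bim.l_mult[OF bim_coord, symmetric] z ..
    have e: "i + int (Suc k) - 2 * s = i + (int k + 1 - 2 * s)" by simp
    show "Rc k (Tau k (diff_img m 1 (Suc k) i s :: 'k pres)) (zE m (i + int (Suc k) - 2 * s)) = Tau k (diff_img m 1 (Suc k) i s)"
      unfolding d(2) bim.lr[OF bim_coord, symmetric] e nd_zE[symmetric]
      unfolding bim.l_mult[OF bim_coord, symmetric] z ..
  qed
  have k: "Suc k - 1 = k" by simp
  show "res_diff m 1 (Suc k) \<in> bimod_hom (Lam m 1) (PR (Suc k)) (PR k :: ('k lam, 'k pres) bimodule)"
    unfolding res_diff_def k by (rule target.hom_of_gens(1)[OF tco]) (rule c, assumption)+
  have "target.nv m (Tau k) (Suc k) (res_diff m 1 (Suc k) :: 'k pres \<Rightarrow> 'k pres) =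
     (\<lambda>s. if 0 \<le> s \<and> s \<le> int (Suc k) then \<Sum>i = 0..<int m. Tau k (diff_img m 1 (Suc k) i s :: 'k pres) else 0)"
    unfolding res_diff_def k by (rule target.hom_of_gens(2)[OF tco]) (rule c, assumption)+
  also have "\<dots> = nd k"
  proof
    fix s
    show "(if 0 \<le> s \<and> s \<le> int (Suc k) then \<Sum>i = 0..<int m. Tau k (diff_img m 1 (Suc k) i s :: 'k pres) else 0) = nd k s"
    proof (cases "0 \<le> s \<and> s \<le> int (Suc k)")
      case True
      have "(\<Sum>i = 0..<int m. Tau k (diff_img m 1 (Suc k) i s :: 'k pres)) = (\<Sum>i = 0..<int m. Lc (zE m i) (nd k s))"
        by (rule sum.cong[OF refl], rule diff_img(2)) (use True in \<open>simp add: res_index_iff\<close>)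
      also have "\<dots> = nd k s"
      proof (intro ext)
        fix s' u
        have sa: "sum f S s' u = (\<Sum>x\<in>S. f x s' u)" for f :: "int \<Rightarrow> 'k coord" and S
          by (induction S rule: infinite_finite_induct) simp_all
        show "(\<Sum>i = 0..<int m. Lc (zE m i) (nd k s)) s' u = (nd k s s' u :: 'k zz)"
          unfolding sa Lc_def sum_distrib_right[symmetric] sum_zE[OF m_pos] by simp
      qed
      finally show ?thesis using True by simp
    next
      case False
      show ?thesis unfolding nd_out[OF False] if_not_P[OF False] ..
    qed
  qed
  finally show "target.nv m (Tau k) (Suc k) (res_diff m 1 (Suc k) :: 'k pres \<Rightarrow> 'k pres) = nd k" .
qed

definition eps0 :: "int \<Rightarrow> 'k::field zz" where "eps0 = (\<lambda>s. if s = 0 then 1 else 0)"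

lemma res_aug:
  shows "res_aug m 1 \<in> bimod_hom (Lam m 1) (PR 0) (regular_bimod (Lam m 1) :: ('k::field lam, 'k lam) bimodule)"
    "target.nv m (alpha m) 0 (res_aug m 1 :: 'k pres \<Rightarrow> 'k lam) = eps0"
proof -
  note e = alpha_gens[OF m_pos, where 'k = 'k]
  have z: "zE m i * zE m i = (zE m i :: 'k zz)" for i by (simp add: zE_mult)
  show "res_aug m 1 \<in> bimod_hom (Lam m 1) (PR 0) (regular_bimod (Lam m 1) :: ('k lam, 'k lam) bimodule)"
    unfolding res_aug_def
    by (rule target.hom_of_gens(1)[OF treg]) (auto simp: e z regular_bimod_def res_index_iff)
  have "target.nv m (alpha m) 0 (res_aug m 1 :: 'k pres \<Rightarrow> 'k lam) = (\<lambda>s. if 0 \<le> s \<and> s \<le> int 0 then \<Sum>i = 0..<int m. alpha m (idem m 1 i :: 'k lam) else 0)"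
    unfolding res_aug_def
    by (rule target.hom_of_gens(2)[OF treg]) (auto simp: e z regular_bimod_def res_index_iff)
  then show "target.nv m (alpha m) 0 (res_aug m 1 :: 'k pres \<Rightarrow> 'k lam) = eps0"
    by (auto simp: eps0_def e(2) sum_zE[OF m_pos] fun_eq_iff)
qed

end

section \<open>Cohomology classes\<close>

text \<open>The degree condition is the shift rule for values in the regular bimodule, combined with
  periodicity.\<close>

definition Cc :: "nat \<Rightarrow> nat \<Rightarrow> (int \<Rightarrow> 'k::field zz) set" where
  "Cc m n = {F. (\<forall>s. gr m (int n - 2 * s) (F s)) \<and> (\<forall>s. \<not> (0 \<le> s \<and> s \<le> int n) \<longrightarrow> F s = 0)}"

lemma Cc_add: "F \<in> Cc m n \<Longrightarrow> G \<in> Cc m n \<Longrightarrow> F + G \<in> Cc m n"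
  and Cc_diff: "F \<in> Cc m n \<Longrightarrow> G \<in> Cc m n \<Longrightarrow> F - G \<in> Cc m n"
  and Cc_neg: "F \<in> Cc m n \<Longrightarrow> - F \<in> Cc m n" and Cc_0: "0 \<in> Cc m n"
  by (simp_all add: Cc_def gr_intros)

lemma gr_zK: "gr m k x \<Longrightarrow> gr m k (zK c * x)"
proof -
  assume x: "gr m k x"
  have "zE m i * (zK c * x) = zK c * x * zE m (i + k)" for i
  proof -
    have "zE m i * (zK c * x) = zK c * (zE m i * x)" by (metis mult.assoc zK_central)
    then show ?thesis using x by (simp add: gr_def mult.assoc)
  qed
  moreover have "per m (zK c * x)" using x by (auto simp: gr_def intro!: per_mult) (simp add: per_def zK_def)?
  ultimately show ?thesis by (simp add: gr_def)
qed

lemma Cc_zK: "F \<in> Cc m n \<Longrightarrow> (\<lambda>s. zK c * F s) \<in> Cc m n"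
  by (simp add: Cc_def gr_zK)

lemma CcD: "F \<in> Cc m n \<Longrightarrow> gr m (int n - 2 * s) (F s)" "F \<in> Cc m n \<Longrightarrow> \<not> (0 \<le> s \<and> s \<le> int n) \<Longrightarrow> F s = 0"
  unfolding Cc_def mem_Collect_eq by blast+

abbreviation "HF \<equiv> bim.Hc (*) (*)"

lemma HF_add: "HF n (F + G) q = HF n F q + HF n G (q :: 'k::field coord)"
  unfolding Hc_regular sum.distrib[symmetric] by (rule sum.cong[OF refl]) (simp add: algebra_simps)

lemma HF_diff: "HF n (F - G) q = HF n F q - HF n G (q :: 'k::field coord)"
  unfolding Hc_regular sum_subtractf[symmetric] by (rule sum.cong[OF refl]) (simp add: algebra_simps)

lemma HF_zK: "HF n (\<lambda>s. zK c * F s) q = zK c * HF n F (q :: 'k::field coord)"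
  unfolding Hc_regular sum_distrib_left
proof (rule sum.cong[OF refl])
  fix x
  have c: "y * (zK c * w) = zK c * (y * w)" for y w :: "'k zz" by (metis mult.assoc zK_central)
  show "q x W1 * (zK c * F x) + q x Wa * (zK c * F x * zA) + q x Wb * (zK c * F x * zB) + q x Wz * (zK c * F x * (zA * zB)) =
    zK c * (q x W1 * F x + q x Wa * (F x * zA) + q x Wb * (F x * zB) + q x Wz * (F x * (zA * zB)))"
    by (simp add: mult.assoc c distrib_left)
qed

lemma HF_0: "HF n 0 (q :: 'k::field coord) = 0"
  by (simp add: Hc_regular)

definition dF :: "nat \<Rightarrow> (int \<Rightarrow> 'k::field zz) \<Rightarrow> int \<Rightarrow> 'k zz" where
  "dF n F = (\<lambda>s. HF n F (nd n s))"

lemma dF_lin: "dF n (F + G) = dF n F + dF n G" "dF n (F - G) = dF n F - dF n G" "dF n 0 = 0"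
  "dF n (\<lambda>s. zK c * F s) = (\<lambda>s. zK c * dF n F s)"
  unfolding dF_def HF_add HF_diff HF_0 HF_zK by (simp_all add: fun_eq_iff)

lemma dF_neg: "dF n (- F) = - dF n F"
  using dF_lin(2)[of n 0 F] by (simp add: dF_lin(3))

lemma dF_formula:
  assumes "F \<in> Cc m n"
  shows "dF n F s = F s * zA + sg (int n + 1 + s) * (zA * F s) + sg (int n + 1 + s) * (zB * F (s - 1)) + sg (int n + 1) * (F (s - 1) * zB)"
  unfolding dF_def by (subst bim.Hc_nd_formula[OF bim_regular]) (rule CcD(2)[OF assms], assumption, simp only: mult.assoc)

definition Bc :: "nat \<Rightarrow> nat \<Rightarrow> (int \<Rightarrow> 'k::field zz) set" where
  "Bc m n = (case n of 0 \<Rightarrow> {0} | Suc k \<Rightarrow> dF k ` Cc m k)"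

lemma Bc_simps: "Bc m 0 = {0}" "Bc m (Suc k) = dF k ` Cc m k" by (simp_all add: Bc_def)

definition Zc :: "nat \<Rightarrow> nat \<Rightarrow> (int \<Rightarrow> 'k::field zz) set" where
  "Zc m n = {F \<in> Cc m n. dF n F = 0}"

lemma Zc_grp: "F \<in> Zc m n \<Longrightarrow> G \<in> Zc m n \<Longrightarrow> F + G \<in> Zc m n" "0 \<in> Zc m n" "F \<in> Zc m n \<Longrightarrow> - F \<in> Zc m n"
  "F \<in> Zc m n \<Longrightarrow> (\<lambda>s. zK c * F s) \<in> Zc m n"
proof -
  show "F \<in> Zc m n \<Longrightarrow> - F \<in> Zc m n"
    using dF_lin(2)[of n 0 F] by (simp add: Zc_def Cc_neg dF_lin(3))
qed (simp_all add: Zc_def Cc_add Cc_0 Cc_zK dF_lin, simp_all add: zero_fun_def)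

lemma Bc_grp: "F \<in> Bc m n \<Longrightarrow> G \<in> Bc m n \<Longrightarrow> F + G \<in> Bc m n" "0 \<in> Bc m n" "F \<in> Bc m n \<Longrightarrow> - F \<in> Bc m n"
  "F \<in> Bc m n \<Longrightarrow> (\<lambda>s. zK c * F s) \<in> Bc m n"
proof -
  show "0 \<in> Bc m n"
    by (cases n) (use dF_lin(3) Cc_0 in \<open>auto simp: Bc_simps intro!: image_eqI[of _ _ 0]\<close>)
  show "F \<in> Bc m n \<Longrightarrow> G \<in> Bc m n \<Longrightarrow> F + G \<in> Bc m n"
    by (cases n) (auto simp: Bc_simps dF_lin(1)[symmetric] Cc_add)
  show "F \<in> Bc m n \<Longrightarrow> - F \<in> Bc m n"
    by (cases n) (auto simp: Bc_simps dF_neg[symmetric] Cc_neg)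
  show "F \<in> Bc m n \<Longrightarrow> (\<lambda>s. zK c * F s) \<in> Bc m n"
    by (cases n) (auto simp: Bc_simps dF_lin(4)[symmetric] Cc_zK zero_fun_def)
qed

context cyc
begin

abbreviation "mk n F \<equiv> target.mkhom m (*) (*) (regular_bimod (Lam m 1)) (alpha m) n F"
abbreviation "ev n f \<equiv> target.nv m (alpha m) n f"
abbreviation "hom0 n \<equiv> bimod_hom (Lam m 1) (PR n) (regular_bimod (Lam m 1))"

lemma Cc_okn: "F \<in> Cc m n \<Longrightarrow> bim.okn (*) (*) m n (F :: int \<Rightarrow> 'k::field zz)"
proof (rule target.okn_zE[OF treg])
  fix s i assume "F \<in> Cc m n"
  from CcD(1)[OF this, of s] show "zE m i * F s = F s * zE m (i + (int n - 2 * s))" by (simp add: gr_def)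
qed

lemma Cc_Mc: "F \<in> Cc m n \<Longrightarrow> (F s :: 'k::field zz) \<in> target.Mc (regular_bimod (Lam m 1) :: ('k lam, 'k lam) bimodule) (alpha m)"
  by (rule Mc_reg) (use CcD(1)[of F m n s] in \<open>simp add: gr_def\<close>)

lemma mk_hom:
  fixes F :: "int \<Rightarrow> 'k::field zz"
  assumes F: "F \<in> Cc m n"
  shows "mk n F \<in> hom0 n" "ev n (mk n F) = F" "p \<in> carrier (PR n) \<Longrightarrow> alpha m (mk n F p) = HF n F (Tau n p)"
proof -
  show "mk n F \<in> hom0 n" by (rule target.mkhom(1)[OF treg Cc_okn[OF F] Cc_Mc[OF F]])
  show "ev n (mk n F) = F" by (rule target.nv_mkhom[OF treg Cc_okn[OF F] Cc_Mc[OF F] CcD(2)[OF F]])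
  show "p \<in> carrier (PR n) \<Longrightarrow> alpha m (mk n F p) = HF n F (Tau n p)"
    by (rule target.mkhom(2)[OF treg Cc_okn[OF F] Cc_Mc[OF F]])
qed

text \<open>With \<open>mk_hom\<close> this makes \<open>mk n\<close> a bijection from the families
  in \<open>Cc m n\<close> onto the cochains, so that cocycles, coboundaries and classes can be
  computed on families of values.\<close>

lemma ev_Cc:
  fixes f :: "'k::field pres \<Rightarrow> 'k lam"
  assumes f: "f \<in> hom0 n"
  shows "ev n f \<in> Cc m n" "mk n (ev n f) = f"
proof -
  have "gr m (int n - 2 * s) (ev n f s)" for s
  proof (cases "0 \<le> s \<and> s \<le> int n")
    case True
    then have s: "0 \<le> s" "s \<le> int n" by auto
    have "f (Gs n s) \<in> carrier (Lam m 1)"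
      using target.bimod_homD(1)[OF treg f Gs(1)[OF s]] by (simp add: regular_bimod_def)
    then have "per m (ev n f s)" unfolding target.nv_Gs[OF treg f s] by (rule coordalg.al_simps(1)[OF calg])
    then show ?thesis using target.nv_zE[OF treg f s] by (simp add: gr_def)
  qed (simp add: target.nv_out[OF treg] gr_intros)
  then show "ev n f \<in> Cc m n" unfolding Cc_def mem_Collect_eq using target.nv_out[OF treg, where f = f and n = n] by blast
  show "mk n (ev n f) = f" by (rule target.mkhom_nv[OF treg f])
qed

lemma mk_inj: "F \<in> Cc m n \<Longrightarrow> G \<in> Cc m n \<Longrightarrow> mk n F = (mk n G :: 'k::field pres \<Rightarrow> 'k lam) \<Longrightarrow> F = G"
  using mk_hom(2)[of F n] mk_hom(2)[of G n] by metis

lemma mk_eqI: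
  fixes F :: "int \<Rightarrow> 'k::field zz"
  assumes F: "F \<in> Cc m n" and "\<And>p. p \<in> carrier (PR n) \<Longrightarrow> f p \<in> carrier (Lam m 1)"
    "\<And>p. p \<in> carrier (PR n) \<Longrightarrow> alpha m (f p) = HF n F (Tau n p)"
  shows "(\<lambda>p\<in>carrier (PR n). f p) = mk n F"
proof (rule extensionalityI[of _ "carrier (PR n)"])
  show "mk n F \<in> extensional (carrier (PR n))" using mk_hom(1)[OF F] by (auto simp: bimod_hom_def PiE_def)
  fix p :: "'k pres" assume p: "p \<in> carrier (PR n)"
  have "mk n F p \<in> carrier (Lam m 1)" using target.bimod_homD(1)[OF treg mk_hom(1)[OF F] p] by (simp add: regular_bimod_def)
  then have "f p = mk n F p" using assms(2,3)[OF p] mk_hom(3)[OF F p]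
    by (intro coordalg.al_inj[OF calg]) auto
  then show "restrict f (carrier (PR n)) p = mk n F p" using p by simp
qed simp

lemma mk_mem: "F \<in> Cc m n \<Longrightarrow> p \<in> carrier (PR n) \<Longrightarrow> mk n F p \<in> carrier (Lam m 1 :: ('k::field, 'k lam) module)"
  using target.bimod_homD(1)[OF treg mk_hom(1)] by (simp add: regular_bimod_def)

abbreviation "CC n \<equiv> (cochains (Lam m 1) (res m 1) n :: ('k::field, 'k pres \<Rightarrow> 'k lam) module)"

lemma CC_ops:
  shows "carrier (CC n :: ('k::field, 'k pres \<Rightarrow> 'k lam) module) = mk n ` Cc m n"
    "F \<in> Cc m n \<Longrightarrow> G \<in> Cc m n \<Longrightarrow> mk n F \<oplus>\<^bsub>CC n\<^esub> mk n G = (mk n (F + G) :: 'k pres \<Rightarrow> 'k lam)"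
    "F \<in> Cc m n \<Longrightarrow> c \<odot>\<^bsub>CC n\<^esub> mk n F = (mk n (\<lambda>s. zK c * F s) :: 'k pres \<Rightarrow> 'k lam)"
    "\<zero>\<^bsub>CC n\<^esub> = (mk n 0 :: 'k pres \<Rightarrow> 'k lam)"
proof -
  show "carrier (CC n :: ('k::field, 'k pres \<Rightarrow> 'k lam) module) = mk n ` Cc m n"
  proof (intro equalityI subsetI)
    fix f :: "'k pres \<Rightarrow> 'k lam" assume "f \<in> carrier (CC n)"
    then have f: "f \<in> hom0 n" by (simp add: cochains_def)
    have "mk n (ev n f) \<in> mk n ` Cc m n" by (rule imageI) (rule ev_Cc(1)[OF f])
    then show "f \<in> mk n ` Cc m n" unfolding ev_Cc(2)[OF f] .
  qed (auto simp: cochains_def mk_hom(1))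
  assume F: "F \<in> Cc m n"
  show "c \<odot>\<^bsub>CC n\<^esub> mk n F = (mk n (\<lambda>s. zK c * F s) :: 'k pres \<Rightarrow> 'k lam)"
    unfolding cochains_def module.simps
    by (rule mk_eqI[OF Cc_zK[OF F]])
      (simp_all add: coordalg.al_simps[OF calg] coordalg.smult_closed[OF calg] mk_mem[OF F] mk_hom(3)[OF F] HF_zK)
  assume G: "G \<in> Cc m n"
  show "mk n F \<oplus>\<^bsub>CC n\<^esub> mk n G = (mk n (F + G) :: 'k pres \<Rightarrow> 'k lam)"
    unfolding cochains_def ring_record_simps
    by (rule mk_eqI[OF Cc_add[OF F G]])
      (simp_all only: coordalg.al_simps[OF calg] coordalg.A_closed[OF calg] mk_mem[OF F] mk_mem[OF G] mk_hom(3)[OF F] mk_hom(3)[OF G] HF_add)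
next
  show "\<zero>\<^bsub>CC n\<^esub> = (mk n 0 :: 'k pres \<Rightarrow> 'k lam)"
    unfolding cochains_def ring_record_simps
    by (rule mk_eqI[OF Cc_0])
      (simp_all only: coordalg.al_0[OF calg] coordalg.A_closed[OF calg] HF_0)
qed

lemma comp_diff:
  fixes F :: "int \<Rightarrow> 'k::field zz"
  assumes F: "F \<in> Cc m n"
  shows "dF n F \<in> Cc m (Suc n)" "compose (carrier (PR (Suc n))) (mk n F) (res_diff m 1 (Suc n)) = mk (Suc n) (dF n F)"
proof -
  note c = target.comp_hom[OF treg mk_hom(1)[OF F] res_diff(1)]
  have e: "ev (Suc n) (compose (carrier (PR (Suc n))) (mk n F) (res_diff m 1 (Suc n))) = dF n F"
    unfolding c(2) res_diff(2) mk_hom(2)[OF F] dF_def ..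
  show "dF n F \<in> Cc m (Suc n)" using ev_Cc(1)[OF c(1)] unfolding e .
  show "compose (carrier (PR (Suc n))) (mk n F) (res_diff m 1 (Suc n)) = mk (Suc n) (dF n F)"
    using ev_Cc(2)[OF c(1)] unfolding e by simp
qed

lemma Bc_Cc: "Bc m n \<subseteq> (Cc m n :: (int \<Rightarrow> 'k::field zz) set)"
  by (cases n) (auto simp: Bc_simps Cc_0 comp_diff(1))

lemma cobnd: "coboundaries (Lam m 1) (res m 1) (res_diff m 1) n = (mk n ` Bc m n :: ('k::field pres \<Rightarrow> 'k lam) set)"
proof (cases n)
  case 0
  show ?thesis unfolding 0 coboundaries.simps CC_ops(4) Bc_simps by simp
next
  case (Suc k)
  show ?thesis
    unfolding Suc coboundaries.simps CC_ops(1) Bc_simps image_image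
    by (rule image_cong[OF refl]) (rule comp_diff(2))
qed

lemma cocyc: "cocycles (Lam m 1) (res m 1) (res_diff m 1) n = (mk n ` Zc m n :: ('k::field pres \<Rightarrow> 'k lam) set)"
proof -
  have "compose (carrier (PR (Suc n))) (mk n F) (res_diff m 1 (Suc n)) = (\<zero>\<^bsub>CC (Suc n)\<^esub> :: 'k pres \<Rightarrow> 'k lam) \<longleftrightarrow> dF n F = 0" if F: "F \<in> Cc m n" for F
    unfolding comp_diff(2)[OF F] CC_ops(4) using mk_inj[OF comp_diff(1)[OF F] Cc_0] by auto
  then show ?thesis unfolding cocycles_def CC_ops(1) Zc_def by blast
qed

definition cls :: "nat \<Rightarrow> (int \<Rightarrow> 'k::field zz) \<Rightarrow> ('k pres \<Rightarrow> 'k lam) set" where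
  "cls n F = coho_class (Lam m 1) (res m 1) (res_diff m 1) n (mk n F)"

lemma cls_eq:
  assumes F: "F \<in> Cc m n"
  shows "cls n F = (\<lambda>B. mk n (B + F)) ` (Bc m n :: (int \<Rightarrow> 'k::field zz) set)"
proof -
  have "cls n F = (\<lambda>B. mk n B \<oplus>\<^bsub>CC n\<^esub> mk n F) ` Bc m n"
    unfolding cls_def coho_class_def a_r_coset_def' cobnd by auto
  also have "\<dots> = (\<lambda>B. mk n (B + F)) ` Bc m n"
    by (rule image_cong[OF refl], rule CC_ops(2)) (use Bc_Cc F in blast)+
  finally show ?thesis .
qed

lemma cls_iff:
  fixes F G :: "int \<Rightarrow> 'k::field zz"
  assumes F: "F \<in> Cc m n" and G: "G \<in> Cc m n"
  shows "cls n F = cls n G \<longleftrightarrow> F - G \<in> Bc m n"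
proof
  assume e: "cls n F = cls n G"
  have "mk n (0 + F) \<in> cls n F" unfolding cls_eq[OF F] by (rule imageI) (rule Bc_grp)
  then obtain B where B: "B \<in> Bc m n" "mk n (0 + F) = (mk n (B + G) :: 'k pres \<Rightarrow> 'k lam)" unfolding e cls_eq[OF G] by blast
  have "0 + F = B + G" by (rule mk_inj[OF _ _ B(2)]) (use B(1) Bc_Cc F G in \<open>auto intro!: Cc_add\<close>)
  then show "F - G \<in> Bc m n" using B(1) by (simp add: algebra_simps)
next
  assume d: "F - G \<in> Bc m n"
  have sub: "cls n F \<subseteq> cls n G" if "F - G \<in> Bc m n" "F \<in> Cc m n" "G \<in> Cc m n" for F G :: "int \<Rightarrow> 'k zz"
    unfolding cls_eq[OF that(2)] cls_eq[OF that(3)]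
  proof
    fix x assume "x \<in> (\<lambda>B. mk n (B + F)) ` Bc m n"
    then obtain B where B: "B \<in> Bc m n" "x = mk n (B + F)" by blast
    then have "x = mk n ((B + (F - G)) + G)" by (simp add: algebra_simps)
    then show "x \<in> (\<lambda>B. mk n (B + G)) ` Bc m n" using Bc_grp(1)[OF B(1) that(1)] by blast
  qed
  have "G - F \<in> Bc m n" using Bc_grp(3)[OF d] by simp
  then show "cls n F = cls n G" using sub[OF d F G] sub[OF _ G F] by blast
qed

abbreviation "ExM n \<equiv> (Ext_mod (Lam m 1) (res m 1) (res_diff m 1) n :: ('k::field, ('k pres \<Rightarrow> 'k lam) set) module)"

lemma ext_sel:
  "carrier (ExM n) = (\<lambda>F. cls n F :: ('k::field pres \<Rightarrow> 'k lam) set) ` Zc m n"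
  "X \<oplus>\<^bsub>ExM n\<^esub> Y = (\<Union>h\<in>X. \<Union>k\<in>Y. {h \<oplus>\<^bsub>CC n\<^esub> (k :: 'k pres \<Rightarrow> 'k lam)})"
  "\<zero>\<^bsub>ExM n\<^esub> = (mk n ` Bc m n :: ('k pres \<Rightarrow> 'k lam) set)"
  "c \<odot>\<^bsub>ExM n\<^esub> X = (\<Union>x\<in>X. coho_class (Lam m 1) (res m 1) (res_diff m 1) n (c \<odot>\<^bsub>CC n\<^esub> (x :: 'k pres \<Rightarrow> 'k lam)))"
  unfolding Ext_mod_def quot_alg_def FactRing_def A_RCOSETS_def' cocyc cls_def coho_class_def set_add_def set_mult_def a_r_coset_def'
  by (auto simp: cobnd)

lemma ExM_ops:
  fixes F G :: "int \<Rightarrow> 'k::field zz"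
  shows "\<zero>\<^bsub>ExM n\<^esub> = (cls n 0 :: ('k pres \<Rightarrow> 'k lam) set)"
    "F \<in> Cc m n \<Longrightarrow> G \<in> Cc m n \<Longrightarrow> cls n F \<oplus>\<^bsub>ExM n\<^esub> cls n G = cls n (F + G)"
    "F \<in> Cc m n \<Longrightarrow> c \<odot>\<^bsub>ExM n\<^esub> cls n F = cls n (\<lambda>s. zK c * F s)"
proof -
  show "\<zero>\<^bsub>ExM n\<^esub> = (cls n 0 :: ('k pres \<Rightarrow> 'k lam) set)" unfolding ext_sel(3) cls_eq[OF Cc_0] by simp
  assume F: "F \<in> Cc m n"
  have BC: "B \<in> Cc m n" if "B \<in> Bc m n" for B :: "int \<Rightarrow> 'k zz" using that Bc_Cc by blast
  {
    assume G: "G \<in> Cc m n"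
    have FG: "F + G \<in> Cc m n" by (rule Cc_add[OF F G])
    have a: "mk n (B + F) \<oplus>\<^bsub>CC n\<^esub> mk n (B' + G) = (mk n ((B + B') + (F + G)) :: 'k pres \<Rightarrow> 'k lam)" if "B \<in> Bc m n" "B' \<in> Bc m n" for B B'
      using CC_ops(2)[OF Cc_add[OF BC[OF that(1)] F] Cc_add[OF BC[OF that(2)] G]] by (simp add: ac_simps)
    have "cls n F \<oplus>\<^bsub>ExM n\<^esub> cls n G = (\<Union>B\<in>Bc m n. \<Union>B'\<in>Bc m n. {mk n ((B + B') + (F + G))})"
      unfolding ext_sel(2) cls_eq[OF F] cls_eq[OF G] by (simp add: a)
    also have "\<dots> = cls n (F + G)"
      unfolding cls_eq[OF FG]
    proof (intro equalityI subsetI)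
      fix x assume "x \<in> (\<Union>B\<in>Bc m n. \<Union>B'\<in>Bc m n. {mk n ((B + B') + (F + G))})"
      then obtain B B' where "B \<in> Bc m n" "B' \<in> Bc m n" "x = mk n ((B + B') + (F + G))" by blast
      then show "x \<in> (\<lambda>B. mk n (B + (F + G))) ` Bc m n" using Bc_grp(1) by blast
    next
      fix x assume "x \<in> (\<lambda>B. mk n (B + (F + G))) ` Bc m n"
      then obtain B where B: "B \<in> Bc m n" "x = mk n (B + (F + G))" by blast
      then have "x = mk n ((B + 0) + (F + G))" by simp
      then show "x \<in> (\<Union>B\<in>Bc m n. \<Union>B'\<in>Bc m n. {mk n ((B + B') + (F + G))})" using B(1) Bc_grp(2) by blast
    qed
    finally show "cls n F \<oplus>\<^bsub>ExM n\<^esub> cls n G = cls n (F + G)" .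
  }
  have s: "coho_class (Lam m 1) (res m 1) (res_diff m 1) n (c \<odot>\<^bsub>CC n\<^esub> mk n (B + F)) = cls n (\<lambda>s. zK c * F s)" if B: "B \<in> Bc m n" for B
  proof -
    have BF: "B + F \<in> Cc m n" by (rule Cc_add[OF BC[OF B] F])
    have e: "(\<lambda>s. zK c * (B + F) s) - (\<lambda>s. zK c * F s) = (\<lambda>s. zK c * B s)" by (simp add: fun_eq_iff algebra_simps)
    show ?thesis
      unfolding CC_ops(3)[OF BF] cls_def[symmetric] cls_iff[OF Cc_zK[OF BF] Cc_zK[OF F]] e
      by (rule Bc_grp(4)[OF B])
  qed
  show "c \<odot>\<^bsub>ExM n\<^esub> cls n F = cls n (\<lambda>s. zK c * F s)"
    unfolding ext_sel(4) cls_eq[OF F] using s Bc_grp(2) by fastforce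
qed

end

section \<open>The Yoneda product\<close>

text \<open>The convolution of two homogeneous families. \<open>G\<close> is the cocycle that is
  lifted and \<open>F\<close> the one that is composed with the lifting.\<close>

definition prodF :: "nat \<Rightarrow> (int \<Rightarrow> 'k::field zz) \<Rightarrow> nat \<Rightarrow> (int \<Rightarrow> 'k zz) \<Rightarrow> int \<Rightarrow> 'k zz" where
  "prodF q G p F = (\<lambda>s. \<Sum>u\<in>{0..int p}. sg (int q * u) * (G (s - u) * F u))"

definition toT :: "nat \<Rightarrow> (int \<Rightarrow> 'k::field zz) \<Rightarrow> 'k zz tw" where
  "toT n F = Tw (\<lambda>k r. if k = n then F (int r) else 0)"

lemma tc_toT [simp]: "tc (toT n F) k r = (if k = n then F (int r) else 0)"
  by (simp add: toT_def)

lemma toT_lin: "toT n (F + G) = toT n F + toT n G" "toT n (F - G) = toT n F - toT n G" "toT n 0 = 0"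
  by (simp_all add: tw_eq_iff)

lemma toT_inj: "F \<in> Cc m n \<Longrightarrow> G \<in> Cc m n \<Longrightarrow> toT n F = toT n G \<Longrightarrow> F = G"
proof
  fix s assume F: "F \<in> Cc m n" and G: "G \<in> Cc m n" and e: "toT n F = toT n G"
  show "F s = G s"
  proof (cases "0 \<le> s")
    case True
    then show ?thesis using arg_cong[OF e, of "\<lambda>x. tc x n (nat s)"] by simp
  next
    case False
    then have "\<not> (0 \<le> s \<and> s \<le> int n)" by simp
    then show ?thesis using CcD(2)[OF F] CcD(2)[OF G] by metis
  qed
qed

text \<open>Identifies the cochain differential with the graded commutator, which makes the Leibniz
  rule \<open>dl_mult\<close> available for \<open>prodF\<close>.\<close>

lemma dl_toT:
  assumes F: "F \<in> Cc m n"
  shows "dl (toT n F) = toT (Suc n) (dF n F)"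
proof -
  have m1: "F (- 1) = 0" by (rule CcD(2)[OF F]) simp
  have "tc (dl (toT n F)) k r = tc (toT (Suc n) (dF n F)) k r" for k r
  proof (cases k)
    case 0
    then show ?thesis by (simp add: tc_dl_0)
  next
    case (Suc j)
    have s1: "sg (int n + 1 + int r) = ((- 1) ^ (Suc n + r) :: 'a zz)" "sg (int n + 1) = ((- 1) ^ Suc n :: 'a zz)"
      using sg_nat[of "Suc n + r", where 'a = "'a zz"] sg_nat[of "Suc n", where 'a = "'a zz"] by (simp_all add: ac_simps)
    show ?thesis
    proof (cases "j = n")
      case True
      show ?thesis
        unfolding Suc True tc_dl tc_toT dF_formula[OF F] s1
        by (cases r) (simp_all add: m1 distrib_left)
    next
      case False
      then show ?thesis unfolding Suc tc_dl tc_toT by simp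
    qed
  qed
  then show ?thesis by (simp add: tw_eq_iff)
qed

lemma prod_toT:
  assumes G: "G \<in> Cc m q" and F: "F \<in> Cc m p"
  shows "toT q G * toT p F = toT (q + p) (prodF q G p (F :: int \<Rightarrow> 'k::field zz))"
proof -
  have h: "toT q G = hom_part q (toT q G)" "toT p F = hom_part p (toT p F)" by (simp_all add: tw_eq_iff tc_hom_part)
  have "tc (toT q G * toT p F) n r = tc (toT (q + p) (prodF q G p F)) n r" for n r
  proof -
    define f where "f u = sg (int q * u) * (G (int r - u) * F u)" for u
    have "(\<Sum>t\<le>r. (- 1) ^ (q * (r - t)) * (G (int t) * F (int (r - t)))) = (\<Sum>u\<in>{0..int r}. f u)"
      by (rule sum.reindex_bij_witness[of _ "\<lambda>u. r - nat u" "\<lambda>t. int (r - t)"])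
        (auto simp: f_def of_nat_diff sg_nat[symmetric])
    also have "\<dots> = (\<Sum>u\<in>{0..int p}. f u)"
    proof (rule sum.mono_neutral_cong)
      show "f i = 0" if "i \<in> {0..int p} - {0..int r}" for i
      proof -
        have "G (int r - i) = 0" by (rule CcD(2)[OF G]) (use that in auto)
        then show ?thesis by (simp add: f_def)
      qed
      show "f i = 0" if "i \<in> {0..int r} - {0..int p}" for i
      proof -
        have "F i = 0" by (rule CcD(2)[OF F]) (use that in auto)
        then show ?thesis by (simp add: f_def)
      qed
    qed simp_all
    finally have S: "(\<Sum>t\<le>r. (- 1) ^ (q * (r - t)) * (G (int t) * F (int (r - t)))) = (\<Sum>u\<in>{0..int p}. f u)" .
    show ?thesis
      using tc_mult_hom_part[of q "toT q G" p "toT p F" n r, folded h]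
      unfolding tc_toT if_P[OF refl] S f_def prodF_def .
  qed
  then show ?thesis by (simp add: tw_eq_iff)
qed

lemma per_zE: "per m (zE m i)"
  by simp

lemma gr_sg: "gr m k x \<Longrightarrow> gr m k (sg j * x)"
  by (simp add: sg_def gr_intros)

lemma prodF_Cc:
  assumes G: "G \<in> Cc m q" and F: "F \<in> Cc m p"
  shows "prodF q G p F \<in> Cc m (q + p)"
  unfolding Cc_def mem_Collect_eq
proof (intro conjI allI impI)
  fix s
  have "gr m (int (q + p) - 2 * s) (G (s - u) * F u)" for u
    using gr_mult[OF CcD(1)[OF G, of "s - u"] CcD(1)[OF F, of u]] by (simp add: algebra_simps)
  then show "gr m (int (q + p) - 2 * s) (prodF q G p F s)" unfolding prodF_def by (intro gr_sum gr_sg)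
  assume s: "\<not> (0 \<le> s \<and> s \<le> int (q + p))"
  have "sg (int q * u) * (G (s - u) * F u) = 0" if "u \<in> {0..int p}" for u
  proof -
    have "G (s - u) = 0" by (rule CcD(2)[OF G]) (use that s in auto)
    then show ?thesis by simp
  qed
  then show "prodF q G p F s = 0" unfolding prodF_def by simp
qed

lemma prodF_lin: "prodF q (G + G') p F = prodF q G p F + prodF q G' p F" "prodF q G p (F + F') = prodF q G p F + prodF q G p F'"
  by (simp_all add: prodF_def fun_eq_iff distrib_left distrib_right sum.distrib)

section \<open>Liftings of cocycles and their uniqueness\<close>

context bim
begin

lemma l_diff: "l x (c - d) = l x c - l x d" and r_diff: "r (c - d) x = r c x - r d x"
  using l_add2[of x "c - d" d] r_add1[of "c - d" d x] by simp_all

lemma Hc_diff: "Hc n \<nu> (q - q') = Hc n \<nu> q - Hc n \<nu> q'"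
  using Hc_add[of n \<nu> "q - q'" q'] by simp

lemma Hc_nu_diff: "Hc n (\<lambda>s. \<nu> s - \<nu>' s) q = Hc n \<nu> q - Hc n \<nu>' q"
  unfolding Hc_def sum_subtractf[symmetric]
  by (rule sum.cong[OF refl]) (simp add: l_diff r_diff algebra_simps)

end

text \<open>This is \<open>d d = 0\<close> evaluated on \<open>G_s\<close>; only the indices
  \<open>s\<close>, \<open>s - 1\<close> and \<open>s - 2\<close> can contribute.\<close>

lemma dc_nd: "dc n (nd (Suc n) s) = (0 :: 'k::field coord)"
proof (intro ext)
  fix t u
  consider "t = s" | "t = s - 1" | "t = s - 2" | "t \<noteq> s" "t \<noteq> s - 1" "t \<noteq> s - 2" by blast
  then show "dc n (nd (Suc n) s) t u = (0 :: 'k coord) t u"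
    by cases (cases u; cases "even n"; cases "even s"; simp add: dc_def nd_def sg_def)+
qed

lemma nd_Pc: "nd k s \<in> Pc m k"
proof -
  have "per m (nd k s t u)" for t u by (cases u) (auto simp: nd_def sg_def)
  moreover have "nd k s t u = 0" if "\<not> (0 \<le> t \<and> t \<le> int k)" for t u
    using that by (cases u) (auto simp: nd_def)
  ultimately show ?thesis unfolding Pc_def by blast
qed

lemma sc_Lc: "sc n (Lc x q) = Lc x (sc n q)"
  by (intro ext, rename_tac s u, case_tac u) (auto simp: sc_def Lc_def sg_def algebra_simps)

text \<open>\<open>sc\<close> is not right linear: it kills \<open>G_s\<close> but sends
  \<open>G_s a\<close> to \<open>G_s\<close>. It does commute with the idempotents, and this
  suffices because it is applied to values on the \<open>G_s\<close>, which have to keep the shift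
  rule.\<close>

lemma sc_Rc: "sc n (Rc n q (zE m j)) = Rc (Suc n) (sc n q) (zE m j :: 'k::field zz)"
proof (intro ext)
  fix s u
  have U: "Rc n q (zE m j) s v = q s v * zE m (j - (int n - 2 * s) + (case v of Wa \<Rightarrow> - 1 | Wb \<Rightarrow> 1 | _ \<Rightarrow> 0))" for n q s v
    by (simp only: Rc_def rc_zE)
  have c: "zE m i * zA = zA * (zE m (i + 1) :: 'k zz)" for i by (simp add: zA_zE)
  show "sc n (Rc n q (zE m j)) s u = Rc (Suc n) (sc n q) (zE m j) s u"
    by (cases u) (auto simp: sc_def U mult.assoc c sg_def distrib_right algebra_simps)
qed

lemma sc_0: "sc n 0 = 0"
  by (intro ext, rename_tac s u, case_tac u) (simp_all add: sc_def)

text \<open>Values of the explicit lifting on \<open>G_s\<close> of degree \<open>q + k\<close>: the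
  element \<open>G_u\<close> of degree \<open>k\<close> occurs with the value of the cocycle at
  \<open>s - u\<close> as left coefficient. The sign makes these maps commute with the
  differentials.\<close>

definition lamc :: "nat \<Rightarrow> (int \<Rightarrow> 'k::field zz) \<Rightarrow> nat \<Rightarrow> int \<Rightarrow> 'k coord" where
  "lamc q G k s = (\<lambda>u w. if w = W1 \<and> 0 \<le> u \<and> u \<le> int k then sg (int q * u) * G (s - u) else 0)"

lemma lamc_zE:
  assumes G: "G \<in> Cc m q"
  shows "Lc (zE m i) (lamc q G k s) = Rc k (lamc q G k s) (zE m (i + (int (q + k) - 2 * s)))"
proof (intro ext)
  fix u w
  have "zE m i * G (s - u) = G (s - u) * zE m (i + (int q - 2 * (s - u)))" using CcD(1)[OF G, of "s - u"] by (simp add: gr_def)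
  also have "i + (int q - 2 * (s - u)) = i + (int (q + k) - 2 * s) - (int k - 2 * u)" by simp
  finally show "Lc (zE m i) (lamc q G k s) u w = Rc k (lamc q G k s) (zE m (i + (int (q + k) - 2 * s))) u w"
    by (cases w) (simp_all add: Lc_def Rc_def rc_zE lamc_def sg_def del: rc.simps)
qed

lemma lamc_Pc: "G \<in> Cc m q \<Longrightarrow> lamc q G k s \<in> Pc m k"
  using CcD(1)[of G m q] by (auto simp: Pc_def lamc_def gr_def)

lemma lamc_out:
  assumes G: "G \<in> Cc m q" and s: "\<not> (0 \<le> s \<and> s \<le> int (q + k))"
  shows "lamc q G k s = 0"
proof (intro ext)
  fix u w
  show "lamc q G k s u w = (0 :: 'a coord) u w"
  proof (cases "0 \<le> u \<and> u \<le> int k")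
    case True
    have "G (s - u) = 0" by (rule CcD(2)[OF G]) (use True s in auto)
    then show ?thesis by (simp add: lamc_def)
  next
    case False
    then show ?thesis by (auto simp: lamc_def)
  qed
qed

text \<open>In the \<open>W1\<close> coordinate at \<open>u\<close> the equation is the cocycle
  condition of \<open>G\<close> at \<open>s - u\<close>; in the other coordinates the terms match by
  themselves.\<close>

lemma lamc_chain:
  assumes G: "G \<in> Zc m q"
  shows "dc k (lamc q G (Suc k) s) = bim.Hc Lc (Rc k) (q + k) (lamc q G k) (nd (q + k) s)"
proof -
  have Gc: "G \<in> Cc m q" and dG: "dF q G = 0" using G by (auto simp: Zc_def)
  let ?n = "int (q + k) + 1"
  show ?thesis
  proof (subst bim.Hc_nd_formula[OF bim_coord])
    show "lamc q G k s = 0" if "\<not> (0 \<le> s \<and> s \<le> int (q + k))" for s by (rule lamc_out[OF Gc that])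
    show "dc k (lamc q G (Suc k) s) = Rc k (lamc q G k s) zA + Lc (sg (?n + s) * zA) (lamc q G k s)
       + Lc (sg (?n + s) * zB) (lamc q G k (s - 1)) + Lc (sg ?n) (Rc k (lamc q G k (s - 1)) zB)"
    proof (intro ext)
      fix u w
      show "dc k (lamc q G (Suc k) s) u w = (Rc k (lamc q G k s) zA + Lc (sg (?n + s) * zA) (lamc q G k s)
       + Lc (sg (?n + s) * zB) (lamc q G k (s - 1)) + Lc (sg ?n) (Rc k (lamc q G k (s - 1)) zB)) u w"
      proof (cases "0 \<le> u \<and> u \<le> int k")
        case False
        then have n: "(0 \<le> u \<and> u \<le> int k) = False" by simp
        show ?thesis unfolding dc_def n by (cases w) (simp_all add: Lc_def Rc_def rc_zA rc_zB lamc_def n)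
      next
        case u: True
        have i: "s - (u + 1) = s - (1 + u)" "s - 1 - u = s - (1 + u)" "s - u - 1 = s - (1 + u)" by simp_all
        show ?thesis
        proof (cases "w = W1")
          case True
          define a b where "a = G (s - u)" and "b = G (s - (1 + u))"
          have "a * zA + sg (int q + 1 + (s - u)) * (zA * a) + sg (int q + 1 + (s - u)) * (zB * b) + sg (int q + 1) * (b * zB) = 0"
            using dF_formula[OF Gc, of "s - u"] unfolding dG a_def b_def i(3) by simp
          \<comment> \<open>The cocycle condition solved for one of its four terms, so that it can
            be substituted in every sign case.\<close>
          then have H: "zA * a = - (sg (int q + 1 + (s - u)) * (a * zA)) - sg (int q + 1 + (s - u)) * (sg (int q + 1) * (b * zB)) - zB * b"
            by (cases "even (int q + 1 + (s - u))") (simp_all add: sg_simps eq_neg_iff_add_eq_0 algebra_simps)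
          show ?thesis
            using u True
            by (cases "even q"; cases "even k"; cases "even u"; cases "even s")
              (simp_all add: H dc_def Lc_def Rc_def rc_zA rc_zB lamc_def i a_def[symmetric] b_def[symmetric] sg_def zD_const algebra_simps)
        next
          case False
          then show ?thesis
            using u by (cases w; cases "even q"; cases "even k"; cases "even u")
              (simp_all add: dc_def Lc_def Rc_def rc_zA rc_zB lamc_def i sg_def zD_const)
        qed
      qed
    qed
  qed
qed

context cyc
begin

lemma toT_0I: "F \<in> Cc m n \<Longrightarrow> toT n F = 0 \<Longrightarrow> F = (0 :: int \<Rightarrow> 'k::field zz)"
  by (rule toT_inj[OF _ Cc_0]) (simp_all add: toT_lin)

lemma Zc_toT: "F \<in> Zc m n \<longleftrightarrow> F \<in> Cc m n \<and> dl (toT n F) = (0 :: 'k::field zz tw)"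
  using dl_toT[of F m n] toT_0I[OF comp_diff(1)] by (auto simp: Zc_def toT_lin)

lemma prodF_Zc:
  fixes F G :: "int \<Rightarrow> 'k::field zz"
  assumes "G \<in> Zc m q" "F \<in> Zc m p" shows "prodF q G p F \<in> Zc m (q + p)"
proof -
  have Gc: "G \<in> Cc m q" and dG: "dl (toT q G) = 0" and Fc: "F \<in> Cc m p" and dF0: "dl (toT p F) = 0"
    using assms by (auto simp: Zc_toT)
  have "dl (toT (q + p) (prodF q G p F)) = 0" unfolding prod_toT[OF Gc Fc, symmetric] dl_mult dG dF0 by simp
  then show ?thesis using prodF_Cc[OF Gc Fc] by (simp add: Zc_toT)
qed

text \<open>Since \<open>dl\<close> kills the left factor, the Leibniz rule reads
  \<open>dl (G * H) = G * dl H\<close>.\<close>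

lemma prodF_Bc_right:
  fixes F G :: "int \<Rightarrow> 'k::field zz"
  assumes G: "G \<in> Zc m q" and F: "F \<in> Bc m p"
  shows "prodF q G p F \<in> Bc m (q + p)"
proof (cases p)
  case 0
  then have "F = 0" using F by (simp add: Bc_simps)
  then have "prodF q G p F = 0" by (simp add: prodF_def fun_eq_iff)
  then show ?thesis by (simp add: Bc_grp)
next
  case (Suc k)
  then obtain H where H: "H \<in> Cc m k" "F = dF k H" using F by (auto simp: Bc_simps)
  have Gc: "G \<in> Cc m q" and dG: "dl (toT q G) = 0" using G by (auto simp: Zc_toT)
  have Fc: "F \<in> Cc m p" using comp_diff(1)[OF H(1)] H(2) Suc by simp
  have P: "prodF q G k H \<in> Cc m (q + k)" by (rule prodF_Cc[OF Gc H(1)])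
  have "toT (q + p) (prodF q G p F) = toT (q + p) (dF (q + k) (prodF q G k H))"
    using dl_toT[OF P] prod_toT[OF Gc Fc] prod_toT[OF Gc H(1)] dl_toT[OF H(1)] dG dl_mult[of "toT q G" "toT k H"]
    by (simp add: Suc H(2))
  then have "prodF q G p F = dF (q + k) (prodF q G k H)"
    using comp_diff(1)[OF P] prodF_Cc[OF Gc Fc] by (intro toT_inj[where m = m and n = "q + p"]) (simp_all add: Suc)
  then show ?thesis using P by (auto simp: Suc Bc_simps)
qed

lemma prodF_Bc_left:
  fixes F G :: "int \<Rightarrow> 'k::field zz"
  assumes G: "G \<in> Bc m q" and F: "F \<in> Zc m p"
  shows "prodF q G p F \<in> Bc m (q + p)"
proof (cases q)
  case 0
  then have "G = 0" using G by (simp add: Bc_simps)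
  then have "prodF q G p F = 0" by (simp add: prodF_def fun_eq_iff)
  then show ?thesis by (simp add: Bc_grp)
next
  case (Suc k)
  then obtain H where H: "H \<in> Cc m k" "G = dF k H" using G by (auto simp: Bc_simps)
  have Gc: "G \<in> Cc m q" using comp_diff(1)[OF H(1)] H(2) Suc by simp
  have Fc: "F \<in> Cc m p" and dF0: "dF p F = 0" using F by (auto simp: Zc_def)
  \<comment> \<open>The Leibniz rule applies \<open>hat\<close> to the right factor; the sign put
    into \<open>F'\<close> undoes this.\<close>
  define F' where "F' = (if even p then F else - F)"
  have F'c: "F' \<in> Cc m p" by (simp add: F'_def Fc Cc_neg)
  have dF': "dl (toT p F') = 0" unfolding dl_toT[OF F'c] using dF0 by (simp add: F'_def toT_lin dF_neg)
  have hF: "hat (toT p F') = toT p F" by (simp add: tw_eq_iff tc_hat F'_def)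
  have P: "prodF k H p F' \<in> Cc m (k + p)" by (rule prodF_Cc[OF H(1) F'c])
  have "toT (q + p) (prodF q G p F) = toT (q + p) (dF (k + p) (prodF k H p F'))"
    using dl_toT[OF P] prod_toT[OF Gc Fc] prod_toT[OF H(1) F'c] dl_toT[OF H(1)] dF' hF dl_mult[of "toT k H" "toT p F'"]
    by (simp add: Suc H(2))
  then have "prodF q G p F = dF (k + p) (prodF k H p F')"
    using comp_diff(1)[OF P] prodF_Cc[OF Gc Fc] by (intro toT_inj[where m = m and n = "q + p"]) (simp_all add: Suc)
  then show ?thesis using P by (auto simp: Suc Bc_simps)
qed

abbreviation "mkL k n \<nu> \<equiv> target.mkhom m Lc (Rc k) (PR k) (Tau k) n \<nu>"
abbreviation "evL k n L \<equiv> target.nv m (Tau k) n L"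
abbreviation "HL k \<equiv> bim.Hc Lc (Rc k)"

definition liftL :: "nat \<Rightarrow> (int \<Rightarrow> 'k::field zz) \<Rightarrow> nat \<Rightarrow> 'k pres \<Rightarrow> 'k pres" where
  "liftL q G k = mkL k (q + k) (lamc q G k)"

lemma liftL:
  fixes G :: "int \<Rightarrow> 'k::field zz"
  assumes G: "G \<in> Cc m q"
  shows "liftL q G k \<in> bimod_hom (Lam m 1) (PR (q + k)) (PR k)" "evL k (q + k) (liftL q G k) = lamc q G k"
proof -
  have ok: "bim.okn Lc (Rc k) m (q + k) (lamc q G k)" by (rule target.okn_zE[OF tco]) (rule lamc_zE[OF G])
  show "liftL q G k \<in> bimod_hom (Lam m 1) (PR (q + k)) (PR k)"
    unfolding liftL_def by (rule target.mkhom(1)[OF tco ok Mc_co[OF lamc_Pc[OF G]]])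
  show "evL k (q + k) (liftL q G k) = lamc q G k"
    unfolding liftL_def by (rule target.nv_mkhom[OF tco ok Mc_co[OF lamc_Pc[OF G]] lamc_out[OF G]])
qed

abbreviation "LI q g \<equiv> liftings (Lam m 1) (res m 1) (res_diff m 1) (res_aug m 1) q g"

lemma liftL_LI:
  fixes G :: "int \<Rightarrow> 'k::field zz"
  assumes G: "G \<in> Zc m q"
  shows "liftL q G \<in> LI q (mk q G)"
proof -
  have Gc: "G \<in> Cc m q" using G by (simp add: Zc_def)
  note L = liftL[OF Gc]
  have L0: "liftL q G 0 \<in> bimod_hom (Lam m 1) (PR q) (PR 0)" "evL 0 q (liftL q G 0) = lamc q G 0" using L[of 0] by simp_all
  note c0 = target.comp_hom[OF treg res_aug(1) L0(1)]
  have "ev q (compose (carrier (PR q)) (res_aug m 1) (liftL q G 0)) = G"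
    unfolding c0(2) res_aug(2) L0(2) by (simp add: Hc_regular eps0_def lamc_def sg_def)
  then have a: "compose (carrier (PR q)) (res_aug m 1) (liftL q G 0) = mk q G" using ev_Cc(2)[OF c0(1)] by simp
  have b: "compose (carrier (PR (q + Suc k))) (res_diff m 1 (Suc k)) (liftL q G (Suc k)) =
    compose (carrier (PR (q + Suc k))) (liftL q G k) (res_diff m 1 (q + Suc k))" for k
  proof -
    note c = target.comp_hom[OF tco res_diff(1) L(1)[of "Suc k"]]
    have d: "res_diff m 1 (q + Suc k) \<in> bimod_hom (Lam m 1) (PR (q + Suc k)) (PR (q + k) :: ('k lam, 'k pres) bimodule)"
      "evL (q + k) (q + Suc k) (res_diff m 1 (q + Suc k) :: 'k pres \<Rightarrow> 'k pres) = nd (q + k)"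
      using res_diff[of "q + k", where 'k = 'k] by simp_all
    note e = target.comp_hom[OF tco L(1) d(1)]
    show ?thesis
    proof (rule target.hom_eqI[OF tco c(1) e(1)])
      show "evL k (q + Suc k) (compose (carrier (PR (q + Suc k))) (res_diff m 1 (Suc k)) (liftL q G (Suc k))) =
        evL k (q + Suc k) (compose (carrier (PR (q + Suc k))) (liftL q G k) (res_diff m 1 (q + Suc k)))"
        unfolding c(2) e(2) res_diff(2) d(2) L(2) Hc_nd lamc_chain[OF G] ..
    qed
  qed
  show ?thesis unfolding liftings_def using L(1) a b by blast
qed

lemma Mc_co_Pc: "x \<in> target.Mc (PR k :: ('k::field lam, 'k pres) bimodule) (Tau k) \<Longrightarrow> x \<in> Pc m k"
  unfolding target.Mc_def[OF tco] using Tau_Pc by blast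

lemma HL_Pc:
  assumes "\<And>s. \<nu> s \<in> Pc m k" "q \<in> Pc m n"
  shows "HL k n \<nu> q \<in> (Pc m k :: 'k::field coord set)"
  by (rule Mc_co_Pc, rule target.Hc_Mc[OF tco]) (rule Mc_co assms)+

lemma HF_per:
  assumes F: "F \<in> Cc m n" and x: "x \<in> Pc m n"
  shows "per m (HF n F x :: 'k::field zz)"
proof -
  have "HF n F x \<in> target.Mc (regular_bimod (Lam m 1) :: ('k lam, 'k lam) bimodule) (alpha m)"
    by (rule target.Hc_Mc[OF treg Cc_Mc[OF F] x])
  then show ?thesis unfolding target.Mc_def[OF treg] using coordalg.al_simps(1)[OF calg[where 'k = 'k]] by (auto simp: regular_bimod_def)
qed

text \<open>Two liftings differ by a chain map that lifts zero; it is contracted with the explicit homotopies \<open>sc\<close>.\<close>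

lemma lift_unique:
  fixes F G :: "int \<Rightarrow> 'k::field zz"
  assumes F: "F \<in> Zc m p" and G: "G \<in> Zc m q" and L: "L \<in> LI q (mk q G)"
  shows "compose (carrier (PR (q + p))) (mk p F) (L p) \<in> hom0 (q + p)"
    "ev (q + p) (compose (carrier (PR (q + p))) (mk p F) (L p)) - prodF q G p F \<in> Bc m (q + p)"
proof -
  have Gc: "G \<in> Cc m q" and Fc: "F \<in> Cc m p" and dF0: "dF p F = 0" using F G by (auto simp: Zc_def)
  have L1: "L k \<in> bimod_hom (Lam m 1) (PR (q + k)) (PR k)" for k using L by (auto simp: liftings_def)
  have L2: "compose (carrier (PR q)) (res_aug m 1) (L 0) = mk q G" using L by (auto simp: liftings_def)
  have L3: "compose (carrier (PR (q + Suc k))) (res_diff m 1 (Suc k)) (L (Suc k)) =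
    compose (carrier (PR (q + Suc k))) (L k) (res_diff m 1 (q + Suc k))" for k using L by (auto simp: liftings_def)
  define \<nu> where "\<nu> k = evL k (q + k) (L k)" for k
  have nuPc: "\<nu> k s \<in> Pc m k" for k s
  proof (cases "0 \<le> s \<and> s \<le> int (q + k)")
    case True
    then show ?thesis unfolding \<nu>_def by (intro Mc_co_Pc target.nv_Mc[OF tco L1]) simp
  next
    case False
    show ?thesis unfolding \<nu>_def target.nv_out[OF tco False] by (rule Pc_group)
  qed
  have nu0: "HF 0 eps0 (\<nu> 0 s) = G s" for s
  proof -
    have L0: "L 0 \<in> bimod_hom (Lam m 1) (PR q) (PR 0)" using L1[of 0] by simp
    have "ev q (mk q G) = (\<lambda>s. HF 0 eps0 (\<nu> 0 s))"
      using target.comp_hom(2)[OF treg res_aug(1) L0] unfolding L2 res_aug(2) \<nu>_def by simp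
    then show ?thesis unfolding mk_hom(2)[OF Gc] by (simp add: fun_eq_iff)
  qed
  have nuS: "dc k (\<nu> (Suc k) s) = HL k (q + k) (\<nu> k) (nd (q + k) s)" for k s
  proof -
    have d: "res_diff m 1 (q + Suc k) \<in> bimod_hom (Lam m 1) (PR (q + Suc k)) (PR (q + k) :: ('k lam, 'k pres) bimodule)"
      "evL (q + k) (q + Suc k) (res_diff m 1 (q + Suc k) :: 'k pres \<Rightarrow> 'k pres) = nd (q + k)"
      using res_diff[of "q + k", where 'k = 'k] by simp_all
    have "(\<lambda>s. HL k (Suc k) (nd k) (\<nu> (Suc k) s)) = (\<lambda>s. HL k (q + k) (\<nu> k) (nd (q + k) s))"
      using target.comp_hom(2)[OF tco res_diff(1) L1[of "Suc k"]] target.comp_hom(2)[OF tco L1 d(1)]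
      unfolding L3 res_diff(2) d(2) \<nu>_def by simp
    then show ?thesis unfolding Hc_nd by (rule fun_cong)
  qed
  \<comment> \<open>The difference from the explicit lifting; it is a chain map over zero.\<close>
  define \<mu> where "\<mu> k s = \<nu> k s - lamc q G k s" for k s
  have muPc: "\<mu> k s \<in> Pc m k" for k s
    using Pc_group(2)[OF nuPc Pc_group(3)[OF lamc_Pc[OF Gc]]] by (simp add: \<mu>_def)
  have muout: "\<mu> k s = 0" if "\<not> (0 \<le> s \<and> s \<le> int (q + k))" for k s
    unfolding \<mu>_def lamc_out[OF Gc that] \<nu>_def target.nv_out[OF tco that] by simp
  have muzE: "Lc (zE m i) (\<mu> k s) = Rc k (\<mu> k s) (zE m (i + (int (q + k) - 2 * s)))" for i k s
  proof (cases "0 \<le> s \<and> s \<le> int (q + k)")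
    case True
    then have s: "0 \<le> s" "s \<le> int (q + k)" by auto
    show ?thesis
      unfolding \<mu>_def bim.l_diff[OF bim_coord] bim.r_diff[OF bim_coord] lamc_zE[OF Gc] \<nu>_def target.nv_zE[OF tco L1 s] ..
  next
    case False
    show ?thesis unfolding muout[OF False] by (simp only: bim.l_0[OF bim_coord] bim.r_0[OF bim_coord])
  qed
  have mu0: "HF 0 (\<lambda>s. if s = 0 then 1 else 0) (\<mu> 0 s) = 0" for s
    using nu0[of s] unfolding \<mu>_def bim.Hc_diff[OF bim_regular] eps0_def by (simp add: Hc_regular lamc_def sg_def)
  have muS: "dc k (\<mu> (Suc k) s) = HL k (q + k) (\<mu> k) (nd (q + k) s)" for k s
  proof -
    have "dc k (\<mu> (Suc k) s) = dc k (\<nu> (Suc k) s) - dc k (lamc q G (Suc k) s)"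
      unfolding \<mu>_def Hc_nd[symmetric] bim.Hc_diff[OF bim_coord] ..
    also have "\<dots> = HL k (q + k) (\<mu> k) (nd (q + k) s)"
      unfolding nuS lamc_chain[OF G] \<mu>_def bim.Hc_nu_diff[OF bim_coord] ..
    finally show ?thesis .
  qed
  \<comment> \<open>The usual recursion for a null homotopy, given by values on the
    \<open>G_s\<close>, with \<open>sc\<close> in place of a choice from projectivity:
    \<open>\<eta> (k + 1)\<close> is \<open>sc\<close> of \<open>\<mu> (k + 1)\<close> minus the
    composite of \<open>\<eta> k\<close> with the differential.\<close>
  define \<eta> where "\<eta> = rec_nat (\<lambda>s. sc 0 (\<mu> 0 s)) (\<lambda>k h s. sc (Suc k) (\<mu> (Suc k) s - HL (Suc k) (q + k) h (nd (q + k) s)))"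
  have e0: "\<eta> 0 s = sc 0 (\<mu> 0 s)" for s by (simp add: \<eta>_def)
  define X where "X k s = \<mu> (Suc k) s - HL (Suc k) (q + k) (\<eta> k) (nd (q + k) s)" for k s
  have eS: "\<eta> (Suc k) s = sc (Suc k) (X k s)" for k s by (simp add: \<eta>_def X_def)
  have szE: "Lc (zE m i) (sc n x) = Rc (Suc n) (sc n x) (zE m j)" if "Lc (zE m i) x = Rc n x (zE m j)" for i j n and x :: "'k coord"
    unfolding sc_Lc[symmetric] that sc_Rc ..
  \<comment> \<open>The values vanish outside the range of \<open>s\<close> and keep the shift rule,
    so that each \<open>\<eta> k\<close> extends to a bimodule homomorphism.\<close>
  have I: "(\<forall>s. \<eta> k s \<in> Pc m (Suc k)) \<and> (\<forall>s. \<not> (0 \<le> s \<and> s \<le> int (q + k)) \<longrightarrow> \<eta> k s = 0) \<and>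
    (\<forall>s i. Lc (zE m i) (\<eta> k s) = Rc (Suc k) (\<eta> k s) (zE m (i + (int (q + k) - 2 * s))))" for k
  proof (induction k)
    case 0
    show ?case unfolding e0 using sc_Pc[OF muPc] muout[of _ 0] szE[OF muzE[of _ 0]] by (auto simp: sc_0)
  next
    case (Suc k)
    then have IH: "\<eta> k s \<in> Pc m (Suc k)" "Lc (zE m i) (\<eta> k s) = Rc (Suc k) (\<eta> k s) (zE m (i + (int (q + k) - 2 * s)))" for s i
      by blast+
    have ok: "bim.okn Lc (Rc (Suc k)) m (q + k) (\<eta> k)" by (rule target.okn_zE[OF tco]) (rule IH(2))
    have XPc: "X k s \<in> Pc m (Suc k)" for s
      using Pc_group(2)[OF muPc Pc_group(3)[OF HL_Pc[OF IH(1) nd_Pc]]] by (simp add: X_def)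
    have Xout: "X k s = 0" if "\<not> (0 \<le> s \<and> s \<le> int (q + Suc k))" for s
    proof -
      have N: "\<not> (0 \<le> s \<and> s \<le> int (Suc (q + k)))" using that by simp
      show ?thesis unfolding X_def muout[OF that] nd_out[OF N] bim.Hc_0[OF bim_coord] by simp
    qed
    have XzE: "Lc (zE m i) (X k s) = Rc (Suc k) (X k s) (zE m (i + (int (q + Suc k) - 2 * s)))" for s i
    proof -
      have i: "i + (int (q + k) + 1 - 2 * s) = i + (int (q + Suc k) - 2 * s)" by simp
      show ?thesis
        unfolding X_def bim.l_diff[OF bim_coord] bim.r_diff[OF bim_coord] muzE
          bim.Hc_Lc[OF bim_coord, symmetric] nd_zE i bim.Hc_Rc[OF bim_coord ok per_zE] ..
    qed
    show ?case
    proof (intro conjI allI impI)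
      show "\<eta> (Suc k) s \<in> Pc m (Suc (Suc k))" for s unfolding eS by (rule sc_Pc[OF XPc])
      show "\<eta> (Suc k) s = 0" if "\<not> (0 \<le> s \<and> s \<le> int (q + Suc k))" for s unfolding eS Xout[OF that] by (rule sc_0)
      show "Lc (zE m i) (\<eta> (Suc k) s) = Rc (Suc (Suc k)) (\<eta> (Suc k) s) (zE m (i + (int (q + Suc k) - 2 * s)))" for s i
        unfolding eS by (rule szE[OF XzE])
    qed
  qed
  have ok: "bim.okn Lc (Rc (Suc k)) m (q + k) (\<eta> k)" for k by (rule target.okn_zE[OF tco]) (use I in blast)
  have etaPc: "\<eta> k s \<in> Pc m (Suc k)" for k s using I by blast
  have XPc: "X k s \<in> Pc m (Suc k)" for k s
    using Pc_group(2)[OF muPc Pc_group(3)[OF HL_Pc[OF etaPc nd_Pc]]] by (simp add: X_def)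
  have okd: "bim.okn Lc (Rc k) m (Suc k) (nd k :: int \<Rightarrow> 'k coord)" for k
    using target.nv_okn[OF tco res_diff(1)] unfolding res_diff(2) .
  have D0: "dc 0 (\<eta> 0 s) = \<mu> 0 s" for s unfolding e0 by (rule exact_aug[OF muPc mu0])
  have dcH: "dc k (HL (Suc k) (q + k) (\<eta> k) x) = HL k (q + k) (\<lambda>s. dc k (\<eta> k s)) x" for k x
    unfolding Hc_nd[symmetric] by (rule bim.Hc_comp[OF bim_coord okd])
  \<comment> \<open>\<open>exact_dc\<close> applies because \<open>X k\<close> is a cycle:
    \<open>d \<mu>_(k+1) - d \<eta>_k d = (\<mu>_k - d \<eta>_k) d\<close>, which is 0 for
    \<open>k = 0\<close> and \<open>\<eta>_(k-1) d d = 0\<close> otherwise.\<close>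
  have DS: "dc (Suc k) (\<eta> (Suc k) s) = X k s" for k s
  proof (induction k arbitrary: s)
    case 0
    have "dc 0 (X 0 s) = 0"
      unfolding X_def Hc_nd[symmetric, of 0] bim.Hc_diff[OF bim_coord] unfolding Hc_nd muS dcH D0 by simp
    then show ?case unfolding eS by (rule exact_dc[OF XPc])
  next
    case (Suc k)
    have "HL (Suc k) (q + Suc k) (\<lambda>s. HL (Suc k) (q + k) (\<eta> k) (nd (q + k) s)) (nd (q + Suc k) s)
       = HL (Suc k) (q + k) (\<eta> k) (HL (q + k) (Suc (q + k)) (nd (q + k)) (nd (Suc (q + k)) s))"
      unfolding bim.Hc_comp[OF bim_coord ok] by simp
    also have "\<dots> = 0" unfolding Hc_nd dc_nd by (rule bim.Hc_0[OF bim_coord])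
    finally have z: "HL (Suc k) (q + Suc k) (\<lambda>s. HL (Suc k) (q + k) (\<eta> k) (nd (q + k) s)) (nd (q + Suc k) s) = 0" .
    have "dc (Suc k) (X (Suc k) s) = 0"
      unfolding X_def[of "Suc k"] Hc_nd[symmetric, of "Suc k"] bim.Hc_diff[OF bim_coord]
      unfolding Hc_nd muS dcH Suc.IH X_def[of k] bim.Hc_nu_diff[OF bim_coord] z by simp
    then show ?case unfolding eS by (rule exact_dc[OF XPc])
  qed
  note C = target.comp_hom[OF treg mk_hom(1)[OF Fc] L1[of p]]
  show "compose (carrier (PR (q + p))) (mk p F) (L p) \<in> hom0 (q + p)" by (rule C(1))
  have lam: "HF p F (lamc q G p s) = prodF q G p F s" for s
    unfolding Hc_regular prodF_def by (rule sum.cong[OF refl]) (simp add: lamc_def mult.assoc)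
  have E: "ev (q + p) (compose (carrier (PR (q + p))) (mk p F) (L p)) - prodF q G p F = (\<lambda>s. HF p F (\<mu> p s))"
    unfolding C(2) mk_hom(2)[OF Fc] \<mu>_def bim.Hc_diff[OF bim_regular] lam \<nu>_def by (simp add: fun_eq_iff)
  have Fdc: "HF p F (dc p x) = 0" for x
    unfolding Hc_nd[symmetric] bim.Hc_comp[OF bim_regular Cc_okn[OF Fc]] dF_def[symmetric] dF0 by (rule HF_0)
  show "ev (q + p) (compose (carrier (PR (q + p))) (mk p F) (L p)) - prodF q G p F \<in> Bc m (q + p)"
  proof (cases p)
    case 0
    have "(\<lambda>s. HF p F (\<mu> p s)) = 0"
      using Fdc[of "\<eta> 0 _"] unfolding 0 D0 by (simp add: fun_eq_iff)
    then show ?thesis unfolding E by (simp add: Bc_grp)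
  next
    case (Suc k)
    \<comment> \<open>In \<open>\<mu>_p = d \<eta>_p + \<eta>_(p-1) d\<close> the first summand is
      killed by the cocycle \<open>F\<close>. What remains is the coboundary of the composite of
      \<open>F\<close> with \<open>\<eta>_(p-1)\<close>.\<close>
    define F' where "F' s = HF p F (\<eta> k s)" for s
    have "\<mu> p s = dc p (\<eta> p s) + HL p (q + k) (\<eta> k) (nd (q + k) s)" for s
      unfolding Suc DS X_def by simp
    then have "HF p F (\<mu> p s) = HF p F (HL p (q + k) (\<eta> k) (nd (q + k) s))" for s
      by (simp only: bim.Hc_add[OF bim_regular] Fdc add_0_left)
    also have "HF p F (HL p (q + k) (\<eta> k) (nd (q + k) s)) = dF (q + k) F' s" for s
      unfolding bim.Hc_comp[OF bim_regular Cc_okn[OF Fc]] dF_def F'_def ..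
    finally have e: "(\<lambda>s. HF p F (\<mu> p s)) = dF (q + k) F'" by (simp add: fun_eq_iff)
    have "F' \<in> Cc m (q + k)"
      unfolding Cc_def mem_Collect_eq
    proof (intro conjI allI impI)
      fix s
      have "zE m i * F' s = F' s * zE m (i + (int (q + k) - 2 * s))" for i
      proof -
        have "zE m i * F' s = HF p F (Rc p (\<eta> k s) (zE m (i + (int (q + k) - 2 * s))))"
          unfolding F'_def bim.Hc_Lc[OF bim_regular, symmetric] using I[of k] Suc by metis
        then show ?thesis unfolding bim.Hc_Rc[OF bim_regular Cc_okn[OF Fc] per_zE] F'_def .
      qed
      moreover have "per m (F' s)" unfolding F'_def by (rule HF_per[OF Fc]) (use etaPc Suc in simp)
      ultimately show "gr m (int (q + k) - 2 * s) (F' s)" by (simp add: gr_def)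
      assume "\<not> (0 \<le> s \<and> s \<le> int (q + k))"
      then have "\<eta> k s = 0" using I by blast
      then show "F' s = 0" unfolding F'_def by (simp only: bim.Hc_0[OF bim_regular])
    qed
    then show ?thesis unfolding E e by (simp add: Suc Bc_simps)
  qed
qed

text \<open>By \<open>lift_unique\<close> and the stability of coboundaries under products, all
  choices in the union give one class; \<open>liftL\<close> shows that there is a choice at
  all.\<close>

lemma yoneda:
  fixes F G :: "int \<Rightarrow> 'k::field zz"
  assumes F: "F \<in> Zc m p" and G: "G \<in> Zc m q"
  shows "yoneda_prod (Lam m 1) (res m 1) (res_diff m 1) (res_aug m 1) p q (cls p F) (cls q G) = cls (q + p) (prodF q G p F)"
proof -
  have Gc: "G \<in> Cc m q" and Fc: "F \<in> Cc m p" using F G by (auto simp: Zc_def)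
  have BZ: "B \<in> Zc m n" if "B \<in> Bc m n" for B :: "int \<Rightarrow> 'k zz" and n
  proof (cases n)
    case 0
    then show ?thesis using that by (simp add: Bc_simps Zc_grp)
  next
    case (Suc k)
    note BB = that
    from Suc obtain H where H: "H \<in> Cc m k" "B = dF k H" using BB by (auto simp: Bc_simps)
    have "dF (Suc k) (dF k H) = 0"
    proof
      fix s
      have "dF (Suc k) (dF k H) s = HF k H (dc k (nd (Suc k) s))"
        unfolding dF_def Hc_nd[symmetric] bim.Hc_comp[OF bim_regular Cc_okn[OF H(1)]] ..
      then show "dF (Suc k) (dF k H) s = 0 s" unfolding dc_nd bim.Hc_0[OF bim_regular] by simp
    qed
    then show ?thesis using comp_diff(1)[OF H(1)] H(2) Suc by (simp add: Zc_def)
  qed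
  have *: "coho_class (Lam m 1) (res m 1) (res_diff m 1) (q + p) (compose (carrier (PR (q + p))) f (L p)) = cls (q + p) (prodF q G p F)"
    if f: "f \<in> cls p F" and g: "g \<in> cls q G" and L: "L \<in> LI q g" for f g L
  proof -
    obtain B where B: "B \<in> Bc m p" "f = mk p (B + F)" using f unfolding cls_eq[OF Fc] by blast
    obtain B' where B': "B' \<in> Bc m q" "g = mk q (B' + G)" using g unfolding cls_eq[OF Gc] by blast
    have Z: "B + F \<in> Zc m p" "B' + G \<in> Zc m q" using BZ[OF B(1)] BZ[OF B'(1)] F G by (auto intro: Zc_grp)
    note u = lift_unique[OF Z L[unfolded B'(2)], folded B(2)]
    let ?h = "compose (carrier (PR (q + p))) f (L p)"
    have "coho_class (Lam m 1) (res m 1) (res_diff m 1) (q + p) ?h = cls (q + p) (ev (q + p) ?h)"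
      unfolding cls_def ev_Cc(2)[OF u(1)] ..
    also have "\<dots> = cls (q + p) (prodF q G p F)"
    proof (rule iffD2[OF cls_iff[OF ev_Cc(1)[OF u(1)] prodF_Cc[OF Gc Fc]]])
      have "prodF q (B' + G) p (B + F) - prodF q G p F = prodF q B' p (B + F) + prodF q G p B"
        unfolding prodF_lin by simp
      then have "prodF q (B' + G) p (B + F) - prodF q G p F \<in> Bc m (q + p)"
        using Bc_grp(1)[OF prodF_Bc_left[OF B'(1) Z(1)] prodF_Bc_right[OF G B(1)]] by simp
      from Bc_grp(1)[OF u(2) this] show "ev (q + p) ?h - prodF q G p F \<in> Bc m (q + p)" by simp
    qed
    finally show ?thesis .
  qed
  have in1: "mk p F \<in> cls p F" "mk q G \<in> cls q G"
    unfolding cls_eq[OF Fc] cls_eq[OF Gc] by (rule image_eqI[of _ _ 0], simp only: add_0, rule Bc_grp(2))+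
  show ?thesis
    unfolding yoneda_prod_def
  proof (intro equalityI subsetI)
    fix x assume "x \<in> (\<Union>f\<in>cls p F. \<Union>g\<in>cls q G. \<Union>L\<in>LI q g.
       coho_class (Lam m 1) (res m 1) (res_diff m 1) (q + p) (compose (carrier (PR (q + p))) f (L p)))"
    then obtain f g L where f: "f \<in> cls p F" and g: "g \<in> cls q G" and L: "L \<in> LI q g"
      and x: "x \<in> coho_class (Lam m 1) (res m 1) (res_diff m 1) (q + p) (compose (carrier (PR (q + p))) f (L p))"
      by (elim UN_E) (rule that)
    show "x \<in> cls (q + p) (prodF q G p F)" using x unfolding *[OF f g L] .
  next
    fix x assume x: "x \<in> cls (q + p) (prodF q G p F)"
    show "x \<in> (\<Union>f\<in>cls p F. \<Union>g\<in>cls q G. \<Union>L\<in>LI q g.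
       coho_class (Lam m 1) (res m 1) (res_diff m 1) (q + p) (compose (carrier (PR (q + p))) f (L p)))"
      by (rule UN_I[OF in1(1)], rule UN_I[OF in1(2)], rule UN_I[OF liftL_LI[OF G]])
        (use x *[OF in1 liftL_LI[OF G]] in simp)
  qed
qed

end

section \<open>The cohomology ring modulo nilpotents\<close>

text \<open>Families of values are indexed by integers and those in \<open>tw\<close> by natural
  numbers; the negative indices are filled with zero.\<close>

definition row :: "'k::field zz tw \<Rightarrow> nat \<Rightarrow> int \<Rightarrow> 'k zz" where
  "row X n = (\<lambda>s. if 0 \<le> s then tc X n (nat s) else 0)"

lemma hom_part_row: "hom_part n X = toT n (row X n)"
  by (simp add: tw_eq_iff tc_hom_part row_def)

lemma row_simps: "row 0 n = 0" "row (X + Y) n = row X n + row Y n" "row (X - Y) n = row X n - row Y n" "row (- X) n = - row X n"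
  "row X n (int r) = tc X n r"
  by (simp_all add: row_def fun_eq_iff)

lemma row_hom_part: "row (hom_part n X) k = (if k = n then row X n else 0)"
  by (simp add: row_def tc_hom_part fun_eq_iff)

lemma row_eqI: "(\<And>n. row X n = row Y n) \<Longrightarrow> X = Y"
  by (metis row_simps(5) tw_eq_iff)

lemma fun_sum: "(\<Sum>x\<in>S. f x) s = (\<Sum>x\<in>S. f x s :: 'a::comm_monoid_add)"
  by (induction S rule: infinite_finite_induct) simp_all

lemma row_sum: "row (\<Sum>i\<in>S. f i) n = (\<Sum>i\<in>S. row (f i) n)"
  by (induction S rule: infinite_finite_induct) (simp_all add: row_simps)

lemma Zc_Cc: "F \<in> Zc m n \<Longrightarrow> F \<in> Cc m n"
  by (simp add: Zc_def)

lemma Zc_sum: "(\<And>i. i \<in> S \<Longrightarrow> f i \<in> Zc m n) \<Longrightarrow> sum f S \<in> Zc m n"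
  by (induction S rule: infinite_finite_induct) (simp_all add: Zc_grp)

text \<open>The sum is arranged by the degree \<open>p\<close> of the right factor, to match the sum
  that defines the product in \<open>Ext_alg\<close>.\<close>

lemma row_mult:
  assumes Y: "\<And>n. row Y n \<in> Cc m n" and X: "\<And>n. row X n \<in> Cc m n"
  shows "row (Y * X) n = (\<Sum>p\<le>n. prodF (n - p) (row Y (n - p)) p (row X p))"
proof
  fix s
  have "row (Y * X) n s = (\<Sum>p\<le>n. prodF p (row Y p) (n - p) (row X (n - p)) s)"
  proof (cases "0 \<le> s")
    case True
    define r where "r = nat s"
    have s: "s = int r" using True by (simp add: r_def)
    have "tc (Y * X) n r = (\<Sum>p\<le>n. tc (hom_part p Y * hom_part (n - p) X) n r)"
      unfolding tc_mult[of Y X] by (rule sum.cong[OF refl], simp only: tc_mult_hom_part, simp)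
    also have "\<dots> = (\<Sum>p\<le>n. prodF p (row Y p) (n - p) (row X (n - p)) (int r))"
      unfolding hom_part_row prod_toT[OF Y X] tc_toT by (rule sum.cong[OF refl]) simp
    finally show ?thesis unfolding s row_simps(5) .
  next
    case False
    have "prodF p (row Y p) (n - p) (row X (n - p)) s = 0" for p
      by (rule CcD(2)[OF prodF_Cc[OF Y X]]) (use False in simp)
    then show ?thesis using False by (simp add: row_def)
  qed
  also have "\<dots> = (\<Sum>p\<le>n. prodF (n - p) (row Y (n - p)) p (row X p) s)"
    by (rule sum.reindex_bij_witness[of _ "\<lambda>p. n - p" "\<lambda>p. n - p"]) auto
  finally show "row (Y * X) n s = (\<Sum>p\<le>n. prodF (n - p) (row Y (n - p)) p (row X p)) s" by (simp add: fun_sum)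
qed

text \<open>The cocycles with finitely many nonzero degrees. They form a subring of the convolution
  ring, of which the cohomology ring is a quotient with reversed multiplication.\<close>

definition Zt :: "nat \<Rightarrow> 'k::field zz tw set" where
  "Zt m = {X. (\<forall>n. row X n \<in> Zc m n) \<and> finite {n. row X n \<noteq> 0}}"

lemma ZtD: "X \<in> Zt m \<Longrightarrow> row X n \<in> Zc m n" "X \<in> Zt m \<Longrightarrow> row X n \<in> Cc m n"
  by (auto simp: Zt_def Zc_def)

lemma Zt_bound: "X \<in> Zt m \<Longrightarrow> \<exists>N. \<forall>n>N. row X n = 0"
proof -
  assume "X \<in> Zt m"
  then have "finite {n. row X n \<noteq> 0}" by (simp add: Zt_def)
  then obtain N where "\<forall>n\<in>{n. row X n \<noteq> 0}. n \<le> N" unfolding finite_nat_set_iff_bounded_le by blast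
  then have "\<forall>n>N. row X n = 0" by force
  then show ?thesis ..
qed

lemma ZtI: "(\<And>n. row X n \<in> Zc m n) \<Longrightarrow> (\<And>n. n > N \<Longrightarrow> row X n = 0) \<Longrightarrow> X \<in> Zt m"
proof -
  assume Z: "\<And>n. row X n \<in> Zc m n" and "\<And>n. n > N \<Longrightarrow> row X n = 0"
  then have "{n. row X n \<noteq> 0} \<subseteq> {..N}" by (metis (mono_tags, lifting) atMost_iff mem_Collect_eq not_le subsetI)
  then have "finite {n. row X n \<noteq> 0}" by (rule finite_subset) simp
  then show ?thesis using Z by (simp add: Zt_def)
qed

text \<open>Only the scalars at vertex 0 are read; for a cocycle they determine those at all other
  vertices.\<close>

definition phi :: "'k::field zz tw \<Rightarrow> 'k fps fps" where
  "phi X = Abs_fps (\<lambda>n. Abs_fps (\<lambda>r. ce (tc X n r) 0))"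

lemma phi_nth [simp]: "fps_nth (fps_nth (phi X) n) r = ce (tc X n r) 0"
  by (simp add: phi_def)

lemma phi_add: "phi (X + Y) = phi X + phi Y" and phi_0: "phi 0 = 0"
  by (rule ff_eqI, simp)+

lemma phi_T: assumes X: "X \<in> Zt m" shows "phi X \<in> Tset m"
proof -
  obtain N where "\<forall>n>N. row X n = 0" using Zt_bound[OF X] by blast
  then have N: "row X n = 0" if "n > N" for n using that by blast
  show ?thesis
  proof (rule TsetI)
    fix n r
    show "fps_nth (fps_nth (phi X) n) r = 0" if a: "n > N"
    proof -
      have "row X n = 0" by (rule N[OF a])
      then have "row X n (int r) = 0" by simp
      then show ?thesis by (simp add: row_simps(5))
    qed
    assume "fps_nth (fps_nth (phi X) n) r \<noteq> 0"
    then have c: "ce (row X n (int r)) 0 \<noteq> 0" by (simp add: row_simps(5))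
    then have "row X n (int r) \<noteq> 0" by auto
    then have "int r \<le> int n" using CcD(2)[OF ZtD(2)[OF X], of "int r" n] by force
    then show "r \<le> n \<and> int m dvd int n - 2 * int r" using gr_ce[OF CcD(1)[OF ZtD(2)[OF X]] c] by simp
  qed
qed

text \<open>A nonzero scalar in degree \<open>p\<close> forces m to divide \<open>p - 2 * t\<close>,
  so \<open>p\<close> is even and the twisting sign is 1. Commutativity of the target allows the
  exchange of the factors.\<close>

lemma phi_mult:
  assumes X: "X \<in> Zt m" and Y: "Y \<in> Zt m" and m: "even m"
  shows "phi (Y * X) = phi X * phi Y"
proof (rule ff_eqI)
  fix n r
  have s: "ce ((- 1) ^ (p * (r - t)) * (tc Y p t * tc X (n - p) (r - t))) 0 = ce (tc Y p t) 0 * ce (tc X (n - p) (r - t)) 0" for p t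
  proof (cases "ce (tc Y p t) 0 = 0")
    case True
    then show ?thesis by (cases "even (p * (r - t))") simp_all
  next
    case False
    then have "fps_nth (fps_nth (phi Y) p) t \<noteq> 0" by simp
    from TsetD[OF phi_T[OF Y] this] have "int m dvd int p - 2 * int t" by simp
    moreover have "2 dvd int m" using m by simp
    ultimately have "2 dvd int p - 2 * int t" by (rule dvd_trans[rotated])
    then have "even p" by simp
    then show ?thesis by simp
  qed
  have "fps_nth (fps_nth (phi (Y * X)) n) r = (\<Sum>p\<le>n. \<Sum>t\<le>r. ce (tc Y p t) 0 * ce (tc X (n - p) (r - t)) 0)"
    unfolding phi_nth tc_mult zz_sum_sel s ..
  also have "\<dots> = fps_nth (fps_nth (phi Y * phi X) n) r"
    by (simp add: fps_mult_nth fps_sum_nth atLeast0AtMost)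
  finally show "fps_nth (fps_nth (phi (Y * X)) n) r = fps_nth (fps_nth (phi X * phi Y) n) r" by (simp add: mult.commute)
qed

text \<open>Every summand of every coefficient is, up to sign, a product of three radical
  values.\<close>

lemma tw_cube:
  assumes "\<And>n r. rad (tc Y n r)" shows "Y * (Y * Y) = (0 :: 'k::field zz tw)"
proof -
  have z: "tc Y a b * (w * (tc Y c d * tc Y e f)) = 0" if "w = (- 1) ^ j" for a b c d e f j and w :: "'k zz"
    using rad3[OF assms assms assms, of a b c d e f] that by (cases "even j") (simp_all add: mult.assoc)
  have "tc (Y * (Y * Y)) n r = 0" for n r
    unfolding tc_mult[of Y "Y * Y"] unfolding tc_mult sum_distrib_left
    by (intro sum.neutral ballI) (simp only: z[OF refl] mult_zero_right)
  then show ?thesis by (simp add: tw_eq_iff)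
qed

context cyc
begin

text \<open>Every term of the differential has a factor \<open>zA\<close> or \<open>zB\<close>.
  Hence the scalars of a cocycle depend only on its class.\<close>

lemma Bc_rad:
  assumes "B \<in> Bc m n" shows "ce (B s :: 'k::field zz) i = 0"
proof (cases n)
  case 0
  then show ?thesis using assms by (simp add: Bc_simps)
next
  case (Suc k)
  with assms obtain F where F: "F \<in> Cc m k" "B = dF k F" by (auto simp: Bc_simps)
  show ?thesis unfolding F(2) dF_formula[OF F(1)] by (simp add: sg_def)
qed

text \<open>The coefficient of \<open>e_i a\<close> in the cocycle condition says that the scalars
  at \<open>i\<close> and \<open>i + 1\<close> agree up to sign, so a zero at vertex 0 propagates
  around the cycle.\<close>

lemma Zc_ce_0:
  assumes F: "F \<in> Zc m n" and z: "\<And>s. ce (F s :: 'k::field zz) 0 = 0"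
  shows "ce (F s) i = 0"
proof -
  have Fc: "F \<in> Cc m n" and d: "dF n F = 0" using F by (auto simp: Zc_def)
  have "ca (dF n F s) i = ce (F s) i + (if even (int n + 1 + s) then ce (F s) (i + 1) else - ce (F s) (i + 1))" for i
    unfolding dF_formula[OF Fc] by (simp add: sg_def)
  note E = this
  have st: "ce (F s) (i + 1) = 0" if "ce (F s) i = 0" for i using E[of i] that d by (simp split: if_splits)
  have "ce (F s) (int j) = 0" for j
  proof (induction j)
    case 0
    then show ?case using z by simp
  next
    case (Suc j)
    then show ?case using st[of "int j"] by (simp add: add.commute)
  qed
  from this[of "nat (i mod int m)"] have "ce (F s) (i mod int m) = 0" using m_pos by simp
  moreover have "per m (F s)" using CcD(1)[OF Fc, of s] by (simp add: gr_def)
  ultimately show ?thesis using bim.per_parts(1)[OF bim_regular, of m "F s"] by simp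
qed

lemma eps0_Zc: "(eps0 :: int \<Rightarrow> 'k::field zz) \<in> Zc m 0"
proof -
  have c: "(eps0 :: int \<Rightarrow> 'k zz) \<in> Cc m 0" using ev_Cc(1)[OF res_aug(1)] unfolding res_aug(2) .
  have "dF 0 (eps0 :: int \<Rightarrow> 'k zz) s = 0" for s
    unfolding dF_formula[OF c] by (simp add: eps0_def sg_def)
  then show ?thesis using c by (simp add: Zc_def fun_eq_iff)
qed

lemma row_1: "row 1 n = (if n = 0 then eps0 else (0 :: int \<Rightarrow> 'k::field zz))"
  by (auto simp: row_def eps0_def fun_eq_iff)

lemma Zt_closed:
  shows "0 \<in> (Zt m :: 'k::field zz tw set)" "1 \<in> (Zt m :: 'k zz tw set)" "X \<in> Zt m \<Longrightarrow> Y \<in> Zt m \<Longrightarrow> X + Y \<in> (Zt m :: 'k zz tw set)"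
    "X \<in> Zt m \<Longrightarrow> - X \<in> (Zt m :: 'k zz tw set)" "X \<in> Zt m \<Longrightarrow> Y \<in> Zt m \<Longrightarrow> Y * X \<in> (Zt m :: 'k zz tw set)"
    "X \<in> Zt m \<Longrightarrow> hom_part n X \<in> (Zt m :: 'k zz tw set)" "X \<in> Zt m \<Longrightarrow> Tw (\<lambda>n r. zK c * tc X n r) \<in> (Zt m :: 'k zz tw set)"
proof -
  show "0 \<in> (Zt m :: 'k zz tw set)" by (rule ZtI[of _ _ 0]) (simp_all add: row_simps Zc_grp)
  show "1 \<in> (Zt m :: 'k zz tw set)" by (rule ZtI[of _ _ 0]) (simp_all add: row_1 eps0_Zc Zc_grp)
  assume X: "X \<in> Zt m"
  obtain N where "\<forall>n>N. row X n = 0" using Zt_bound[OF X] by blast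
  then have N: "row X n = 0" if "n > N" for n using that by blast
  show "- X \<in> Zt m" by (rule ZtI[of _ _ N]) (simp_all add: row_simps ZtD[OF X] Zc_grp N)
  show "hom_part n X \<in> Zt m" by (rule ZtI[of _ _ n]) (simp_all add: row_hom_part ZtD[OF X] Zc_grp)
  have "row (Tw (\<lambda>n r. zK c * tc X n r)) n = (\<lambda>s. zK c * row X n s)" for n by (simp add: row_def fun_eq_iff)
  then show "Tw (\<lambda>n r. zK c * tc X n r) \<in> Zt m" by (intro ZtI[of _ _ N]) (simp_all add: ZtD[OF X] Zc_grp N zero_fun_def)
  assume Y: "Y \<in> Zt m"
  obtain N' where "\<forall>n>N'. row Y n = 0" using Zt_bound[OF Y] by blast
  then have N': "row Y n = 0" if "n > N'" for n using that by blast
  show "X + Y \<in> Zt m" by (rule ZtI[of _ _ "max N N'"]) (simp_all add: row_simps ZtD[OF X] ZtD[OF Y] Zc_grp N N')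
  note R = row_mult[OF ZtD(2)[OF Y] ZtD(2)[OF X]]
  show "Y * X \<in> Zt m"
  proof (rule ZtI)
    show "row (Y * X) n \<in> Zc m n" for n
      unfolding R
    proof (rule Zc_sum)
      fix p assume "p \<in> {..n}"
      then show "prodF (n - p) (row Y (n - p)) p (row X p) \<in> Zc m n"
        using prodF_Zc[OF ZtD(1)[OF Y] ZtD(1)[OF X], of "n - p" p] by simp
    qed
    show "row (Y * X) n = 0" if "n > N + N'" for n
      unfolding R
    proof (rule sum.neutral, rule ballI)
      fix p assume "p \<in> {..n}"
      then have "p > N \<or> n - p > N'" using that by auto
      then show "prodF (n - p) (row Y (n - p)) p (row X p) = 0"
        using N N' by (auto simp: prodF_def fun_eq_iff)
    qed
  qed
qed

lemma ExM_monoid: "abelian_monoid (ExM n :: ('k::field, ('k pres \<Rightarrow> 'k lam) set) module)"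
  by (rule abelian_monoidI) (auto simp: ext_sel(1) ExM_ops Zc_Cc Zc_grp ac_simps intro!: imageI)

lemma ExM_finsum:
  assumes "finite S" "\<And>p. p \<in> S \<Longrightarrow> f p \<in> Zc m n"
  shows "finsum (ExM n) (\<lambda>p. cls n (f p)) S = (cls n (\<Sum>p\<in>S. f p) :: ('k::field pres \<Rightarrow> 'k lam) set)"
  using assms
proof (induction S rule: finite_induct)
  case empty
  show ?case by (simp add: abelian_monoid.finsum_empty[OF ExM_monoid] ExM_ops zero_fun_def)
next
  case (insert x S)
  have Z: "sum f S \<in> Zc m n" by (rule Zc_sum) (use insert in auto)
  have "finsum (ExM n) (\<lambda>p. cls n (f p)) (insert x S) = cls n (f x) \<oplus>\<^bsub>ExM n\<^esub> (finsum (ExM n) (\<lambda>p. cls n (f p)) S :: ('k pres \<Rightarrow> 'k lam) set)"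
    by (rule abelian_monoid.finsum_insert[OF ExM_monoid]) (use insert in \<open>auto simp: ext_sel(1)\<close>)
  also have "finsum (ExM n) (\<lambda>p. cls n (f p)) S = (cls n (sum f S) :: ('k pres \<Rightarrow> 'k lam) set)"
    by (rule insert(3)) (use insert(4) in auto)
  also have "cls n (f x) \<oplus>\<^bsub>ExM n\<^esub> cls n (sum f S) = (cls n (f x + sum f S) :: ('k pres \<Rightarrow> 'k lam) set)"
    by (rule ExM_ops(2)[OF Zc_Cc Zc_Cc[OF Z]]) (use insert(4) in auto)
  finally show ?case unfolding sum.insert[OF insert(1,2)] .
qed

definition Th :: "'k::field zz tw \<Rightarrow> 'k hh" where
  "Th X = (\<lambda>n. cls n (row X n))"

abbreviation "HM \<equiv> (HH m 1 :: ('k::field, 'k hh) module)"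

lemma HH_sel:
  "x \<in> carrier HM \<longleftrightarrow> (\<forall>n. x n \<in> carrier (ExM n)) \<and> finite {n. x n \<noteq> (\<zero>\<^bsub>ExM n\<^esub> :: ('k::field pres \<Rightarrow> 'k lam) set)}"
  "x \<otimes>\<^bsub>HM\<^esub> y = (\<lambda>n. finsum (ExM n) (\<lambda>p. yoneda_prod (Lam m 1) (res m 1) (res_diff m 1) (res_aug m 1) p (n - p) (x p) (y (n - p))) {..n})"
  "\<one>\<^bsub>HM\<^esub> = homog (Lam m 1) (res m 1) (res_diff m 1) 0 (coho_class (Lam m 1) (res m 1) (res_diff m 1) 0 (res_aug m 1))"
  "\<zero>\<^bsub>HM\<^esub> = (\<lambda>n. \<zero>\<^bsub>ExM n\<^esub>)" "x \<oplus>\<^bsub>HM\<^esub> y = (\<lambda>n. x n \<oplus>\<^bsub>ExM n\<^esub> y n)" "c \<odot>\<^bsub>HM\<^esub> x = (\<lambda>n. c \<odot>\<^bsub>ExM n\<^esub> x n)"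
  unfolding HH_def Ext_alg_def by simp_all

lemma Th_carrier: "X \<in> Zt m \<Longrightarrow> Th X \<in> carrier (HM :: ('k::field, 'k hh) module)"
proof -
  assume X: "X \<in> Zt m"
  have "{n. Th X n \<noteq> \<zero>\<^bsub>ExM n\<^esub>} \<subseteq> {n. row X n \<noteq> 0}" by (auto simp: Th_def ExM_ops)
  then have "finite {n. Th X n \<noteq> \<zero>\<^bsub>ExM n\<^esub>}" by (rule finite_subset) (use X in \<open>simp add: Zt_def\<close>)
  then show ?thesis using ZtD(1)[OF X] by (auto simp: HH_sel(1) Th_def ext_sel(1))
qed

lemma Th_surj: "x \<in> carrier (HM :: ('k::field, 'k hh) module) \<Longrightarrow> \<exists>X\<in>Zt m. Th X = x"
proof -
  assume x: "x \<in> carrier (HM :: ('k, 'k hh) module)"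
  \<comment> \<open>The zero class gets the representative 0, so that the chosen cocycles have
    finite support.\<close>
  have "\<exists>F. F \<in> Zc m n \<and> x n = cls n F \<and> (x n = \<zero>\<^bsub>ExM n\<^esub> \<longrightarrow> F = 0)" for n
  proof (cases "x n = \<zero>\<^bsub>ExM n\<^esub>")
    case True
    then show ?thesis by (intro exI[of _ 0]) (simp add: Zc_grp ExM_ops)
  next
    case False
    have "x n \<in> carrier (ExM n)" using x by (simp add: HH_sel(1))
    then show ?thesis using False by (auto simp: ext_sel(1))
  qed
  then obtain F where F: "\<And>n. F n \<in> Zc m n" "\<And>n. x n = cls n (F n)" "\<And>n. x n = \<zero>\<^bsub>ExM n\<^esub> \<Longrightarrow> F n = 0" by metis
  define X where "X = Tw (\<lambda>n r. F n (int r))"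
  have rX: "row X n = F n" for n
  proof
    fix s
    show "row X n s = F n s" using CcD(2)[OF Zc_Cc[OF F(1)], of s n] by (auto simp: X_def row_def)
  qed
  have "finite {n. row X n \<noteq> 0}"
    by (rule finite_subset[of _ "{n. x n \<noteq> \<zero>\<^bsub>ExM n\<^esub>}"]) (use x F(3) in \<open>auto simp: HH_sel(1) rX\<close>)
  then have "X \<in> Zt m" using F(1) by (simp add: Zt_def rX)
  moreover have "Th X = x" using F(2) by (simp add: Th_def rX fun_eq_iff)
  ultimately show ?thesis by blast
qed

text \<open>In a Yoneda product the second factor is lifted and becomes the left factor of the
  convolution; therefore \<open>Th\<close> reverses products.\<close>

lemma Th_ops:
  shows "Th 0 = \<zero>\<^bsub>HM :: ('k::field, 'k hh) module\<^esub>" "Th 1 = \<one>\<^bsub>HM :: ('k, 'k hh) module\<^esub>"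
    "X \<in> Zt m \<Longrightarrow> Y \<in> Zt m \<Longrightarrow> Th X \<oplus>\<^bsub>HM\<^esub> Th Y = (Th (X + Y) :: 'k hh)"
    "X \<in> Zt m \<Longrightarrow> Y \<in> Zt m \<Longrightarrow> Th X \<otimes>\<^bsub>HM\<^esub> Th Y = (Th (Y * X) :: 'k hh)"
    "X \<in> Zt m \<Longrightarrow> c \<odot>\<^bsub>HM\<^esub> Th X = (Th (Tw (\<lambda>n r. zK c * tc X n r)) :: 'k hh)"
proof -
  show "Th 0 = \<zero>\<^bsub>HM :: ('k::field, 'k hh) module\<^esub>" by (simp add: Th_def HH_sel row_simps ExM_ops)
  have "coho_class (Lam m 1) (res m 1) (res_diff m 1) 0 (res_aug m 1) = (cls 0 eps0 :: ('k pres \<Rightarrow> 'k lam) set)"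
  proof -
    have R: "mk 0 eps0 = (res_aug m 1 :: 'k pres \<Rightarrow> 'k lam)" using ev_Cc(2)[OF res_aug(1)] unfolding res_aug(2) .
    show ?thesis unfolding cls_def R ..
  qed
  then show "Th 1 = \<one>\<^bsub>HM :: ('k, 'k hh) module\<^esub>" by (auto simp: Th_def HH_sel(3) homog_def row_1 ExM_ops fun_eq_iff)
  assume X: "X \<in> Zt m"
  have "row (Tw (\<lambda>n r. zK c * tc X n r)) n = (\<lambda>s. zK c * row X n s)" for n by (simp add: row_def fun_eq_iff)
  then show "c \<odot>\<^bsub>HM\<^esub> Th X = (Th (Tw (\<lambda>n r. zK c * tc X n r)) :: 'k hh)"
    by (simp add: HH_sel(6) Th_def ExM_ops ZtD[OF X])
  assume Y: "Y \<in> Zt m"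
  show "Th X \<oplus>\<^bsub>HM\<^esub> Th Y = (Th (X + Y) :: 'k hh)"
    by (simp add: HH_sel(5) Th_def ExM_ops ZtD[OF X] ZtD[OF Y] row_simps)
  show "Th X \<otimes>\<^bsub>HM\<^esub> Th Y = (Th (Y * X) :: 'k hh)"
  proof
    fix n
    let ?f = "\<lambda>p. prodF (n - p) (row Y (n - p)) p (row X p)"
    have f: "?f p \<in> Zc m n" if "p \<in> {..n}" for p
      using prodF_Zc[OF ZtD(1)[OF Y] ZtD(1)[OF X], of "n - p" p] that by simp
    have "(Th X \<otimes>\<^bsub>HM\<^esub> Th Y) n = finsum (ExM n) (\<lambda>p. cls n (?f p)) {..n}"
      unfolding HH_sel(2)
    proof (rule abelian_monoid.finsum_cong'[OF ExM_monoid refl])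
      show "(\<lambda>p. cls n (?f p)) \<in> {..n} \<rightarrow> carrier (ExM n)" using f by (auto simp: ext_sel(1))
      fix p assume p: "p \<in> {..n}"
      then show "yoneda_prod (Lam m 1) (res m 1) (res_diff m 1) (res_aug m 1) p (n - p) (Th X p) (Th Y (n - p)) = cls n (?f p)"
        unfolding Th_def yoneda[OF ZtD(1)[OF X] ZtD(1)[OF Y]] by simp
    qed
    also have "\<dots> = cls n (\<Sum>p\<in>{..n}. ?f p)" by (rule ExM_finsum) (simp_all add: f)
    also have "\<dots> = Th (Y * X) n" unfolding Th_def row_mult[OF ZtD(2)[OF Y] ZtD(2)[OF X]] ..
    finally show "(Th X \<otimes>\<^bsub>HM\<^esub> Th Y) n = (Th (Y * X) :: 'k hh) n" .
  qed
qed

lemma HH_ring: "ring (HM :: ('k::field, 'k hh) module)"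
proof -
  note c = Zt_closed[where 'k = 'k] and o = Th_ops[where 'k = 'k]
  have s: "\<exists>X\<in>Zt m. x = Th X" if "x \<in> carrier HM" for x :: "'k hh" using Th_surj[OF that] by metis
  show ?thesis
  proof (rule ringI)
    show "abelian_group (HM :: ('k, 'k hh) module)"
    proof (rule abelian_groupI)
      fix x y z :: "'k hh" assume "x \<in> carrier HM" "y \<in> carrier HM" "z \<in> carrier HM"
      then obtain X Y Z where X: "X \<in> Zt m" "x = Th X" and Y: "Y \<in> Zt m" "y = Th Y" and Z: "Z \<in> Zt m" "z = Th Z" using s by meson
      show "x \<oplus>\<^bsub>HM\<^esub> y \<oplus>\<^bsub>HM\<^esub> z = x \<oplus>\<^bsub>HM\<^esub> (y \<oplus>\<^bsub>HM\<^esub> z)" unfolding X(2) Y(2) Z(2) by (simp add: o c X(1) Y(1) Z(1) add.assoc)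
    next
      fix x y :: "'k hh" assume "x \<in> carrier HM" "y \<in> carrier HM"
      then obtain X Y where X: "X \<in> Zt m" "x = Th X" and Y: "Y \<in> Zt m" "y = Th Y" using s by meson
      show "x \<oplus>\<^bsub>HM\<^esub> y \<in> carrier HM" "x \<oplus>\<^bsub>HM\<^esub> y = y \<oplus>\<^bsub>HM\<^esub> x"
        unfolding X(2) Y(2) by (simp_all add: o c X(1) Y(1) Th_carrier add.commute)
    next
      fix x :: "'k hh" assume "x \<in> carrier HM"
      then obtain X where X: "X \<in> Zt m" "x = Th X" using s by meson
      show "\<zero>\<^bsub>HM\<^esub> \<oplus>\<^bsub>HM\<^esub> x = x" unfolding X(2) o(1)[symmetric] by (simp add: o(3) c X(1))
      show "\<exists>y\<in>carrier HM. y \<oplus>\<^bsub>HM\<^esub> x = \<zero>\<^bsub>HM\<^esub>"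
        by (rule bexI[of _ "Th (- X)"]) (simp_all add: o(3) c X Th_carrier flip: o(1))
    next
      show "\<zero>\<^bsub>HM\<^esub> \<in> carrier (HM :: ('k, 'k hh) module)" unfolding o(1)[symmetric] by (rule Th_carrier[OF c(1)])
    qed
    show "Group.monoid (HM :: ('k, 'k hh) module)"
    proof (rule monoidI)
      fix x y z :: "'k hh" assume "x \<in> carrier HM" "y \<in> carrier HM" "z \<in> carrier HM"
      then obtain X Y Z where X: "X \<in> Zt m" "x = Th X" and Y: "Y \<in> Zt m" "y = Th Y" and Z: "Z \<in> Zt m" "z = Th Z" using s by meson
      show "x \<otimes>\<^bsub>HM\<^esub> y \<otimes>\<^bsub>HM\<^esub> z = x \<otimes>\<^bsub>HM\<^esub> (y \<otimes>\<^bsub>HM\<^esub> z)" unfolding X(2) Y(2) Z(2) by (simp add: o c X(1) Y(1) Z(1) mult.assoc)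
    next
      fix x y :: "'k hh" assume "x \<in> carrier HM" "y \<in> carrier HM"
      then obtain X Y where X: "X \<in> Zt m" "x = Th X" and Y: "Y \<in> Zt m" "y = Th Y" using s by meson
      show "x \<otimes>\<^bsub>HM\<^esub> y \<in> carrier HM" unfolding X(2) Y(2) by (simp_all add: o c X(1) Y(1) Th_carrier)
    next
      fix x :: "'k hh" assume "x \<in> carrier HM"
      then obtain X where X: "X \<in> Zt m" "x = Th X" using s by meson
      show "\<one>\<^bsub>HM\<^esub> \<otimes>\<^bsub>HM\<^esub> x = x" "x \<otimes>\<^bsub>HM\<^esub> \<one>\<^bsub>HM\<^esub> = x" unfolding X(2) o(2)[symmetric] by (simp_all add: o(4) c X(1))
    next
      show "\<one>\<^bsub>HM\<^esub> \<in> carrier (HM :: ('k, 'k hh) module)" unfolding o(2)[symmetric] by (rule Th_carrier[OF c(2)])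
    qed
    fix x y z :: "'k hh" assume "x \<in> carrier HM" "y \<in> carrier HM" "z \<in> carrier HM"
    then obtain X Y Z where X: "X \<in> Zt m" "x = Th X" and Y: "Y \<in> Zt m" "y = Th Y" and Z: "Z \<in> Zt m" "z = Th Z" using s by meson
    show "(x \<oplus>\<^bsub>HM\<^esub> y) \<otimes>\<^bsub>HM\<^esub> z = x \<otimes>\<^bsub>HM\<^esub> z \<oplus>\<^bsub>HM\<^esub> y \<otimes>\<^bsub>HM\<^esub> z" "z \<otimes>\<^bsub>HM\<^esub> (x \<oplus>\<^bsub>HM\<^esub> y) = z \<otimes>\<^bsub>HM\<^esub> x \<oplus>\<^bsub>HM\<^esub> z \<otimes>\<^bsub>HM\<^esub> y"
      unfolding X(2) Y(2) Z(2) by (simp_all add: o c X(1) Y(1) Z(1) distrib_left distrib_right)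
  qed
qed

definition Phi :: "'k::field hh \<Rightarrow> 'k fps fps" where
  "Phi x = phi (SOME X. X \<in> Zt m \<and> Th X = x)"

text \<open>Two cocycles with the same class differ in each degree by a coboundary, whose values are
  radical by \<open>Bc_rad\<close>.\<close>

lemma Phi_Th: assumes X: "X \<in> Zt m" shows "Phi (Th X :: 'k::field hh) = phi X"
proof -
  define Y where "Y = (SOME Y. Y \<in> Zt m \<and> Th Y = (Th X :: 'k hh))"
  have Y: "Y \<in> Zt m \<and> Th Y = (Th X :: 'k hh)" unfolding Y_def by (rule someI[of _ X]) (simp add: X)
  have "ce (tc Y n r) 0 = ce (tc X n r) 0" for n r
  proof -
    have "cls n (row Y n) = (cls n (row X n) :: ('k pres \<Rightarrow> 'k lam) set)" using Y by (simp add: Th_def fun_eq_iff)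
    then have "row Y n - row X n \<in> Bc m n" using cls_iff ZtD(2)[OF X] ZtD(2)[OF conjunct1[OF Y]] by blast
    from Bc_rad[OF this, of "int r" 0] show ?thesis by (simp add: row_simps)
  qed
  then show ?thesis unfolding Phi_def Y_def[symmetric] by (intro ff_eqI) simp
qed

end

context cyc
begin

lemma HH_epi:
  assumes em: "even m" and surj: "\<And>f. f \<in> Tset m \<Longrightarrow> \<exists>X\<in>Zt m. phi X = (f :: 'k::field fps fps)"
  shows "alg_epi HM (Tset m) (\<lambda>k f. fc k * f) (Phi :: 'k hh \<Rightarrow> 'k fps fps)"
proof (rule alg_epi.intro)
  show "ring (HM :: ('k, 'k hh) module)" by (rule HH_ring)
  show "subring_set (Tset m :: 'k fps fps set)" by (rule subring_Tset)
  have s: "\<exists>X\<in>Zt m. x = Th X" if "x \<in> carrier HM" for x :: "'k hh" using Th_surj[OF that] by metis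
  show "(Phi :: 'k hh \<Rightarrow> 'k fps fps) ` carrier HM = Tset m"
  proof (intro equalityI subsetI)
    fix f assume "f \<in> (Phi :: 'k hh \<Rightarrow> 'k fps fps) ` carrier HM"
    then obtain x where x: "x \<in> carrier HM" "f = Phi (x :: 'k hh)" by blast
    obtain X where "X \<in> Zt m" "x = Th X" using s[OF x(1)] by blast
    then show "f \<in> Tset m" unfolding x(2) by (simp add: Phi_Th phi_T)
  next
    fix f :: "'k fps fps" assume "f \<in> Tset m"
    then obtain X where X: "X \<in> Zt m" "phi X = f" using surj by blast
    have "Phi (Th X :: 'k hh) \<in> Phi ` carrier HM" by (rule imageI) (rule Th_carrier[OF X(1)])
    then show "f \<in> (Phi :: 'k hh \<Rightarrow> 'k fps fps) ` carrier HM" unfolding Phi_Th[OF X(1)] X(2) .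
  qed
  show "Phi \<one>\<^bsub>HM :: ('k, 'k hh) module\<^esub> = 1"
    unfolding Th_ops(2)[symmetric] Phi_Th[OF Zt_closed(2)] by (rule ff_eqI) (simp flip: mon_0)
  fix x y :: "'k hh" and k :: 'k
  assume x: "x \<in> carrier HM"
  obtain X where X: "X \<in> Zt m" "x = Th X" using s[OF x] by blast
  show "k \<odot>\<^bsub>HM\<^esub> x \<in> carrier HM" unfolding X(2) Th_ops(5)[OF X(1)] by (rule Th_carrier[OF Zt_closed(7)[OF X(1)]])
  show "Phi (k \<odot>\<^bsub>HM\<^esub> x) = fc k * Phi x" unfolding X(2) Th_ops(5)[OF X(1)] Phi_Th[OF Zt_closed(7)[OF X(1)]] Phi_Th[OF X(1)]
    by (rule ff_eqI) simp
  assume y: "y \<in> carrier HM"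
  obtain Y where Y: "Y \<in> Zt m" "y = Th Y" using s[OF y] by blast
  show "Phi (x \<otimes>\<^bsub>HM\<^esub> y) = Phi x * Phi y"
    unfolding X(2) Y(2) Th_ops(4)[OF X(1) Y(1)] Phi_Th[OF Zt_closed(5)[OF X(1) Y(1)]] Phi_Th[OF X(1)] Phi_Th[OF Y(1)]
    by (rule phi_mult[OF X(1) Y(1) em])
  show "Phi (x \<oplus>\<^bsub>HM\<^esub> y) = Phi x + Phi y"
    unfolding X(2) Y(2) Th_ops(3)[OF X(1) Y(1)] Phi_Th[OF Zt_closed(3)[OF X(1) Y(1)]] Phi_Th[OF X(1)] Phi_Th[OF Y(1)]
    by (rule phi_add)
qed

text \<open>The target lies in an integral domain, so nilpotent classes go to 0. Conversely, the
  homogeneous parts of an element of the kernel are represented by cocycles with radical values and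
  have cube zero.\<close>

lemma nil_eq:
  assumes epi: "alg_epi HM (Tset m) (\<lambda>k f. fc k * f) (Phi :: 'k::field hh \<Rightarrow> 'k fps fps)"
  shows "nil_ideal m 1 = alg_epi.ker HM (Phi :: 'k hh \<Rightarrow> 'k fps fps)"
proof -
  interpret e: alg_epi HM "Tset m" "\<lambda>k f. fc k * f" "Phi :: 'k hh \<Rightarrow> 'k fps fps" by (rule epi)
  interpret R: ring "HM :: ('k, 'k hh) module" by (rule HH_ring)
  let ?S = "homog_nilpotents (Lam m 1) (res m 1) (res_diff m 1) (res_aug m 1) :: 'k hh set"
  have S: "?S = {x \<in> carrier HM. (\<exists>n X. x = homog (Lam m 1) (res m 1) (res_diff m 1) n X) \<and> (\<exists>s::nat. x [^]\<^bsub>HM\<^esub> s = \<zero>\<^bsub>HM\<^esub>)}"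
    unfolding homog_nilpotents_def HH_def ..
  have Sc: "?S \<subseteq> carrier HM" unfolding S by blast
  have pw: "Phi (x [^]\<^bsub>HM\<^esub> (s::nat)) = Phi x ^ s" if "x \<in> carrier HM" for x :: "'k hh" and s
    by (induction s) (simp_all add: e.h_one e.h_mult R.nat_pow_closed that mult.commute)
  have "?S \<subseteq> e.ker"
  proof
    fix x assume "x \<in> ?S"
    then obtain s :: nat where x: "x \<in> carrier HM" "x [^]\<^bsub>HM\<^esub> s = \<zero>\<^bsub>HM\<^esub>" unfolding S by blast
    have "Phi x ^ s = 0" using pw[OF x(1), of s] unfolding x(2) e.h_zero by simp
    then show "x \<in> e.ker" using x(1) by (simp add: e.ker_def)
  qed
  then have 1: "Idl\<^bsub>HM\<^esub> ?S \<subseteq> e.ker" by (rule R.genideal_minimal[OF e.ideal_ker])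
  interpret I: ideal "Idl\<^bsub>HM\<^esub> ?S" HM by (rule R.genideal_ideal[OF Sc])
  have "e.ker \<subseteq> Idl\<^bsub>HM\<^esub> ?S"
  proof
    fix x assume "x \<in> e.ker"
    then have x: "x \<in> carrier HM" "Phi x = 0" by (auto simp: e.ker_def)
    obtain X where X: "X \<in> Zt m" "Th X = x" using Th_surj[OF x(1)] by blast
    have "phi X = 0" using x(2) Phi_Th[OF X(1)] X(2) by simp
    then have c0: "ce (tc X n r) 0 = 0" for n r using phi_nth[of X n r] by simp
    have c1: "ce (row X n s) 0 = 0" for n s using c0 by (simp add: row_def)
    have rr: "ce (row X n s) i = 0" for n s i by (rule Zc_ce_0[OF ZtD(1)[OF X(1)]]) (rule c1)
    have rad: "rad (tc (hom_part n X) k r)" for n k r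
      using rr[of n "int r"] by (simp add: rad_def tc_hom_part row_simps(5))
    have hp: "hom_part n X \<in> Zt m" for n by (rule Zt_closed(6)[OF X(1)])
    have inS: "Th (hom_part n X) \<in> ?S" for n
      unfolding S
    proof (intro CollectI conjI exI)
      show "Th (hom_part n X) \<in> carrier HM" by (rule Th_carrier[OF hp])
      show "Th (hom_part n X) = homog (Lam m 1) (res m 1) (res_diff m 1) n (cls n (row X n))"
        by (simp add: Th_def homog_def row_hom_part ExM_ops fun_eq_iff)
      let ?Y = "hom_part n X"
      have "Th ?Y [^]\<^bsub>HM\<^esub> (Suc (Suc (Suc 0))) = Th (?Y * (?Y * (?Y * 1)))"
        by (simp only: nat_pow_Suc nat_pow_0 Th_ops(2)[symmetric] Th_ops(4)[OF Zt_closed(2) hp] Th_ops(4)[OF _ hp] Zt_closed(2) Zt_closed(5)[OF Zt_closed(2) hp] Zt_closed(5)[OF Zt_closed(5)[OF Zt_closed(2) hp] hp])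
      also have "?Y * (?Y * (?Y * 1)) = 0" using tw_cube[OF rad] by simp
      finally show "Th ?Y [^]\<^bsub>HM\<^esub> (Suc (Suc (Suc 0))) = \<zero>\<^bsub>HM\<^esub>" unfolding Th_ops(1) .
    qed
    have sumZ: "(\<Sum>n\<le>N. hom_part n X) \<in> Zt m" for N
      by (induction N) (simp_all add: hp Zt_closed(3))
    have sumI: "Th (\<Sum>n\<le>N. hom_part n X) \<in> Idl\<^bsub>HM\<^esub> ?S" for N
    proof (induction N)
      case 0
      show ?case using R.genideal_self[OF Sc] inS by auto
    next
      case (Suc N)
      have "Th (\<Sum>n\<le>Suc N. hom_part n X) = Th (\<Sum>n\<le>N. hom_part n X) \<oplus>\<^bsub>HM\<^esub> (Th (hom_part (Suc N) X) :: 'k hh)"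
        unfolding Th_ops(3)[OF sumZ hp] by simp
      then show ?case using I.a_closed[OF Suc] R.genideal_self[OF Sc] inS by auto
    qed
    obtain N where N: "\<forall>n>N. row X n = 0" using Zt_bound[OF X(1)] by blast
    have "(\<Sum>n\<le>N. hom_part n X) = X"
    proof (rule row_eqI)
      fix n
      have "row (\<Sum>n\<le>N. hom_part n X) n = (\<Sum>i\<le>N. if i = n then row X n else 0)"
        unfolding row_sum row_hom_part by (rule sum.cong[OF refl]) auto
      also have "\<dots> = (if n \<le> N then row X n else 0)" by simp
      also have "\<dots> = row X n" using N by (auto simp: not_le)
      finally show "row (\<Sum>n\<le>N. hom_part n X) n = row X n" .
    qed
    then show "x \<in> Idl\<^bsub>HM\<^esub> ?S" using sumI[of N] X(2) by simp
  qed
  then show ?thesis using 1 unfolding nil_ideal_def by (rule antisym[rotated])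
qed

section \<open>Cocycles with prescribed scalars and the three classes\<close>

definition Wf :: "'k::field fps fps \<Rightarrow> 'k zz tw" where
  "Wf f = Tw (\<lambda>n r. zD (\<lambda>i. fps_nth (fps_nth f n) r * sg (i * int r)))"

lemma per_sgn: "even m \<Longrightarrow> per m (zD (\<lambda>i. c * sg (i * s)) :: 'k::field zz)"
  by (simp add: sg_def dvd_mod_iff)

lemma zD_0: "zD (\<lambda>i. 0) = 0" by (simp add: zz_eq_iff)

text \<open>The cocycle condition demands \<open>c_(i+1) = (-1)^(n+s) c_i\<close> for the scalars on
  \<open>G_s\<close>. Divisibility by the even number m makes \<open>n\<close> even, so starting at
  vertex 0 the scalar at \<open>i\<close> carries \<open>(-1)^(i s)\<close>, and this sign is
  m-periodic.\<close>

lemma Wf: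
  assumes em: "even m" and f: "f \<in> Tset m"
  shows "Wf f \<in> Zt m" "phi (Wf f) = (f :: 'k::field fps fps)"
proof -
  show "phi (Wf f) = f" by (rule ff_eqI) (simp add: Wf_def sg_def)
  obtain N where N: "\<forall>n>N. fps_nth f n = 0" using f unfolding Tset_def by blast
  define c where "c n s = fps_nth (fps_nth f n) (nat s)" for n s
  have row: "row (Wf f) n s = (if 0 \<le> s then zD (\<lambda>i. c n s * sg (i * s)) else 0)" for n s
    by (simp add: row_def Wf_def c_def)
  have nz: "s \<le> int n \<and> int m dvd int n - 2 * s \<and> even n" if "c n s \<noteq> 0" "0 \<le> s" for n s
  proof -
    have a: "nat s \<le> n \<and> int m dvd int n - 2 * int (nat s)" by (rule TsetD[OF f]) (use that in \<open>simp add: c_def\<close>)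
    moreover have "2 dvd int m" using em by simp
    ultimately have "2 dvd int n - 2 * int (nat s)" using dvd_trans by blast
    then have "even n" by simp
    then show ?thesis using a that(2) by auto
  qed
  have C: "row (Wf f) n \<in> Cc m n" for n
    unfolding Cc_def mem_Collect_eq
  proof (intro conjI allI impI)
    fix s
    show "gr m (int n - 2 * s) (row (Wf f) n s)"
    proof (cases "0 \<le> s \<and> c n s \<noteq> 0")
      case True
      then have d: "int m dvd int n - 2 * s" using nz by blast
      have "zE m i * zD x = zD x * zE m (i + (int n - 2 * s))" for i and x :: "int \<Rightarrow> 'k"
      proof -
        have "zE m (i + (int n - 2 * s)) = (zE m i :: 'k zz)" by (rule zE_cong) (use d in \<open>simp add: mod_eq_dvd_iff\<close>)
        then show ?thesis by (simp add: zz_eq_iff)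
      qed
      then show ?thesis using True per_sgn[OF em] unfolding gr_def row by (simp del: per_zD)
    qed (auto simp: row zD_0)
    assume "\<not> (0 \<le> s \<and> s \<le> int n)"
    then show "row (Wf f) n s = 0" using nz[of n s] by (cases "c n s = 0") (auto simp: row zD_0)
  qed
  have A: "zD d * zA + sg j * (zA * zD d) = 0" if "\<And>i. d i + sg j * d (i + 1) = 0" for d :: "int \<Rightarrow> 'k" and j
    using that by (cases "even j") (simp_all add: sg_def zz_eq_iff)
  have B: "sg j * (zB * zD d) + sg l * (zD d * zB) = 0" if "\<And>i. sg j * d (i - 1) + sg l * d i = 0" for d :: "int \<Rightarrow> 'k" and j l
    using that by (cases "even j"; cases "even l") (simp_all add: sg_def zz_eq_iff)
  have "dF n (row (Wf f) n) s = 0" for n s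
  proof -
    let ?F = "row (Wf f) n"
    \<comment> \<open>The differential vanishes in two halves: the terms with \<open>?F s\<close>
      give multiples of \<open>zA\<close>, those with \<open>?F (s - 1)\<close> multiples of
      \<open>zB\<close>.\<close>
    have a: "?F s * zA + sg (int n + 1 + s) * (zA * ?F s) = 0"
    proof (cases "0 \<le> s \<and> c n s \<noteq> 0")
      case True
      then have "even n" using nz by blast
      then have "c n s * sg (i * s) + sg (int n + 1 + s) * (c n s * sg ((i + 1) * s)) = 0" for i
        by (cases "even s"; cases "even i") (simp_all add: sg_def)
      then show ?thesis using True unfolding row by (simp add: A)
    qed (auto simp: row zD_0)
    have b: "sg (int n + 1 + s) * (zB * ?F (s - 1)) + sg (int n + 1) * (?F (s - 1) * zB) = 0"
    proof (cases "0 \<le> s - 1 \<and> c n (s - 1) \<noteq> 0")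
      case True
      then have "even n" using nz by blast
      then have "sg (int n + 1 + s) * (c n (s - 1) * sg ((i - 1) * (s - 1))) + sg (int n + 1) * (c n (s - 1) * sg (i * (s - 1))) = 0" for i
        by (cases "even s"; cases "even i") (simp_all add: sg_def)
      then show ?thesis using True unfolding row by (simp add: B)
    qed (auto simp: row zD_0)
    show ?thesis unfolding dF_formula[OF C] using a b by (simp add: add.assoc)
  qed
  then have "row (Wf f) n \<in> Zc m n" for n using C by (simp add: Zc_def fun_eq_iff)
  then show "Wf f \<in> Zt m" by (rule ZtI[of _ _ N]) (use N in \<open>simp add: row c_def zD_0 fun_eq_iff\<close>)
qed

lemma hh_class_Th:
  fixes c :: "int \<Rightarrow> 'k::field lam"
  assumes em: "even m" and r: "r \<le> n" "int m dvd int n - 2 * int r" and k: "k = int n - 2 * int r"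
    and c: "\<And>i. i \<in> {0..<int m} \<Longrightarrow> c i \<in> carrier (Lam m 1)" "\<And>i. i \<in> {0..<int m} \<Longrightarrow> alpha m (c i) = zK (sg (i * int r)) * zE m i"
  shows "hh_class m 1 n k c = Th (Wf (mon n r))"
proof -
  let ?A = "Lam m 1 :: ('k, 'k lam) module"
  define img where "img = (\<lambda>i s. if int n - 2 * s = k then c i else \<zero>\<^bsub>?A\<^esub>)"
  have ks: "int n - 2 * s = k \<longleftrightarrow> s = int r" for s using k by auto
  have im: "img i s \<in> carrier (regular_bimod ?A)" "zE m i * alpha m (img i s) = alpha m (img i s)"
    "alpha m (img i s) * zE m (i + int n - 2 * s) = alpha m (img i s)" if ix: "(i, s) \<in> res_index m n" for i s
  proof -
    have i: "i \<in> {0..<int m}" using ix by (simp add: res_index_iff)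
    have e: "zE m (i + int n - 2 * int r) = (zE m i :: 'k zz)" by (rule zE_cong) (use r(2) in \<open>simp add: mod_eq_dvd_iff algebra_simps\<close>)
    have z: "zE m i * (zK x * zE m i) = (zK x * zE m i :: 'k zz)" for x by (simp add: zz_eq_iff)
    show "img i s \<in> carrier (regular_bimod ?A)" "zE m i * alpha m (img i s) = alpha m (img i s)"
      "alpha m (img i s) * zE m (i + int n - 2 * s) = alpha m (img i s)"
      unfolding img_def ks using c[OF i] coordalg.A_closed(4)[OF calg[where 'k = 'k]] coordalg.al_0[OF calg[where 'k = 'k]]
      by (auto simp: regular_bimod_def e z mult.assoc)
  qed
  let ?f = "hom_of_gens m 1 n (regular_bimod ?A) img"
  have h: "?f \<in> hom0 n" by (rule target.hom_of_gens(1)[OF treg]) (rule im, assumption)+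
  have "ev n ?f = (\<lambda>s. if 0 \<le> s \<and> s \<le> int n then \<Sum>i = 0..<int m. alpha m (img i s) else 0)"
    by (rule target.hom_of_gens(2)[OF treg]) (rule im, assumption)+
  also have "\<dots> = row (Wf (mon n r)) n"
  proof
    fix s
    have "(\<Sum>i = 0..<int m. alpha m (img i (int r))) = (\<Sum>i = 0..<int m. zK (1 * sg (i * int r)) * zE m i)"
      by (rule sum.cong[OF refl]) (use c in \<open>simp add: img_def ks\<close>)
    also have "\<dots> = zD (\<lambda>i. 1 * sg (i * int r))" by (rule zD_expand[OF m_pos per_sgn[OF em], symmetric])
    finally have S: "(\<Sum>i = 0..<int m. alpha m (img i (int r))) = zD (\<lambda>i. 1 * sg (i * int r))" .
    show "(if 0 \<le> s \<and> s \<le> int n then \<Sum>i = 0..<int m. alpha m (img i s) else 0) = row (Wf (mon n r)) n s"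
    proof (cases "s = int r")
      case True
      then show ?thesis using S r(1) by (simp add: row_def Wf_def)
    next
      case False
      have "row (Wf (mon n r)) n s = (0 :: 'k zz)" using False by (auto simp: row_def Wf_def zD_0)
      moreover have "alpha m (img i s) = 0" for i using False coordalg.al_0[OF calg[where 'k = 'k]] by (simp add: img_def ks)
      ultimately show ?thesis by simp
    qed
  qed
  finally have "coho_class ?A (res m 1) (res_diff m 1) n ?f = cls n (row (Wf (mon n r)) n)"
    unfolding cls_def using ev_Cc(2)[OF h] by simp
  moreover have "row (Wf (mon n r)) j = (0 :: int \<Rightarrow> 'k zz)" if "j \<noteq> n" for j
    using that by (simp add: row_def Wf_def zD_0 fun_eq_iff)
  ultimately show ?thesis
    unfolding hh_class_def img_def[symmetric]
  proof (intro ext)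
    fix j assume 1: "coho_class ?A (res m 1) (res_diff m 1) n ?f = cls n (row (Wf (mon n r)) n)"
      and 2: "\<And>j. j \<noteq> n \<Longrightarrow> row (Wf (mon n r)) j = (0 :: int \<Rightarrow> 'k zz)"
    show "homog ?A (res m 1) (res_diff m 1) n (coho_class ?A (res m 1) (res_diff m 1) n ?f) j = Th (Wf (mon n r)) j"
    proof (cases "j = n")
      case True
      then show ?thesis unfolding 1 by (simp add: homog_def Th_def)
    next
      case False
      then show ?thesis unfolding Th_def 2[OF False] by (simp add: homog_def ExM_ops)
    qed
  qed
qed

lemma hh_class_mon:
  fixes c :: "int \<Rightarrow> 'k::field lam"
  assumes em: "even m" and r: "r \<le> n" "int m dvd int n - 2 * int r" and k: "k = int n - 2 * int r"
    and c: "\<And>i. i \<in> {0..<int m} \<Longrightarrow> c i \<in> carrier (Lam m 1)" "\<And>i. i \<in> {0..<int m} \<Longrightarrow> alpha m (c i) = zK (sg (i * int r)) * zE m i"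
  shows "hh_class m 1 n k c \<in> carrier HM" "Phi (hh_class m 1 n k c) = mon n r"
proof -
  have T: "mon n r \<in> (Tset m :: 'k fps fps set)" using fc_mon_T[OF r, of 1] by (simp add: fc_simps)
  have e: "hh_class m 1 n k c = Th (Wf (mon n r))" by (rule hh_class_Th[OF em r k]) (use c in auto)
  show "hh_class m 1 n k c \<in> carrier HM" unfolding e by (rule Th_carrier[OF Wf(1)[OF em T]])
  show "Phi (hh_class m 1 n k c) = mon n r" unfolding e Phi_Th[OF Wf(1)[OF em T]] by (rule Wf(2)[OF em T])
qed

text \<open>The index r is 1, 0 and m for the three classes. So the sign \<open>(-1)^(i r)\<close>
  is \<open>(-1)^i\<close> for the first one and 1 for the other two, m being even.\<close>

lemma chi_mon:
  assumes em: "even m"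
  shows "chi20 m 1 \<in> carrier (HM :: ('k::field, 'k hh) module)" "Phi (chi20 m 1 :: 'k hh) = mon 2 1"
    "chi_plus m 1 \<in> carrier (HM :: ('k::field, 'k hh) module)" "Phi (chi_plus m 1 :: 'k hh) = mon m 0"
    "chi_minus m 1 \<in> carrier (HM :: ('k::field, 'k hh) module)" "Phi (chi_minus m 1 :: 'k hh) = mon m m"
proof -
  note g = alpha_gens[OF m_pos, where 'k = 'k]
  have a: "((- 1) ^ nat i) \<odot>\<^bsub>Lam m 1\<^esub> idem m 1 i \<in> carrier (Lam m 1 :: ('k, 'k lam) module)" for i
    by (rule coordalg.smult_closed[OF calg g(1)])
  have s: "(- 1) ^ nat i = (sg i :: 'k)" if "0 \<le> i" for i using sg_nat[of "nat i", where 'a = 'k] that by simp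
  have b: "alpha m (((- 1) ^ nat i) \<odot>\<^bsub>Lam m 1\<^esub> (idem m 1 i :: 'k lam)) = zK (sg (i * int 1)) * zE m i" if "i \<in> {0..<int m}" for i
    unfolding coordalg.al_simps(5)[OF calg g(1)] g(2) using s[of i] that by simp
  note H = hh_class_mon[OF em, where 'k = 'k]
  show "chi20 m 1 \<in> carrier (HM :: ('k::field, 'k hh) module)"
    unfolding chi20_def by (rule H(1)[where r = 1]) (simp, simp, simp, rule a, rule b)
  show "Phi (chi20 m 1 :: 'k hh) = mon 2 1"
    unfolding chi20_def by (rule H(2)[where r = 1]) (simp, simp, simp, rule a, rule b)
  show "chi_plus m 1 \<in> carrier (HM :: ('k::field, 'k hh) module)"
    unfolding chi_plus_def by (rule H(1)[where r = 0]) (simp_all add: g sg_def zK_simps)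
  show "Phi (chi_plus m 1 :: 'k hh) = mon m 0"
    unfolding chi_plus_def by (rule H(2)[where r = 0]) (simp_all add: g sg_def zK_simps)
  show "chi_minus m 1 \<in> carrier (HM :: ('k::field, 'k hh) module)"
    unfolding chi_minus_def by (rule H(1)[where r = m]) (simp_all add: g sg_def zK_simps em)
  show "Phi (chi_minus m 1 :: 'k hh) = mon m m"
    unfolding chi_minus_def by (rule H(2)[where r = m]) (simp_all add: g sg_def zK_simps em)
qed

end

section \<open>The isomorphism with the polynomial quotient and its consequences\<close>

lemma algebra_Tset: "algebra field_ring (alg_of (Tset m) (\<lambda>k f. fc k * f) :: ('k::field, 'k fps fps) module)"
proof (rule algebraI)
  show "cring (field_ring :: 'k ring)" by (rule cring_field_ring)
  show "cring (alg_of (Tset m) (\<lambda>k f. fc k * f) :: ('k, 'k fps fps) module)" by (rule cring_alg_of[OF subring_Tset])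
qed (simp_all add: field_ring_def fc_simps fc_T Tset_closed algebra_simps)

theorem corollary4p5:
  fixes m :: nat
  assumes "m \<ge> 3" and "even m"
  shows "(\<exists>h \<in> alg_iso (poly3_alg Quota chi_ideal m) (HH_mod_nil m 1 :: ('k::field, 'k hh set) module).
            h (chi_ideal m +>\<^bsub>poly3_alg\<^esub> var X20) = nil_ideal m 1 +>\<^bsub>HH m 1\<^esub> chi20 m 1 \<and>
            h (chi_ideal m +>\<^bsub>poly3_alg\<^esub> var Xplus) = nil_ideal m 1 +>\<^bsub>HH m 1\<^esub> chi_plus m 1 \<and>
            h (chi_ideal m +>\<^bsub>poly3_alg\<^esub> var Xminus) = nil_ideal m 1 +>\<^bsub>HH m 1\<^esub> chi_minus m 1) \<and>
         algebra field_ring (HH_mod_nil m 1 :: ('k, 'k hh set) module) \<and>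
         fin_gen_algebra (HH_mod_nil m 1 :: ('k, 'k hh set) module) \<and>
         krull_dim (HH_mod_nil m 1 :: ('k, 'k hh set) module) = 2"
proof -
  interpret cyc m by unfold_locales (rule assms(1))
  let ?H = "HH m 1 :: ('k, 'k hh) module" and ?Q = "HH_mod_nil m 1 :: ('k, 'k hh set) module"
  let ?P = "poly3_alg :: ('k, 'k poly3) module" and ?I = "chi_ideal m :: 'k poly3 set" and ?J = "nil_ideal m 1 :: 'k hh set"
  let ?T = "alg_of (Tset m) (\<lambda>k f. fc k * f) :: ('k, 'k fps fps) module"
  define f1 :: "'k poly3 set \<Rightarrow> 'k fps fps" where "f1 = alg_epi.fac (Ev m)"
  define f2 :: "'k hh set \<Rightarrow> 'k fps fps" where "f2 = alg_epi.fac Phi"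
  note e1 = Ev_epi[OF m_pos, where 'k = 'k]
  have e2: "alg_epi ?H (Tset m) (\<lambda>k f. fc k * f) (Phi :: 'k hh \<Rightarrow> 'k fps fps)"
    by (rule HH_epi[OF assms(2)]) (use Wf[OF assms(2)] in blast)
  have ker1: "alg_epi.ker ?P (Ev m) = ?I" by (rule ker_Ev[OF m_pos])
  have ker2: "alg_epi.ker ?H Phi = ?J" by (rule nil_eq[OF e2, symmetric])
  have Q: "?Q = ?H Quota ?J" by (simp add: HH_mod_nil_def)
  have i1: "f1 \<in> alg_iso (?P Quota ?I) ?T" using alg_epi.fac_alg_iso[OF e1] unfolding ker1 f1_def .
  have i2: "f2 \<in> alg_iso ?Q ?T" using alg_epi.fac_alg_iso[OF e2] unfolding ker2 f2_def Q .
  have r2: "ring ?Q" using alg_epi.ring_quot[OF e2] unfolding ker2 Q .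
  have s2: "k \<odot>\<^bsub>?Q\<^esub> x \<in> carrier ?Q" if "x \<in> carrier ?Q" for k x
    using alg_epi.smult_quot_closed[OF e2] that unfolding ker2 Q by blast
  have i2': "f2 \<in> ring_iso ?Q ?T" using i2 by (simp add: alg_iso_def)
  have bij: "bij_betw f2 (carrier ?Q) (Tset m)" using ring_iso_memE(5)[OF i2'] by simp
  \<comment> \<open>Both quotients are identified with \<open>Tset m\<close>. The desired
    isomorphism is the first identification followed by the inverse of the second.\<close>
  define g where "g = inv_into (carrier ?Q) f2"
  have g: "g \<in> alg_iso ?T ?Q" unfolding g_def by (rule alg_iso_inv[OF i2 r2 s2])
  have g': "g \<in> ring_iso ?T ?Q" using g by (simp add: alg_iso_def)
  have cQ: "?J +>\<^bsub>?H\<^esub> c \<in> carrier ?Q" if "c \<in> carrier ?H" for c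
    using alg_epi.carrier_quot[OF e2] that unfolding ker2 Q by blast
  have gval: "g (Phi c) = ?J +>\<^bsub>?H\<^esub> c" if c: "c \<in> carrier ?H" for c
  proof -
    have "f2 (?J +>\<^bsub>?H\<^esub> c) = Phi c" using alg_epi.fac_coset[OF e2 c] unfolding ker2 f2_def .
    then show ?thesis unfolding g_def using inv_into_f_f[OF bij_betw_imp_inj_on[OF bij] cQ[OF c]] by simp
  qed
  have f1val: "f1 (?I +>\<^bsub>?P\<^esub> p) = Ev m p" for p
    using alg_epi.fac_coset[OF e1, of p] unfolding ker1 f1_def by (simp add: poly3_alg_def)
  have Ev_var: "Ev m (var X20) = (mon 2 1 :: 'k fps fps)" "Ev m (var Xplus) = (mon m 0 :: 'k fps fps)" "Ev m (var Xminus) = (mon m m :: 'k fps fps)"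
    unfolding var_eq Ev_single by (simp_all add: dg_def fc_simps)
  note chi = chi_mon[OF assms(2), where 'k = 'k]
  have h: "g \<circ> f1 \<in> alg_iso (?P Quota ?I) ?Q" by (rule alg_iso_comp[OF i1 g])
  have hv: "(g \<circ> f1) (?I +>\<^bsub>?P\<^esub> var X20) = ?J +>\<^bsub>?H\<^esub> chi20 m 1"
    "(g \<circ> f1) (?I +>\<^bsub>?P\<^esub> var Xplus) = ?J +>\<^bsub>?H\<^esub> chi_plus m 1"
    "(g \<circ> f1) (?I +>\<^bsub>?P\<^esub> var Xminus) = ?J +>\<^bsub>?H\<^esub> chi_minus m 1"
    unfolding o_apply f1val Ev_var chi(2,4,6)[symmetric] by (rule gval, rule chi)+
  have alg: "algebra field_ring ?Q" by (rule alg_iso_algebra[OF i2 r2 s2 algebra_Tset])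
  have crT: "cring ?T" by (rule cring_alg_of[OF subring_Tset])
  have crQ: "cring ?Q" by (rule cring_iso[OF i2' r2 crT])
  have kd: "krull_dim ?Q = 2" unfolding krull_dim_iso[OF i2' crQ crT] by (rule krull_dim_T[OF m_pos])
  have fg: "fin_gen_algebra ?Q"
  proof -
    interpret Q: ring ?Q by (rule r2)
    define S where "S = {g (mon 2 1), g (mon m 0), g (mon m m)}"
    let ?U = "range (\<lambda>k. k \<odot>\<^bsub>?Q\<^esub> \<one>\<^bsub>?Q\<^esub>)"
    have S: "S \<subseteq> carrier ?Q" unfolding S_def chi(2,4,6)[symmetric] using gval cQ chi(1,3,5) by simp
    have SU: "S \<union> ?U \<subseteq> carrier ?Q" using S s2[OF Q.one_closed] by auto
    let ?G = "generate_ring ?Q (S \<union> ?U)"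
    have gm: "g (x * y) = g x \<otimes>\<^bsub>?Q\<^esub> g y" "g (x + y) = g x \<oplus>\<^bsub>?Q\<^esub> g y" if "x \<in> Tset m" "y \<in> Tset m" for x y
      using ring_iso_memE(2,3)[OF g'] that by simp_all
    have g1: "g 1 = \<one>\<^bsub>?Q\<^esub>" using ring_iso_memE(4)[OF g'] by simp
    have T: "mon 2 1 \<in> (Tset m :: 'k fps fps set)" "mon m 0 \<in> (Tset m :: 'k fps fps set)" "mon m m \<in> (Tset m :: 'k fps fps set)"
      unfolding Ev_var[symmetric] by (rule Ev_T)+
    have Tp: "x ^ n \<in> Tset m" if "x \<in> Tset m" for x :: "'k fps fps" and n
      by (induction n) (simp_all add: Tset_closed that)
    have pw: "g (x ^ n) \<in> ?G" if "x \<in> Tset m" "g x \<in> ?G" for x n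
    proof (induction n)
      case 0
      show ?case using generate_ring.one by (simp add: g1)
    next
      case (Suc n)
      show ?case using generate_ring.eng_mult[OF that(2) Suc] by (simp add: gm that Tp)
    qed
    have sc: "g (fc c) \<in> ?G" for c
    proof -
      have "\<forall>k. \<forall>x\<in>Tset m. g (fc k * x) = k \<odot>\<^bsub>?Q\<^esub> g x" using g unfolding alg_iso_def by auto
      then have "g (fc c * 1) = c \<odot>\<^bsub>?Q\<^esub> g 1" using subring_setD(1)[OF subring_Tset] by blast
      then have "g (fc c) = c \<odot>\<^bsub>?Q\<^esub> \<one>\<^bsub>?Q\<^esub>" by (simp add: g1)
      then show ?thesis by (intro generate_ring.incl) auto
    qed
    have inG: "g (mon 2 1) \<in> ?G" "g (mon m 0) \<in> ?G" "g (mon m m) \<in> ?G"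
      by (rule generate_ring.incl; simp add: S_def)+
    \<comment> \<open>Every element of \<open>Tset m\<close> is an evaluated polynomial, and
      evaluated monomials are products of a scalar and powers of the three generators.\<close>
    have all: "g (Ev m p) \<in> ?G" for p
    proof (induction p rule: pm_induct)
      case zero
      show ?case using sc[of 0] by (simp add: fc_simps)
    next
      case (add p q)
      show ?case unfolding Ev_add gm(2)[OF Ev_T Ev_T] by (rule generate_ring.eng_add[OF add])
    next
      case (single k c)
      obtain a b d where k: "k = mexp a b d" by (rule mexp_cases)
      have e: "Ev m (Poly_Mapping.single k c) = fc c * (mon 2 1 ^ a * (mon m 0 ^ b * mon m m ^ d))"
        unfolding Ev_single k mon_power mon_mult by (simp add: dg_def algebra_simps)
      show ?case
        unfolding e by (simp add: gm Tset_closed fc_T Tp T) (intro generate_ring.eng_mult sc pw T inG)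
    qed
    have "carrier ?Q \<subseteq> ?G"
    proof
      fix x assume x: "x \<in> carrier ?Q"
      then have "f2 x \<in> Tset m" using bij by (auto simp: bij_betw_def)
      then obtain p where "f2 x = Ev m p" using Ev_surj[OF m_pos] by blast
      moreover have "g (f2 x) = x" unfolding g_def using inv_into_f_f[OF bij_betw_imp_inj_on[OF bij] x] .
      ultimately show "x \<in> ?G" using all[of p] by simp
    qed
    moreover have "?G \<subseteq> carrier ?Q" using Q.generate_ring_in_carrier[OF SU] by blast
    moreover have "finite S" by (simp add: S_def)
    ultimately show ?thesis unfolding fin_gen_algebra_def using S by blast
  qed
  show ?thesis using h hv alg fg kd by blast
qed

end
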